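(* Let $(\mathcal A,\mathcal B,\mathcal C)$ be a recollement of abelian categories with functors $i\colon\mathcal A\to\mathcal B$, $e\colon\mathcal B\to\mathcal C$, and assume that $\mathcal B$ and $\mathcal C$ have enough projective and injective objects. Let $m$ and $n$ be two nonnegative integers. Assume that one of the following two sets of conditions holds: (i) - $(\alpha')$ $\sup\{\operatorname{id}_{\mathcal B}i(I)\mid I\in\operatorname{Inj}\mathcal A\}<m$; - $(\epsilon)$ every object of $\mathcal B$ has an $m$-th syzygy which lies in ${}^{\perp}i(\operatorname{Inj}\mathcal A)$; - $(\beta)$ $\sup\{\operatorname{pd}_{\mathcal C}e(P)\mid P\in\operatorname{Proj}\mathcal B\}\le n$. (ii) - $(\gamma')$ $\sup\{\operatorname{pd}_{\mathcal B}i(P)\mid P\in\operatorname{Proj}\mathcal A\}<n$; - $(\epsilon^{\mathrm{op}})$ every object of $\mathcal B$ has an $n$-th cosyzygy which lies in $i(\operatorname{Proj}\mathcal A)^{\perp}$; - $(\delta)$ $\sup\{\operatorname{id}_{\mathcal C}e(I)\mid I\in\operatorname{Inj}\mathcal B\}\le m$. Then the functor $e$ is an $(m+n)$-homological isomorphism, and in particular the map $$e^j_{B,B'}\colon\operatorname{Ext}^j_{\mathcal B}(B,B')\longrightarrow\operatorname{Ext}^j_{\mathcal C}(e(B),e(B'))$$ is an isomorphism for all objects $B$ and $B'$ of $\mathcal B$ and for every $j>m+n$.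
   Context: A recollement $(\mathcal A,\mathcal B,\mathcal C)$ of abelian categories consists of abelian categories and additive functors $i\colon\mathcal A\to\mathcal B$, $e\colon\mathcal B\to\mathcal C$, $q,p\colon\mathcal B\to\mathcal A$, $l,r\colon\mathcal C\to\mathcal B$ such that $l\dashv e\dashv r$ and $q\dashv i\dashv p$ are adjoint triples, $i,l,r$ are fully faithful, and the essential image of $i$ equals $\operatorname{Ker}e=\{B\mid e(B)=0\}$. The functors $i$ and $e$ are then exact. $\operatorname{Proj}$ and $\operatorname{Inj}$ denote the classes of projective and injective objects. For a class $\mathcal X$ of objects of $\mathcal B$, $\mathcal X^{\perp}=\{B\mid\operatorname{Hom}_{\mathcal B}(X,B)=0\ \forall X\in\mathcal X\}$ and ${}^{\perp}\mathcal X=\{B\mid\operatorname{Hom}_{\mathcal B}(B,X)=0\ \forall X\in\mathcal X\}$. An $n$-th syzygy of $B$ is the kernel of $P_{n-1}\to P_{n-2}$ in some projective resolution $\cdots\to P_1\to P_0\to B\to0$ (with $P_{-1}=B$; a $0$-th syzygy is $B$). An $n$-th cosyzygy of $B$ is the image of $I^{n-1}\to I^n$ in some injective coresolution $0\to B\to I^0\to I^1\to\cdots$ (a $0$-th cosyzygy is $B$). The map $e^j_{X,Y}\colon\operatorname{Ext}^j_{\mathcal B}(X,Y)\to\operatorname{Ext}^j_{\mathcal C}(e(X),e(Y))$ is the homomorphism induced by applying the exact functor $e$ to morphisms ($j=0$) or to $j$-fold extensions ($j>0$). A functor $f\colon\mathcal D\to\mathcal F$ between abelian categories is a $t$-homological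 isomorphism if $\operatorname{Ext}^j_{\mathcal D}(X,Y)\cong\operatorname{Ext}^j_{\mathcal F}(f(X),f(Y))$ for all objects $X,Y$ of $\mathcal D$ and all $j>t$. *)

theory Defs
  imports "HOL-Algebra.Group" "HOL-Library.Extended_Real"
begin

section \<open>Abelian categories\<close>

text \<open>
  \<open>Comp C g f\<close>, written \<open>g \<cdot>\<^bsub>C\<^esub> f\<close>, is the composite "first \<open>f\<close>, then \<open>g\<close>"; it is only
  meaningful if \<open>Cod f = Dom g\<close>. \<open>Plus\<close> and \<open>Zero\<close> are the addition and the zero of the hom groups.
\<close>

record ('o, 'm) precat =
  Obj :: "'o set"
  Arr :: "'m set"
  Dom :: "'m \<Rightarrow> 'o"
  Cod :: "'m \<Rightarrow> 'o"
  Ident :: "'o \<Rightarrow> 'm"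
  Comp :: "'m \<Rightarrow> 'm \<Rightarrow> 'm" (infixr "\<cdot>\<index>" 70)
  Plus :: "'m \<Rightarrow> 'm \<Rightarrow> 'm"
  Zero :: "'o \<Rightarrow> 'o \<Rightarrow> 'm"

definition homset :: "('o, 'm) precat \<Rightarrow> 'o \<Rightarrow> 'o \<Rightarrow> 'm set" where
  "homset C X Y = {f \<in> Arr C. Dom C f = X \<and> Cod C f = Y}"

definition hom_group :: "('o, 'm) precat \<Rightarrow> 'o \<Rightarrow> 'o \<Rightarrow> 'm monoid" where
  "hom_group C X Y = \<lparr>carrier = homset C X Y, mult = Plus C, one = Zero C X Y\<rparr>"

locale category =
  fixes C :: "('o, 'm) precat" (structure)
  assumes Dom_Obj: "f \<in> Arr C \<Longrightarrow> Dom C f \<in> Obj C"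
    and Cod_Obj: "f \<in> Arr C \<Longrightarrow> Cod C f \<in> Obj C"
    and Ident_hom: "X \<in> Obj C \<Longrightarrow> Ident C X \<in> homset C X X"
    and Comp_hom: "\<lbrakk>f \<in> homset C X Y; g \<in> homset C Y Z\<rbrakk> \<Longrightarrow> g \<cdot> f \<in> homset C X Z"
    and Comp_Ident_left: "f \<in> homset C X Y \<Longrightarrow> Ident C Y \<cdot> f = f"
    and Comp_Ident_right: "f \<in> homset C X Y \<Longrightarrow> f \<cdot> Ident C X = f"
    and Comp_assoc: "\<lbrakk>f \<in> homset C W X; g \<in> homset C X Y; h \<in> homset C Y Z\<rbrakk>
      \<Longrightarrow> (h \<cdot> g) \<cdot> f = h \<cdot> (g \<cdot> f)"

locale preadditive_category = category +
  assumes hom_comm_group: "\<lbrakk>X \<in> Obj C; Y \<in> Obj C\<rbrakk> \<Longrightarrow> comm_group (hom_group C X Y)"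
    and Comp_Plus_left: "\<lbrakk>f \<in> homset C X Y; g \<in> homset C Y Z; h \<in> homset C Y Z\<rbrakk>
      \<Longrightarrow> Plus C g h \<cdot> f = Plus C (g \<cdot> f) (h \<cdot> f)"
    and Comp_Plus_right: "\<lbrakk>f \<in> homset C X Y; g \<in> homset C X Y; h \<in> homset C Y Z\<rbrakk>
      \<Longrightarrow> h \<cdot> Plus C f g = Plus C (h \<cdot> f) (h \<cdot> g)"

definition zero_object :: "('o, 'm) precat \<Rightarrow> 'o \<Rightarrow> bool" where
  "zero_object C X \<longleftrightarrow> X \<in> Obj C \<and>
     (\<forall>Y\<in>Obj C. (\<exists>!f. f \<in> homset C X Y) \<and> (\<exists>!f. f \<in> homset C Y X))"

definition isomorphic_objects :: "('o, 'm) precat \<Rightarrow> 'o \<Rightarrow> 'o \<Rightarrow> bool" where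
  "isomorphic_objects C X Y \<longleftrightarrow> X \<in> Obj C \<and> Y \<in> Obj C \<and>
     (\<exists>f\<in>homset C X Y. \<exists>g\<in>homset C Y X.
        g \<cdot>\<^bsub>C\<^esub> f = Ident C X \<and> f \<cdot>\<^bsub>C\<^esub> g = Ident C Y)"

definition is_mono :: "('o, 'm) precat \<Rightarrow> 'm \<Rightarrow> bool" where
  "is_mono C f \<longleftrightarrow> f \<in> Arr C \<and>
     (\<forall>W\<in>Obj C. \<forall>g\<in>homset C W (Dom C f). \<forall>h\<in>homset C W (Dom C f).
        f \<cdot>\<^bsub>C\<^esub> g = f \<cdot>\<^bsub>C\<^esub> h \<longrightarrow> g = h)"

definition is_epi :: "('o, 'm) precat \<Rightarrow> 'm \<Rightarrow> bool" where
  "is_epi C f \<longleftrightarrow> f \<in> Arr C \<and>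
     (\<forall>W\<in>Obj C. \<forall>g\<in>homset C (Cod C f) W. \<forall>h\<in>homset C (Cod C f) W.
        g \<cdot>\<^bsub>C\<^esub> f = h \<cdot>\<^bsub>C\<^esub> f \<longrightarrow> g = h)"

definition is_kernel :: "('o, 'm) precat \<Rightarrow> 'm \<Rightarrow> 'm \<Rightarrow> bool" where
  "is_kernel C k f \<longleftrightarrow> f \<in> Arr C \<and> k \<in> Arr C \<and> Cod C k = Dom C f \<and>
     f \<cdot>\<^bsub>C\<^esub> k = Zero C (Dom C k) (Cod C f) \<and>
     (\<forall>W\<in>Obj C. \<forall>g\<in>homset C W (Dom C f). f \<cdot>\<^bsub>C\<^esub> g = Zero C W (Cod C f) \<longrightarrow>
        (\<exists>!h. h \<in> homset C W (Dom C k) \<and> k \<cdot>\<^bsub>C\<^esub> h = g))"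

definition is_cokernel :: "('o, 'm) precat \<Rightarrow> 'm \<Rightarrow> 'm \<Rightarrow> bool" where
  "is_cokernel C c f \<longleftrightarrow> f \<in> Arr C \<and> c \<in> Arr C \<and> Dom C c = Cod C f \<and>
     c \<cdot>\<^bsub>C\<^esub> f = Zero C (Dom C f) (Cod C c) \<and>
     (\<forall>W\<in>Obj C. \<forall>g\<in>homset C (Cod C f) W. g \<cdot>\<^bsub>C\<^esub> f = Zero C (Dom C f) W \<longrightarrow>
        (\<exists>!h. h \<in> homset C (Cod C c) W \<and> h \<cdot>\<^bsub>C\<^esub> c = g))"

definition is_biproduct ::
  "('o, 'm) precat \<Rightarrow> 'o \<Rightarrow> 'o \<Rightarrow> 'o \<Rightarrow> 'm \<Rightarrow> 'm \<Rightarrow> 'm \<Rightarrow> 'm \<Rightarrow> bool" where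
  "is_biproduct C X Y S i1 i2 p1 p2 \<longleftrightarrow>
     X \<in> Obj C \<and> Y \<in> Obj C \<and> S \<in> Obj C \<and>
     i1 \<in> homset C X S \<and> i2 \<in> homset C Y S \<and> p1 \<in> homset C S X \<and> p2 \<in> homset C S Y \<and>
     p1 \<cdot>\<^bsub>C\<^esub> i1 = Ident C X \<and> p2 \<cdot>\<^bsub>C\<^esub> i2 = Ident C Y \<and>
     p2 \<cdot>\<^bsub>C\<^esub> i1 = Zero C X Y \<and> p1 \<cdot>\<^bsub>C\<^esub> i2 = Zero C Y X \<and>
     Plus C (i1 \<cdot>\<^bsub>C\<^esub> p1) (i2 \<cdot>\<^bsub>C\<^esub> p2) = Ident C S"

locale abelian_category = preadditive_category +
  assumes ex_zero_object: "\<exists>Z. zero_object C Z"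
    and ex_biproduct: "\<lbrakk>X \<in> Obj C; Y \<in> Obj C\<rbrakk>
      \<Longrightarrow> \<exists>S i1 i2 p1 p2. is_biproduct C X Y S i1 i2 p1 p2"
    and ex_kernel: "f \<in> Arr C \<Longrightarrow> \<exists>k. is_kernel C k f"
    and ex_cokernel: "f \<in> Arr C \<Longrightarrow> \<exists>c. is_cokernel C c f"
    and mono_is_kernel: "is_mono C f \<Longrightarrow> \<exists>g. is_kernel C f g"
    and epi_is_cokernel: "is_epi C f \<Longrightarrow> \<exists>g. is_cokernel C f g"

text \<open>The image of \<open>f\<close> is the kernel of its cokernel.\<close>

definition is_image :: "('o, 'm) precat \<Rightarrow> 'm \<Rightarrow> 'm \<Rightarrow> bool" where
  "is_image C m f \<longleftrightarrow> (\<exists>c. is_cokernel C c f \<and> is_kernel C m c)"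

definition exact_at :: "('o, 'm) precat \<Rightarrow> 'm \<Rightarrow> 'm \<Rightarrow> bool" where
  "exact_at C f g \<longleftrightarrow> (\<exists>m. is_image C m f \<and> is_kernel C m g)"


section \<open>Functors and recollements\<close>

record ('o1, 'm1, 'o2, 'm2) prefunctor =
  OMap :: "'o1 \<Rightarrow> 'o2"
  AMap :: "'m1 \<Rightarrow> 'm2"

definition additive_functor ::
  "('o1, 'm1) precat \<Rightarrow> ('o2, 'm2) precat \<Rightarrow> ('o1, 'm1, 'o2, 'm2) prefunctor \<Rightarrow> bool" where
  "additive_functor C D F \<longleftrightarrow>
     (\<forall>X\<in>Obj C. OMap F X \<in> Obj D) \<and>
     (\<forall>X\<in>Obj C. \<forall>Y\<in>Obj C. \<forall>f\<in>homset C X Y. AMap F f \<in> homset D (OMap F X) (OMap F Y)) \<and>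
     (\<forall>X\<in>Obj C. AMap F (Ident C X) = Ident D (OMap F X)) \<and>
     (\<forall>X\<in>Obj C. \<forall>Y\<in>Obj C. \<forall>Z\<in>Obj C. \<forall>f\<in>homset C X Y. \<forall>g\<in>homset C Y Z.
        AMap F (g \<cdot>\<^bsub>C\<^esub> f) = AMap F g \<cdot>\<^bsub>D\<^esub> AMap F f) \<and>
     (\<forall>X\<in>Obj C. \<forall>Y\<in>Obj C. \<forall>f\<in>homset C X Y. \<forall>g\<in>homset C X Y.
        AMap F (Plus C f g) = Plus D (AMap F f) (AMap F g))"

definition fully_faithful ::
  "('o1, 'm1) precat \<Rightarrow> ('o2, 'm2) precat \<Rightarrow> ('o1, 'm1, 'o2, 'm2) prefunctor \<Rightarrow> bool" where
  "fully_faithful C D F \<longleftrightarrow>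
     (\<forall>X\<in>Obj C. \<forall>Y\<in>Obj C.
        bij_betw (AMap F) (homset C X Y) (homset D (OMap F X) (OMap F Y)))"

text \<open>\<open>F : C \<rightarrow> D\<close> is left adjoint to \<open>G : D \<rightarrow> C\<close>.\<close>

definition adjoint_pair ::
  "('o1, 'm1) precat \<Rightarrow> ('o2, 'm2) precat \<Rightarrow> ('o1, 'm1, 'o2, 'm2) prefunctor
    \<Rightarrow> ('o2, 'm2, 'o1, 'm1) prefunctor \<Rightarrow> bool" where
  "adjoint_pair C D F G \<longleftrightarrow> (\<exists>\<phi>.
     (\<forall>X\<in>Obj C. \<forall>Y\<in>Obj D.
        bij_betw (\<phi> X Y) (homset D (OMap F X) Y) (homset C X (OMap G Y))) \<and>
     (\<forall>X\<in>Obj C. \<forall>X'\<in>Obj C. \<forall>Y\<in>Obj D. \<forall>Y'\<in>Obj D.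
        \<forall>f\<in>homset C X' X. \<forall>g\<in>homset D Y Y'. \<forall>u\<in>homset D (OMap F X) Y.
          \<phi> X' Y' (g \<cdot>\<^bsub>D\<^esub> u \<cdot>\<^bsub>D\<^esub> AMap F f) = AMap G g \<cdot>\<^bsub>C\<^esub> \<phi> X Y u \<cdot>\<^bsub>C\<^esub> f))"

definition recollement ::
  "('oa, 'ma) precat \<Rightarrow> ('ob, 'mb) precat \<Rightarrow> ('oc, 'mc) precat
    \<Rightarrow> ('oa, 'ma, 'ob, 'mb) prefunctor \<Rightarrow> ('ob, 'mb, 'oc, 'mc) prefunctor
    \<Rightarrow> ('ob, 'mb, 'oa, 'ma) prefunctor \<Rightarrow> ('ob, 'mb, 'oa, 'ma) prefunctor
    \<Rightarrow> ('oc, 'mc, 'ob, 'mb) prefunctor \<Rightarrow> ('oc, 'mc, 'ob, 'mb) prefunctor \<Rightarrow> bool" where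
  "recollement A B C i e q p l r \<longleftrightarrow>
     abelian_category A \<and> abelian_category B \<and> abelian_category C \<and>
     additive_functor A B i \<and> additive_functor B C e \<and>
     additive_functor B A q \<and> additive_functor B A p \<and>
     additive_functor C B l \<and> additive_functor C B r \<and>
     adjoint_pair C B l e \<and> adjoint_pair B C e r \<and>
     adjoint_pair B A q i \<and> adjoint_pair A B i p \<and>
     fully_faithful A B i \<and> fully_faithful C B l \<and> fully_faithful C B r \<and>
     {X \<in> Obj B. \<exists>Y\<in>Obj A. isomorphic_objects B X (OMap i Y)}
       = {X \<in> Obj B. zero_object C (OMap e X)}"


section \<open>Projectives, injectives, resolutions and dimensions\<close>

definition Proj :: "('o, 'm) precat \<Rightarrow> 'o set" where
  "Proj C = {P \<in> Obj C. \<forall>g f. is_epi C g \<and> f \<in> homset C P (Cod C g) \<longrightarrow>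
     (\<exists>h\<in>homset C P (Dom C g). g \<cdot>\<^bsub>C\<^esub> h = f)}"

definition Inj :: "('o, 'm) precat \<Rightarrow> 'o set" where
  "Inj C = {I \<in> Obj C. \<forall>g f. is_mono C g \<and> f \<in> homset C (Dom C g) I \<longrightarrow>
     (\<exists>h\<in>homset C (Cod C g) I. h \<cdot>\<^bsub>C\<^esub> g = f)}"

definition enough_projectives :: "('o, 'm) precat \<Rightarrow> bool" where
  "enough_projectives C \<longleftrightarrow> (\<forall>X\<in>Obj C. \<exists>P\<in>Proj C. \<exists>f\<in>homset C P X. is_epi C f)"

definition enough_injectives :: "('o, 'm) precat \<Rightarrow> bool" where
  "enough_injectives C \<longleftrightarrow> (\<forall>X\<in>Obj C. \<exists>I\<in>Inj C. \<exists>f\<in>homset C X I. is_mono C f)"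

definition left_perp :: "('o, 'm) precat \<Rightarrow> 'o set \<Rightarrow> 'o set" where
  "left_perp C S = {X \<in> Obj C. \<forall>Y\<in>S. homset C X Y = {Zero C X Y}}"

definition right_perp :: "('o, 'm) precat \<Rightarrow> 'o set \<Rightarrow> 'o set" where
  "right_perp C S = {Y \<in> Obj C. \<forall>X\<in>S. homset C X Y = {Zero C X Y}}"

text \<open>
  In a projective resolution \<open>d 0\<close> is the augmentation \<open>P 0 \<rightarrow> X\<close>, and \<open>d (Suc k)\<close> is the
  differential \<open>P (Suc k) \<rightarrow> P k\<close>. Dually, in an injective coresolution \<open>d 0\<close> is the
  coaugmentation \<open>X \<rightarrow> I 0\<close>, and \<open>d (Suc k)\<close> is the differential \<open>I k \<rightarrow> I (Suc k)\<close>.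
\<close>

definition projective_resolution ::
  "('o, 'm) precat \<Rightarrow> 'o \<Rightarrow> (nat \<Rightarrow> 'o) \<Rightarrow> (nat \<Rightarrow> 'm) \<Rightarrow> bool" where
  "projective_resolution C X P d \<longleftrightarrow>
     X \<in> Obj C \<and> (\<forall>k. P k \<in> Proj C) \<and>
     d 0 \<in> homset C (P 0) X \<and> (\<forall>k. d (Suc k) \<in> homset C (P (Suc k)) (P k)) \<and>
     is_epi C (d 0) \<and> (\<forall>k. exact_at C (d (Suc k)) (d k))"

definition injective_coresolution ::
  "('o, 'm) precat \<Rightarrow> 'o \<Rightarrow> (nat \<Rightarrow> 'o) \<Rightarrow> (nat \<Rightarrow> 'm) \<Rightarrow> bool" where
  "injective_coresolution C X I d \<longleftrightarrow>
     X \<in> Obj C \<and> (\<forall>k. I k \<in> Inj C) \<and>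
     d 0 \<in> homset C X (I 0) \<and> (\<forall>k. d (Suc k) \<in> homset C (I k) (I (Suc k))) \<and>
     is_mono C (d 0) \<and> (\<forall>k. exact_at C (d k) (d (Suc k)))"

fun syzygy :: "('o, 'm) precat \<Rightarrow> nat \<Rightarrow> 'o \<Rightarrow> 'o \<Rightarrow> bool" where
  "syzygy C 0 X K \<longleftrightarrow> X \<in> Obj C \<and> K = X"
| "syzygy C (Suc n) X K \<longleftrightarrow>
     (\<exists>P d k. projective_resolution C X P d \<and> is_kernel C k (d n) \<and> Dom C k = K)"

fun cosyzygy :: "('o, 'm) precat \<Rightarrow> nat \<Rightarrow> 'o \<Rightarrow> 'o \<Rightarrow> bool" where
  "cosyzygy C 0 X K \<longleftrightarrow> X \<in> Obj C \<and> K = X"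
| "cosyzygy C (Suc n) X K \<longleftrightarrow>
     (\<exists>I d k. injective_coresolution C X I d \<and> is_image C k (d (Suc n)) \<and> Dom C k = K)"

text \<open>
  The projective (injective) dimension is the least length of a projective resolution
  (injective coresolution), \<open>\<infinity>\<close> if there is no finite one, and \<open>-\<infinity>\<close> for zero objects.
\<close>

definition proj_dim :: "('o, 'm) precat \<Rightarrow> 'o \<Rightarrow> ereal" where
  "proj_dim C X = (if zero_object C X then -\<infinity> else
     (INF n \<in> {n. \<exists>P d. projective_resolution C X P d \<and> (\<forall>k>n. zero_object C (P k))}.
        ereal (real n)))"

definition inj_dim :: "('o, 'm) precat \<Rightarrow> 'o \<Rightarrow> ereal" where
  "inj_dim C X = (if zero_object C X then -\<infinity> else
     (INF n \<in> {n. \<exists>I d. injective_coresolution C X I d \<and> (\<forall>k>n. zero_object C (I k))}.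
        ereal (real n)))"


section \<open>Yoneda Ext groups\<close>

text \<open>
  For \<open>j > 0\<close>, a \<open>j\<close>-fold extension \<open>0 \<rightarrow> Y \<rightarrow> E \<rightarrow> \<dots> \<rightarrow> E' \<rightarrow> X \<rightarrow> 0\<close> is represented by the
  list of its \<open>j + 1\<close> arrows between \<open>Y\<close> and \<open>X\<close>; \<open>seq_obj C fs k\<close> is its \<open>k\<close>-th object, counted
  from \<open>Y\<close> (\<open>k = 0\<close>) to \<open>X\<close> (\<open>k = j + 1\<close>). For \<open>j = 0\<close>, the one-element list \<open>[f]\<close> stands for the
  morphism \<open>f : X \<rightarrow> Y\<close> (note the direction), so that Ext in degree 0 is Hom up to this encoding.
\<close>

definition seq_obj :: "('o, 'm) precat \<Rightarrow> 'm list \<Rightarrow> nat \<Rightarrow> 'o" where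
  "seq_obj C fs k = (if k < length fs then Dom C (fs ! k) else Cod C (last fs))"

definition extensions :: "('o, 'm) precat \<Rightarrow> nat \<Rightarrow> 'o \<Rightarrow> 'o \<Rightarrow> 'm list set" where
  "extensions C j X Y =
     (if j = 0 then {[f] | f. f \<in> homset C X Y}
      else {fs. length fs = Suc j \<and> set fs \<subseteq> Arr C \<and>
              Dom C (fs ! 0) = Y \<and> Cod C (fs ! j) = X \<and>
              is_mono C (fs ! 0) \<and> is_epi C (fs ! j) \<and>
              (\<forall>k<j. exact_at C (fs ! k) (fs ! Suc k))})"

text \<open>Existence of a morphism of sequences \<open>fs \<rightarrow> gs\<close> that is \<open>a\<close> on the first object and
  \<open>b\<close> on the last one.\<close>

definition seq_morphism ::
  "('o, 'm) precat \<Rightarrow> 'm list \<Rightarrow> 'm list \<Rightarrow> 'm \<Rightarrow> 'm \<Rightarrow> bool" where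
  "seq_morphism C fs gs a b \<longleftrightarrow> length gs = length fs \<and>
     (\<exists>h. h 0 = a \<and> h (length fs) = b \<and>
        (\<forall>k\<le>length fs. h k \<in> homset C (seq_obj C fs k) (seq_obj C gs k)) \<and>
        (\<forall>k<length fs. gs ! k \<cdot>\<^bsub>C\<^esub> h k = h (Suc k) \<cdot>\<^bsub>C\<^esub> fs ! k))"

text \<open>For \<open>j > 0\<close>, \<open>ext_equiv\<close> is the equivalence relation generated by the morphisms of
  extensions that are the identity on both ends; for \<open>j = 0\<close> it is equality.\<close>

definition ext_step :: "('o, 'm) precat \<Rightarrow> nat \<Rightarrow> 'o \<Rightarrow> 'o \<Rightarrow> ('m list \<times> 'm list) set" where
  "ext_step C j X Y = {(fs, gs). fs \<in> extensions C j X Y \<and> gs \<in> extensions C j X Y \<and>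
     (if j = 0 then fs = gs else seq_morphism C fs gs (Ident C Y) (Ident C X))}"

definition ext_equiv :: "('o, 'm) precat \<Rightarrow> nat \<Rightarrow> 'o \<Rightarrow> 'o \<Rightarrow> ('m list \<times> 'm list) set" where
  "ext_equiv C j X Y = (ext_step C j X Y \<union> (ext_step C j X Y)\<inverse>)\<^sup>*"

definition seq_direct_sum ::
  "('o, 'm) precat \<Rightarrow> 'm list \<Rightarrow> 'm list \<Rightarrow> 'm list
    \<Rightarrow> (nat \<Rightarrow> 'm) \<Rightarrow> (nat \<Rightarrow> 'm) \<Rightarrow> (nat \<Rightarrow> 'm) \<Rightarrow> (nat \<Rightarrow> 'm) \<Rightarrow> bool" where
  "seq_direct_sum C fs gs ss i1 i2 p1 p2 \<longleftrightarrow>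
     length gs = length fs \<and> length ss = length fs \<and>
     (\<forall>k\<le>length fs. is_biproduct C (seq_obj C fs k) (seq_obj C gs k) (seq_obj C ss k)
                      (i1 k) (i2 k) (p1 k) (p2 k)) \<and>
     (\<forall>k<length fs. ss ! k =
        Plus C (i1 (Suc k) \<cdot>\<^bsub>C\<^esub> fs ! k \<cdot>\<^bsub>C\<^esub> p1 k) (i2 (Suc k) \<cdot>\<^bsub>C\<^esub> gs ! k \<cdot>\<^bsub>C\<^esub> p2 k))"

text \<open>
  Baer sum: \<open>hs\<close> is \<open>\<nabla> (fs \<oplus> gs) \<Delta>\<close>, where \<open>\<nabla> = p1 + p2 : Y \<oplus> Y \<rightarrow> Y\<close> and
  \<open>\<Delta> = i1 + i2 : X \<rightarrow> X \<oplus> X\<close>. The extension \<open>ts\<close> from \<open>Y\<close> to \<open>X \<oplus> X\<close> is \<open>\<nabla> (fs \<oplus> gs)\<close>: up to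
  equivalence, the pushout of an extension \<open>E\<close> along \<open>a\<close> is any extension that receives a morphism
  from \<open>E\<close> which is \<open>a\<close> on the left end and the identity on the right end. Dually, \<open>hs\<close> is the
  pullback of \<open>ts\<close> along \<open>\<Delta>\<close>.
\<close>

definition baer_sum ::
  "('o, 'm) precat \<Rightarrow> nat \<Rightarrow> 'o \<Rightarrow> 'o \<Rightarrow> 'm list \<Rightarrow> 'm list \<Rightarrow> 'm list \<Rightarrow> bool" where
  "baer_sum C j X Y fs gs hs \<longleftrightarrow>
     (\<exists>ss ts i1 i2 p1 p2 XX.
        seq_direct_sum C fs gs ss i1 i2 p1 p2 \<and> XX = seq_obj C ss (Suc j) \<and>
        ts \<in> extensions C j XX Y \<and> hs \<in> extensions C j X Y \<and>
        seq_morphism C ss ts (Plus C (p1 0) (p2 0)) (Ident C XX) \<and>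
        seq_morphism C hs ts (Ident C Y) (Plus C (i1 (Suc j)) (i2 (Suc j))))"

definition ext_add ::
  "('o, 'm) precat \<Rightarrow> nat \<Rightarrow> 'o \<Rightarrow> 'o \<Rightarrow> 'm list set \<Rightarrow> 'm list set \<Rightarrow> 'm list set" where
  "ext_add C j X Y a b =
     (if j = 0 then {[Plus C f g] | f g. [f] \<in> a \<and> [g] \<in> b}
      else ext_equiv C j X Y `` {hs. \<exists>fs\<in>a. \<exists>gs\<in>b. baer_sum C j X Y fs gs hs})"

text \<open>
  The zero of Ext: the zero morphism for \<open>j = 0\<close>, the split extensions for \<open>j = 1\<close>, and the class
  of \<open>0 \<rightarrow> Y = Y \<rightarrow> 0 \<rightarrow> \<dots> \<rightarrow> 0 \<rightarrow> X = X \<rightarrow> 0\<close> for \<open>j > 1\<close>, where exactness forces the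
  unnamed objects to be zero objects.
\<close>

definition trivial_extension :: "('o, 'm) precat \<Rightarrow> nat \<Rightarrow> 'o \<Rightarrow> 'o \<Rightarrow> 'm list \<Rightarrow> bool" where
  "trivial_extension C j X Y fs \<longleftrightarrow> fs \<in> extensions C j X Y \<and>
     (if j = 0 then fs = [Zero C X Y]
      else if j = 1 then (\<exists>s\<in>homset C X (Dom C (fs ! 1)). fs ! 1 \<cdot>\<^bsub>C\<^esub> s = Ident C X)
      else fs ! 0 = Ident C Y \<and> fs ! j = Ident C X \<and>
           (\<forall>k\<in>{1..<j}. fs ! k = Zero C (seq_obj C fs k) (seq_obj C fs (Suc k))))"

definition Ext :: "('o, 'm) precat \<Rightarrow> nat \<Rightarrow> 'o \<Rightarrow> 'o \<Rightarrow> 'm list set monoid" where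
  "Ext C j X Y =
     \<lparr>carrier = extensions C j X Y // ext_equiv C j X Y,
      mult = ext_add C j X Y,
      one = ext_equiv C j X Y `` {fs. trivial_extension C j X Y fs}\<rparr>"

text \<open>
  The map \<open>Ext C j X Y \<rightarrow> Ext D j (F X) (F Y)\<close> induced by an exact functor \<open>F : C \<rightarrow> D\<close>: it sends
  the class of \<open>fs\<close> to the class of the image of \<open>fs\<close> under \<open>F\<close>.
\<close>

definition ext_map ::
  "('o2, 'm2) precat \<Rightarrow> ('o1, 'm1, 'o2, 'm2) prefunctor \<Rightarrow> nat \<Rightarrow> 'o1 \<Rightarrow> 'o1
    \<Rightarrow> 'm1 list set \<Rightarrow> 'm2 list set" where
  "ext_map D F j X Y a = ext_equiv D j (OMap F X) (OMap F Y) `` (map (AMap F) ` a)"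

definition homological_isomorphism ::
  "('o1, 'm1) precat \<Rightarrow> ('o2, 'm2) precat \<Rightarrow> ('o1, 'm1, 'o2, 'm2) prefunctor \<Rightarrow> nat \<Rightarrow> bool" where
  "homological_isomorphism C D F t \<longleftrightarrow>
     (\<forall>X\<in>Obj C. \<forall>Y\<in>Obj C. \<forall>j>t. Ext C j X Y \<cong> Ext D j (OMap F X) (OMap F Y))"

end

theory Submission
  imports Defs
begin

text \<open>
  Case (ii) is case (i) for the opposite categories, so assume (i). By \<open>(\<alpha>')\<close> and \<open>(\<epsilon>)\<close>, every
  object \<open>X\<close> of \<open>B\<close> has an \<open>m\<close>-th syzygy \<open>K\<close> with \<open>Ext\<^sup>s(K, i I) = 0\<close> for all \<open>s \<ge> 0\<close> and all
  injective \<open>I\<close>. Such an object has no nonzero maps to the image of \<open>i\<close>, hence is a quotient of some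
  \<open>l Q\<close> with \<open>Q\<close> projective, and the kernel is of the same kind. So \<open>X\<close> has a projective resolution \<open>R\<close>
  that consists of objects \<open>l Q\<close> from degree \<open>m\<close> on. On these objects and on their syzygies \<open>e\<close> is
  bijective on Hom groups into any \<open>Y\<close>. The terms of \<open>e R\<close> have projective dimension at most \<open>n\<close> by
  \<open>(\<beta>)\<close>, and are projective from degree \<open>m\<close> on, so in degrees \<open>j > m + n\<close> they are acyclic enough for
  \<open>e R\<close> to compute \<open>Ext\<^sup>j(e X, e Y)\<close>: every extension is equivalent to a pushout of \<open>e R\<close> along a map
  \<open>f\<close> from the \<open>j\<close>-th syzygy, where \<open>f\<close> is unique up to maps that factor through the next term. This
  is seen by mapping extensions to an injective coresolution of \<open>e Y\<close>. Comparing with \<open>R\<close> gives the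
  bijection. It is additive since \<open>e\<close> preserves Baer sums, which correspond to sums of the maps \<open>f\<close>.
\<close>

section \<open>Preadditive categories\<close>

text \<open>The bound on \<open>j\<close> comes from counting positions in the resolution of
  \<open>X\<close> with left end \<open>K\<close>. Its \<open>j\<close> terms are numbered from
  \<open>K\<close>; the first \<open>j - m\<close> are of the form \<open>l Q\<close>, so
  \<open>e\<close> sends them to projectives. At a position \<open>k > j - m\<close> only
  \<open>Ext^s\<close> with \<open>s \<ge> k - 1\<close> has to vanish (degree \<open>k\<close> to
  lift a map, degree \<open>k - 1\<close> to lift a homotopy), and \<open>j > m + n\<close> makes
  such \<open>s\<close> larger than \<open>n\<close>. As also \<open>j - m \<ge> 1\<close>, the term
  next to \<open>K\<close> is some \<open>l Q\<close>, so homotopies can be brought back from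
  \<open>C\<close>. The main obstacle is that equivalence of Yoneda extensions is generated by
  zigzags, so inequivalence is hard to see directly. Cocycles \<open>X \<rightarrow> J j\<close> in
  an injective coresolution serve as invariants of zigzags. Vanishing of Ext is therefore expressed
  by cocycles too, and dimension shifting is done by hand on them. Bijectivity is proved for
  extensions up to equivalence, apart from the group structure. In this form it passes to opposite
  categories by reversing lists, and Baer sums never have to be dualized.\<close>

context category
begin

lemma hom_iff: "f \<in> homset C X Y \<longleftrightarrow> f \<in> Arr C \<and> Dom C f = X \<and> Cod C f = Y"
  by (simp add: homset_def)

lemma homD: "f \<in> homset C X Y \<Longrightarrow> f \<in> Arr C \<and> Dom C f = X \<and> Cod C f = Y"
  by (simp add: homset_def)

lemma hom_Obj: "f \<in> homset C X Y \<Longrightarrow> X \<in> Obj C \<and> Y \<in> Obj C"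
  using Dom_Obj Cod_Obj by (auto simp: homset_def)

lemma comp_simps [simp]:
  assumes "f \<in> Arr C" "g \<in> Arr C" "Cod C f = Dom C g"
  shows "g \<cdot> f \<in> Arr C" "Dom C (g \<cdot> f) = Dom C f" "Cod C (g \<cdot> f) = Cod C g"
  using Comp_hom[of f "Dom C f" "Cod C f" g "Cod C g"] assms by (auto simp: homset_def)

lemma comp_assoc [simp]:
  assumes "f \<in> Arr C" "g \<in> Arr C" "h \<in> Arr C" "Cod C f = Dom C g" "Cod C g = Dom C h"
  shows "(h \<cdot> g) \<cdot> f = h \<cdot> (g \<cdot> f)"
  using Comp_assoc[of f "Dom C f" "Cod C f" g "Cod C g" h "Cod C h"] assms by (auto simp: homset_def)

lemma Ident_simps [simp]:
  assumes "X \<in> Obj C"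
  shows "Ident C X \<in> Arr C" "Dom C (Ident C X) = X" "Cod C (Ident C X) = X"
  using Ident_hom[OF assms] by (auto simp: homset_def)

lemma comp_Ident [simp]:
  "f \<in> Arr C \<Longrightarrow> Cod C f = Y \<Longrightarrow> Ident C Y \<cdot> f = f"
  "f \<in> Arr C \<Longrightarrow> Dom C f = X \<Longrightarrow> f \<cdot> Ident C X = f"
  using Comp_Ident_left Comp_Ident_right by (auto simp: homset_def)

lemma Dom_Cod_Obj [simp]: "f \<in> Arr C \<Longrightarrow> Dom C f \<in> Obj C" "f \<in> Arr C \<Longrightarrow> Cod C f \<in> Obj C"
  using Dom_Obj Cod_Obj by auto

text \<open>Composites are kept associated to the right, so an equation
  \<open>g \<cdot> f = h\<close> does not match \<open>g \<cdot> (f \<cdot> x)\<close>. This is the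
  form in which such equations are applied throughout.\<close>

lemma comp_cong_assoc1:
  assumes "g \<cdot> f = h" "f \<in> Arr C" "g \<in> Arr C" "x \<in> Arr C"
    "Cod C f = Dom C g" "Cod C x = Dom C f"
  shows "g \<cdot> (f \<cdot> x) = h \<cdot> x"
  using comp_assoc[of x f g] assms(2-) by (simp add: assms(1))

lemma comp_cong_assoc:
  assumes "g \<cdot> f = g' \<cdot> f'" "f \<in> Arr C" "g \<in> Arr C" "f' \<in> Arr C" "g' \<in> Arr C" "x \<in> Arr C"
    "Cod C f = Dom C g" "Cod C f' = Dom C g'" "Cod C x = Dom C f" "Dom C f' = Dom C f"
  shows "g \<cdot> (f \<cdot> x) = g' \<cdot> (f' \<cdot> x)"
  using comp_cong_assoc1[OF assms(1)] comp_assoc[of x f' g'] assms(2-) by simp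

lemma monoD:
  assumes "is_mono C f" "f \<cdot> g = f \<cdot> h" "g \<in> Arr C" "h \<in> Arr C"
    "Cod C g = Dom C f" "Cod C h = Dom C f" "Dom C g = Dom C h"
  shows "g = h"
  using assms unfolding is_mono_def homset_def by (metis (mono_tags, lifting) Dom_Obj mem_Collect_eq)

lemma epiD:
  assumes "is_epi C f" "g \<cdot> f = h \<cdot> f" "g \<in> Arr C" "h \<in> Arr C"
    "Dom C g = Cod C f" "Dom C h = Cod C f" "Cod C g = Cod C h"
  shows "g = h"
  using assms unfolding is_epi_def homset_def by (metis (mono_tags, lifting) Cod_Obj mem_Collect_eq)

end

text \<open>Negation is not part of \<open>precat\<close>; it is recovered as the inverse in the hom
  group that \<open>Dom\<close> and \<open>Cod\<close> of \<open>f\<close> select.\<close>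

definition arr_neg :: "('o, 'm) precat \<Rightarrow> 'm \<Rightarrow> 'm" where
  "arr_neg C f = inv\<^bsub>hom_group C (Dom C f) (Cod C f)\<^esub> f"

definition arr_diff :: "('o, 'm) precat \<Rightarrow> 'm \<Rightarrow> 'm \<Rightarrow> 'm" where
  "arr_diff C f g = Plus C f (arr_neg C g)"

context preadditive_category
begin

lemma hom_groupD:
  assumes "X \<in> Obj C" "Y \<in> Obj C"
  shows "\<And>f g. f \<in> homset C X Y \<Longrightarrow> g \<in> homset C X Y \<Longrightarrow> Plus C f g \<in> homset C X Y"
    "Zero C X Y \<in> homset C X Y"
    "\<And>f. f \<in> homset C X Y \<Longrightarrow> Plus C (Zero C X Y) f = f"
    "\<And>f g. f \<in> homset C X Y \<Longrightarrow> g \<in> homset C X Y \<Longrightarrow> Plus C f g = Plus C g f"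
    "\<And>f g h. \<lbrakk>f \<in> homset C X Y; g \<in> homset C X Y; h \<in> homset C X Y\<rbrakk>
      \<Longrightarrow> Plus C (Plus C f g) h = Plus C f (Plus C g h)"
    "\<And>f. f \<in> homset C X Y \<Longrightarrow> arr_neg C f \<in> homset C X Y"
    "\<And>f. f \<in> homset C X Y \<Longrightarrow> Plus C f (arr_neg C f) = Zero C X Y"
proof -
  note G = hom_comm_group[OF assms]
  note g = comm_group.axioms(2)[OF G]
  note mon = group.is_monoid[OF g]
  note cm = comm_group.axioms(1)[OF G]
  note [simp] = hom_group_def
  show "\<And>f g. f \<in> homset C X Y \<Longrightarrow> g \<in> homset C X Y \<Longrightarrow> Plus C f g \<in> homset C X Y"
    using monoid.m_closed[OF mon] by simp
  show "Zero C X Y \<in> homset C X Y"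
    using monoid.one_closed[OF mon] by simp
  show "\<And>f. f \<in> homset C X Y \<Longrightarrow> Plus C (Zero C X Y) f = f"
    using monoid.l_one[OF mon] by simp
  show "\<And>f g. f \<in> homset C X Y \<Longrightarrow> g \<in> homset C X Y \<Longrightarrow> Plus C f g = Plus C g f"
    using comm_monoid.m_comm[OF cm] by simp
  show "\<And>f g h. \<lbrakk>f \<in> homset C X Y; g \<in> homset C X Y; h \<in> homset C X Y\<rbrakk>
      \<Longrightarrow> Plus C (Plus C f g) h = Plus C f (Plus C g h)"
    using monoid.m_assoc[OF mon] by simp
  show "\<And>f. f \<in> homset C X Y \<Longrightarrow> arr_neg C f \<in> homset C X Y"
    using group.inv_closed[OF g] by (simp add: arr_neg_def hom_iff)
  show "\<And>f. f \<in> homset C X Y \<Longrightarrow> Plus C f (arr_neg C f) = Zero C X Y"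
    using group.r_inv[OF g] by (simp add: arr_neg_def hom_iff)
qed

lemma Plus_simps [simp]:
  assumes "f \<in> Arr C" "g \<in> Arr C" "Dom C f = Dom C g" "Cod C f = Cod C g"
  shows "Plus C f g \<in> Arr C" "Dom C (Plus C f g) = Dom C g" "Cod C (Plus C f g) = Cod C g"
  using hom_groupD(1)[of "Dom C f" "Cod C f" f g] assms by (auto simp: hom_iff)

lemma Zero_simps [simp]:
  assumes "X \<in> Obj C" "Y \<in> Obj C"
  shows "Zero C X Y \<in> Arr C" "Dom C (Zero C X Y) = X" "Cod C (Zero C X Y) = Y"
  using hom_groupD(2)[of X Y] assms by (auto simp: hom_iff)

lemma Plus_comm:
  assumes "f \<in> Arr C" "g \<in> Arr C" "Dom C f = Dom C g" "Cod C f = Cod C g"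
  shows "Plus C f g = Plus C g f"
  using hom_groupD(4)[of "Dom C f" "Cod C f" f g] assms by (auto simp: hom_iff)

lemma neg_simps [simp]:
  assumes "f \<in> Arr C"
  shows "arr_neg C f \<in> Arr C" "Dom C (arr_neg C f) = Dom C f" "Cod C (arr_neg C f) = Cod C f"
  using hom_groupD(6)[of "Dom C f" "Cod C f" f] assms by (auto simp: hom_iff)

lemma Plus_neg:
  assumes "f \<in> Arr C"
  shows "Plus C f (arr_neg C f) = Zero C (Dom C f) (Cod C f)"
    "Plus C (arr_neg C f) f = Zero C (Dom C f) (Cod C f)"
  using hom_groupD(7)[of "Dom C f" "Cod C f" f] Plus_comm[of "arr_neg C f" f] assms by (auto simp: hom_iff)

lemma Plus_Zero [simp]:
  assumes "f \<in> Arr C" "Dom C f = X" "Cod C f = Y"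
  shows "Plus C f (Zero C X Y) = f" "Plus C (Zero C X Y) f = f"
  using hom_groupD(3)[of X Y f] Plus_comm[of "Zero C X Y" f] assms by (auto simp: hom_iff)

lemma Plus_assoc:
  assumes "f \<in> Arr C" "g \<in> Arr C" "h \<in> Arr C" "Dom C f = Dom C g" "Cod C f = Cod C g"
    "Dom C h = Dom C g" "Cod C h = Cod C g"
  shows "Plus C (Plus C f g) h = Plus C f (Plus C g h)"
  using hom_groupD(5)[of "Dom C f" "Cod C f" f g h] assms by (auto simp: hom_iff)

lemma Plus_left_comm:
  assumes "f \<in> Arr C" "g \<in> Arr C" "h \<in> Arr C" "Dom C f = Dom C g" "Cod C f = Cod C g"
    "Dom C h = Dom C g" "Cod C h = Cod C g"
  shows "Plus C f (Plus C g h) = Plus C g (Plus C f h)"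
proof -
  have "Plus C f (Plus C g h) = Plus C (Plus C f g) h"
    using assms by (subst Plus_assoc) auto
  also have "\<dots> = Plus C (Plus C g f) h"
    using assms by (subst Plus_comm[of f g]) auto
  also have "\<dots> = Plus C g (Plus C f h)"
    using assms by (subst Plus_assoc) auto
  finally show ?thesis .
qed

lemmas Plus_ac = Plus_assoc Plus_comm Plus_left_comm

lemma Plus_neg_cancel [simp]:
  assumes "f \<in> Arr C" "g \<in> Arr C" "Dom C f = Dom C g" "Cod C f = Cod C g"
  shows "Plus C f (Plus C (arr_neg C f) g) = g" "Plus C (arr_neg C f) (Plus C f g) = g"
  using assms by (simp_all flip: Plus_assoc add: Plus_neg)

lemma Plus_left_cancel:
  assumes "Plus C f g = Plus C f h" "f \<in> Arr C" "g \<in> Arr C" "h \<in> Arr C" "Dom C f = Dom C g" "Cod C f = Cod C g"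
    "Dom C h = Dom C g" "Cod C h = Cod C g"
  shows "g = h"
  using assms by (metis Plus_neg_cancel(2))

lemma Comp_Plus [simp]:
  "\<lbrakk>f \<in> Arr C; g \<in> Arr C; h \<in> Arr C; Cod C f = Dom C g; Dom C h = Dom C g; Cod C h = Cod C g\<rbrakk>
      \<Longrightarrow> Plus C g h \<cdot> f = Plus C (g \<cdot> f) (h \<cdot> f)"
  "\<lbrakk>f \<in> Arr C; g \<in> Arr C; h \<in> Arr C; Dom C f = Dom C g; Cod C f = Dom C h; Cod C g = Dom C h\<rbrakk>
      \<Longrightarrow> h \<cdot> Plus C f g = Plus C (h \<cdot> f) (h \<cdot> g)"
  using Comp_Plus_left[of f "Dom C f" "Cod C f" g "Cod C g" h]
    Comp_Plus_right[of f "Dom C f" "Cod C f" g h "Cod C h"] by (auto simp: homset_def)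

lemma Zero_comp [simp]:
  assumes "f \<in> Arr C" "Cod C f = Y" "Z \<in> Obj C"
  shows "Zero C Y Z \<cdot> f = Zero C (Dom C f) Z"
proof -
  have Y: "Y \<in> Obj C" using assms by auto
  have "Plus C (Zero C Y Z \<cdot> f) (Zero C Y Z \<cdot> f) = Plus C (Zero C Y Z) (Zero C Y Z) \<cdot> f"
    using assms Y by (subst Comp_Plus(1)) auto
  also have "\<dots> = Plus C (Zero C Y Z \<cdot> f) (Zero C (Dom C f) Z)"
    using assms Y by simp
  finally show ?thesis
    by (rule Plus_left_cancel) (use assms Y in auto)
qed

lemma comp_Zero [simp]:
  assumes "f \<in> Arr C" "Dom C f = Y" "X \<in> Obj C"
  shows "f \<cdot> Zero C X Y = Zero C X (Cod C f)"
proof -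
  have Y: "Y \<in> Obj C" using assms by auto
  have "Plus C (f \<cdot> Zero C X Y) (f \<cdot> Zero C X Y) = f \<cdot> Plus C (Zero C X Y) (Zero C X Y)"
    using assms Y by (subst Comp_Plus(2)) auto
  also have "\<dots> = Plus C (f \<cdot> Zero C X Y) (Zero C X (Cod C f))"
    using assms Y by simp
  finally show ?thesis
    by (rule Plus_left_cancel) (use assms Y in auto)
qed

lemma neg_unique:
  assumes "Plus C f g = Zero C (Dom C f) (Cod C f)" "f \<in> Arr C" "g \<in> Arr C" "Dom C g = Dom C f" "Cod C g = Cod C f"
  shows "g = arr_neg C f"
  by (rule Plus_left_cancel[of f]) (use assms in \<open>auto simp: Plus_neg\<close>)

lemma neg_comp [simp]:
  assumes "f \<in> Arr C" "g \<in> Arr C" "Cod C f = Dom C g"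
  shows "arr_neg C g \<cdot> f = arr_neg C (g \<cdot> f)" "g \<cdot> arr_neg C f = arr_neg C (g \<cdot> f)"
proof -
  have "Plus C (g \<cdot> f) (arr_neg C g \<cdot> f) = Plus C g (arr_neg C g) \<cdot> f"
    using assms by (subst Comp_Plus(1)) auto
  also have "\<dots> = Zero C (Dom C f) (Cod C g)"
    using assms by (simp add: Plus_neg)
  finally show "arr_neg C g \<cdot> f = arr_neg C (g \<cdot> f)"
    by (intro neg_unique) (use assms in auto)
  have "Plus C (g \<cdot> f) (g \<cdot> arr_neg C f) = g \<cdot> Plus C f (arr_neg C f)"
    using assms by (subst Comp_Plus(2)) auto
  also have "\<dots> = Zero C (Dom C f) (Cod C g)"
    using assms by (simp add: Plus_neg)
  finally show "g \<cdot> arr_neg C f = arr_neg C (g \<cdot> f)"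
    by (intro neg_unique) (use assms in auto)
qed

lemma minus_simps [simp]:
  assumes "f \<in> Arr C" "g \<in> Arr C" "Dom C f = Dom C g" "Cod C f = Cod C g"
  shows "arr_diff C f g \<in> Arr C" "Dom C (arr_diff C f g) = Dom C g" "Cod C (arr_diff C f g) = Cod C g"
  using assms by (auto simp: arr_diff_def)

lemma minus_self [simp]: "f \<in> Arr C \<Longrightarrow> arr_diff C f f = Zero C (Dom C f) (Cod C f)"
  by (simp add: arr_diff_def Plus_neg)

lemma minus_comp:
  "\<lbrakk>f \<in> Arr C; g \<in> Arr C; h \<in> Arr C; Cod C f = Dom C g; Dom C h = Dom C g; Cod C h = Cod C g\<rbrakk>
      \<Longrightarrow> arr_diff C g h \<cdot> f = arr_diff C (g \<cdot> f) (h \<cdot> f)"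
  "\<lbrakk>f \<in> Arr C; g \<in> Arr C; h \<in> Arr C; Dom C f = Dom C g; Cod C f = Dom C h; Cod C g = Dom C h\<rbrakk>
      \<Longrightarrow> h \<cdot> arr_diff C f g = arr_diff C (h \<cdot> f) (h \<cdot> g)"
  by (auto simp: arr_diff_def)

lemma minus_eq_iff:
  assumes "f \<in> Arr C" "g \<in> Arr C" "h \<in> Arr C" "Dom C f = Dom C g" "Cod C f = Cod C g"
    "Dom C h = Dom C g" "Cod C h = Cod C g"
  shows "arr_diff C f g = h \<longleftrightarrow> f = Plus C g h"
proof
  show "arr_diff C f g = h \<Longrightarrow> f = Plus C g h" using assms
    unfolding arr_diff_def by (auto simp: Plus_comm[of f "arr_neg C g"])
  show "f = Plus C g h \<Longrightarrow> arr_diff C f g = h" using assms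
    unfolding arr_diff_def by (simp add: Plus_comm[of g h] Plus_assoc Plus_neg)
qed

lemma minus_eq_Zero_iff:
  assumes "f \<in> Arr C" "g \<in> Arr C" "Dom C f = Dom C g" "Cod C f = Cod C g" "X = Dom C g" "Y = Cod C g"
  shows "arr_diff C f g = Zero C X Y \<longleftrightarrow> f = g"
  using assms by (subst minus_eq_iff) auto

lemma is_monoI:
  assumes "f \<in> Arr C" "\<And>g. g \<in> Arr C \<Longrightarrow> Cod C g = Dom C f \<Longrightarrow> f \<cdot> g = Zero C (Dom C g) (Cod C f)
    \<Longrightarrow> g = Zero C (Dom C g) (Dom C f)"
  shows "is_mono C f"
  unfolding is_mono_def
proof (intro conjI ballI impI)
  fix W g h assume g: "g \<in> homset C W (Dom C f)" and h: "h \<in> homset C W (Dom C f)" and e: "f \<cdot> g = f \<cdot> h"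
  have "arr_diff C g h = Zero C W (Dom C f)"
    using assms(2)[of "arr_diff C g h"] g h e assms(1) by (simp add: hom_iff minus_comp)
  then show "g = h" using g h by (simp add: hom_iff minus_eq_Zero_iff)
qed fact

lemma is_epiI:
  assumes "f \<in> Arr C" "\<And>g. g \<in> Arr C \<Longrightarrow> Dom C g = Cod C f \<Longrightarrow> g \<cdot> f = Zero C (Dom C f) (Cod C g)
    \<Longrightarrow> g = Zero C (Cod C f) (Cod C g)"
  shows "is_epi C f"
  unfolding is_epi_def
proof (intro conjI ballI impI)
  fix W g h assume g: "g \<in> homset C (Cod C f) W" and h: "h \<in> homset C (Cod C f) W" and e: "g \<cdot> f = h \<cdot> f"
  have "arr_diff C g h = Zero C (Cod C f) W"
    using assms(2)[of "arr_diff C g h"] g h e assms(1) by (simp add: hom_iff minus_comp)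
  then show "g = h" using g h by (simp add: hom_iff minus_eq_Zero_iff)
qed fact

lemma mono_Zero:
  assumes "is_mono C f" "f \<cdot> g = Zero C X Y" "g \<in> Arr C" "Cod C g = Dom C f" "Dom C g = X" "Cod C f = Y"
  shows "g = Zero C X (Dom C f)"
proof -
  have "f \<in> Arr C" using assms by (auto simp: is_mono_def)
  then show ?thesis using assms by (rule_tac monoD[OF assms(1)]) auto
qed

lemma epi_Zero:
  assumes "is_epi C f" "g \<cdot> f = Zero C X Y" "g \<in> Arr C" "Dom C g = Cod C f" "Dom C f = X" "Cod C g = Y"
  shows "g = Zero C (Cod C f) Y"
proof -
  have "f \<in> Arr C" using assms by (auto simp: is_epi_def)
  then show ?thesis using assms by (rule_tac epiD[OF assms(1)]) auto
qed

lemma kernel_unique: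
  assumes "is_kernel C k f" "W \<in> Obj C" "g \<in> homset C W (Dom C f)" "f \<cdot> g = Zero C W (Cod C f)"
  shows "\<exists>!h. h \<in> homset C W (Dom C k) \<and> k \<cdot> h = g"
proof -
  have "\<forall>W\<in>Obj C. \<forall>g\<in>homset C W (Dom C f). f \<cdot> g = Zero C W (Cod C f) \<longrightarrow>
        (\<exists>!h. h \<in> homset C W (Dom C k) \<and> k \<cdot> h = g)"
    using assms(1) unfolding is_kernel_def by (elim conjE)
  from this[rule_format, OF assms(2-)] show ?thesis .
qed

lemma cokernel_unique:
  assumes "is_cokernel C k f" "W \<in> Obj C" "g \<in> homset C (Cod C f) W" "g \<cdot> f = Zero C (Dom C f) W"
  shows "\<exists>!h. h \<in> homset C (Cod C k) W \<and> h \<cdot> k = g"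
proof -
  have "\<forall>W\<in>Obj C. \<forall>g\<in>homset C (Cod C f) W. g \<cdot> f = Zero C (Dom C f) W \<longrightarrow>
        (\<exists>!h. h \<in> homset C (Cod C k) W \<and> h \<cdot> k = g)"
    using assms(1) unfolding is_cokernel_def by (elim conjE)
  from this[rule_format, OF assms(2-)] show ?thesis .
qed

lemma kernelD:
  assumes "is_kernel C k f"
  shows "f \<in> Arr C" "k \<in> Arr C" "Cod C k = Dom C f" "f \<cdot> k = Zero C (Dom C k) (Cod C f)" "is_mono C k"
proof -
  show *: "f \<in> Arr C" "k \<in> Arr C" "Cod C k = Dom C f" "f \<cdot> k = Zero C (Dom C k) (Cod C f)"
    using assms by (auto simp: is_kernel_def)
  show "is_mono C k" unfolding is_mono_def
  proof (intro conjI ballI impI)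
    fix W g h assume W: "W \<in> Obj C" and g: "g \<in> homset C W (Dom C k)" and h: "h \<in> homset C W (Dom C k)" and e: "k \<cdot> g = k \<cdot> h"
    have "k \<cdot> g \<in> homset C W (Dom C f)" using g * by (auto simp: hom_iff)
    moreover have "f \<cdot> (k \<cdot> g) = Zero C W (Cod C f)"
      using g * comp_cong_assoc1[OF *(4), of g] by (auto simp: hom_iff)
    ultimately have "\<exists>!x. x \<in> homset C W (Dom C k) \<and> k \<cdot> x = k \<cdot> g"
      using W by (intro kernel_unique[OF assms])
    then show "g = h" using g h e by auto
  qed fact
qed

lemma kernel_lift:
  assumes "is_kernel C k f" "g \<in> Arr C" "Cod C g = Dom C f" "f \<cdot> g = Zero C (Dom C g) (Cod C f)"
  obtains h where "h \<in> Arr C" "Dom C h = Dom C g" "Cod C h = Dom C k" "k \<cdot> h = g"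
proof -
  have "\<exists>!h. h \<in> homset C (Dom C g) (Dom C k) \<and> k \<cdot> h = g"
    by (rule kernel_unique[OF assms(1)]) (use assms in \<open>auto simp: hom_iff\<close>)
  then show thesis using that by (auto simp: hom_iff)
qed

lemma kernelI:
  assumes "f \<in> Arr C" "is_mono C k" "Cod C k = Dom C f" "f \<cdot> k = Zero C (Dom C k) (Cod C f)"
    "\<And>g. g \<in> Arr C \<Longrightarrow> Cod C g = Dom C f \<Longrightarrow> f \<cdot> g = Zero C (Dom C g) (Cod C f) \<Longrightarrow>
       \<exists>h\<in>Arr C. Dom C h = Dom C g \<and> Cod C h = Dom C k \<and> k \<cdot> h = g"
  shows "is_kernel C k f"
  unfolding is_kernel_def
proof (intro conjI ballI impI)
  show "k \<in> Arr C" using assms(2) by (simp add: is_mono_def)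
  fix W g assume "g \<in> homset C W (Dom C f)" "f \<cdot> g = Zero C W (Cod C f)"
  then obtain h where "h\<in>Arr C" "Dom C h = Dom C g" "Cod C h = Dom C k" "k \<cdot> h = g" "Dom C g = W"
    using assms(5)[of g] by (auto simp: hom_iff)
  then show "\<exists>!h. h \<in> homset C W (Dom C k) \<and> k \<cdot> h = g"
    by (intro ex1I[of _ h], simp add: hom_iff, elim conjE, rule_tac monoD[OF assms(2)]) (auto simp: hom_iff)
qed (use assms(1-4) in auto)

lemma cokernelD:
  assumes "is_cokernel C k f"
  shows "f \<in> Arr C" "k \<in> Arr C" "Dom C k = Cod C f" "k \<cdot> f = Zero C (Dom C f) (Cod C k)" "is_epi C k"
proof -
  show *: "f \<in> Arr C" "k \<in> Arr C" "Dom C k = Cod C f" "k \<cdot> f = Zero C (Dom C f) (Cod C k)"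
    using assms by (auto simp: is_cokernel_def)
  show "is_epi C k" unfolding is_epi_def
  proof (intro conjI ballI impI)
    fix W g h assume W: "W \<in> Obj C" and g: "g \<in> homset C (Cod C k) W" and h: "h \<in> homset C (Cod C k) W" and e: "g \<cdot> k = h \<cdot> k"
    have "g \<cdot> k \<in> homset C (Cod C f) W" using g * by (auto simp: hom_iff)
    moreover have "(g \<cdot> k) \<cdot> f = Zero C (Dom C f) W"
      using g * by (auto simp: hom_iff)
    ultimately have "\<exists>!x. x \<in> homset C (Cod C k) W \<and> x \<cdot> k = g \<cdot> k"
      using W by (intro cokernel_unique[OF assms])
    then show "g = h" using g h e by auto
  qed fact
qed

lemma cokernel_desc:
  assumes "is_cokernel C k f" "g \<in> Arr C" "Dom C g = Cod C f" "g \<cdot> f = Zero C (Dom C f) (Cod C g)"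
  obtains h where "h \<in> Arr C" "Dom C h = Cod C k" "Cod C h = Cod C g" "h \<cdot> k = g"
proof -
  have "\<exists>!h. h \<in> homset C (Cod C k) (Cod C g) \<and> h \<cdot> k = g"
    by (rule cokernel_unique[OF assms(1)]) (use assms in \<open>auto simp: hom_iff\<close>)
  then show thesis using that by (auto simp: hom_iff)
qed

lemma cokernelI:
  assumes "f \<in> Arr C" "is_epi C k" "Dom C k = Cod C f" "k \<cdot> f = Zero C (Dom C f) (Cod C k)"
    "\<And>g. g \<in> Arr C \<Longrightarrow> Dom C g = Cod C f \<Longrightarrow> g \<cdot> f = Zero C (Dom C f) (Cod C g) \<Longrightarrow>
       \<exists>h\<in>Arr C. Dom C h = Cod C k \<and> Cod C h = Cod C g \<and> h \<cdot> k = g"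
  shows "is_cokernel C k f"
  unfolding is_cokernel_def
proof (intro conjI ballI impI)
  show "k \<in> Arr C" using assms(2) by (simp add: is_epi_def)
  fix W g assume "g \<in> homset C (Cod C f) W" "g \<cdot> f = Zero C (Dom C f) W"
  then obtain h where "h\<in>Arr C" "Dom C h = Cod C k" "Cod C h = Cod C g" "h \<cdot> k = g" "Cod C g = W"
    using assms(5)[of g] by (auto simp: hom_iff)
  then show "\<exists>!h. h \<in> homset C (Cod C k) W \<and> h \<cdot> k = g"
    by (intro ex1I[of _ h], simp add: hom_iff, elim conjE, rule_tac epiD[OF assms(2)]) (auto simp: hom_iff)
qed (use assms(1-4) in auto)

end

section \<open>Abelian categories and exactness\<close>

text \<open>Objects, arrows and sums are kept and only the reading of an arrow is reversed, so the
  double opposite is equal to \<open>C\<close> and results can be pulled back by rewriting. The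
  arguments of \<open>Zero\<close> swap because they are domain and codomain.\<close>

definition op_cat :: "('o, 'm) precat \<Rightarrow> ('o, 'm) precat" where
  "op_cat C = \<lparr>Obj = Obj C, Arr = Arr C, Dom = Cod C, Cod = Dom C, Ident = Ident C,
     Comp = (\<lambda>g f. f \<cdot>\<^bsub>C\<^esub> g), Plus = Plus C, Zero = (\<lambda>X Y. Zero C Y X)\<rparr>"

lemma op_simps [simp]:
  "Obj (op_cat C) = Obj C" "Arr (op_cat C) = Arr C" "Dom (op_cat C) = Cod C" "Cod (op_cat C) = Dom C"
  "Ident (op_cat C) = Ident C" "g \<cdot>\<^bsub>op_cat C\<^esub> f = f \<cdot>\<^bsub>C\<^esub> g" "Plus (op_cat C) = Plus C" "Zero (op_cat C) X Y = Zero C Y X"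
  by (simp_all add: op_cat_def)

lemma op_op [simp]: "op_cat (op_cat C) = C"
  by (simp add: op_cat_def)

lemma homset_op [simp]: "homset (op_cat C) X Y = homset C Y X"
  by (auto simp: homset_def)

lemma is_mono_op [simp]: "is_mono (op_cat C) f \<longleftrightarrow> is_epi C f"
  by (simp add: is_mono_def is_epi_def)

lemma is_epi_op [simp]: "is_epi (op_cat C) f \<longleftrightarrow> is_mono C f"
  by (simp add: is_mono_def is_epi_def)

lemma is_kernel_op [simp]: "is_kernel (op_cat C) k f \<longleftrightarrow> is_cokernel C k f"
  by (simp add: is_kernel_def is_cokernel_def)

lemma is_cokernel_op [simp]: "is_cokernel (op_cat C) k f \<longleftrightarrow> is_kernel C k f"
  by (simp add: is_kernel_def is_cokernel_def)

lemma Proj_op [simp]: "Proj (op_cat C) = Inj C"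
  by (simp add: Proj_def Inj_def)

lemma Inj_op [simp]: "Inj (op_cat C) = Proj C"
  by (simp add: Proj_def Inj_def)

lemma enough_projectives_op [simp]: "enough_projectives (op_cat C) = enough_injectives C"
  by (simp add: enough_projectives_def enough_injectives_def)

lemma enough_injectives_op [simp]: "enough_injectives (op_cat C) = enough_projectives C"
  by (simp add: enough_projectives_def enough_injectives_def)

lemma zero_object_op [simp]: "zero_object (op_cat C) X = zero_object C X"
  by (auto simp: zero_object_def)

lemma (in category) category_op: "category (op_cat C)"
  by unfold_locales (auto simp: hom_iff)

lemma (in preadditive_category) preadditive_op: "preadditive_category (op_cat C)"
proof -
  show ?thesis
  proof (intro preadditive_category.intro preadditive_category_axioms.intro category_op)
    fix X Y assume "X \<in> Obj (op_cat C)" "Y \<in> Obj (op_cat C)"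
    then have "comm_group (hom_group C Y X)" by (simp add: hom_comm_group)
    then show "comm_group (hom_group (op_cat C) X Y)" by (simp add: hom_group_def)
  qed (auto simp: hom_iff)
qed

context abelian_category
begin

lemma epi_Zero_comp:
  assumes "is_epi C e" "m \<cdot> e = f" "g \<cdot> f = Zero C X Y" "m \<in> Arr C" "g \<in> Arr C"
    "Dom C m = Cod C e" "Dom C g = Cod C m" "X = Dom C e" "Y = Cod C g"
  shows "g \<cdot> m = Zero C (Dom C m) Y"
proof -
  have e: "e \<in> Arr C" using assms by (simp add: is_epi_def)
  have "(g \<cdot> m) \<cdot> e = Zero C X Y" unfolding assms(3)[symmetric] assms(2)[symmetric]
    by (rule comp_assoc) (use e assms in auto)
  then have "g \<cdot> m = Zero C (Cod C e) Y"
    by (rule epi_Zero[OF assms(1)]) (use e assms in auto)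
  then show ?thesis using assms by simp
qed

lemma biproduct_op: "is_biproduct C X Y S i1 i2 p1 p2 \<Longrightarrow> is_biproduct (op_cat C) X Y S p1 p2 i1 i2"
  by (simp add: is_biproduct_def)

lemma abelian_op: "abelian_category (op_cat C)"
proof -
  interpret op: preadditive_category "op_cat C" by (rule preadditive_op)
  show ?thesis
  proof unfold_locales
    fix X Y assume "X \<in> Obj (op_cat C)" "Y \<in> Obj (op_cat C)"
    then show "\<exists>S i1 i2 p1 p2. is_biproduct (op_cat C) X Y S i1 i2 p1 p2"
      using ex_biproduct[of X Y] biproduct_op by fastforce
  qed (use ex_zero_object ex_kernel ex_cokernel mono_is_kernel epi_is_cokernel in auto)
qed

text \<open>The mono \<open>f\<close> is the kernel of some \<open>g\<close>, and \<open>g\<close>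
  factors through the cokernel \<open>c\<close>. So whatever \<open>c\<close> kills is killed by
  \<open>g\<close> and hence factors through \<open>f\<close>.\<close>

lemma mono_kernel_of_coker:
  assumes "is_mono C f" "is_cokernel C c f"
  shows "is_kernel C f c"
proof (rule kernelI)
  obtain g where g: "is_kernel C f g" using mono_is_kernel assms by auto
  note gD = kernelD[OF g] and cD = cokernelD[OF assms(2)]
  obtain h where h: "h \<in> Arr C" "Dom C h = Cod C c" "Cod C h = Cod C g" "h \<cdot> c = g"
    using cokernel_desc[OF assms(2), of g] gD by auto
  fix x assume x: "x \<in> Arr C" "Cod C x = Dom C c" "c \<cdot> x = Zero C (Dom C x) (Cod C c)"
  have "g \<cdot> x = h \<cdot> (c \<cdot> x)" using h x cD comp_assoc[of x c h] by simp
  then have "g \<cdot> x = Zero C (Dom C x) (Cod C g)" using h x by simp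
  from kernel_lift[OF g x(1) _ this] show "\<exists>h\<in>Arr C. Dom C h = Dom C x \<and> Cod C h = Dom C f \<and> f \<cdot> h = x"
    using gD cD x by metis
qed (use assms cokernelD[OF assms(2)] in auto)

lemma epi_coker_of_kernel:
  assumes "is_epi C f" "is_kernel C k f"
  shows "is_cokernel C f k"
  using abelian_category.mono_kernel_of_coker[OF abelian_op, of f k] assms by simp

text \<open>To see that \<open>e\<close> is epi, let \<open>a \<cdot> e\<close> be zero. Then
  \<open>f\<close> factors through the mono \<open>m \<cdot> k\<close> with \<open>k\<close> the
  kernel of \<open>a\<close>. The cokernel of this mono kills \<open>f\<close>, hence factors
  through \<open>c\<close> and kills \<open>m\<close>. So \<open>m\<close> factors through
  \<open>m \<cdot> k\<close>, which splits \<open>k\<close>, and \<open>a\<close> is zero.\<close>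

lemma image_factor:
  assumes c: "is_cokernel C c f" and m: "is_kernel C m c"
  obtains e where "is_epi C e" "Dom C e = Dom C f" "Cod C e = Dom C m" "m \<cdot> e = f"
proof -
  note cD = cokernelD[OF c] and mD = kernelD[OF m]
  obtain e where e: "e \<in> Arr C" "Dom C e = Dom C f" "Cod C e = Dom C m" "m \<cdot> e = f"
    using kernel_lift[OF m, of f] cD by auto
  have "is_epi C e"
  proof (rule is_epiI)
    fix a assume a: "a \<in> Arr C" "Dom C a = Cod C e" "a \<cdot> e = Zero C (Dom C e) (Cod C a)"
    obtain k where k: "is_kernel C k a" using ex_kernel a by auto
    note kD = kernelD[OF k]
    obtain e' where e': "e' \<in> Arr C" "Dom C e' = Dom C e" "Cod C e' = Dom C k" "k \<cdot> e' = e"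
      using kernel_lift[OF k, of e] e a by auto
    have mk: "m \<cdot> k \<in> Arr C" using mD kD e a by simp
    have mono: "is_mono C (m \<cdot> k)"
    proof (rule is_monoI)
      fix g assume g: "g \<in> Arr C" "Cod C g = Dom C (m \<cdot> k)" "(m \<cdot> k) \<cdot> g = Zero C (Dom C g) (Cod C (m \<cdot> k))"
      have "k \<cdot> g = Zero C (Dom C g) (Dom C m)"
        by (rule mono_Zero[OF mD(5)]) (use g mD kD e a in auto)
      then have "g = Zero C (Dom C g) (Dom C k)"
        by (rule mono_Zero[OF kD(5)]) (use g mD kD e a in auto)
      then show "g = Zero C (Dom C g) (Dom C (m \<cdot> k))"
        using mD kD e a by auto
    qed fact
    obtain d where d: "is_cokernel C d (m \<cdot> k)" using ex_cokernel mk by auto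
    note dD = cokernelD[OF d]
    have ker: "is_kernel C (m \<cdot> k) d" by (rule mono_kernel_of_coker) fact+
    have f: "(m \<cdot> k) \<cdot> e' = f" using e e' mD kD a by simp
    have "(d \<cdot> (m \<cdot> k)) \<cdot> e' = d \<cdot> ((m \<cdot> k) \<cdot> e')"
      by (rule comp_assoc) (use e(1-3) e'(1-3) mD(1-3) kD(1-3) a(1,2) dD(1-3) in auto)
    then have "d \<cdot> f = Zero C (Dom C (m \<cdot> k)) (Cod C d) \<cdot> e'"
      unfolding f dD(4) ..
    then have "d \<cdot> f = Zero C (Dom C f) (Cod C d)"
      using e(1-3) e'(1-3) mD(1-3) kD(1-3) a(1,2) dD(1-3) by simp
    then obtain d' where d': "d' \<in> Arr C" "Dom C d' = Cod C c" "Cod C d' = Cod C d" "d' \<cdot> c = d"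
      using cokernel_desc[OF c, of d] dD mD kD e a cD by auto
    have "d \<cdot> m = d' \<cdot> (c \<cdot> m)" using d' mD cD comp_assoc[of m c d'] by simp
    then have "d \<cdot> m = Zero C (Dom C m) (Cod C d)" using mD d' by simp
    then obtain s where s: "s \<in> Arr C" "Dom C s = Dom C m" "Cod C s = Dom C k" "(m \<cdot> k) \<cdot> s = m"
      using kernel_lift[OF ker, of m] mD kD e a dD by auto
    have "k \<cdot> s = Ident C (Dom C m)"
      by (rule monoD[OF mD(5)]) (use s mD kD e a in auto)
    then have "a = a \<cdot> (k \<cdot> s)" using a e by simp
    also have "\<dots> = Zero C (Dom C m) (Cod C a)"
      using comp_cong_assoc1[OF kD(4), of s] s kD a e by simp
    finally show "a = Zero C (Cod C e) (Cod C a)" using e by simp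
  qed fact
  then show thesis using that e by auto
qed

lemma epi_mono_factor:
  assumes "f \<in> Arr C"
  obtains m e where "is_mono C m" "is_epi C e" "Dom C e = Dom C f" "Cod C e = Dom C m" "m \<cdot> e = f" "Cod C m = Cod C f"
proof -
  obtain c where c: "is_cokernel C c f" using ex_cokernel assms by auto
  obtain m where m: "is_kernel C m c" using ex_kernel cokernelD[OF c] by auto
  from image_factor[OF c m] show thesis using that kernelD[OF m] cokernelD[OF c] by metis
qed

lemma monoA: "is_mono C f \<Longrightarrow> f \<in> Arr C" and epiA: "is_epi C f \<Longrightarrow> f \<in> Arr C"
  by (auto simp: is_mono_def is_epi_def)

lemma exact_atE:
  assumes "exact_at C f g"
  obtains m e where "is_kernel C m g" "is_epi C e" "Dom C e = Dom C f" "Cod C e = Dom C m" "m \<cdot> e = f"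
  using assms image_factor unfolding exact_at_def is_image_def by metis

lemma cokernel_comp_epi:
  assumes "is_cokernel C c (m \<cdot> e)" "is_epi C e" "m \<in> Arr C" "Cod C e = Dom C m"
  shows "is_cokernel C c m"
proof (rule cokernelI)
  note eA = epiA[OF assms(2)] and cD = cokernelD[OF assms(1)]
  show "c \<cdot> m = Zero C (Dom C m) (Cod C c)"
    using eA cD assms(3,4) epi_Zero[OF assms(2), of "c \<cdot> m" "Dom C e" "Cod C c"] by auto
  fix g assume g: "g \<in> Arr C" "Dom C g = Cod C m" "g \<cdot> m = Zero C (Dom C m) (Cod C g)"
  have "g \<cdot> (m \<cdot> e) = Zero C (Dom C e) (Cod C g)"
    using comp_cong_assoc1[OF g(3), of e] g eA assms(3,4) by auto
  then show "\<exists>h\<in>Arr C. Dom C h = Cod C c \<and> Cod C h = Cod C g \<and> h \<cdot> c = g"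
    using cokernel_desc[OF assms(1), of g] g eA assms(3,4) by auto
qed (use assms cokernelD[OF assms(1)] epiA in auto)

lemma exact_atI:
  assumes "is_kernel C m g" "is_epi C e" "Cod C e = Dom C m"
  shows "exact_at C (m \<cdot> e) g"
proof -
  note mD = kernelD[OF assms(1)] and eA = epiA[OF assms(2)]
  obtain c where c: "is_cokernel C c (m \<cdot> e)" using ex_cokernel mD eA assms by (meson comp_simps(1))
  have "is_kernel C m c"
    using mono_kernel_of_coker[OF mD(5) cokernel_comp_epi[OF c assms(2) mD(2) assms(3)]] .
  then show ?thesis unfolding exact_at_def is_image_def using c assms by auto
qed

lemma exact_at_simps:
  assumes "exact_at C f g"
  shows "f \<in> Arr C" "g \<in> Arr C" "Cod C f = Dom C g" "g \<cdot> f = Zero C (Dom C f) (Cod C g)"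
proof -
  obtain m e where m: "is_kernel C m g" and e: "is_epi C e" "Dom C e = Dom C f" "Cod C e = Dom C m" "m \<cdot> e = f"
    using exact_atE[OF assms] by metis
  note mD = kernelD[OF m] and eA = epiA[OF e(1)]
  show "f \<in> Arr C" "g \<in> Arr C" "Cod C f = Dom C g" using mD eA e by auto
  show "g \<cdot> f = Zero C (Dom C f) (Cod C g)"
    using comp_cong_assoc1[OF mD(4), of e] mD eA e by auto
qed

text \<open>Exactness is defined by the image of the first arrow, which is not visibly self-dual.
  When \<open>g\<close> is written as a mono \<open>n\<close> after an epi \<open>p\<close>, the epi
  \<open>p\<close> has the same kernel \<open>m\<close> as \<open>g\<close>. So \<open>p\<close> is
  the cokernel of \<open>m\<close>, and also of \<open>f\<close> because \<open>e\<close> is epi.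
  This is the factorization that the opposite category asks for.\<close>

lemma exact_at_op_imp:
  assumes "exact_at C f g"
  shows "exact_at (op_cat C) g f"
proof -
  obtain m e where m: "is_kernel C m g" and e: "is_epi C e" "Dom C e = Dom C f" "Cod C e = Dom C m" "m \<cdot> e = f"
    using exact_atE[OF assms] by metis
  note mD = kernelD[OF m] and eA = epiA[OF e(1)] and fg = exact_at_simps[OF assms]
  obtain n p where np: "is_mono C n" "is_epi C p" "Dom C p = Dom C g" "Cod C p = Dom C n" "n \<cdot> p = g" "Cod C n = Cod C g"
    using epi_mono_factor[of g] mD by metis
  note nA = monoA[OF np(1)] and pA = epiA[OF np(2)]
  have pm: "p \<cdot> m = Zero C (Dom C m) (Cod C p)" unfolding np(4)
  proof (rule mono_Zero[OF np(1)])
    have "n \<cdot> (p \<cdot> m) = g \<cdot> m" using comp_assoc[of m p n] np nA pA mD(1-3) by simp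
    then show "n \<cdot> (p \<cdot> m) = Zero C (Dom C m) (Cod C g)" using mD(4) by simp
  qed (use np nA pA mD in auto)
  have "is_kernel C m p"
  proof (rule kernelI)
    fix x assume x: "x \<in> Arr C" "Cod C x = Dom C p" "p \<cdot> x = Zero C (Dom C x) (Cod C p)"
    have "g \<cdot> x = n \<cdot> (p \<cdot> x)" using np nA pA x comp_assoc[of x p n] by simp
    then have "g \<cdot> x = Zero C (Dom C x) (Cod C g)" using x nA np by simp
    then show "\<exists>h\<in>Arr C. Dom C h = Dom C x \<and> Cod C h = Dom C m \<and> m \<cdot> h = x"
      using kernel_lift[OF m, of x] x np by auto
  qed (use mD pA np pm in auto)
  then have pc: "is_cokernel C p m" by (rule epi_coker_of_kernel[OF np(2)])
  have "is_cokernel C p f"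
  proof (rule cokernelI)
    show "p \<cdot> f = Zero C (Dom C f) (Cod C p)"
      using comp_cong_assoc1[OF pm, of e] pA nA mD eA e np by auto
    fix x assume x: "x \<in> Arr C" "Dom C x = Cod C f" "x \<cdot> f = Zero C (Dom C f) (Cod C x)"
    then have "x \<cdot> m = Zero C (Dom C m) (Cod C x)"
      by (intro epi_Zero_comp[OF e(1) e(4)]) (use e mD fg in auto)
    then show "\<exists>h\<in>Arr C. Dom C h = Cod C p \<and> Cod C h = Cod C x \<and> h \<cdot> p = x"
      using cokernel_desc[OF pc, of x] x mD fg by auto
  qed (use np fg pA in auto)
  then have "is_kernel (op_cat C) p f" "is_epi (op_cat C) n" using np by auto
  from abelian_category.exact_atI[OF abelian_op this] show ?thesis using np by simp
qed

lemma exact_at_op: "exact_at (op_cat C) g f \<longleftrightarrow> exact_at C f g"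
  using exact_at_op_imp abelian_category.exact_at_op_imp[OF abelian_op] by force

lemma ProjD:
  assumes "P \<in> Proj C" "is_epi C g" "f \<in> Arr C" "Dom C f = P" "Cod C f = Cod C g"
  obtains h where "h \<in> Arr C" "Dom C h = P" "Cod C h = Dom C g" "g \<cdot> h = f"
proof -
  have "\<exists>h\<in>homset C P (Dom C g). g \<cdot> h = f"
    using assms unfolding Proj_def by (auto simp: homset_def)
  then show thesis using that by (auto simp: hom_iff)
qed

lemma exact_lift:
  assumes "exact_at C f g" "P \<in> Proj C" "x \<in> Arr C" "Dom C x = P" "Cod C x = Cod C f"
    "g \<cdot> x = Zero C P (Cod C g)"
  obtains y where "y \<in> Arr C" "Dom C y = P" "Cod C y = Dom C f" "f \<cdot> y = x"
proof -
  obtain m e where m: "is_kernel C m g" and e: "is_epi C e" "Dom C e = Dom C f" "Cod C e = Dom C m" "m \<cdot> e = f"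
    using exact_atE[OF assms(1)] by metis
  note mD = kernelD[OF m] and eA = epiA[OF e(1)] and fg = exact_at_simps[OF assms(1)]
  obtain z where z: "z \<in> Arr C" "Dom C z = P" "Cod C z = Dom C m" "m \<cdot> z = x"
    using kernel_lift[OF m, of x] assms fg by auto
  obtain y where y: "y \<in> Arr C" "Dom C y = P" "Cod C y = Dom C e" "e \<cdot> y = z"
    using ProjD[OF assms(2) e(1), of z] z e by auto
  have "f \<cdot> y = x" using comp_cong_assoc1[OF e(4), of y] y z mD(1-3) eA e(1-3) by simp
  then show thesis using that y e by auto
qed

lemma exact_extend:
  assumes "exact_at C f g" "J \<in> Inj C" "x \<in> Arr C" "Cod C x = J" "Dom C x = Dom C g"
    "x \<cdot> f = Zero C (Dom C f) J"
  obtains y where "y \<in> Arr C" "Cod C y = J" "Dom C y = Cod C g" "y \<cdot> g = x"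
  using abelian_category.exact_lift[OF abelian_op, of g f J x thesis] assms exact_at_op by auto

lemma mono_extend:
  assumes "is_mono C g" "J \<in> Inj C" "x \<in> Arr C" "Cod C x = J" "Dom C x = Dom C g"
  obtains y where "y \<in> Arr C" "Cod C y = J" "Dom C y = Cod C g" "y \<cdot> g = x"
proof -
  have "\<exists>h\<in>homset C (Cod C g) J. h \<cdot> g = x"
    using assms unfolding Inj_def by (auto simp: homset_def)
  then show thesis using that by (auto simp: hom_iff)
qed

lemma exact_kernel_self:
  assumes "is_kernel C k f"
  shows "exact_at C k f"
proof -
  note kD = kernelD[OF assms]
  have "exact_at C (k \<cdot> Ident C (Dom C k)) f"
    by (rule exact_atI[OF assms]) (use kD in \<open>auto simp: is_epi_def hom_iff\<close>)
  then show ?thesis using kD by simp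
qed

text \<open>The epi \<open>e\<close> with \<open>m \<cdot> e = f\<close> is also mono, as
  \<open>f\<close> is. It is then the kernel of an arrow \<open>h\<close> that vanishes because
  \<open>e\<close> is epi, so the identity factors through \<open>e\<close>, and lifts along
  \<open>m\<close> become lifts along \<open>f\<close>.\<close>

lemma mono_exact_kernel:
  assumes "is_mono C f" "exact_at C f g"
  shows "is_kernel C f g"
proof (rule kernelI)
  note fg = exact_at_simps[OF assms(2)]
  obtain m e where m: "is_kernel C m g" and e: "is_epi C e" "Dom C e = Dom C f" "Cod C e = Dom C m" "m \<cdot> e = f"
    using exact_atE[OF assms(2)] by metis
  note mD = kernelD[OF m] and eA = epiA[OF e(1)]
  have "is_mono C e"
  proof (rule is_monoI)
    fix x assume x: "x \<in> Arr C" "Cod C x = Dom C e" "e \<cdot> x = Zero C (Dom C x) (Cod C e)"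
    have "f \<cdot> x = Zero C (Dom C x) (Cod C f)" using comp_cong_assoc1[OF e(4), of x] x e(1-3) mD(1-3) eA fg(1-3) by simp
    then show "x = Zero C (Dom C x) (Dom C e)" using mono_Zero[OF assms(1), of x] x e by auto
  qed fact
  then obtain h where h: "is_kernel C e h" using mono_is_kernel by auto
  note hD = kernelD[OF h]
  have "h = Zero C (Cod C e) (Cod C h)"
    using epi_Zero[OF e(1), of h] hD by auto
  then have "h \<cdot> Ident C (Cod C e) = Zero C (Cod C e) (Cod C h)" using hD by simp
  then obtain s where s: "s \<in> Arr C" "Dom C s = Cod C e" "Cod C s = Dom C e" "e \<cdot> s = Ident C (Cod C e)"
    using kernel_lift[OF h, of "Ident C (Cod C e)"] hD eA by auto
  fix x assume x: "x \<in> Arr C" "Cod C x = Dom C g" "g \<cdot> x = Zero C (Dom C x) (Cod C g)"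
  then obtain y where y: "y \<in> Arr C" "Dom C y = Dom C x" "Cod C y = Dom C m" "m \<cdot> y = x"
    using kernel_lift[OF m, of x] by auto
  have "f \<cdot> (s \<cdot> y) = m \<cdot> (e \<cdot> (s \<cdot> y))"
    by (rule comp_cong_assoc1[OF e(4), symmetric]) (use s(1-3) y e(1-3) mD(1-3) eA in auto)
  also have "e \<cdot> (s \<cdot> y) = (e \<cdot> s) \<cdot> y"
    by (rule comp_assoc[symmetric]) (use s(1-3) y e(1-3) mD(1-3) eA in auto)
  also have "m \<cdot> ((e \<cdot> s) \<cdot> y) = x" using s y e by simp
  finally show "\<exists>h\<in>Arr C. Dom C h = Dom C x \<and> Cod C h = Dom C f \<and> f \<cdot> h = x"
    using s y e by (intro bexI[of _ "s \<cdot> y"]) auto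
qed (use assms exact_at_simps[OF assms(2)] in auto)

end

section \<open>Testing epimorphisms and exactness on maps from projectives\<close>

locale enough_proj = abelian_category +
  assumes enough_projectives: "enough_projectives C"
begin

lemma cover:
  assumes "X \<in> Obj C"
  obtains P p where "P \<in> Proj C" "is_epi C p" "Dom C p = P" "Cod C p = X" "p \<in> Arr C"
proof -
  obtain P p where "P \<in> Proj C" "p \<in> homset C P X" "is_epi C p"
    using enough_projectives assms unfolding enough_projectives_def by blast
  then show thesis using that by (auto simp: hom_iff)
qed

text \<open>Maps out of projectives play the role of elements. Lifting one projective cover of the
  codomain already forces \<open>f\<close> to be epi.\<close>

lemma is_epiI_proj:
  assumes "f \<in> Arr C" "\<And>x. x \<in> Arr C \<Longrightarrow> Dom C x \<in> Proj C \<Longrightarrow> Cod C x = Cod C f \<Longrightarrow>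
     \<exists>y\<in>Arr C. Dom C y = Dom C x \<and> Cod C y = Dom C f \<and> f \<cdot> y = x"
  shows "is_epi C f"
proof -
  obtain P p where p: "P \<in> Proj C" "is_epi C p" "Dom C p = P" "Cod C p = Cod C f" "p \<in> Arr C"
    using cover[of "Cod C f"] assms(1) by auto
  then obtain y where y: "y\<in>Arr C" "Dom C y = Dom C p" "Cod C y = Dom C f" "f \<cdot> y = p"
    using assms(2)[of p] by auto
  show ?thesis
  proof (rule is_epiI)
    fix g assume g: "g \<in> Arr C" "Dom C g = Cod C f" "g \<cdot> f = Zero C (Dom C f) (Cod C g)"
    have "g \<cdot> p = Zero C P (Cod C g)"
      using comp_cong_assoc1[OF g(3), of y] g y p assms(1) by simp
    then show "g = Zero C (Cod C f) (Cod C g)" using epi_Zero[OF p(2), of g] p g by auto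
  qed fact
qed

text \<open>The criterion behind all later diagram chases: the lifts say that the map
  \<open>e\<close> induced by \<open>f\<close> into the kernel of \<open>g\<close> is surjective on
  maps from projectives.\<close>

lemma exact_atI_proj:
  assumes "f \<in> Arr C" "g \<in> Arr C" "Cod C f = Dom C g" "g \<cdot> f = Zero C (Dom C f) (Cod C g)"
    "\<And>x. x \<in> Arr C \<Longrightarrow> Dom C x \<in> Proj C \<Longrightarrow> Cod C x = Cod C f \<Longrightarrow> g \<cdot> x = Zero C (Dom C x) (Cod C g) \<Longrightarrow>
     \<exists>y\<in>Arr C. Dom C y = Dom C x \<and> Cod C y = Dom C f \<and> f \<cdot> y = x"
  shows "exact_at C f g"
proof -
  obtain m where m: "is_kernel C m g" using ex_kernel assms by auto
  note mD = kernelD[OF m]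
  obtain e where e: "e \<in> Arr C" "Dom C e = Dom C f" "Cod C e = Dom C m" "m \<cdot> e = f"
    using kernel_lift[OF m, of f] assms by auto
  have "is_epi C e"
  proof (rule is_epiI_proj)
    fix x assume x: "x \<in> Arr C" "Dom C x \<in> Proj C" "Cod C x = Cod C e"
    have "g \<cdot> (m \<cdot> x) = Zero C (Dom C x) (Cod C g)"
      using comp_cong_assoc1[OF mD(4), of x] x mD e by simp
    then obtain y where y: "y\<in>Arr C" "Dom C y = Dom C x" "Cod C y = Dom C f" "f \<cdot> y = m \<cdot> x"
      using assms(5)[of "m \<cdot> x"] x mD e assms(3) by auto
    have "m \<cdot> (e \<cdot> y) = m \<cdot> x" using y(4) comp_cong_assoc1[OF e(4), of y] e(1-3) y(1-3) mD(1-3) by simp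
    then have "e \<cdot> y = x" by (rule monoD[OF mD(5)]) (use e y x in auto)
    then show "\<exists>y\<in>Arr C. Dom C y = Dom C x \<and> Cod C y = Dom C e \<and> e \<cdot> y = x"
      using y e by auto
  qed fact
  from exact_atI[OF m this] e show ?thesis by simp
qed

end

section \<open>Morphisms of exact sequences\<close>

text \<open>Nothing is asked at the two ends, so that truncated coresolutions are covered together
  with extensions.\<close>

definition exact_seq :: "('o, 'm) precat \<Rightarrow> 'm list \<Rightarrow> bool" where
  "exact_seq C fs \<longleftrightarrow> fs \<noteq> [] \<and> set fs \<subseteq> Arr C \<and> (\<forall>k. Suc k < length fs \<longrightarrow> exact_at C (fs ! k) (fs ! Suc k))"

text \<open>Gives a name to the components that \<open>seq_morphism\<close> hides behind an
  existential quantifier.\<close>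

definition seq_map :: "('o, 'm) precat \<Rightarrow> 'm list \<Rightarrow> 'm list \<Rightarrow> (nat \<Rightarrow> 'm) \<Rightarrow> bool" where
  "seq_map C fs gs h \<longleftrightarrow> length gs = length fs \<and>
     (\<forall>k\<le>length fs. h k \<in> homset C (seq_obj C fs k) (seq_obj C gs k)) \<and>
     (\<forall>k<length fs. gs ! k \<cdot>\<^bsub>C\<^esub> h k = h (Suc k) \<cdot>\<^bsub>C\<^esub> fs ! k)"

context abelian_category
begin

lemma exact_seqD:
  assumes "exact_seq C fs" "k < length fs"
  shows "fs ! k \<in> Arr C" "Dom C (fs ! k) = seq_obj C fs k" "Cod C (fs ! k) = seq_obj C fs (Suc k)"
proof -
  show "fs ! k \<in> Arr C" "Dom C (fs ! k) = seq_obj C fs k"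
    using assms by (auto simp: exact_seq_def seq_obj_def)
  show "Cod C (fs ! k) = seq_obj C fs (Suc k)"
  proof (cases "Suc k < length fs")
    case True
    then have "exact_at C (fs ! k) (fs ! Suc k)" using assms by (auto simp: exact_seq_def)
    from exact_at_simps(3)[OF this] show ?thesis using True by (simp add: seq_obj_def)
  next
    case False
    then have "length fs = Suc k" using assms by auto
    then show ?thesis using assms by (auto simp: seq_obj_def last_conv_nth exact_seq_def)
  qed
qed

lemma exact_seq_Obj:
  assumes "exact_seq C fs" "k \<le> length fs"
  shows "seq_obj C fs k \<in> Obj C"
proof (cases k)
  case 0
  then show ?thesis using exact_seqD[OF assms(1), of 0] assms by (auto simp: exact_seq_def dest: Dom_Cod_Obj(1))
next
  case (Suc k')
  then show ?thesis using exact_seqD[OF assms(1), of k'] assms Dom_Cod_Obj(2)[of "fs ! k'"] by auto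
qed

lemma exact_seq_comp:
  assumes "exact_seq C fs" "Suc k < length fs"
  shows "exact_at C (fs ! k) (fs ! Suc k)"
    "fs ! Suc k \<cdot> fs ! k = Zero C (seq_obj C fs k) (seq_obj C fs (Suc (Suc k)))"
proof -
  show e: "exact_at C (fs ! k) (fs ! Suc k)" using assms by (auto simp: exact_seq_def)
  show "fs ! Suc k \<cdot> fs ! k = Zero C (seq_obj C fs k) (seq_obj C fs (Suc (Suc k)))"
    using exact_at_simps(4)[OF e] exact_seqD[OF assms(1)] assms(2) by simp
qed

lemma seq_morphismE:
  assumes "seq_morphism C fs gs a b"
  obtains h where "h 0 = a" "h (length fs) = b" "seq_map C fs gs h"
  using assms unfolding seq_morphism_def seq_map_def by blast

lemma seq_mapD:
  assumes "seq_map C fs gs h"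
  shows "length gs = length fs"
    "\<And>k. k \<le> length fs \<Longrightarrow> h k \<in> Arr C"
    "\<And>k. k \<le> length fs \<Longrightarrow> Dom C (h k) = seq_obj C fs k"
    "\<And>k. k \<le> length fs \<Longrightarrow> Cod C (h k) = seq_obj C gs k"
    "\<And>k. k < length fs \<Longrightarrow> gs ! k \<cdot> h k = h (Suc k) \<cdot> fs ! k"
  using assms unfolding seq_map_def hom_iff by blast+

lemma seq_morphismI:
  assumes "h 0 = a" "h (length fs) = b" "length gs = length fs"
    "\<And>k. k \<le> length fs \<Longrightarrow> h k \<in> Arr C"
    "\<And>k. k \<le> length fs \<Longrightarrow> Dom C (h k) = seq_obj C fs k"
    "\<And>k. k \<le> length fs \<Longrightarrow> Cod C (h k) = seq_obj C gs k"
    "\<And>k. k < length fs \<Longrightarrow> gs ! k \<cdot> h k = h (Suc k) \<cdot> fs ! k"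
  shows "seq_morphism C fs gs a b"
  using assms unfolding seq_morphism_def hom_iff by blast

lemma seq_morphism_ends:
  assumes "seq_morphism C fs gs a b"
  shows "a \<in> Arr C" "Dom C a = seq_obj C fs 0" "Cod C a = seq_obj C gs 0"
    "b \<in> Arr C" "Dom C b = seq_obj C fs (length fs)" "Cod C b = seq_obj C gs (length gs)"
proof -
  from assms obtain h where h: "h 0 = a" "h (length fs) = b" "seq_map C fs gs h"
    by (rule seq_morphismE)
  note hD = seq_mapD[OF h(3)]
  show "a \<in> Arr C" "Dom C a = seq_obj C fs 0" "Cod C a = seq_obj C gs 0"
    using hD(2-4)[of 0] h(1) by auto
  show "b \<in> Arr C" "Dom C b = seq_obj C fs (length fs)" "Cod C b = seq_obj C gs (length gs)"
    using hD(2-4)[of "length fs"] h(2) hD(1) by auto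
qed

lemma seq_morphism_comp:
  assumes "seq_morphism C fs gs a b" "seq_morphism C gs hs a' b'" "exact_seq C fs" "exact_seq C gs" "exact_seq C hs"
  shows "seq_morphism C fs hs (a' \<cdot> a) (b' \<cdot> b)"
proof -
  from assms(1) obtain h where h: "h 0 = a" "h (length fs) = b" "seq_map C fs gs h"
    by (rule seq_morphismE)
  note h = h(1,2) seq_mapD[OF h(3)]
  from assms(2) obtain h' where h': "h' 0 = a'" "h' (length gs) = b'" "seq_map C gs hs h'"
    by (rule seq_morphismE)
  note h' = h'(1,2) seq_mapD[OF h'(3)]
  show ?thesis
  proof (rule seq_morphismI[of "\<lambda>k. h' k \<cdot> h k"])
    fix k assume k: "k < length fs"
    note D = exact_seqD[OF assms(3), of k] exact_seqD[OF assms(4), of k] exact_seqD[OF assms(5), of k]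
    have "hs ! k \<cdot> (h' k \<cdot> h k) = h' (Suc k) \<cdot> (gs ! k \<cdot> h k)"
      by (rule comp_cong_assoc) (use h(3-6) h'(3-7) k D in auto)
    also have "\<dots> = h' (Suc k) \<cdot> (h (Suc k) \<cdot> fs ! k)" using h(7) k by simp
    also have "\<dots> = (h' (Suc k) \<cdot> h (Suc k)) \<cdot> fs ! k"
      by (rule comp_assoc[symmetric]) (use h(3-6) h'(3-6) k D in auto)
    finally show "hs ! k \<cdot> (h' k \<cdot> h k) = (h' (Suc k) \<cdot> h (Suc k)) \<cdot> fs ! k" .
  qed (use h(1-6) h'(1-6) in auto)
qed

lemma seq_morphism_minus:
  assumes "seq_morphism C fs gs a b" "seq_morphism C fs gs a' b'" "exact_seq C fs" "exact_seq C gs"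
  shows "seq_morphism C fs gs (arr_diff C a a') (arr_diff C b b')"
proof -
  from assms(1) obtain h where h: "h 0 = a" "h (length fs) = b" "seq_map C fs gs h"
    by (rule seq_morphismE)
  note h = h(1,2) seq_mapD[OF h(3)]
  from assms(2) obtain h' where h': "h' 0 = a'" "h' (length fs) = b'" "seq_map C fs gs h'"
    by (rule seq_morphismE)
  note h' = h'(1,2) seq_mapD[OF h'(3)]
  show ?thesis
  proof (rule seq_morphismI[of "\<lambda>k. arr_diff C (h k) (h' k)"])
    fix k assume k: "k < length fs"
    then show "gs ! k \<cdot> arr_diff C (h k) (h' k) = arr_diff C (h (Suc k)) (h' (Suc k)) \<cdot> fs ! k"
      using h(3-7) h'(3-7) exact_seqD[OF assms(3), of k] exact_seqD[OF assms(4), of k]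
      by (simp add: minus_comp)
  qed (use h(1-6) h'(1-6) in auto)
qed

text \<open>In each of the next four lemmas, the components (or the homotopy) are built one object at a time,
  from the right end in the two \<open>down\<close> lemmas and from the left end in the two \<open>up\<close> lemmas. For the
  homotopies it is enough to control \<open>g\<^sub>k s f\<^sub>k\<close>, which avoids keeping track of the earlier components.\<close>

lemma down_exist:
  assumes fs: "exact_seq C fs" "length fs = Suc n" and gs: "exact_seq C gs" "length gs = Suc n"
    and b: "b \<in> homset C (seq_obj C fs (Suc n)) (seq_obj C gs (Suc n))"
    and start: "\<exists>y\<in>homset C (seq_obj C fs n) (seq_obj C gs n). gs ! n \<cdot> y = b \<cdot> fs ! n"
    and step: "\<And>k t. k < n \<Longrightarrow> t \<in> homset C (seq_obj C fs k) (seq_obj C gs (Suc k)) \<Longrightarrow>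
      gs ! Suc k \<cdot> t = Zero C (seq_obj C fs k) (seq_obj C gs (Suc (Suc k))) \<Longrightarrow>
      \<exists>y\<in>homset C (seq_obj C fs k) (seq_obj C gs k). gs ! k \<cdot> y = t"
  shows "\<exists>a. seq_morphism C fs gs a b"
proof -
  have "\<exists>h. h (Suc n) = b \<and> (\<forall>k. n - i \<le> k \<longrightarrow> k \<le> Suc n \<longrightarrow> h k \<in> homset C (seq_obj C fs k) (seq_obj C gs k)) \<and>
      (\<forall>k. n - i \<le> k \<longrightarrow> k \<le> n \<longrightarrow> gs ! k \<cdot> h k = h (Suc k) \<cdot> fs ! k)" if "i \<le> n" for i
    using that
  proof (induction i)
    case 0
    obtain y where "y \<in> homset C (seq_obj C fs n) (seq_obj C gs n)" "gs ! n \<cdot> y = b \<cdot> fs ! n"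
      using start by auto
    then show ?case using b
      by (intro exI[of _ "\<lambda>k. if k = n then y else b"]) (auto simp: le_Suc_eq dest: antisym)
  next
    case (Suc i)
    define k where "k = n - Suc i"
    have k: "n - i = Suc k" "k < n" using Suc.prems by (auto simp: k_def)
    obtain h where h: "h (Suc n) = b"
      "\<And>l. Suc k \<le> l \<Longrightarrow> l \<le> Suc n \<Longrightarrow> h l \<in> homset C (seq_obj C fs l) (seq_obj C gs l)"
      "\<And>l. Suc k \<le> l \<Longrightarrow> l \<le> n \<Longrightarrow> gs ! l \<cdot> h l = h (Suc l) \<cdot> fs ! l"
      using Suc k by auto
    note h1 = homD[OF h(2)[of "Suc k"]] homD[OF h(2)[of "Suc (Suc k)"]]
    note D = exact_seqD[OF fs(1), of k] exact_seqD[OF fs(1), of "Suc k"] exact_seqD[OF gs(1), of "Suc k"]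
    have "gs ! Suc k \<cdot> (h (Suc k) \<cdot> fs ! k) = h (Suc (Suc k)) \<cdot> (fs ! Suc k \<cdot> fs ! k)"
      by (rule comp_cong_assoc[OF h(3)]) (use k h1 D fs(2) gs(2) in auto)
    also have "\<dots> = Zero C (seq_obj C fs k) (seq_obj C gs (Suc (Suc k)))"
      using exact_seq_comp(2)[OF fs(1), of k] exact_seq_Obj[OF fs(1), of k] h1 k fs(2) by auto
    finally have z: "gs ! Suc k \<cdot> (h (Suc k) \<cdot> fs ! k) = Zero C (seq_obj C fs k) (seq_obj C gs (Suc (Suc k)))" .
    have t: "h (Suc k) \<cdot> fs ! k \<in> homset C (seq_obj C fs k) (seq_obj C gs (Suc k))"
      using h1 D k fs(2) by (auto simp: hom_iff)
    obtain y where y: "y \<in> homset C (seq_obj C fs k) (seq_obj C gs k)" "gs ! k \<cdot> y = h (Suc k) \<cdot> fs ! k"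
      using step[OF k(2) t z] by auto
    have "n - Suc i = k" by (simp add: k_def)
    moreover have "(h(k := y)) l \<in> homset C (seq_obj C fs l) (seq_obj C gs l)" if "k \<le> l" "l \<le> Suc n" for l
      using that y h(2)[of l] by (cases "l = k") auto
    moreover have "gs ! l \<cdot> (h(k := y)) l = (h(k := y)) (Suc l) \<cdot> fs ! l" if "k \<le> l" "l \<le> n" for l
      using that y h(3)[of l] by (cases "l = k") auto
    ultimately show ?case using h(1) k by (intro exI[of _ "h(k := y)"]) auto
  qed
  from this[of n] obtain h where h: "h (Suc n) = b"
      "\<And>l. l \<le> Suc n \<Longrightarrow> h l \<in> homset C (seq_obj C fs l) (seq_obj C gs l)"
      "\<And>l. l \<le> n \<Longrightarrow> gs ! l \<cdot> h l = h (Suc l) \<cdot> fs ! l" by auto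
  show ?thesis unfolding seq_morphism_def
    using h fs(2) gs(2) by (intro exI[of _ "h 0"] conjI exI[of _ h]) auto
qed

lemma down_homotopy:
  assumes fs: "exact_seq C fs" "length fs = Suc n" and gs: "exact_seq C gs" "length gs = Suc n"
    and h: "seq_morphism C fs gs a b"
    and s: "s \<in> homset C (seq_obj C fs (Suc n)) (seq_obj C gs n)" "b = gs ! n \<cdot> s"
    and mono: "is_mono C (gs ! 0)"
    and step: "\<And>k t. k < n \<Longrightarrow> t \<in> homset C (seq_obj C fs (Suc k)) (seq_obj C gs (Suc k)) \<Longrightarrow>
      gs ! Suc k \<cdot> t = Zero C (seq_obj C fs (Suc k)) (seq_obj C gs (Suc (Suc k))) \<Longrightarrow>
      \<exists>y\<in>homset C (seq_obj C fs (Suc k)) (seq_obj C gs k). gs ! k \<cdot> y = t"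
  shows "\<exists>w\<in>homset C (seq_obj C fs 1) (seq_obj C gs 0). a = w \<cdot> fs ! 0"
proof -
  from h obtain h where h0: "h 0 = a" "h (length fs) = b" "seq_map C fs gs h"
    by (rule seq_morphismE)
  note h = h0(1) h0(2)[unfolded fs(2)] seq_mapD(2-5)[OF h0(3), unfolded fs(2) less_Suc_eq_le]
  have "\<exists>s\<in>homset C (seq_obj C fs (Suc (n - i))) (seq_obj C gs (n - i)).
      gs ! (n - i) \<cdot> (s \<cdot> fs ! (n - i)) = gs ! (n - i) \<cdot> h (n - i)" if "i \<le> n" for i
    using that
  proof (induction i)
    case 0
    have "gs ! n \<cdot> (s \<cdot> fs ! n) = b \<cdot> fs ! n"
      unfolding s(2) by (rule comp_assoc[symmetric])
        (use homD[OF s(1)] exact_seqD[OF fs(1), of n] exact_seqD[OF gs(1), of n] fs(2) gs(2) in auto)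
    then show ?case using s h(2) h(6)[of n] by auto
  next
    case (Suc i)
    define k where "k = n - Suc i"
    have k: "n - i = Suc k" "k < n" using Suc.prems by (auto simp: k_def)
    obtain s where s: "s \<in> homset C (seq_obj C fs (Suc (Suc k))) (seq_obj C gs (Suc k))"
      "gs ! Suc k \<cdot> (s \<cdot> fs ! Suc k) = gs ! Suc k \<cdot> h (Suc k)"
      using Suc k by auto
    note sD = homD[OF s(1)]
    note D = exact_seqD[OF fs(1), of k] exact_seqD[OF fs(1), of "Suc k"] exact_seqD[OF gs(1), of "Suc k"]
       exact_seqD[OF gs(1), of "k"]
    have "gs ! Suc k \<cdot> arr_diff C (h (Suc k)) (s \<cdot> fs ! Suc k) =
      arr_diff C (gs ! Suc k \<cdot> h (Suc k)) (gs ! Suc k \<cdot> (s \<cdot> fs ! Suc k))"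
      by (rule minus_comp) (use D k h(3-5)[of "Suc k"] sD fs(2) gs(2) in auto)
    also have "\<dots> = Zero C (seq_obj C fs (Suc k)) (seq_obj C gs (Suc (Suc k)))"
      unfolding s(2) using D k h(3-5)[of "Suc k"] fs(2) gs(2) by simp
    finally obtain y where y: "y\<in>homset C (seq_obj C fs (Suc k)) (seq_obj C gs k)"
      "gs ! k \<cdot> y = arr_diff C (h (Suc k)) (s \<cdot> fs ! Suc k)"
      using step[OF k(2), of "arr_diff C (h (Suc k)) (s \<cdot> fs ! Suc k)"] D k h(3-5)[of "Suc k"] sD fs(2) gs(2)
      by (auto simp: hom_iff)
    note yD = homD[OF y(1)]
    have z: "(s \<cdot> fs ! Suc k) \<cdot> fs ! k = Zero C (seq_obj C fs k) (seq_obj C gs (Suc k))"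
      using exact_seq_comp(2)[OF fs(1), of k] exact_seq_Obj[OF fs(1), of k] sD k D fs(2) gs(2) by auto
    have "gs ! k \<cdot> (y \<cdot> fs ! k) = arr_diff C (h (Suc k)) (s \<cdot> fs ! Suc k) \<cdot> fs ! k"
      by (rule comp_cong_assoc1[OF y(2)]) (use yD D k fs(2) gs(2) in auto)
    also have "\<dots> = arr_diff C (h (Suc k) \<cdot> fs ! k) ((s \<cdot> fs ! Suc k) \<cdot> fs ! k)"
      by (rule minus_comp) (use D k h(3-5)[of "Suc k"] sD fs(2) gs(2) in auto)
    also have "\<dots> = h (Suc k) \<cdot> fs ! k"
      unfolding z using D k h(3-5)[of "Suc k"] exact_seq_Obj[OF fs(1), of k]
        exact_seq_Obj[OF gs(1), of "Suc k"] fs(2) gs(2)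
      by (subst minus_eq_iff) auto
    finally show ?case using y(1) h(6)[of k] k by (auto simp: k_def)
  qed
  from this[of n] obtain s where s: "s\<in>homset C (seq_obj C fs 1) (seq_obj C gs 0)"
      "gs ! 0 \<cdot> (s \<cdot> fs ! 0) = gs ! 0 \<cdot> h 0" by auto
  have "s \<cdot> fs ! 0 = h 0"
    by (rule monoD[OF mono s(2)]) (use homD[OF s(1)] h(3-5)[of 0] exact_seqD[OF fs(1), of 0]
        exact_seqD[OF gs(1), of 0] fs(2) gs(2) in auto)
  then show ?thesis using s(1) h(1) by auto
qed

lemma up_exist:
  assumes fs: "exact_seq C fs" "length fs = Suc n" and gs: "exact_seq C gs" "length gs = Suc n"
    and a: "a \<in> homset C (seq_obj C fs 0) (seq_obj C gs 0)"
    and mono: "is_mono C (fs ! 0)"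
    and inj: "\<And>k. k \<le> n \<Longrightarrow> seq_obj C gs (Suc k) \<in> Inj C"
  shows "\<exists>b. seq_morphism C fs gs a b"
proof -
  have "\<exists>h. h 0 = a \<and> (\<forall>k\<le>i. h k \<in> homset C (seq_obj C fs k) (seq_obj C gs k)) \<and>
      (\<forall>k<i. gs ! k \<cdot> h k = h (Suc k) \<cdot> fs ! k)" if "i \<le> Suc n" for i
    using that
  proof (induction i)
    case 0
    then show ?case using a by (intro exI[of _ "\<lambda>k. a"]) auto
  next
    case (Suc i)
    obtain h where h: "h 0 = a"
      "\<And>l. l \<le> i \<Longrightarrow> h l \<in> homset C (seq_obj C fs l) (seq_obj C gs l)"
      "\<And>l. l < i \<Longrightarrow> gs ! l \<cdot> h l = h (Suc l) \<cdot> fs ! l"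
      using Suc by auto
    note hD = homD[OF h(2)[of i]]
    note D = exact_seqD[OF fs(1), of i] exact_seqD[OF gs(1), of i]
    obtain y where y: "y \<in> Arr C" "Dom C y = seq_obj C fs (Suc i)" "Cod C y = seq_obj C gs (Suc i)"
      "y \<cdot> fs ! i = gs ! i \<cdot> h i"
    proof (cases i)
      case 0
      show ?thesis
        by (rule mono_extend[OF mono inj[of 0], of "gs ! 0 \<cdot> h 0"])
          (use 0 that D hD Suc.prems fs(2) gs(2) in auto)
    next
      case (Suc j)
      note hjD = homD[OF h(2)[of j]]
      note Dj = exact_seqD[OF fs(1), of j] exact_seqD[OF gs(1), of j]
      have "(gs ! i \<cdot> h i) \<cdot> fs ! j = gs ! i \<cdot> (h i \<cdot> fs ! j)"
        by (rule comp_assoc) (use hD D Dj hjD Suc \<open>Suc i \<le> Suc n\<close> fs(2) gs(2) in auto)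
      also have "h i \<cdot> fs ! j = gs ! j \<cdot> h j" using h(3)[of j] Suc by simp
      also have "gs ! i \<cdot> (gs ! j \<cdot> h j) = Zero C (seq_obj C gs j) (seq_obj C gs (Suc i)) \<cdot> h j"
        by (rule comp_cong_assoc1) (use exact_seq_comp(2)[OF gs(1), of j] hD D Dj hjD Suc \<open>Suc i \<le> Suc n\<close> fs(2) gs(2) in auto)
      also have "\<dots> = Zero C (Dom C (fs ! j)) (seq_obj C gs (Suc i))"
        using hjD Dj D exact_seq_Obj[OF gs(1), of "Suc i"] Suc \<open>Suc i \<le> Suc n\<close> fs(2) gs(2) by auto
      finally have z: "(gs ! i \<cdot> h i) \<cdot> fs ! j = Zero C (Dom C (fs ! j)) (seq_obj C gs (Suc i))" .
      have "exact_at C (fs ! j) (fs ! i)"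
        using exact_seq_comp(1)[OF fs(1), of j] Suc \<open>Suc i \<le> Suc n\<close> fs(2) by simp
      then show ?thesis
        by (rule exact_extend[OF _ inj[of i], of _ _ "gs ! i \<cdot> h i"])
          (use z that D hD Suc \<open>Suc i \<le> Suc n\<close> fs(2) gs(2) in auto)
    qed
    have "(h(Suc i := y)) l \<in> homset C (seq_obj C fs l) (seq_obj C gs l)" if "l \<le> Suc i" for l
      using that y h(2)[of l] by (cases "l = Suc i") (auto simp: hom_iff)
    moreover have "gs ! l \<cdot> (h(Suc i := y)) l = (h(Suc i := y)) (Suc l) \<cdot> fs ! l" if "l < Suc i" for l
      using that y h(3)[of l] by (cases "l = i") auto
    ultimately show ?case using h(1) by (intro exI[of _ "h(Suc i := y)"]) auto
  qed
  from this[of "Suc n"] obtain h where h: "h 0 = a"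
      "\<And>l. l \<le> Suc n \<Longrightarrow> h l \<in> homset C (seq_obj C fs l) (seq_obj C gs l)"
      "\<And>l. l < Suc n \<Longrightarrow> gs ! l \<cdot> h l = h (Suc l) \<cdot> fs ! l" by auto
  show ?thesis unfolding seq_morphism_def
    using h fs(2) gs(2) by (intro exI[of _ "h (Suc n)"] conjI exI[of _ h]) auto
qed

lemma up_homotopy:
  assumes fs: "exact_seq C fs" "length fs = Suc n" and gs: "exact_seq C gs" "length gs = Suc n"
    and h: "seq_morphism C fs gs (Zero C (seq_obj C fs 0) (seq_obj C gs 0)) b"
    and epi: "is_epi C (fs ! n)"
    and inj: "\<And>k. k < n \<Longrightarrow> seq_obj C gs (Suc k) \<in> Inj C"
  shows "\<exists>w\<in>homset C (seq_obj C fs (Suc n)) (seq_obj C gs n). b = gs ! n \<cdot> w"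
proof -
  from h obtain h where h0: "h 0 = Zero C (seq_obj C fs 0) (seq_obj C gs 0)" "h (length fs) = b" "seq_map C fs gs h"
    by (rule seq_morphismE)
  note h = h0(1) h0(2)[unfolded fs(2)] seq_mapD(2-5)[OF h0(3), unfolded fs(2) less_Suc_eq_le]
  have "\<exists>s\<in>homset C (seq_obj C fs (Suc i)) (seq_obj C gs i).
      (gs ! i \<cdot> s) \<cdot> fs ! i = h (Suc i) \<cdot> fs ! i" if "i \<le> n" for i
    using that
  proof (induction i)
    case 0
    note D = exact_seqD[OF fs(1), of 0] exact_seqD[OF gs(1), of 0]
    have "Zero C (seq_obj C fs 1) (seq_obj C gs 0) \<in> homset C (seq_obj C fs 1) (seq_obj C gs 0)"
      using exact_seq_Obj[OF fs(1)] exact_seq_Obj[OF gs(1)] fs(2) gs(2) by (auto simp: hom_iff)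
    moreover have "(gs ! 0 \<cdot> Zero C (seq_obj C fs 1) (seq_obj C gs 0)) \<cdot> fs ! 0 = h 1 \<cdot> fs ! 0"
      using h(1) h(6)[of 0] D fs(2) gs(2) exact_seq_Obj[OF fs(1)] exact_seq_Obj[OF gs(1)]  by auto
    ultimately show ?case by auto
  next
    case (Suc k)
    then have k: "k < n" by simp
    obtain s where s: "s \<in> homset C (seq_obj C fs (Suc k)) (seq_obj C gs k)"
      "(gs ! k \<cdot> s) \<cdot> fs ! k = h (Suc k) \<cdot> fs ! k"
      using Suc by auto
    note sD = homD[OF s(1)]
    note D = exact_seqD[OF fs(1), of k] exact_seqD[OF fs(1), of "Suc k"] exact_seqD[OF gs(1), of "Suc k"]
       exact_seqD[OF gs(1), of "k"]
    define t where "t = arr_diff C (h (Suc k)) (gs ! k \<cdot> s)"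
    have tD: "t \<in> Arr C" "Dom C t = seq_obj C fs (Suc k)" "Cod C t = seq_obj C gs (Suc k)"
      unfolding t_def using D k h(3-5)[of "Suc k"] sD fs(2) gs(2) by auto
    have "t \<cdot> fs ! k = arr_diff C (h (Suc k) \<cdot> fs ! k) ((gs ! k \<cdot> s) \<cdot> fs ! k)"
      unfolding t_def by (rule minus_comp) (use D k h(3-5)[of "Suc k"] sD fs(2) gs(2) in auto)
    also have "\<dots> = Zero C (Dom C (fs ! k)) (seq_obj C gs (Suc k))"
      unfolding s(2) using D k h(3-5)[of "Suc k"] fs(2) gs(2) by simp
    finally have z: "t \<cdot> fs ! k = Zero C (Dom C (fs ! k)) (seq_obj C gs (Suc k))" .
    have "exact_at C (fs ! k) (fs ! Suc k)" using exact_seq_comp(1)[OF fs(1), of k] k fs(2) by auto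
    then obtain y where y: "y \<in> Arr C" "Cod C y = seq_obj C gs (Suc k)" "Dom C y = Cod C (fs ! Suc k)"
      "y \<cdot> fs ! Suc k = t"
      by (rule exact_extend[OF _ inj[OF k], of _ _ t]) (use z tD D k fs(2) in auto)
    have z2: "gs ! Suc k \<cdot> (gs ! k \<cdot> s) = Zero C (seq_obj C fs (Suc k)) (seq_obj C gs (Suc (Suc k)))"
    proof -
      have "gs ! Suc k \<cdot> (gs ! k \<cdot> s) = Zero C (seq_obj C gs k) (seq_obj C gs (Suc (Suc k))) \<cdot> s"
        by (rule comp_cong_assoc1) (use exact_seq_comp(2)[OF gs(1), of k] sD D k fs(2) gs(2) in auto)
      then show ?thesis using sD exact_seq_Obj[OF gs(1), of "Suc (Suc k)"] k gs(2) by auto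
    qed
    have "(gs ! Suc k \<cdot> y) \<cdot> fs ! Suc k = gs ! Suc k \<cdot> (y \<cdot> fs ! Suc k)"
      by (rule comp_assoc) (use y D k fs(2) gs(2) in auto)
    also have "\<dots> = arr_diff C (gs ! Suc k \<cdot> h (Suc k)) (gs ! Suc k \<cdot> (gs ! k \<cdot> s))"
      unfolding y(4) t_def by (rule minus_comp) (use D k h(3-5)[of "Suc k"] sD fs(2) gs(2) in auto)
    also have "\<dots> = gs ! Suc k \<cdot> h (Suc k)"
      unfolding z2 using D k h(3-5)[of "Suc k"] exact_seq_Obj[OF fs(1), of "Suc k"]
         exact_seq_Obj[OF gs(1), of "Suc (Suc k)"] fs(2) gs(2)
      by (subst minus_eq_iff) auto
    finally show ?case using y h(6)[of "Suc k"] k D fs(2)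
      by (intro bexI[of _ y]) (auto simp: hom_iff)
  qed
  from this[of n] obtain s where s: "s\<in>homset C (seq_obj C fs (Suc n)) (seq_obj C gs n)"
      "(gs ! n \<cdot> s) \<cdot> fs ! n = h (Suc n) \<cdot> fs ! n" by auto
  have "gs ! n \<cdot> s = h (Suc n)"
    by (rule epiD[OF epi s(2)]) (use homD[OF s(1)] h(3-5)[of "Suc n"] exact_seqD[OF fs(1), of n]
        exact_seqD[OF gs(1), of n] fs(2) gs(2) in auto)
  then show ?thesis using s(1) h(2) by auto
qed

end

section \<open>Extensions and pushouts\<close>

context abelian_category
begin

lemma extensions_iff:
  assumes "0 < j"
  shows "fs \<in> extensions C j X Y \<longleftrightarrow> length fs = Suc j \<and> exact_seq C fs \<and> seq_obj C fs 0 = Y \<and>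
    seq_obj C fs (Suc j) = X \<and> is_mono C (fs ! 0) \<and> is_epi C (fs ! j)"
proof (cases "length fs = Suc j")
  case True
  then have "last fs = fs ! j" by (subst last_conv_nth) auto
  then show ?thesis using assms True by (auto simp: extensions_def exact_seq_def seq_obj_def)
qed (use assms in \<open>auto simp: extensions_def\<close>)

lemma extensionsD:
  assumes "fs \<in> extensions C j X Y" "0 < j"
  shows "length fs = Suc j" "exact_seq C fs" "seq_obj C fs 0 = Y" "seq_obj C fs (Suc j) = X"
    "is_mono C (fs ! 0)" "is_epi C (fs ! j)" "X \<in> Obj C" "Y \<in> Obj C"
  using assms exact_seq_Obj[of fs 0] exact_seq_Obj[of fs "Suc j"] by (auto simp: extensions_iff)

lemma ext_step_iff:
  assumes "0 < j"
  shows "(fs, gs) \<in> ext_step C j X Y \<longleftrightarrow> fs \<in> extensions C j X Y \<and> gs \<in> extensions C j X Y \<and>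
    seq_morphism C fs gs (Ident C Y) (Ident C X)"
  using assms by (auto simp: ext_step_def)

end

lemma ext_equiv_refl [simp]: "(fs, fs) \<in> ext_equiv C j X Y"
  by (simp add: ext_equiv_def)

lemma ext_equiv_step: "(fs, gs) \<in> ext_step C j X Y \<Longrightarrow> (fs, gs) \<in> ext_equiv C j X Y"
  by (auto simp: ext_equiv_def)

lemma ext_equiv_sym: "(fs, gs) \<in> ext_equiv C j X Y \<Longrightarrow> (gs, fs) \<in> ext_equiv C j X Y"
proof -
  assume a: "(fs, gs) \<in> ext_equiv C j X Y"
  have "sym (ext_equiv C j X Y)"
    unfolding ext_equiv_def by (intro sym_rtrancl sym_Un_converse)
  with a show ?thesis by (auto dest: symD)
qed

lemma ext_equiv_trans:
  "(fs, gs) \<in> ext_equiv C j X Y \<Longrightarrow> (gs, hs) \<in> ext_equiv C j X Y \<Longrightarrow> (fs, hs) \<in> ext_equiv C j X Y"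
  unfolding ext_equiv_def by (rule rtrancl_trans)

lemma ext_equiv_class_eq:
  "(fs, gs) \<in> ext_equiv C j X Y \<Longrightarrow> ext_equiv C j X Y `` {fs} = ext_equiv C j X Y `` {gs}"
  by (auto intro: ext_equiv_sym ext_equiv_trans)

lemma ext_equiv_extensions:
  assumes "(fs, gs) \<in> ext_equiv C j X Y"
  shows "fs \<in> extensions C j X Y \<longleftrightarrow> gs \<in> extensions C j X Y"
  using assms unfolding ext_equiv_def
  by (induction rule: rtrancl_induct) (auto simp: ext_step_def)

text \<open>The reflexive closure also relates lists that are not extensions to themselves, so
  membership in \<open>extensions\<close> is a premise and is carried along by the induction. The
  two step cases are the two directions of an arrow in a zigzag.\<close>

lemma ext_equiv_induct [consumes 2, case_names refl step_fwd step_bwd]: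
  assumes "(fs, gs) \<in> ext_equiv C j X Y" "fs \<in> extensions C j X Y"
    "P fs"
    "\<And>gs hs. gs \<in> extensions C j X Y \<Longrightarrow> hs \<in> extensions C j X Y \<Longrightarrow> (gs, hs) \<in> ext_step C j X Y \<Longrightarrow> P gs \<Longrightarrow> P hs"
    "\<And>gs hs. gs \<in> extensions C j X Y \<Longrightarrow> hs \<in> extensions C j X Y \<Longrightarrow> (hs, gs) \<in> ext_step C j X Y \<Longrightarrow> P gs \<Longrightarrow> P hs"
  shows "P gs"
proof -
  have "gs \<in> extensions C j X Y \<and> P gs"
    using assms(1,2) unfolding ext_equiv_def
  proof (induction rule: rtrancl_induct)
    case base
    then show ?case using assms(3) by simp
  next
    case (step gs hs)
    moreover have "gs \<in> extensions C j X Y" "hs \<in> extensions C j X Y"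
      using step(2) by (auto simp: ext_step_def)
    ultimately show ?case using assms(4,5)[of gs hs] by auto
  qed
  then show ?thesis ..
qed

context abelian_category
begin

lemma neg_ZeroD:
  assumes "arr_neg C f = Zero C X Y" "f \<in> Arr C" "Dom C f = X" "Cod C f = Y"
  shows "f = Zero C X Y"
proof -
  have "Plus C f (arr_neg C f) = f" unfolding assms(1) using assms(2-) by simp
  moreover have "Plus C f (arr_neg C f) = Zero C X Y" using Plus_neg(1)[OF assms(2)] assms(3,4) by simp
  ultimately show ?thesis by simp
qed

text \<open>The pushout is the cokernel of the difference of the two maps into a direct sum. The
  last clause holds because a map from a projective lifts to the direct sum, hence is a sum of maps
  through the two legs; it makes element chases in the pushout possible.\<close>

lemma pushout_ex:
  assumes k: "is_mono C k" and f: "f \<in> Arr C" "Dom C f = Dom C k"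
  obtains k' t where "k' \<in> Arr C" "t \<in> Arr C" "Dom C k' = Cod C f" "Dom C t = Cod C k" "Cod C t = Cod C k'"
    "is_mono C k'" "k' \<cdot> f = t \<cdot> k"
    "\<And>u v. \<lbrakk>u \<in> Arr C; v \<in> Arr C; Dom C u = Cod C f; Dom C v = Cod C k; Cod C v = Cod C u; u \<cdot> f = v \<cdot> k\<rbrakk>
      \<Longrightarrow> \<exists>w\<in>Arr C. Dom C w = Cod C k' \<and> Cod C w = Cod C u \<and> w \<cdot> k' = u \<and> w \<cdot> t = v"
    "\<And>w w'. \<lbrakk>w \<in> Arr C; w' \<in> Arr C; Dom C w = Cod C k'; Dom C w' = Cod C k'; Cod C w' = Cod C w;
      w \<cdot> k' = w' \<cdot> k'; w \<cdot> t = w' \<cdot> t\<rbrakk> \<Longrightarrow> w = w'"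
    "\<And>x. \<lbrakk>x \<in> Arr C; Dom C x \<in> Proj C; Cod C x = Cod C k'\<rbrakk>
      \<Longrightarrow> \<exists>y\<in>Arr C. \<exists>z\<in>Arr C. Dom C y = Dom C x \<and> Dom C z = Dom C x \<and> Cod C y = Cod C f \<and> Cod C z = Cod C k \<and>
        x = Plus C (k' \<cdot> y) (t \<cdot> z)"
proof -
  note kA = monoA[OF k]
  obtain S i1 i2 p1 p2 where bp: "is_biproduct C (Cod C f) (Cod C k) S i1 i2 p1 p2"
    using ex_biproduct[of "Cod C f" "Cod C k"] f kA by auto
  have S: "i1 \<in> Arr C" "i2 \<in> Arr C" "p1 \<in> Arr C" "p2 \<in> Arr C"
    "Dom C i1 = Cod C f" "Cod C i1 = S" "Dom C i2 = Cod C k" "Cod C i2 = S"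
    "Dom C p1 = S" "Cod C p1 = Cod C f" "Dom C p2 = S" "Cod C p2 = Cod C k"
    using bp by (auto simp: is_biproduct_def hom_iff)
  have SO: "S \<in> Obj C" using S by auto
  have eqs: "p1 \<cdot> i1 = Ident C (Cod C f)" "p2 \<cdot> i2 = Ident C (Cod C k)" "p2 \<cdot> i1 = Zero C (Cod C f) (Cod C k)"
    "p1 \<cdot> i2 = Zero C (Cod C k) (Cod C f)" "Plus C (i1 \<cdot> p1) (i2 \<cdot> p2) = Ident C S"
    using bp by (auto simp: is_biproduct_def)
  define u where "u = arr_diff C (i1 \<cdot> f) (i2 \<cdot> k)"
  have u: "u \<in> Arr C" "Dom C u = Dom C k" "Cod C u = S"
    unfolding u_def using S f kA by auto
  have p2u: "p2 \<cdot> u = arr_neg C k"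
  proof -
    have "p2 \<cdot> u = arr_diff C (p2 \<cdot> (i1 \<cdot> f)) (p2 \<cdot> (i2 \<cdot> k))"
      unfolding u_def by (rule minus_comp) (use S f kA in auto)
    also have "p2 \<cdot> (i1 \<cdot> f) = Zero C (Dom C k) (Cod C k)"
      using comp_cong_assoc1[OF eqs(3), of f] S f kA by simp
    also have "p2 \<cdot> (i2 \<cdot> k) = k"
      using comp_cong_assoc1[OF eqs(2), of k] S f kA by simp
    finally show ?thesis using kA by (simp add: arr_diff_def)
  qed
  \<comment> \<open>The second component of \<open>u\<close> is the negative of \<open>k\<close>,
    hence mono. So \<open>u\<close> is the kernel of its cokernel, which is what makes
    \<open>k'\<close> mono below.\<close>
  have "is_mono C u"
  proof (rule is_monoI)
    fix g assume g: "g \<in> Arr C" "Cod C g = Dom C u" "u \<cdot> g = Zero C (Dom C g) (Cod C u)"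
    have "arr_neg C k \<cdot> g = p2 \<cdot> (u \<cdot> g)"
      by (rule comp_cong_assoc1[OF p2u, symmetric]) (use S u g in auto)
    also have "\<dots> = Zero C (Dom C g) (Cod C k)" unfolding g(3) using S u g by simp
    finally have "k \<cdot> arr_neg C g = Zero C (Dom C g) (Cod C k)" using kA u g by simp
    then have z: "arr_neg C g = Zero C (Dom C g) (Dom C k)"
      by (rule mono_Zero[OF k]) (use kA u g in auto)
    show "g = Zero C (Dom C g) (Dom C u)"
      by (rule neg_ZeroD) (use z g u in auto)
  qed fact
  obtain c where c: "is_cokernel C c u" using ex_cokernel u by auto
  note cD = cokernelD[OF c]
  have ker: "is_kernel C u c" by (rule mono_kernel_of_coker) fact+
  define k' t where "k' = c \<cdot> i1" and "t = c \<cdot> i2"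
  have k't: "k' \<in> Arr C" "t \<in> Arr C" "Dom C k' = Cod C f" "Dom C t = Cod C k" "Cod C t = Cod C c" "Cod C k' = Cod C c"
    unfolding k'_def t_def using S cD u by auto
  have split: "x = Plus C (i1 \<cdot> (p1 \<cdot> x)) (i2 \<cdot> (p2 \<cdot> x))" if "x \<in> Arr C" "Cod C x = S" for x
  proof -
    have "x = Plus C (i1 \<cdot> p1) (i2 \<cdot> p2) \<cdot> x" using that eqs(5) by simp
    also have "\<dots> = Plus C (i1 \<cdot> (p1 \<cdot> x)) (i2 \<cdot> (p2 \<cdot> x))"
      using S that by (subst Comp_Plus(1)) auto
    finally show ?thesis .
  qed
  have csplit: "c \<cdot> x = Plus C (k' \<cdot> (p1 \<cdot> x)) (t \<cdot> (p2 \<cdot> x))" if "x \<in> Arr C" "Cod C x = S" for x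
  proof -
    have "c \<cdot> x = c \<cdot> Plus C (i1 \<cdot> (p1 \<cdot> x)) (i2 \<cdot> (p2 \<cdot> x))"
      by (rule arg_cong[OF split[OF that]])
    also have "\<dots> = Plus C (c \<cdot> (i1 \<cdot> (p1 \<cdot> x))) (c \<cdot> (i2 \<cdot> (p2 \<cdot> x)))"
      by (rule Comp_Plus(2)) (use cD u S that in auto)
    finally show ?thesis unfolding k'_def t_def using cD u S that by simp
  qed
  show thesis
  proof (rule that[of k' t])
    have "arr_diff C (k' \<cdot> f) (t \<cdot> k) = c \<cdot> u"
      unfolding u_def k'_def t_def by (subst minus_comp(2)) (use cD u S f kA in auto)
    also have "\<dots> = Zero C (Dom C k) (Cod C c)" using cD u by simp
    finally show "k' \<cdot> f = t \<cdot> k" using k't f kA by (simp add: minus_eq_Zero_iff)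
    show "is_mono C k'"
    proof (rule is_monoI)
      fix y assume y: "y \<in> Arr C" "Cod C y = Dom C k'" "k' \<cdot> y = Zero C (Dom C y) (Cod C k')"
      have "c \<cdot> (i1 \<cdot> y) = Zero C (Dom C y) (Cod C c)"
        using y(3) cD u S y k't unfolding k'_def by simp
      then obtain z where z: "z \<in> Arr C" "Dom C z = Dom C y" "Cod C z = Dom C u" "u \<cdot> z = i1 \<cdot> y"
        using kernel_lift[OF ker, of "i1 \<cdot> y"] S y k't cD u by auto
      have "p2 \<cdot> (u \<cdot> z) = Zero C (Dom C y) (Cod C k)"
        unfolding z(4) using comp_cong_assoc1[OF eqs(3), of y] S y k't kA by simp
      moreover have "p2 \<cdot> (u \<cdot> z) = arr_neg C k \<cdot> z"
        by (rule comp_cong_assoc1[OF p2u]) (use S u z in auto)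
      ultimately have "k \<cdot> arr_neg C z = Zero C (Dom C y) (Cod C k)" using kA z u by simp
      then have n: "arr_neg C z = Zero C (Dom C y) (Dom C k)"
        by (rule mono_Zero[OF k]) (use kA u z in auto)
      have "z = Zero C (Dom C y) (Dom C k)"
        by (rule neg_ZeroD[OF n]) (use z u in auto)
      then have "i1 \<cdot> y = Zero C (Dom C y) S" using z u y kA by simp
      then have "p1 \<cdot> (i1 \<cdot> y) = Zero C (Dom C y) (Cod C f)" using S y by simp
      moreover have "p1 \<cdot> (i1 \<cdot> y) = y"
        using comp_cong_assoc1[OF eqs(1), of y] S y k't by simp
      ultimately have "y = Zero C (Dom C y) (Cod C f)" by (rule trans[OF sym, rotated])
      then show "y = Zero C (Dom C y) (Dom C k')" unfolding k't .
    qed fact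
  next
    fix a b assume ab: "a \<in> Arr C" "b \<in> Arr C" "Dom C a = Cod C f" "Dom C b = Cod C k" "Cod C b = Cod C a" "a \<cdot> f = b \<cdot> k"
    define g where "g = Plus C (a \<cdot> p1) (b \<cdot> p2)"
    have gD: "g \<in> Arr C" "Dom C g = S" "Cod C g = Cod C a" unfolding g_def using ab S by auto
    have gi1: "g \<cdot> i1 = a"
    proof -
      have "g \<cdot> i1 = Plus C (a \<cdot> (p1 \<cdot> i1)) (b \<cdot> (p2 \<cdot> i1))"
        unfolding g_def by (subst Comp_Plus(1)) (use ab S in auto)
      then show ?thesis using eqs ab f kA by simp
    qed
    have gi2: "g \<cdot> i2 = b"
    proof -
      have "g \<cdot> i2 = Plus C (a \<cdot> (p1 \<cdot> i2)) (b \<cdot> (p2 \<cdot> i2))"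
        unfolding g_def by (subst Comp_Plus(1)) (use ab S in auto)
      then show ?thesis using eqs ab f kA by simp
    qed
    have "g \<cdot> u = arr_diff C (g \<cdot> (i1 \<cdot> f)) (g \<cdot> (i2 \<cdot> k))"
      unfolding u_def by (rule minus_comp) (use gD S f kA in auto)
    also have "g \<cdot> (i1 \<cdot> f) = a \<cdot> f"
      by (rule comp_cong_assoc1[OF gi1]) (use gD S f kA in auto)
    also have "g \<cdot> (i2 \<cdot> k) = b \<cdot> k"
      by (rule comp_cong_assoc1[OF gi2]) (use gD S f kA in auto)
    also have "arr_diff C (a \<cdot> f) (b \<cdot> k) = Zero C (Dom C u) (Cod C g)"
      unfolding ab(6) using ab kA u gD by simp
    finally obtain w where w: "w \<in> Arr C" "Dom C w = Cod C c" "Cod C w = Cod C g" "w \<cdot> c = g"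
      using cokernel_desc[OF c, of g] gD u by auto
    have "w \<cdot> k' = a" unfolding k'_def gi1[symmetric]
      by (rule comp_cong_assoc1[OF w(4)]) (use w S cD u in auto)
    moreover have "w \<cdot> t = b" unfolding t_def gi2[symmetric]
      by (rule comp_cong_assoc1[OF w(4)]) (use w S cD u in auto)
    ultimately show "\<exists>w\<in>Arr C. Dom C w = Cod C k' \<and> Cod C w = Cod C a \<and> w \<cdot> k' = a \<and> w \<cdot> t = b"
      using w gD k't by auto
  next
    fix w w' assume w: "w \<in> Arr C" "w' \<in> Arr C" "Dom C w = Cod C k'" "Dom C w' = Cod C k'" "Cod C w' = Cod C w"
      "w \<cdot> k' = w' \<cdot> k'" "w \<cdot> t = w' \<cdot> t"
    have *: "v \<cdot> c = Plus C ((v \<cdot> k') \<cdot> p1) ((v \<cdot> t) \<cdot> p2)" if "v \<in> Arr C" "Dom C v = Cod C k'" for v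
    proof -
      have "c = c \<cdot> Ident C S" using cD u by simp
      also have "\<dots> = Plus C (k' \<cdot> (p1 \<cdot> Ident C S)) (t \<cdot> (p2 \<cdot> Ident C S))"
        by (rule csplit) (use SO in auto)
      also have "\<dots> = Plus C (k' \<cdot> p1) (t \<cdot> p2)" using S SO by simp
      finally have "v \<cdot> c = v \<cdot> Plus C (k' \<cdot> p1) (t \<cdot> p2)" by (rule arg_cong)
      then show ?thesis using that k't S by simp
    qed
    have "w \<cdot> c = w' \<cdot> c" using *[of w] *[of w'] w by simp
    then show "w = w'" by (rule epiD[OF cD(5)]) (use w k't in auto)
  next
    fix x assume x: "x \<in> Arr C" "Dom C x \<in> Proj C" "Cod C x = Cod C k'"
    obtain s where s: "s \<in> Arr C" "Dom C s = Dom C x" "Cod C s = Dom C c" "c \<cdot> s = x"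
      using ProjD[OF x(2) cD(5), of x] x k't by auto
    show "\<exists>y\<in>Arr C. \<exists>z\<in>Arr C. Dom C y = Dom C x \<and> Dom C z = Dom C x \<and> Cod C y = Cod C f \<and> Cod C z = Cod C k \<and>
        x = Plus C (k' \<cdot> y) (t \<cdot> z)"
    proof (rule bexI[of _ "p1 \<cdot> s"], rule bexI[of _ "p2 \<cdot> s"], intro conjI)
      show "x = Plus C (k' \<cdot> (p1 \<cdot> s)) (t \<cdot> (p2 \<cdot> s))"
        using csplit[of s] s(1,3,4) u cD(3) by simp
    qed (use s(1-3) S u cD(3) in auto)
  qed (use k't in auto)
qed

text \<open>Adds the homotopy whose only component is \<open>g\<close>. It affects positions 0 and 1
  only, since the next square sees \<open>gs ! 1 \<cdot> gs ! 0\<close>, which is zero. The length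
  is at least 2, so the right end \<open>b\<close> stays the same.\<close>

lemma seq_morphism_modify:
  assumes h: "seq_morphism C fs gs a b" and fs: "exact_seq C fs" "length fs = Suc (Suc n)"
    and gs: "exact_seq C gs" and g: "g \<in> homset C (seq_obj C fs 1) (seq_obj C gs 0)"
  shows "seq_morphism C fs gs (Plus C a (g \<cdot> fs ! 0)) b"
proof -
  from h obtain h where h: "h 0 = a" "h (length fs) = b" "seq_map C fs gs h"
    by (rule seq_morphismE)
  note h = h(1,2) seq_mapD[OF h(3)]
  note gD = homD[OF g]
  note D = exact_seqD[OF fs(1), of 0] exact_seqD[OF fs(1), of "Suc 0"] exact_seqD[OF gs, of 0] exact_seqD[OF gs, of "Suc 0"]
  note H = h(4-6)[of 0] h(4-6)[of "Suc 0"] h(4-6)[of "Suc (Suc 0)"]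
  define h' where "h' = h(0 := Plus C (h 0) (g \<cdot> fs ! 0), 1 := Plus C (h 1) (gs ! 0 \<cdot> g))"
  show ?thesis
  proof (rule seq_morphismI[of h'])
    fix k assume k: "k \<le> length fs"
    consider "k = 0" | "k = Suc 0" | "k \<ge> Suc (Suc 0)" by linarith
    note cs = this
    show "h' k \<in> Arr C" by (cases rule: cs) (use h(3-6) k D gD fs(2) in \<open>auto simp: h'_def\<close>)
    show "Dom C (h' k) = seq_obj C fs k" by (cases rule: cs) (use h(3-6) k D gD fs(2) in \<open>auto simp: h'_def\<close>)
    show "Cod C (h' k) = seq_obj C gs k" by (cases rule: cs) (use h(3-6) k D gD fs(2) in \<open>auto simp: h'_def\<close>)
  next
    fix k assume k: "k < length fs"
    consider "k = 0" | "k = Suc 0" | "k \<ge> Suc (Suc 0)" by linarith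
    then show "gs ! k \<cdot> h' k = h' (Suc k) \<cdot> fs ! k"
    proof cases
      case 1
      have "gs ! 0 \<cdot> Plus C (h 0) (g \<cdot> fs ! 0) = Plus C (gs ! 0 \<cdot> h 0) ((gs ! 0 \<cdot> g) \<cdot> fs ! 0)"
        using D H gD fs(2) h(3) by simp
      also have "gs ! 0 \<cdot> h 0 = h 1 \<cdot> fs ! 0" using h(7)[of 0] fs(2) by simp
      finally show ?thesis using 1 D H gD fs(2) h(3) by (simp add: h'_def)
    next
      case 2
      have z: "gs ! Suc 0 \<cdot> (gs ! 0 \<cdot> g) = Zero C (seq_obj C fs (Suc 0)) (seq_obj C gs (Suc (Suc 0)))"
        using comp_cong_assoc1[OF exact_seq_comp(2)[OF gs, of 0], of g] D gD fs(2) h(3)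
          exact_seq_Obj[OF gs, of "Suc (Suc 0)"] by simp
      have "gs ! Suc 0 \<cdot> Plus C (h (Suc 0)) (gs ! 0 \<cdot> g) = Plus C (gs ! Suc 0 \<cdot> h (Suc 0)) (gs ! Suc 0 \<cdot> (gs ! 0 \<cdot> g))"
        by (rule Comp_Plus) (use D H gD fs(2) h(3) in auto)
      also have "\<dots> = h (Suc (Suc 0)) \<cdot> fs ! Suc 0"
        unfolding z using h(7)[of 1] D H gD fs(2) h(3) by simp
      finally show ?thesis using 2 by (simp add: h'_def)
    next
      case 3
      then show ?thesis using h(7)[of k] k by (auto simp: h'_def)
    qed
  qed (use h(1,2) fs in \<open>auto simp: h'_def h(3)\<close>)
qed

end

section \<open>Pushout of an extension along a map from its left end\<close>

context enough_proj
begin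

text \<open>Only the first two arrows of \<open>R\<close> change: the left one is pushed out along
  \<open>f\<close>, and the next one is induced on the pushout. The last clause is a universal
  property for whole sequences: a morphism from \<open>R\<close> whose left component factors
  through \<open>f\<close> descends to \<open>F\<close> with the same right end. Later arguments use
  \<open>F\<close> only through these properties.\<close>

lemma pushout_extension:
  assumes R: "R \<in> extensions C j X K" and j: "0 < j" and f: "f \<in> homset C K Y"
  obtains F where "F \<in> extensions C j X Y" "seq_morphism C R F f (Ident C X)"
    "\<And>G a b. exact_seq C G \<Longrightarrow> a \<in> homset C Y (seq_obj C G 0) \<Longrightarrow>
       seq_morphism C R G (a \<cdot> f) b \<Longrightarrow> seq_morphism C F G a b"
proof -
  note RD = extensionsD[OF R j] and fD = homD[OF f]
  have YO: "Y \<in> Obj C" using fD by auto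
  have l1: "0 < length R" "Suc 0 < length R" using RD j by auto
  note D0 = exact_seqD[OF RD(2) l1(1)] and D1 = exact_seqD[OF RD(2) l1(2)]
  note O2 = exact_seq_Obj[OF RD(2), of "Suc (Suc 0)"]
  note z1 = exact_seq_comp[OF RD(2) l1(2)]
  have fk: "Dom C f = Dom C (R ! 0)" using D0 fD RD by simp
  obtain k' t where p: "k' \<in> Arr C" "t \<in> Arr C" "Dom C k' = Cod C f" "Dom C t = Cod C (R ! 0)" "Cod C t = Cod C k'"
    "is_mono C k'" "k' \<cdot> f = t \<cdot> R ! 0"
    and desc: "\<And>u v. \<lbrakk>u \<in> Arr C; v \<in> Arr C; Dom C u = Cod C f; Dom C v = Cod C (R ! 0); Cod C v = Cod C u; u \<cdot> f = v \<cdot> R ! 0\<rbrakk>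
      \<Longrightarrow> \<exists>w\<in>Arr C. Dom C w = Cod C k' \<and> Cod C w = Cod C u \<and> w \<cdot> k' = u \<and> w \<cdot> t = v"
    and joint: "\<And>w w'. \<lbrakk>w \<in> Arr C; w' \<in> Arr C; Dom C w = Cod C k'; Dom C w' = Cod C k'; Cod C w' = Cod C w;
      w \<cdot> k' = w' \<cdot> k'; w \<cdot> t = w' \<cdot> t\<rbrakk> \<Longrightarrow> w = w'"
    and elt: "\<And>x. \<lbrakk>x \<in> Arr C; Dom C x \<in> Proj C; Cod C x = Cod C k'\<rbrakk>
      \<Longrightarrow> \<exists>y\<in>Arr C. \<exists>z\<in>Arr C. Dom C y = Dom C x \<and> Dom C z = Dom C x \<and> Cod C y = Cod C f \<and> Cod C z = Cod C (R ! 0) \<and>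
        x = Plus C (k' \<cdot> y) (t \<cdot> z)"
    by (rule pushout_ex[OF RD(5) _ fk]) (use fD in blast)+
  define E2 where "E2 = seq_obj C R (Suc (Suc 0))"
  have E2: "E2 \<in> Obj C" using O2 RD(1) j by (simp add: E2_def)
  \<comment> \<open>The new second arrow is zero on \<open>Y\<close> and the old one on the middle
    term. The two agree on \<open>K\<close> since consecutive arrows of \<open>R\<close> compose to
    zero.\<close>
  have "\<exists>w\<in>Arr C. Dom C w = Cod C k' \<and> Cod C w = Cod C (Zero C Y E2) \<and> w \<cdot> k' = Zero C Y E2 \<and> w \<cdot> t = R ! 1"
    by (rule desc) (use D0 D1 z1(2) fD YO E2 RD(3) in \<open>auto simp: E2_def\<close>)
  then obtain d' where d': "d' \<in> Arr C" "Dom C d' = Cod C k'" "Cod C d' = E2" "d' \<cdot> k' = Zero C Y E2" "d' \<cdot> t = R ! 1"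
    using YO E2 by auto
  define F where "F = R[0 := k', 1 := d']"
  have lF: "length F = Suc j" using RD by (simp add: F_def)
  have F0: "F ! 0 = k'" and F1: "F ! Suc 0 = d'" and Fk: "\<And>k. Suc (Suc 0) \<le> k \<Longrightarrow> F ! k = R ! k"
    using RD j by (auto simp: F_def nth_list_update)
  have ex0: "exact_at C k' d'"
  proof (rule exact_atI_proj)
    fix x assume x: "x \<in> Arr C" "Dom C x \<in> Proj C" "Cod C x = Cod C k'" "d' \<cdot> x = Zero C (Dom C x) (Cod C d')"
    obtain y z where yz: "y\<in>Arr C" "z\<in>Arr C" "Dom C y = Dom C x" "Dom C z = Dom C x" "Cod C y = Cod C f" "Cod C z = Cod C (R ! 0)"
      "x = Plus C (k' \<cdot> y) (t \<cdot> z)" using elt[OF x(1-3)] by blast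
    \<comment> \<open>The first summand of \<open>x\<close> dies, so \<open>R ! 1 \<cdot> z\<close>
      is zero and \<open>z\<close> comes from some \<open>v\<close> along \<open>R ! 0\<close>. The
      pushout square then moves \<open>t \<cdot> z\<close> into the image of
      \<open>k'\<close>.\<close>
    have "d' \<cdot> x = Plus C (d' \<cdot> (k' \<cdot> y)) (d' \<cdot> (t \<cdot> z))"
      unfolding yz(7) by (rule Comp_Plus(2)) (use d' yz(1-6) p fD in auto)
    also have "d' \<cdot> (k' \<cdot> y) = Zero C (Dom C x) E2"
      using comp_cong_assoc1[OF d'(4), of y] yz(1-6) p d' E2 fD by simp
    also have "d' \<cdot> (t \<cdot> z) = R ! 1 \<cdot> z"
      by (rule comp_cong_assoc1[OF d'(5)]) (use yz(1-6) p d' in auto)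
    finally have "R ! Suc 0 \<cdot> z = Zero C (Dom C x) (Cod C (R ! Suc 0))"
      using x d' yz(1-6) D0 D1 by (simp add: E2_def)
    then obtain v where v: "v \<in> Arr C" "Dom C v = Dom C x" "Cod C v = Dom C (R ! 0)" "R ! 0 \<cdot> v = z"
      using exact_lift[OF z1(1) x(2), of z] yz D0 D1 by auto
    have "t \<cdot> z = k' \<cdot> (f \<cdot> v)" unfolding v(4)[symmetric]
      by (rule comp_cong_assoc[OF p(7)[symmetric]]) (use p v fD D0 fk in auto)
    then have "x = Plus C (k' \<cdot> y) (k' \<cdot> (f \<cdot> v))" using yz(7) by simp
    also have "\<dots> = k' \<cdot> Plus C y (f \<cdot> v)"
      by (rule Comp_Plus(2)[symmetric]) (use yz(1-6) v p fD fk in auto)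
    finally have "k' \<cdot> Plus C y (f \<cdot> v) = x" by simp
    then show "\<exists>y\<in>Arr C. Dom C y = Dom C x \<and> Cod C y = Dom C k' \<and> k' \<cdot> y = x"
      using yz(1-6) v p fD fk by (intro bexI[of _ "Plus C y (f \<cdot> v)"]) auto
  qed (use p d' fD in auto)
  \<comment> \<open>The image of \<open>d'\<close> contains that of \<open>R ! 1\<close>. This
    settles exactness one place further and, for \<open>j = 1\<close>, that the last arrow is
    epi.\<close>
  have R1lift: "\<exists>y\<in>Arr C. Dom C y = Dom C x \<and> Cod C y = Dom C d' \<and> d' \<cdot> y = x"
    if "z \<in> Arr C" "Dom C z = Dom C x" "Cod C z = Dom C (R ! 1)" "R ! 1 \<cdot> z = x" for x z
  proof -
    have "d' \<cdot> (t \<cdot> z) = R ! 1 \<cdot> z"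
      by (rule comp_cong_assoc1[OF d'(5)]) (use that p d' D0 D1 in auto)
    then show ?thesis using that p d' D0 D1 by (intro bexI[of _ "t \<cdot> z"]) auto
  qed
  have ex1: "exact_at C d' (R ! Suc (Suc 0))" if l: "Suc (Suc 0) < length R"
  proof (rule exact_atI_proj)
    note D2 = exact_seqD[OF RD(2) l] and z2 = exact_seq_comp[OF RD(2) l]
    have "R ! Suc (Suc 0) \<cdot> d' = Zero C (Cod C k') (seq_obj C R (Suc (Suc (Suc 0))))"
    proof (rule joint)
      show "(R ! Suc (Suc 0) \<cdot> d') \<cdot> k' = Zero C (Cod C k') (seq_obj C R (Suc (Suc (Suc 0)))) \<cdot> k'"
        using D2 d' p E2 exact_seq_Obj[OF RD(2), of "Suc (Suc (Suc 0))"] fD YO l by (simp add: E2_def)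
      show "(R ! Suc (Suc 0) \<cdot> d') \<cdot> t = Zero C (Cod C k') (seq_obj C R (Suc (Suc (Suc 0)))) \<cdot> t"
        using D0 D2 d' p E2 exact_seq_Obj[OF RD(2), of "Suc (Suc (Suc 0))"] fD YO l z2 by (simp add: E2_def)
    qed (use D2 d' p E2 exact_seq_Obj[OF RD(2), of "Suc (Suc (Suc 0))"] l in \<open>auto simp: E2_def\<close>)
    then show "R ! Suc (Suc 0) \<cdot> d' = Zero C (Dom C d') (Cod C (R ! Suc (Suc 0)))"
      using d' D2 by simp
    fix x assume x: "x \<in> Arr C" "Dom C x \<in> Proj C" "Cod C x = Cod C d'"
      "R ! Suc (Suc 0) \<cdot> x = Zero C (Dom C x) (Cod C (R ! Suc (Suc 0)))"
    obtain z where "z \<in> Arr C" "Dom C z = Dom C x" "Cod C z = Dom C (R ! 1)" "R ! 1 \<cdot> z = x"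
      using exact_lift[OF z2(1) x(2), of x] x D1 d' by (auto simp: E2_def)
    then show "\<exists>y\<in>Arr C. Dom C y = Dom C x \<and> Cod C y = Dom C d' \<and> d' \<cdot> y = x"
      by (rule R1lift)
  qed (use d' exact_seqD[OF RD(2) l] in \<open>auto simp: E2_def\<close>)
  have exF: "exact_seq C F"
    unfolding exact_seq_def
  proof (intro conjI allI impI)
    show "F \<noteq> []" using lF by auto
    show "set F \<subseteq> Arr C" using RD(2) d'(1) p(1) unfolding F_def exact_seq_def
      by (intro set_update_subsetI) auto
    fix k assume k: "Suc k < length F"
    consider "k = 0" | "k = Suc 0" | "k \<ge> Suc (Suc 0)" by linarith
    then show "exact_at C (F ! k) (F ! Suc k)"
    proof cases
      case 1 then show ?thesis using ex0 F0 F1 by simp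
    next
      case 2 then show ?thesis using ex1 F1 Fk[of "Suc (Suc 0)"] k lF RD(1) by simp
    next
      case 3 then show ?thesis using Fk[of k] Fk[of "Suc k"] exact_seq_comp(1)[OF RD(2), of k] k lF RD(1) by simp
    qed
  qed
  have lF1: "0 < length F" "Suc 0 < length F" using lF j by auto
  have SF0: "seq_obj C F 0 = Y" using exact_seqD(2)[OF exF lF1(1)] F0 p fD by simp
  have SF1: "seq_obj C F (Suc 0) = Cod C k'" using exact_seqD(3)[OF exF lF1(1)] F0 by simp
  have SFk: "seq_obj C F k = seq_obj C R k" if "Suc (Suc 0) \<le> k" "k \<le> Suc j" for k
  proof -
    define i where "i = k - 2"
    have i: "k = Suc (Suc i)" using that(1) by (simp add: i_def)
    show ?thesis
    proof (cases "i = 0")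
      case True
      then show ?thesis using exact_seqD(3)[OF exF lF1(2)] F1 d' i by (simp add: E2_def)
    next
      case False
      then show ?thesis using exact_seqD(3)[OF exF, of "Suc i"] exact_seqD(3)[OF RD(2), of "Suc i"] lF RD(1) Fk[of "Suc i"] that i
        by auto
    qed
  qed
  have epi: "is_epi C (F ! j)"
  proof (cases "j = 1")
    case True
    have "is_epi C d'"
    proof (rule is_epiI_proj)
      fix x assume x: "x \<in> Arr C" "Dom C x \<in> Proj C" "Cod C x = Cod C d'"
      have "is_epi C (R ! 1)" using RD(6) True by simp
      then obtain z where "z \<in> Arr C" "Dom C z = Dom C x" "Cod C z = Dom C (R ! 1)" "R ! 1 \<cdot> z = x"
        using ProjD[OF x(2), of "R ! 1" x] x D1 d' by (auto simp: E2_def)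
      then show "\<exists>y\<in>Arr C. Dom C y = Dom C x \<and> Cod C y = Dom C d' \<and> d' \<cdot> y = x"
        by (rule R1lift)
    qed fact
    then show ?thesis using F1 True by simp
  next
    case False
    then show ?thesis using RD(6) Fk[of j] j by simp
  qed
  have Fext: "F \<in> extensions C j X Y"
    unfolding extensions_iff[OF j] using lF exF SF0 SFk[of "Suc j"] RD p(6) F0 epi j by auto
  have mor: "seq_morphism C R F f (Ident C X)"
  proof (rule seq_morphismI[of "\<lambda>k. if k = 0 then f else if k = 1 then t else Ident C (seq_obj C R k)"])
    fix k assume k: "k \<le> length R"
    consider "k = 0" | "k = Suc 0" | "k \<ge> Suc (Suc 0)" by linarith
    note cs = this
    let ?h = "if k = 0 then f else if k = 1 then t else Ident C (seq_obj C R k)"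
    show "?h \<in> Arr C" "Dom C ?h = seq_obj C R k" "Cod C ?h = seq_obj C F k"
      using cs fD p(1-5) exact_seq_Obj[OF RD(2) k] RD D0 SF0 SF1 SFk[of k] k by auto
  next
    fix k assume k: "k < length R"
    consider "k = 0" | "k = Suc 0" | "k \<ge> Suc (Suc 0)" by linarith
    then show "F ! k \<cdot> (if k = 0 then f else if k = 1 then t else Ident C (seq_obj C R k)) =
         (if Suc k = 0 then f else if Suc k = 1 then t else Ident C (seq_obj C R (Suc k))) \<cdot> R ! k"
    proof cases
      case 1 then show ?thesis using F0 p by simp
    next
      case 2 then show ?thesis using F1 d' D1 by simp
    next
      case 3 then show ?thesis using Fk[of k] exact_seqD[OF RD(2) k] by simp
    qed
  qed (use RD lF j in auto)
  show thesis
  proof (rule that[OF Fext mor])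
    fix G a b assume G: "exact_seq C G" and a: "a \<in> homset C Y (seq_obj C G 0)"
      and m: "seq_morphism C R G (a \<cdot> f) b"
    from m obtain h where h: "h 0 = a \<cdot> f" "h (length R) = b" "seq_map C R G h"
      by (rule seq_morphismE)
    note h = h(1,2) seq_mapD[OF h(3)]
    note aD = homD[OF a]
    have lG: "0 < length G" "Suc 0 < length G" using h(3) l1 by auto
    note G0 = exact_seqD[OF G lG(1)] and G1 = exact_seqD[OF G lG(2)] and zG = exact_seq_comp[OF G lG(2)]
    note h1 = h(4-6)[of "Suc 0"] and h2 = h(4-6)[of "Suc (Suc 0)"]
    \<comment> \<open>The component on the pushout is glued from \<open>G ! 0 \<cdot> a\<close> and
      the old component \<open>h 1\<close>; all further components are kept.\<close>
    have "\<exists>w\<in>Arr C. Dom C w = Cod C k' \<and> Cod C w = Cod C (G ! 0 \<cdot> a) \<and> w \<cdot> k' = G ! 0 \<cdot> a \<and> w \<cdot> t = h 1"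
      by (rule desc) (use aD fD G0 h1 l1 D0 h(7)[of 0] h(1) in auto)
    then obtain w where w: "w \<in> Arr C" "Dom C w = Cod C k'" "Cod C w = seq_obj C G (Suc 0)"
       "w \<cdot> k' = G ! 0 \<cdot> a" "w \<cdot> t = h 1"
      using aD G0 by auto
    have sq: "G ! Suc 0 \<cdot> w = h (Suc (Suc 0)) \<cdot> d'"
    proof (rule joint)
      have "(G ! Suc 0 \<cdot> w) \<cdot> k' = G ! Suc 0 \<cdot> (G ! 0 \<cdot> a)" using w G1 p(1) by simp
      also have "\<dots> = Zero C Y (seq_obj C G (Suc (Suc 0)))"
        using comp_cong_assoc1[OF zG(2), of a] aD G0 G1 by (auto dest: Dom_Cod_Obj(2))
      also have "\<dots> = (h (Suc (Suc 0)) \<cdot> d') \<cdot> k'"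
        using d' p h2 l1 YO fD by (simp add: E2_def)
      finally show "(G ! Suc 0 \<cdot> w) \<cdot> k' = (h (Suc (Suc 0)) \<cdot> d') \<cdot> k'" .
      have "(G ! Suc 0 \<cdot> w) \<cdot> t = G ! Suc 0 \<cdot> h 1" using w G1 p(1-5) by simp
      also have "\<dots> = h (Suc (Suc 0)) \<cdot> R ! 1" using h(7)[of 1] l1 by simp
      also have "\<dots> = (h (Suc (Suc 0)) \<cdot> d') \<cdot> t" using d' p(1-5) h2 l1 by (simp add: E2_def)
      finally show "(G ! Suc 0 \<cdot> w) \<cdot> t = (h (Suc (Suc 0)) \<cdot> d') \<cdot> t" .
    qed (use w G1 d' p(1-5) h2 l1 in \<open>auto simp: E2_def\<close>)
    show "seq_morphism C F G a b"
    proof (rule seq_morphismI[of "h(0 := a, 1 := w)"])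
      fix k assume k: "k \<le> length F"
      consider "k = 0" | "k = Suc 0" | "k \<ge> Suc (Suc 0)" by linarith
      note cs = this
      show "(h(0 := a, 1 := w)) k \<in> Arr C" "Dom C ((h(0 := a, 1 := w)) k) = seq_obj C F k"
          "Cod C ((h(0 := a, 1 := w)) k) = seq_obj C G k"
        using cs aD w(1-3) SF0 SF1 SFk[of k] h(4-6)[of k] k RD(1) lF by auto
    next
      fix k assume k: "k < length F"
      consider "k = 0" | "k = Suc 0" | "k \<ge> Suc (Suc 0)" by linarith
      then show "G ! k \<cdot> (h(0 := a, 1 := w)) k = (h(0 := a, 1 := w)) (Suc k) \<cdot> F ! k"
      proof cases
        case 1 then show ?thesis using F0 w by simp
      next
        case 2 then show ?thesis using F1 sq by simp
      next
        case 3 then show ?thesis using Fk[of k] h(7)[of k] k lF RD(1) by simp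
      qed
    qed (use h(2,3) RD(1) lF j in auto)
  qed
qed

text \<open>The homotopy \<open>g\<close> is absorbed into the morphism to \<open>E'\<close>, so
  both extensions receive a morphism from \<open>R\<close> with the same left component
  \<open>f\<close>. The pushout of \<open>R\<close> along \<open>f\<close> then maps to both, which
  is a zigzag.\<close>

lemma ext_equiv_of_common:
  assumes R: "R \<in> extensions C j X K" and j: "0 < j"
    and E: "E \<in> extensions C j X Y" "E' \<in> extensions C j X Y"
    and m: "seq_morphism C R E f (Ident C X)" "seq_morphism C R E' f' (Ident C X)"
    and g: "g \<in> homset C (seq_obj C R 1) Y" "arr_diff C f f' = g \<cdot> R ! 0"
  shows "(E, E') \<in> ext_equiv C j X Y"
proof -
  note RD = extensionsD[OF R j] and ED = extensionsD[OF E(1) j] and E'D = extensionsD[OF E(2) j]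
  note fD = seq_morphism_ends(1-3)[OF m(1)] and f'D = seq_morphism_ends(1-3)[OF m(2)]
  have fh: "f \<in> homset C K Y" using fD RD ED by (auto simp: hom_iff)
  obtain n where n: "j = Suc n" using j by (cases j) auto
  have g': "g \<in> homset C (seq_obj C R 1) (seq_obj C E' 0)" using g E'D by simp
  have R0: "R ! 0 \<in> Arr C" "Dom C (R ! 0) = seq_obj C R 0" "Cod C (R ! 0) = seq_obj C R 1"
    using exact_seqD[OF RD(2), of 0] RD(1) by auto
  have "f = Plus C f' (g \<cdot> R ! 0)"
    by (rule iffD1[OF minus_eq_iff g(2)]) (use fD f'D g' R0 RD ED E'D in \<open>auto simp: hom_iff\<close>)
  then have m2: "seq_morphism C R E' f (Ident C X)"
    using seq_morphism_modify[OF m(2) RD(2) _ E'D(2) g', of n] RD(1) n by simp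
  obtain F where F: "F \<in> extensions C j X Y"
    and univ: "\<And>G a b. exact_seq C G \<Longrightarrow> a \<in> homset C Y (seq_obj C G 0) \<Longrightarrow>
       seq_morphism C R G (a \<cdot> f) b \<Longrightarrow> seq_morphism C F G a b"
    using pushout_extension[OF R j fh] by metis
  have "Ident C Y \<cdot> f = f" using fh by (auto simp: hom_iff)
  then have "seq_morphism C F G (Ident C Y) (Ident C X)" if "seq_morphism C R G f (Ident C X)" "G \<in> extensions C j X Y" for G
    using univ[of G "Ident C Y"] that extensionsD[OF that(2) j] by (simp add: hom_iff)
  then have "(F, E) \<in> ext_step C j X Y" "(F, E') \<in> ext_step C j X Y"
    using m(1) m2 E F by (auto simp: ext_step_iff[OF j])
  then show ?thesis using ext_equiv_step ext_equiv_sym ext_equiv_trans by metis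
qed

end

section \<open>Vanishing of Ext\<close>

text \<open>For an injective coresolution \<open>(J, d)\<close> of \<open>Y\<close>, this says \<open>Ext\<^sup>s(W, Y) = 0\<close>, including
  \<open>Hom(W, Y) = 0\<close> for \<open>s = 0\<close>. Recall that \<open>d s\<close> ends in \<open>J s\<close>.\<close>

definition ext_vanish :: "('o, 'm) precat \<Rightarrow> (nat \<Rightarrow> 'o) \<Rightarrow> (nat \<Rightarrow> 'm) \<Rightarrow> 'o \<Rightarrow> nat \<Rightarrow> bool" where
  "ext_vanish C J d W s \<longleftrightarrow> (\<forall>t\<in>homset C W (J s). d (Suc s) \<cdot>\<^bsub>C\<^esub> t = Zero C W (J (Suc s)) \<longrightarrow>
     (case s of 0 \<Rightarrow> t = Zero C W (J 0) | Suc r \<Rightarrow> \<exists>y\<in>homset C W (J r). d s \<cdot>\<^bsub>C\<^esub> y = t))"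

context abelian_category
begin

lemma exact_lift_hom:
  assumes "exact_at C f g" "P \<in> Proj C" "x \<in> homset C P (Cod C f)" "g \<cdot> x = Zero C P (Cod C g)"
  shows "\<exists>y\<in>homset C P (Dom C f). f \<cdot> y = x"
  by (rule exact_lift[OF assms(1,2), of x]) (use assms(3,4) in \<open>auto simp: hom_iff\<close>)

lemma kernel_lift_hom:
  assumes "is_kernel C k f" "x \<in> homset C W (Dom C f)" "f \<cdot> x = Zero C W (Cod C f)"
  shows "\<exists>y\<in>homset C W (Dom C k). k \<cdot> y = x"
  by (rule kernel_lift[OF assms(1), of x]) (use assms(2,3) in \<open>auto simp: hom_iff\<close>)

lemma coresD:
  assumes "injective_coresolution C Y J d"
  shows "J k \<in> Inj C" "J k \<in> Obj C" "Y \<in> Obj C" "d k \<in> Arr C" "Cod C (d k) = J k" "Dom C (d 0) = Y" "Dom C (d (Suc k)) = J k"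
    "is_mono C (d 0)" "exact_at C (d k) (d (Suc k))"
    "d (Suc (Suc k)) \<cdot> d (Suc k) = Zero C (J k) (J (Suc (Suc k)))"
proof -
  show 1: "J k \<in> Inj C" "Y \<in> Obj C" "Dom C (d 0) = Y" "Dom C (d (Suc k)) = J k" "is_mono C (d 0)" "exact_at C (d k) (d (Suc k))"
    using assms by (auto simp: injective_coresolution_def hom_iff)
  show "J k \<in> Obj C" using 1(1) by (auto simp: Inj_def)
  show 2: "d k \<in> Arr C" "Cod C (d k) = J k" for k
    using assms by (cases k, auto simp: injective_coresolution_def hom_iff)+
  show "d (Suc (Suc k)) \<cdot> d (Suc k) = Zero C (J k) (J (Suc (Suc k)))"
    using exact_at_simps(4)[of "d (Suc k)" "d (Suc (Suc k))"] assms 1 2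
    by (auto simp: injective_coresolution_def)
qed

lemma ext_vanishD:
  assumes "ext_vanish C J d W s" "t \<in> Arr C" "Dom C t = W" "Cod C t = J s" "d (Suc s) \<cdot> t = Zero C W (J (Suc s))"
  shows "s = 0 \<Longrightarrow> t = Zero C W (J 0)"
    "s = Suc r \<Longrightarrow> \<exists>y\<in>Arr C. Dom C y = W \<and> Cod C y = J r \<and> d (Suc r) \<cdot> y = t"
proof -
  have t: "t \<in> homset C W (J s)" using assms by (simp add: hom_iff)
  note * = assms(1)[unfolded ext_vanish_def, rule_format, OF t assms(5)]
  show "s = 0 \<Longrightarrow> t = Zero C W (J 0)" using * by simp
  show "s = Suc r \<Longrightarrow> \<exists>y\<in>Arr C. Dom C y = W \<and> Cod C y = J r \<and> d (Suc r) \<cdot> y = t"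
    using * by (auto simp: homset_def)
qed

lemma ext_vanish_proj:
  assumes J: "injective_coresolution C Y J d" and W: "W \<in> Proj C" and s: "0 < s"
  shows "ext_vanish C J d W s"
  unfolding ext_vanish_def
proof (intro ballI impI)
  note c = coresD[OF J]
  fix t assume t: "t \<in> homset C W (J s)" "d (Suc s) \<cdot> t = Zero C W (J (Suc s))"
  obtain r where r: "s = Suc r" using s by (cases s) auto
  obtain y where "y \<in> Arr C" "Dom C y = W" "Cod C y = J r" "d s \<cdot> y = t"
    using exact_lift[OF c(9)[of s] W, of t] t c r by (auto simp: hom_iff)
  then show "case s of 0 \<Rightarrow> t = Zero C W (J 0) | Suc r \<Rightarrow> \<exists>y\<in>homset C W (J r). d s \<cdot> y = t"
    using r by (auto simp: hom_iff)
qed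

lemma ext_vanish_zero:
  assumes J: "injective_coresolution C Y J d" and W: "zero_object C W"
  shows "ext_vanish C J d W s"
  unfolding ext_vanish_def
proof (intro ballI impI)
  note c = coresD[OF J]
  have W': "W \<in> Obj C" using W by (simp add: zero_object_def)
  fix t assume t: "t \<in> homset C W (J s)"
  have "\<exists>!f. f \<in> homset C W (J s)" using W c(2)[of s] by (auto simp: zero_object_def)
  moreover have "Zero C W (J s) \<in> homset C W (J s)" using W' c(2) by (simp add: hom_iff)
  ultimately have t0: "t = Zero C W (J s)" using t by blast
  show "case s of 0 \<Rightarrow> t = Zero C W (J 0) | Suc r \<Rightarrow> \<exists>y\<in>homset C W (J r). d s \<cdot> y = t"
  proof (cases s)
    case (Suc r)
    then show ?thesis using t0 W' c by (auto simp: hom_iff intro!: bexI[of _ "Zero C W (J r)"])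
  qed (use t0 in simp)
qed

lemma ext_vanish_zero_target:
  assumes J: "injective_coresolution C Y J d" and W: "W \<in> Obj C" and z: "zero_object C (J s)"
  shows "ext_vanish C J d W s"
  unfolding ext_vanish_def
proof (intro ballI impI)
  note c = coresD[OF J]
  fix t assume t: "t \<in> homset C W (J s)"
  have "\<exists>!f. f \<in> homset C W (J s)" using z W by (auto simp: zero_object_def)
  moreover have "Zero C W (J s) \<in> homset C W (J s)" using W c(2) by (simp add: hom_iff)
  ultimately have t0: "t = Zero C W (J s)" using t by blast
  show "case s of 0 \<Rightarrow> t = Zero C W (J 0) | Suc r \<Rightarrow> \<exists>y\<in>homset C W (J r). d s \<cdot> y = t"
  proof (cases s)
    case (Suc r)
    then show ?thesis using t0 W c by (auto simp: hom_iff intro!: bexI[of _ "Zero C W (J r)"])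
  qed (use t0 in simp)
qed

lemma Proj_Obj: "P \<in> Proj C \<Longrightarrow> P \<in> Obj C" and Inj_Obj: "P \<in> Inj C \<Longrightarrow> P \<in> Obj C"
  by (auto simp: Proj_def Inj_def)

text \<open>The part \<open>Ext^s(Dom p) \<rightarrow> Ext^s(Dom k) \<rightarrow> Ext^(s+1)(Cod
  p)\<close> of the long exact sequence, argued on cocycles: \<open>t\<close> extends to
  \<open>v\<close> by injectivity of \<open>J s\<close>, and the coboundary of \<open>v\<close>
  descends to a cocycle \<open>w\<close> on the quotient.\<close>

lemma ext_vanish_kernel:
  assumes J: "injective_coresolution C Y J d" and k: "is_kernel C k p" and p: "is_epi C p"
    and Q: "ext_vanish C J d (Dom C p) s" and W: "ext_vanish C J d (Cod C p) (Suc s)"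
  shows "ext_vanish C J d (Dom C k) s"
  unfolding ext_vanish_def
proof (intro ballI impI)
  note c = coresD[OF J] and kD = kernelD[OF k]
  note coker = epi_coker_of_kernel[OF p k]
  fix t assume t: "t \<in> homset C (Dom C k) (J s)" "d (Suc s) \<cdot> t = Zero C (Dom C k) (J (Suc s))"
  note tD = homD[OF t(1)]
  obtain v where v: "v \<in> Arr C" "Cod C v = J s" "Dom C v = Dom C p" "v \<cdot> k = t"
    using mono_extend[OF kD(5) c(1)[of s], of t] tD kD by auto
  have "(d (Suc s) \<cdot> v) \<cdot> k = Zero C (Dom C k) (J (Suc s))"
    using v t(2) c(4,5,7) kD(1-3) by simp
  then obtain w where w: "w \<in> Arr C" "Dom C w = Cod C p" "Cod C w = J (Suc s)" "w \<cdot> p = d (Suc s) \<cdot> v"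
    using cokernel_desc[OF coker, of "d (Suc s) \<cdot> v"] v c(4,5,7) kD(1-3) by auto
  have "(d (Suc (Suc s)) \<cdot> w) \<cdot> p = d (Suc (Suc s)) \<cdot> (d (Suc s) \<cdot> v)"
    using w c(4,5,7) kD(1-3) by simp
  also have "\<dots> = Zero C (Dom C p) (J (Suc (Suc s)))"
    using comp_cong_assoc1[OF c(10)[of s], of v] c(2,4,5,7) v by simp
  finally have "d (Suc (Suc s)) \<cdot> w = Zero C (Cod C p) (J (Suc (Suc s)))"
    by (rule epi_Zero[OF p]) (use w c(4,5,7) in auto)
  then obtain w' where w': "w' \<in> Arr C" "Dom C w' = Cod C p" "Cod C w' = J s" "d (Suc s) \<cdot> w' = w"
    using ext_vanishD(2)[OF W, of w s] w by blast
  \<comment> \<open>Subtracting a primitive of \<open>w\<close> turns \<open>v\<close> into a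
    cocycle, and the restriction to the kernel is still \<open>t\<close>.\<close>
  define v' where "v' = arr_diff C v (w' \<cdot> p)"
  have v'D: "v' \<in> Arr C" "Dom C v' = Dom C p" "Cod C v' = J s"
    unfolding v'_def using v w' kD by auto
  have "d (Suc s) \<cdot> v' = arr_diff C (d (Suc s) \<cdot> v) (d (Suc s) \<cdot> (w' \<cdot> p))"
    unfolding v'_def by (rule minus_comp) (use v w' kD c(4,5,7) in auto)
  also have "d (Suc s) \<cdot> (w' \<cdot> p) = d (Suc s) \<cdot> v"
    using comp_cong_assoc1[OF w'(4), of p] w w' kD c(4,5,7) by simp
  also have "arr_diff C (d (Suc s) \<cdot> v) (d (Suc s) \<cdot> v) = Zero C (Dom C p) (J (Suc s))"
    using v c(4,5,7) by simp
  finally have dv': "d (Suc s) \<cdot> v' = Zero C (Dom C p) (J (Suc s))" .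
  have "v' \<cdot> k = arr_diff C (v \<cdot> k) ((w' \<cdot> p) \<cdot> k)"
    unfolding v'_def by (rule minus_comp) (use v w' kD in auto)
  also have "(w' \<cdot> p) \<cdot> k = Zero C (Dom C k) (J s)"
    using w' kD by simp
  also have "arr_diff C (v \<cdot> k) (Zero C (Dom C k) (J s)) = t"
    using v tD kD c(2) by (subst minus_eq_iff) auto
  finally have v'k: "v' \<cdot> k = t" .
  show "case s of 0 \<Rightarrow> t = Zero C (Dom C k) (J 0) | Suc r \<Rightarrow> \<exists>y\<in>homset C (Dom C k) (J r). d s \<cdot> y = t"
  proof (cases s)
    case 0
    then have "v' = Zero C (Dom C p) (J 0)" using ext_vanishD(1)[OF Q v'D dv'] by simp
    then have "v' \<cdot> k = Zero C (Dom C p) (J 0) \<cdot> k" by simp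
    then show ?thesis using v'k 0 kD c(2) by simp
  next
    case (Suc r)
    then obtain y where y: "y \<in> Arr C" "Dom C y = Dom C p" "Cod C y = J r" "d (Suc r) \<cdot> y = v'"
      using ext_vanishD(2)[OF Q v'D dv', of r] by blast
    have "d (Suc r) \<cdot> (y \<cdot> k) = t" unfolding v'k[symmetric]
      by (rule comp_cong_assoc1[OF y(4)]) (use y kD c(4,5,7) in auto)
    then show ?thesis using Suc y kD by (auto simp: hom_iff intro!: bexI[of _ "y \<cdot> k"])
  qed
qed

text \<open>The part \<open>Ext^s(Dom k) \<rightarrow> Ext^(s+1)(Cod p) \<rightarrow> Ext^(s+1)(Dom
  p)\<close> of the same sequence. A primitive \<open>v\<close> of \<open>w \<cdot> p\<close>
  restricts to a cocycle on the kernel; once \<open>v\<close> is changed so as to vanish there, it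
  descends to a primitive of \<open>w\<close>.\<close>

lemma ext_vanish_cokernel:
  assumes J: "injective_coresolution C Y J d" and k: "is_kernel C k p" and p: "is_epi C p"
    and U: "ext_vanish C J d (Dom C k) s" and Q: "ext_vanish C J d (Dom C p) (Suc s)"
  shows "ext_vanish C J d (Cod C p) (Suc s)"
  unfolding ext_vanish_def
proof (intro ballI impI)
  note c = coresD[OF J] and kD = kernelD[OF k]
  note coker = epi_coker_of_kernel[OF p k]
  fix w assume w: "w \<in> homset C (Cod C p) (J (Suc s))" "d (Suc (Suc s)) \<cdot> w = Zero C (Cod C p) (J (Suc (Suc s)))"
  note wD = homD[OF w(1)]
  have "d (Suc (Suc s)) \<cdot> (w \<cdot> p) = Zero C (Dom C p) (J (Suc (Suc s)))"
    using comp_cong_assoc1[OF w(2), of p] wD kD c(2,4,5,7) by simp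
  then obtain v where v: "v \<in> Arr C" "Dom C v = Dom C p" "Cod C v = J s" "d (Suc s) \<cdot> v = w \<cdot> p"
    using ext_vanishD(2)[OF Q, of "w \<cdot> p" s] wD kD by auto
  have "d (Suc s) \<cdot> (v \<cdot> k) = (w \<cdot> p) \<cdot> k"
    by (rule comp_cong_assoc1[OF v(4)]) (use v kD c(4,5,7) in auto)
  also have "\<dots> = Zero C (Dom C k) (J (Suc s))" using wD kD by simp
  finally have dvk: "d (Suc s) \<cdot> (v \<cdot> k) = Zero C (Dom C k) (J (Suc s))" .
  have vk: "v \<cdot> k \<in> homset C (Dom C k) (J s)" using v kD by (auto simp: hom_iff)
  have "\<exists>v'\<in>homset C (Dom C p) (J s). d (Suc s) \<cdot> v' = w \<cdot> p \<and> v' \<cdot> k = Zero C (Dom C k) (J s)"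
  proof (cases s)
    case 0
    then have "v \<cdot> k = Zero C (Dom C k) (J s)" using ext_vanishD(1)[OF U _ _ _ dvk] homD[OF vk] by simp
    then show ?thesis using v by (auto simp: hom_iff)
  next
    case (Suc r)
    then obtain u where u: "u \<in> Arr C" "Dom C u = Dom C k" "Cod C u = J r" "d s \<cdot> u = v \<cdot> k"
      using ext_vanishD(2)[OF U _ _ _ dvk, of r] homD[OF vk] by auto
    obtain u' where u': "u' \<in> Arr C" "Cod C u' = J r" "Dom C u' = Dom C p" "u' \<cdot> k = u"
      using mono_extend[OF kD(5) c(1)[of r], of u] u kD by auto
    \<comment> \<open>The restriction of \<open>v\<close> is the coboundary of \<open>u\<close>.
      Extending \<open>u\<close> to \<open>u'\<close> and subtracting its coboundary makes
      \<open>v\<close> vanish on the kernel and leaves the coboundary of \<open>v\<close>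
      unchanged.\<close>
    define v' where "v' = arr_diff C v (d s \<cdot> u')"
    have v'D: "v' \<in> Arr C" "Dom C v' = Dom C p" "Cod C v' = J s"
      unfolding v'_def using v u' c(4,5,7) Suc by auto
    have "d (Suc s) \<cdot> v' = arr_diff C (d (Suc s) \<cdot> v) (d (Suc s) \<cdot> (d s \<cdot> u'))"
      unfolding v'_def by (rule minus_comp) (use v u' c(4,5,7) Suc in auto)
    also have "d (Suc s) \<cdot> (d s \<cdot> u') = Zero C (Dom C p) (J (Suc s))"
      using comp_cong_assoc1[OF c(10)[of r], of u'] c(2,4,5,7) u' Suc by simp
    also have "arr_diff C (d (Suc s) \<cdot> v) (Zero C (Dom C p) (J (Suc s))) = w \<cdot> p"
      unfolding v(4) using wD kD c(2) by (subst minus_eq_iff) auto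
    finally have 1: "d (Suc s) \<cdot> v' = w \<cdot> p" .
    have "v' \<cdot> k = arr_diff C (v \<cdot> k) ((d s \<cdot> u') \<cdot> k)"
      unfolding v'_def by (rule minus_comp) (use v u' kD c(4,5,7) Suc in auto)
    also have "(d s \<cdot> u') \<cdot> k = v \<cdot> k" using u'(1-3) u(4) kD c(4,5,7) Suc u'(4) by simp
    also have "arr_diff C (v \<cdot> k) (v \<cdot> k) = Zero C (Dom C k) (J s)" using v kD by simp
    finally show ?thesis using 1 v'D by (auto simp: hom_iff)
  qed
  then obtain v' where v': "v' \<in> Arr C" "Dom C v' = Dom C p" "Cod C v' = J s" "d (Suc s) \<cdot> v' = w \<cdot> p"
    "v' \<cdot> k = Zero C (Dom C k) (J s)" by (auto simp: hom_iff)
  then obtain w' where w': "w' \<in> Arr C" "Dom C w' = Cod C p" "Cod C w' = J s" "w' \<cdot> p = v'"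
    using cokernel_desc[OF coker, of v'] kD by auto
  have "(d (Suc s) \<cdot> w') \<cdot> p = w \<cdot> p" using w' v'(4) c(4,5,7) kD(1-3) by simp
  then have "d (Suc s) \<cdot> w' = w"
    by (rule epiD[OF p]) (use w' wD c(4,5,7) in auto)
  then show "case Suc s of 0 \<Rightarrow> w = Zero C (Cod C p) (J 0) | Suc r \<Rightarrow> \<exists>y\<in>homset C (Cod C p) (J r). d (Suc s) \<cdot> y = w"
    using w' by (auto simp: hom_iff intro!: bexI[of _ w'])
qed

section \<open>Splicing and the comparison theorem for extensions\<close>

lemma extension_base:
  assumes "is_epi C p" "is_kernel C k p"
  shows "[k, p] \<in> extensions C 1 (Cod C p) (Dom C k)" "seq_obj C [k, p] 1 = Dom C p"
  using assms kernelD[OF assms(2)] exact_kernel_self[OF assms(2)]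
  by (auto simp: extensions_iff exact_seq_def seq_obj_def)

lemma kernel_mono_comp:
  assumes "is_kernel C k p" "is_mono C m" "Dom C m = Cod C p"
  shows "is_kernel C k (m \<cdot> p)"
proof (rule kernelI)
  note kD = kernelD[OF assms(1)] and mA = monoA[OF assms(2)]
  show "(m \<cdot> p) \<cdot> k = Zero C (Dom C k) (Cod C (m \<cdot> p))" using kD mA assms(3) by simp
  fix g assume g: "g \<in> Arr C" "Cod C g = Dom C (m \<cdot> p)" "(m \<cdot> p) \<cdot> g = Zero C (Dom C g) (Cod C (m \<cdot> p))"
  have "p \<cdot> g = Zero C (Dom C g) (Dom C m)"
    by (rule mono_Zero[OF assms(2)]) (use g kD mA assms(3) in auto)
  then show "\<exists>h\<in>Arr C. Dom C h = Dom C g \<and> Cod C h = Dom C k \<and> k \<cdot> h = g"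
    using kernel_lift[OF assms(1), of g] g kD mA assms(3) by auto
qed (use kernelD[OF assms(1)] monoA[OF assms(2)] assms in auto)

text \<open>Prolongs an extension at its left end by the short exact sequence of \<open>p\<close>.
  The degree grows by one and the old inner positions shift by one. The new second arrow has kernel
  \<open>k\<close> because \<open>R ! 0\<close> is mono.\<close>

lemma extension_splice:
  assumes R: "R \<in> extensions C j X K" and j: "0 < j" and p: "is_epi C p" "Cod C p = K" and k: "is_kernel C k p"
  defines "R' \<equiv> k # (R ! 0 \<cdot> p) # tl R"
  shows "R' \<in> extensions C (Suc j) X (Dom C k)" "seq_obj C R' 1 = Dom C p"
    "\<And>i. 1 \<le> i \<Longrightarrow> i \<le> j \<Longrightarrow> seq_obj C R' (Suc i) = seq_obj C R i"
proof -
  note RD = extensionsD[OF R j] and kD = kernelD[OF k] and pA = epiA[OF p(1)]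
  have l: "0 < length R" "Suc 0 < length R" using RD j by auto
  note D0 = exact_seqD[OF RD(2) l(1)]
  have l': "length R' = Suc (Suc j)" using RD j by (simp add: R'_def)
  have n0: "R' ! 0 = k" and n1: "R' ! Suc 0 = R ! 0 \<cdot> p" by (simp_all add: R'_def)
  have nk: "R' ! Suc i = R ! i" if "1 \<le> i" "i < length R" for i
    using that by (cases i) (simp_all add: R'_def nth_tl)
  have q: "R ! 0 \<cdot> p \<in> Arr C" "Dom C (R ! 0 \<cdot> p) = Dom C p" "Cod C (R ! 0 \<cdot> p) = Cod C (R ! 0)"
    using D0 pA p RD by auto
  have ker: "is_kernel C (R ! 0) (R ! Suc 0)"
    using mono_exact_kernel[OF RD(5) exact_seq_comp(1)[OF RD(2) l(2)]] by simp
  have ex: "exact_seq C R'"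
    unfolding exact_seq_def
  proof (intro conjI allI impI)
    show "R' \<noteq> []" by (simp add: R'_def)
    have "set (tl R) \<subseteq> Arr C" using RD(2) unfolding exact_seq_def by (cases R) auto
    then show "set R' \<subseteq> Arr C" using kD q by (auto simp: R'_def)
    fix i assume i: "Suc i < length R'"
    define r where "r = i - 1"
    consider "i = 0" | "i = Suc 0" | "i = Suc r" "1 \<le> r" unfolding r_def by linarith
    then show "exact_at C (R' ! i) (R' ! Suc i)"
    proof cases
      case 1
      have "is_kernel C k (R ! 0 \<cdot> p)"
        by (rule kernel_mono_comp[OF k RD(5)]) (use D0 RD p in auto)
      then show ?thesis using exact_kernel_self 1 n0 n1 by simp
    next
      case 2
      have "exact_at C (R ! 0 \<cdot> p) (R ! Suc 0)"
        by (rule exact_atI[OF ker p(1)]) (use D0 RD p in auto)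
      then show ?thesis using 2 n1 nk[of 1] l by simp
    next
      case 3
      then show ?thesis using nk[of r] nk[of "Suc r"] exact_seq_comp(1)[OF RD(2), of r] i l' RD(1) by simp
    qed
  qed
  show s1: "seq_obj C R' 1 = Dom C p" using exact_seqD(2)[OF ex, of 1] n1 q l' by simp
  show sk: "seq_obj C R' (Suc i) = seq_obj C R i" if "1 \<le> i" "i \<le> j" for i
    using exact_seqD(2)[OF ex, of "Suc i"] exact_seqD(2)[OF RD(2), of i] nk[of i] that l' RD(1) by simp
  have s0: "seq_obj C R' 0 = Dom C k" using exact_seqD(2)[OF ex, of 0] n0 l' by simp
  have sl: "seq_obj C R' (Suc (Suc j)) = X"
    using exact_seqD(3)[OF ex, of "Suc j"] exact_seqD(3)[OF RD(2), of j] nk[of j] j l' RD(1,4) by simp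
  show "R' \<in> extensions C (Suc j) X (Dom C k)"
    using l' ex s0 sl kD(5) n0 nk[of j] j RD(1,6) by (simp add: extensions_iff)
qed

text \<open>The comparison theorem for projective resolutions, carried one step beyond the
  projective terms: \<open>E ! 0\<close> is a kernel, so the lifts end with a map \<open>f\<close>
  between the left ends.\<close>

lemma lift_extension:
  assumes P: "P \<in> extensions C j X K" and j: "0 < j" and proj: "\<And>k. 1 \<le> k \<Longrightarrow> k \<le> j \<Longrightarrow> seq_obj C P k \<in> Proj C"
    and E: "E \<in> extensions C j X' Y" and b: "b \<in> homset C X X'"
  shows "\<exists>f. seq_morphism C P E f b"
proof -
  note PD = extensionsD[OF P j] and ED = extensionsD[OF E j] and bD = homD[OF b]
  show ?thesis
  proof (rule down_exist[OF PD(2,1) ED(2,1)])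
    show "b \<in> homset C (seq_obj C P (Suc j)) (seq_obj C E (Suc j))" using b PD ED by simp
    note D = exact_seqD[OF PD(2), of j] exact_seqD[OF ED(2), of j]
    obtain y where "y \<in> Arr C" "Dom C y = seq_obj C P j" "Cod C y = Dom C (E ! j)" "E ! j \<cdot> y = b \<cdot> P ! j"
      using ProjD[OF proj[of j] ED(6), of "b \<cdot> P ! j"] D PD ED bD j by auto
    then show "\<exists>y\<in>homset C (seq_obj C P j) (seq_obj C E j). E ! j \<cdot> y = b \<cdot> P ! j"
      using D ED by (auto simp: hom_iff)
  next
    fix k t assume k: "k < j" and t: "t \<in> homset C (seq_obj C P k) (seq_obj C E (Suc k))"
      "E ! Suc k \<cdot> t = Zero C (seq_obj C P k) (seq_obj C E (Suc (Suc k)))"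
    note D = exact_seqD[OF ED(2), of k] exact_seqD[OF ED(2), of "Suc k"] and tD = homD[OF t(1)]
    have ex: "exact_at C (E ! k) (E ! Suc k)" using exact_seq_comp(1)[OF ED(2), of k] k ED(1) by simp
    show "\<exists>y\<in>homset C (seq_obj C P k) (seq_obj C E k). E ! k \<cdot> y = t"
    proof (cases "k = 0")
      case True
      then have ker: "is_kernel C (E ! k) (E ! Suc k)" using mono_exact_kernel[OF _ ex] ED(5) by simp
      show ?thesis using kernel_lift_hom[OF ker, of t] D t k ED(1) by simp
    next
      case False
      then show ?thesis using exact_lift_hom[OF ex proj[of k], of t] D t k ED(1) by simp
    qed
  qed
qed

text \<open>The difference of the two morphisms covers zero on the right end, hence is null
  homotopic; only the last component of the homotopy is recorded. The target is any exact sequence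
  with mono left end, as truncated coresolutions occur here too.\<close>

lemma lift_extension_unique:
  assumes P: "P \<in> extensions C j X K" and j: "0 < j" and proj: "\<And>k. 1 \<le> k \<Longrightarrow> k \<le> j \<Longrightarrow> seq_obj C P k \<in> Proj C"
    and E: "exact_seq C E" "length E = Suc j" "is_mono C (E ! 0)"
    and m: "seq_morphism C P E f b" "seq_morphism C P E f' b"
  shows "\<exists>w\<in>homset C (seq_obj C P 1) (seq_obj C E 0). arr_diff C f f' = w \<cdot> P ! 0"
proof -
  note PD = extensionsD[OF P j] and bD = seq_morphism_ends(4-6)[OF m(1)]
  have "seq_morphism C P E (arr_diff C f f') (arr_diff C b b)"
    using seq_morphism_minus[OF m] PD E by auto
  then show ?thesis
  proof (rule down_homotopy[OF PD(2,1) E(1,2) _ _ _ E(3)])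
    note Ej = exact_seqD[OF E(1), of j]
    show "Zero C X (seq_obj C E j) \<in> homset C (seq_obj C P (Suc j)) (seq_obj C E j)"
      using PD exact_seq_Obj[OF E(1), of j] E(2) by (auto simp: hom_iff)
    show "arr_diff C b b = E ! j \<cdot> Zero C X (seq_obj C E j)"
      using bD PD E(2) Ej by simp
    fix k t assume k: "k < j" and t: "t \<in> homset C (seq_obj C P (Suc k)) (seq_obj C E (Suc k))"
      "E ! Suc k \<cdot> t = Zero C (seq_obj C P (Suc k)) (seq_obj C E (Suc (Suc k)))"
    note D = exact_seqD[OF E(1), of k] exact_seqD[OF E(1), of "Suc k"] and tD = homD[OF t(1)]
    have ex: "exact_at C (E ! k) (E ! Suc k)" using exact_seq_comp(1)[OF E(1), of k] k E(2) by simp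
    show "\<exists>y\<in>homset C (seq_obj C P (Suc k)) (seq_obj C E k). E ! k \<cdot> y = t"
      using exact_lift_hom[OF ex proj[of "Suc k"], of t] D t k E(2) by simp
  qed
qed

end

section \<open>Existence of injective coresolutions and projective presentations\<close>

locale enough_proj_inj = enough_proj +
  assumes enough_injectives: "enough_injectives C"
begin

lemma embed:
  assumes "X \<in> Obj C"
  obtains i where "is_mono C i" "Dom C i = X" "Cod C i \<in> Inj C"
proof -
  obtain I i where "I \<in> Inj C" "i \<in> homset C X I" "is_mono C i"
    using enough_injectives assms unfolding enough_injectives_def by blast
  then show thesis using that by (auto simp: hom_iff)
qed

lemma coresolution_ex:
  assumes "X \<in> Obj C"
  obtains J d where "injective_coresolution C X J d"
proof -
  have "\<exists>d. \<forall>n. (is_mono C (d 0) \<and> Dom C (d 0) = X \<or> n \<noteq> 0) \<and> Cod C (d n) \<in> Inj C \<and> d n \<in> Arr C \<and> exact_at C (d n) (d (Suc n))"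
  proof -
    define Pr where "Pr n x \<longleftrightarrow> x \<in> Arr C \<and> Cod C x \<in> Inj C \<and> (n = 0 \<longrightarrow> is_mono C x \<and> Dom C x = X)" for n :: nat and x
    obtain i where i: "is_mono C i" "Dom C i = X" "Cod C i \<in> Inj C" using embed[OF assms] .
    have "\<exists>d. \<forall>n. Pr n (d n) \<and> exact_at C (d n) (d (Suc n))"
    proof (rule dependent_nat_choice)
      show "\<exists>x. Pr 0 x" using i monoA by (auto simp: Pr_def)
      fix x n assume x: "Pr n x"
      obtain c where c: "is_cokernel C c x" using ex_cokernel x by (auto simp: Pr_def)
      note cD = cokernelD[OF c]
      obtain u where u: "is_mono C u" "Dom C u = Cod C c" "Cod C u \<in> Inj C" using embed[of "Cod C c"] cD by auto
      \<comment> \<open>The next differential is the cokernel of the previous one followed by an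
        embedding. In the opposite category this is an epi followed by a kernel, the shape that
        \<open>exact_atI\<close> handles.\<close>
      have "exact_at (op_cat C) (c \<cdot>\<^bsub>op_cat C\<^esub> u) x"
        by (rule abelian_category.exact_atI[OF abelian_op]) (use c u in auto)
      then have "exact_at C x (u \<cdot> c)" by (simp add: exact_at_op)
      then show "\<exists>y. Pr (Suc n) y \<and> exact_at C x y"
        using u cD monoA[OF u(1)] by (intro exI[of _ "u \<cdot> c"]) (auto simp: Pr_def)
    qed
    then show ?thesis unfolding Pr_def by metis
  qed
  then obtain d where d: "is_mono C (d 0)" "Dom C (d 0) = X" "\<And>n. Cod C (d n) \<in> Inj C" "\<And>n. d n \<in> Arr C"
    "\<And>n. exact_at C (d n) (d (Suc n))" by metis
  have "injective_coresolution C X (\<lambda>k. Cod C (d k)) d"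
    unfolding injective_coresolution_def using d assms exact_at_simps(3)[OF d(5)] by (auto simp: hom_iff)
  then show thesis by (rule that)
qed

lemma presentation_ex:
  assumes X: "X \<in> Obj C" and j: "0 < j"
  obtains P K where "P \<in> extensions C j X K" "\<And>k. 1 \<le> k \<Longrightarrow> k \<le> j \<Longrightarrow> seq_obj C P k \<in> Proj C"
proof -
  have "\<exists>P K. P \<in> extensions C j X K \<and> (\<forall>k. 1 \<le> k \<longrightarrow> k \<le> j \<longrightarrow> seq_obj C P k \<in> Proj C)"
    using j
  proof (induction j rule: nat_induct_non_zero)
    case 1
    obtain Q p where p: "Q \<in> Proj C" "is_epi C p" "Dom C p = Q" "Cod C p = X" "p \<in> Arr C" using cover[OF X] .
    obtain k where k: "is_kernel C k p" using ex_kernel p by auto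
    have "\<forall>i. 1 \<le> i \<longrightarrow> i \<le> 1 \<longrightarrow> seq_obj C [k, p] i \<in> Proj C"
      using extension_base(2)[OF p(2) k] p by (metis le_antisym)
    then show ?case using extension_base(1)[OF p(2) k] p by auto
  next
    case (Suc n)
    then obtain P K where P: "P \<in> extensions C n X K" "\<And>k. 1 \<le> k \<Longrightarrow> k \<le> n \<Longrightarrow> seq_obj C P k \<in> Proj C" by blast
    have K: "K \<in> Obj C" using extensionsD[OF P(1)] Suc by auto
    obtain Q p where p: "Q \<in> Proj C" "is_epi C p" "Dom C p = Q" "Cod C p = K" "p \<in> Arr C" using cover[OF K] .
    obtain k where k: "is_kernel C k p" using ex_kernel p by auto
    note s = extension_splice[OF P(1) Suc(1) p(2,4) k]
    have "seq_obj C (k # (P ! 0 \<cdot> p) # tl P) i \<in> Proj C" if i: "1 \<le> i" "i \<le> Suc n" for i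
    proof (cases "i = 1")
      case True then show ?thesis using s(2) p by simp
    next
      case False
      then obtain r where "i = Suc r" "1 \<le> r" "r \<le> n" using i by (cases i) auto
      then show ?thesis using s(3) P(2) by simp
    qed
    then show ?case using s(1) by blast
  qed
  then show thesis using that by blast
qed

end

section \<open>Extensions classified by acyclic resolutions\<close>

text \<open>The groups that obstruct lifting a map \<open>X \<rightarrow> J j\<close> to a morphism from \<open>R\<close> to
  \<open>Y \<rightarrow> J 0 \<rightarrow> \<dots> \<rightarrow> J j\<close>, and lifting a homotopy. The index \<open>k\<close> counts the objects of \<open>R\<close> from the
  left, so that \<open>seq_obj C R j\<close> is the term next to \<open>X\<close>.\<close>

definition acyclic_seq :: "('o, 'm) precat \<Rightarrow> (nat \<Rightarrow> 'o) \<Rightarrow> (nat \<Rightarrow> 'm) \<Rightarrow> nat \<Rightarrow> 'm list \<Rightarrow> bool" where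
  "acyclic_seq C J d j R \<longleftrightarrow> (\<forall>k. 1 \<le> k \<and> k \<le> j \<longrightarrow> ext_vanish C J d (seq_obj C R k) k \<and>
     (k < j \<longrightarrow> ext_vanish C J d (seq_obj C R (Suc k)) k))"

context abelian_category
begin

text \<open>The truncation \<open>Y \<rightarrow> J 0 \<rightarrow> ... \<rightarrow> J j\<close>
  has \<open>j + 1\<close> arrows, as a \<open>j\<close>-fold extension does, so it can be the
  target of a \<open>seq_morphism\<close> from one. Note the shift: position \<open>k + 1\<close>
  holds \<open>J k\<close>.\<close>

lemma cores_list:
  assumes J: "injective_coresolution C Y J d"
  shows "length (map d [0..<Suc j]) = Suc j" "k \<le> j \<Longrightarrow> map d [0..<Suc j] ! k = d k"
    "exact_seq C (map d [0..<Suc j])" "seq_obj C (map d [0..<Suc j]) 0 = Y"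
    "k \<le> j \<Longrightarrow> seq_obj C (map d [0..<Suc j]) (Suc k) = J k"
proof -
  note c = coresD[OF J]
  show 1: "length (map d [0..<Suc j]) = Suc j" by simp
  show 2: "k \<le> j \<Longrightarrow> map d [0..<Suc j] ! k = d k" for k
    by (simp add: nth_append del: upt_Suc)
  show 3: "exact_seq C (map d [0..<Suc j])"
    unfolding exact_seq_def
  proof (intro conjI allI impI)
    show "set (map d [0..<Suc j]) \<subseteq> Arr C" using c(4) by auto
    fix k assume "Suc k < length (map d [0..<Suc j])"
    then show "exact_at C (map d [0..<Suc j] ! k) (map d [0..<Suc j] ! Suc k)"
      using 2[of k] 2[of "Suc k"] c(9)[of k] by (simp del: upt_Suc)
  qed simp
  show "seq_obj C (map d [0..<Suc j]) 0 = Y"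
    using exact_seqD(2)[OF 3, of 0] 2[of 0] c(6) by (simp del: upt_Suc)
  show "k \<le> j \<Longrightarrow> seq_obj C (map d [0..<Suc j]) (Suc k) = J k"
    using exact_seqD(3)[OF 3, of k] 2[of k] c(5) by (simp del: upt_Suc)
qed

text \<open>The right component \<open>x\<close> is the cocycle that represents \<open>E\<close> in
  the description of \<open>Ext^j(X, Y)\<close> by an injective coresolution of
  \<open>Y\<close>.\<close>

lemma coextension_exist:
  assumes J: "injective_coresolution C Y J d" and E: "E \<in> extensions C j X Y" and j: "0 < j"
  shows "\<exists>x. seq_morphism C E (map d [0..<Suc j]) (Ident C Y) x"
proof -
  note ED = extensionsD[OF E j] and G = cores_list[OF J, where j = j] and c = coresD[OF J]
  show ?thesis
    by (rule up_exist[OF ED(2,1) G(3,1)]) (use ED G c in \<open>auto simp: hom_iff simp del: upt_Suc\<close>)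
qed

lemma coextension_unique:
  assumes J: "injective_coresolution C Y J d" and E: "E \<in> extensions C j X Y" and j: "0 < j"
    and m: "seq_morphism C E (map d [0..<Suc j]) (Ident C Y) x"
      "seq_morphism C E (map d [0..<Suc j]) (Ident C Y) x'"
  shows "\<exists>w\<in>homset C X (seq_obj C (map d [0..<Suc j]) j). arr_diff C x x' = d j \<cdot> w"
proof -
  note ED = extensionsD[OF E j] and G = cores_list[OF J, where j = j] and c = coresD[OF J]
  let ?G = "map d [0..<Suc j]"
  have "seq_morphism C E ?G (arr_diff C (Ident C Y) (Ident C Y)) (arr_diff C x x')"
    by (rule seq_morphism_minus[OF m ED(2) G(3)])
  then have "seq_morphism C E ?G (Zero C (seq_obj C E 0) (seq_obj C ?G 0)) (arr_diff C x x')"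
    using ED G by (simp del: upt_Suc)
  then have "\<exists>w\<in>homset C (seq_obj C E (Suc j)) (seq_obj C ?G j). arr_diff C x x' = ?G ! j \<cdot> w"
    by (rule up_homotopy[OF ED(2,1) G(3,1)]) (use ED G c in \<open>auto simp del: upt_Suc\<close>)
  then show ?thesis using ED(4) G(2)[of j] by (simp del: upt_Suc)
qed

lemma minus_triangle:
  assumes "f \<in> Arr C" "g \<in> Arr C" "h \<in> Arr C" "Dom C f = Dom C g" "Cod C f = Cod C g"
    "Dom C h = Dom C g" "Cod C h = Cod C g"
  shows "arr_diff C f h = Plus C (arr_diff C f g) (arr_diff C g h)"
proof -
  have "Plus C (arr_diff C f g) (arr_diff C g h) = Plus C f (Plus C (arr_neg C g) (Plus C g (arr_neg C h)))"
    unfolding arr_diff_def using assms by (simp add: Plus_assoc)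
  also have "Plus C (arr_neg C g) (Plus C g (arr_neg C h)) = arr_neg C h" using assms by simp
  finally show ?thesis by (simp add: arr_diff_def)
qed

text \<open>The cocycle modulo coboundaries is an invariant of the whole zigzag. Along a forward
  step, a morphism to the coresolution pulls back to the previous extension. Along a backward step,
  a cocycle of the previous extension pulls back to the next one and is compared there with the
  given cocycle.\<close>

lemma coextension_class:
  assumes J: "injective_coresolution C Y J d" and E: "E \<in> extensions C j X Y" and j: "0 < j"
    and eq: "(E, E') \<in> ext_equiv C j X Y"
    and m: "seq_morphism C E (map d [0..<Suc j]) (Ident C Y) x"
      "seq_morphism C E' (map d [0..<Suc j]) (Ident C Y) x'"
  shows "\<exists>w\<in>homset C X (seq_obj C (map d [0..<Suc j]) j). arr_diff C x x' = d j \<cdot> w"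
proof -
  note G = cores_list[OF J, where j = j] and c = coresD[OF J]
  let ?G = "map d [0..<Suc j]"
  have xD: "x \<in> Arr C" "Dom C x = X" "Cod C x = J j"
    using seq_morphism_ends(4-6)[OF m(1)] extensionsD[OF E j] G by (auto simp del: upt_Suc)
  have *: "seq_morphism C E1 ?G (Ident C Y) y"
    if "(E1, E2) \<in> ext_step C j X Y" "seq_morphism C E2 ?G (Ident C Y) y" for E1 E2 y
  proof -
    have s: "E1 \<in> extensions C j X Y" "E2 \<in> extensions C j X Y" "seq_morphism C E1 E2 (Ident C Y) (Ident C X)"
      using that(1) by (auto simp: ext_step_iff[OF j])
    note D = extensionsD[OF s(1) j] extensionsD[OF s(2) j]
    have "seq_morphism C E1 ?G (Ident C Y \<cdot> Ident C Y) (y \<cdot> Ident C X)"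
      by (rule seq_morphism_comp[OF s(3) that(2)]) (use D G in auto)
    then show ?thesis using seq_morphism_ends(4-6)[OF that(2)] D by simp
  qed
  have "\<forall>x'. seq_morphism C E' ?G (Ident C Y) x' \<longrightarrow>
     (\<exists>w\<in>homset C X (seq_obj C ?G j). arr_diff C x x' = d j \<cdot> w)"
    using eq E
  proof (induction rule: ext_equiv_induct)
    case refl
    then show ?case using coextension_unique[OF J E j m(1)] by blast
  next
    case (step_fwd gs hs)
    then show ?case using *[of gs hs] by blast
  next
    case (step_bwd gs hs)
    show ?case
    proof (intro allI impI)
      fix x' assume x': "seq_morphism C hs ?G (Ident C Y) x'"
      obtain y where y: "seq_morphism C gs ?G (Ident C Y) y"
        using coextension_exist[OF J step_bwd(1) j] by blast
      obtain w1 where w1: "w1\<in>homset C X (seq_obj C ?G j)" "arr_diff C x y = d j \<cdot> w1"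
        using step_bwd(4) y by blast
      obtain w2 where w2: "w2\<in>homset C X (seq_obj C ?G j)" "arr_diff C y x' = d j \<cdot> w2"
        using coextension_unique[OF J step_bwd(2) j *[OF step_bwd(3) y] x'] by blast
      note yD = seq_morphism_ends(4-6)[OF y] seq_morphism_ends(4-6)[OF x']
        extensionsD[OF step_bwd(1) j] extensionsD[OF step_bwd(2) j]
      have "arr_diff C x x' = Plus C (arr_diff C x y) (arr_diff C y x')"
        by (rule minus_triangle) (use xD yD G in \<open>auto simp del: upt_Suc\<close>)
      also have "\<dots> = d j \<cdot> Plus C w1 w2" unfolding w1 w2
        by (rule Comp_Plus(2)[symmetric]) (use homD[OF w1(1)] homD[OF w2(1)] c(4) exact_seqD(2)[OF G(3), of j] G in \<open>auto simp del: upt_Suc\<close>)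
      finally show "\<exists>w\<in>homset C X (seq_obj C ?G j). arr_diff C x x' = d j \<cdot> w"
        using homD[OF w1(1)] homD[OF w2(1)] by (auto simp: hom_iff simp del: upt_Suc)
    qed
  qed
  then show ?thesis using m(2) by blast
qed

text \<open>At \<open>k = 0\<close> the coaugmentation is a kernel, so the lift exists. For
  \<open>k > 0\<close> position \<open>k + 1\<close> holds \<open>J k\<close>, and the lift is the
  vanishing of \<open>Ext^k(W, Y)\<close>.\<close>

lemma cores_lift:
  assumes J: "injective_coresolution C Y J d" and k: "Suc k \<le> j" and W: "0 < k \<Longrightarrow> ext_vanish C J d W k"
    and t: "t \<in> homset C W (seq_obj C (map d [0..<Suc j]) (Suc k))"
      "map d [0..<Suc j] ! Suc k \<cdot> t = Zero C W (seq_obj C (map d [0..<Suc j]) (Suc (Suc k)))"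
  shows "\<exists>y\<in>homset C W (seq_obj C (map d [0..<Suc j]) k). map d [0..<Suc j] ! k \<cdot> y = t"
proof -
  note G = cores_list[OF J, where j = j] and c = coresD[OF J]
  have t': "t \<in> homset C W (J k)" "d (Suc k) \<cdot> t = Zero C W (J (Suc k))"
    using t G(5)[of k] G(5)[of "Suc k"] G(2)[of "Suc k"] k by (simp_all del: upt_Suc)
  show ?thesis
  proof (cases k)
    case 0
    have ker: "is_kernel C (d 0) (d (Suc 0))" using mono_exact_kernel[OF c(8,9)] .
    show ?thesis using kernel_lift_hom[OF ker, of t W] t' 0 G(2)[of k] G(4) c k by (simp del: upt_Suc)
  next
    case (Suc r)
    then have W': "ext_vanish C J d W (Suc r)" using W by simp
    show ?thesis using W'[unfolded ext_vanish_def, rule_format, of t] t' Suc G(2)[of k] G(5)[of r] k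
      by (simp del: upt_Suc)
  qed
qed

text \<open>Equivalence of \<open>E\<close> and \<open>E'\<close> means that their cocycles differ
  by a coboundary \<open>d j \<cdot> w\<close>. Here \<open>w\<close> starts a homotopy from
  \<open>R\<close> to the coresolution, which acyclicity continues to the left. At position
  \<open>k + 1\<close> of \<open>R\<close> this takes vanishing in degree \<open>k\<close>, the
  second condition in \<open>acyclic_seq\<close>.\<close>

lemma class_unique:
  assumes J: "injective_coresolution C Y J d" and R: "R \<in> extensions C j X K" and j: "0 < j"
    and ac: "acyclic_seq C J d j R"
    and E: "E \<in> extensions C j X Y" "(E, E') \<in> ext_equiv C j X Y"
    and m: "seq_morphism C R E f (Ident C X)" "seq_morphism C R E' f' (Ident C X)"
  shows "\<exists>g\<in>homset C (seq_obj C R 1) Y. arr_diff C f f' = g \<cdot> R ! 0"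
proof -
  note G = cores_list[OF J, where j = j] and c = coresD[OF J]
  let ?G = "map d [0..<Suc j]"
  have E': "E' \<in> extensions C j X Y" using ext_equiv_extensions[OF E(2)] E(1) by simp
  note RD = extensionsD[OF R j] and ED = extensionsD[OF E(1) j] and E'D = extensionsD[OF E' j]
  obtain x where x: "seq_morphism C E ?G (Ident C Y) x" using coextension_exist[OF J E(1) j] by blast
  obtain x' where x': "seq_morphism C E' ?G (Ident C Y) x'" using coextension_exist[OF J E' j] by blast
  obtain w where w: "w\<in>homset C X (seq_obj C ?G j)" "arr_diff C x x' = d j \<cdot> w"
    using coextension_class[OF J E(1) j E(2) x x'] by blast
  have "seq_morphism C R ?G (Ident C Y \<cdot> f) (x \<cdot> Ident C X)"
    by (rule seq_morphism_comp[OF m(1) x RD(2) ED(2) G(3)])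
  then have 1: "seq_morphism C R ?G f x"
    using seq_morphism_ends[OF m(1)] seq_morphism_ends[OF x] ED by simp
  have "seq_morphism C R ?G (Ident C Y \<cdot> f') (x' \<cdot> Ident C X)"
    by (rule seq_morphism_comp[OF m(2) x' RD(2) E'D(2) G(3)])
  then have 2: "seq_morphism C R ?G f' x'"
    using seq_morphism_ends[OF m(2)] seq_morphism_ends[OF x'] E'D by simp
  have "seq_morphism C R ?G (arr_diff C f f') (arr_diff C x x')"
    by (rule seq_morphism_minus[OF 1 2 RD(2) G(3)])
  then have "\<exists>w\<in>homset C (seq_obj C R 1) (seq_obj C ?G 0). arr_diff C f f' = w \<cdot> R ! 0"
  proof (rule down_homotopy[OF RD(2,1) G(3,1)])
    show "w \<in> homset C (seq_obj C R (Suc j)) (seq_obj C ?G j)" using w RD by simp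
    show "arr_diff C x x' = ?G ! j \<cdot> w" using w G(2)[of j] by (simp del: upt_Suc)
    show "is_mono C (?G ! 0)" using c(8) G(2)[of 0] by (simp del: upt_Suc)
    fix k t assume "k < j" "t \<in> homset C (seq_obj C R (Suc k)) (seq_obj C ?G (Suc k))"
      "?G ! Suc k \<cdot> t = Zero C (seq_obj C R (Suc k)) (seq_obj C ?G (Suc (Suc k)))"
    then show "\<exists>y\<in>homset C (seq_obj C R (Suc k)) (seq_obj C ?G k). ?G ! k \<cdot> y = t"
      using ac by (intro cores_lift[OF J]) (auto simp: acyclic_seq_def Suc_le_eq simp del: upt_Suc)
  qed
  then show ?thesis using G(4) by (simp del: upt_Suc)
qed

end

section \<open>Every extension as a pushout of an acyclic resolution\<close>

context enough_proj_inj
begin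

text \<open>Lifting the cocycle of \<open>E\<close> down \<open>R\<close> gives \<open>f\<close>,
  and the pushout \<open>F\<close> of \<open>R\<close> along \<open>f\<close> has the same cocycle.
  The terms of \<open>R\<close> are only acyclic, so \<open>R\<close> need not map to
  \<open>E\<close>. A projective presentation \<open>P\<close> maps to both \<open>E\<close> and
  \<open>F\<close>, and the two left components are homotopic because they lie over the same
  cocycle.\<close>

lemma class_exists:
  assumes J: "injective_coresolution C Y J d" and R: "R \<in> extensions C j X K" and j: "0 < j"
    and ac: "acyclic_seq C J d j R"
    and E: "E \<in> extensions C j X Y"
  shows "\<exists>F f. F \<in> extensions C j X Y \<and> seq_morphism C R F f (Ident C X) \<and> (E, F) \<in> ext_equiv C j X Y"
proof -
  note G = cores_list[OF J, where j = j] and c = coresD[OF J]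
  let ?G = "map d [0..<Suc j]"
  note RD = extensionsD[OF R j] and ED = extensionsD[OF E j]
  obtain x where x: "seq_morphism C E ?G (Ident C Y) x" using coextension_exist[OF J E j] by blast
  have xD: "x \<in> Arr C" "Dom C x = X" "Cod C x = J j"
    using seq_morphism_ends(4-6)[OF x] ED G by (auto simp del: upt_Suc)
  have dj: "d j \<in> Arr C" "Dom C (d j) = seq_obj C ?G j" "Cod C (d j) = J j"
    using exact_seqD[OF G(3), of j] G(2)[of j] G(5)[of j] by (auto simp del: upt_Suc)
  from x obtain h where hm: "h (length E) = x" "seq_map C E ?G h"
    by (rule seq_morphismE)
  then have h: "h (Suc j) = x" "h j \<in> Arr C" "Dom C (h j) = seq_obj C E j" "Cod C (h j) = seq_obj C ?G j"
    "?G ! j \<cdot> h j = h (Suc j) \<cdot> E ! j"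
    using seq_mapD[OF hm(2)] ED(1) by (simp_all del: upt_Suc)
  obtain j' where j': "j = Suc j'" using j by (cases j) auto
  \<comment> \<open>\<open>x\<close> is a cocycle because its composite with the epi
    \<open>E ! j\<close> factors through \<open>d j\<close>.\<close>
  have "(d (Suc j) \<cdot> x) \<cdot> E ! j = d (Suc j) \<cdot> (d j \<cdot> h j)"
    using h(5) h(1) xD c(4,5,7) exact_seqD[OF ED(2), of j] ED G(2)[of j] by (simp del: upt_Suc)
  also have "\<dots> = Zero C (Dom C (E ! j)) (J (Suc j))"
    using comp_cong_assoc1[OF c(10)[of j'], of "h j"] c(2,4,5,7) h dj j' exact_seqD[OF ED(2), of j] ED(1) by (simp del: upt_Suc)
  finally have "d (Suc j) \<cdot> x = Zero C (Cod C (E ! j)) (J (Suc j))"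
    by (rule epi_Zero[OF ED(6)]) (use xD c(4,5,7) exact_seqD[OF ED(2), of j] ED in auto)
  then have dx: "d (Suc j) \<cdot> x = Zero C X (J (Suc j))" using exact_seqD[OF ED(2), of j] ED by simp
  obtain f where f: "seq_morphism C R ?G f x"
  proof -
    have "\<exists>f. seq_morphism C R ?G f x"
    proof (rule down_exist[OF RD(2,1) G(3,1)])
      show "x \<in> homset C (seq_obj C R (Suc j)) (seq_obj C ?G (Suc j))"
        using xD RD G(5)[of j] by (simp add: hom_iff del: upt_Suc)
      note Rj = exact_seqD[OF RD(2), of j]
      \<comment> \<open>The lift starts at the right end with \<open>k = j\<close> in
        \<open>acyclic_seq\<close>: \<open>x \<cdot> R ! j\<close> is a cocycle on the term next to
        \<open>X\<close>, hence a coboundary.\<close>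
      have "d (Suc j) \<cdot> (x \<cdot> R ! j) = Zero C (seq_obj C R j) (J (Suc j))"
        using comp_cong_assoc1[OF dx, of "R ! j"] Rj RD xD c(2,4,5,7) by simp
      then have "\<exists>y\<in>Arr C. Dom C y = seq_obj C R j \<and> Cod C y = J j' \<and> d (Suc j') \<cdot> y = x \<cdot> R ! j"
        using ac j' Rj RD xD by (intro ext_vanishD(2)[of J d _ j]) (auto simp: acyclic_seq_def)
      then show "\<exists>y\<in>homset C (seq_obj C R j) (seq_obj C ?G j). ?G ! j \<cdot> y = x \<cdot> R ! j"
        using j' G(2)[of j] G(5)[of j'] by (auto simp: hom_iff simp del: upt_Suc)
    next
      fix k t assume "k < j" "t \<in> homset C (seq_obj C R k) (seq_obj C ?G (Suc k))"
        "?G ! Suc k \<cdot> t = Zero C (seq_obj C R k) (seq_obj C ?G (Suc (Suc k)))"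
      then show "\<exists>y\<in>homset C (seq_obj C R k) (seq_obj C ?G k). ?G ! k \<cdot> y = t"
        using ac by (intro cores_lift[OF J]) (auto simp: acyclic_seq_def Suc_le_eq simp del: upt_Suc)
    qed
    then show thesis using that by blast
  qed
  have fh: "f \<in> homset C K Y" using seq_morphism_ends(1-3)[OF f] RD G(4) by (auto simp: hom_iff simp del: upt_Suc)
  obtain F where F: "F \<in> extensions C j X Y" "seq_morphism C R F f (Ident C X)"
    and univ: "\<And>G a b. exact_seq C G \<Longrightarrow> a \<in> homset C Y (seq_obj C G 0) \<Longrightarrow>
       seq_morphism C R G (a \<cdot> f) b \<Longrightarrow> seq_morphism C F G a b"
    using pushout_extension[OF R j fh] by metis
  note FD = extensionsD[OF F(1) j]
  have Fx: "seq_morphism C F ?G (Ident C Y) x"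
    by (rule univ) (use G fh f FD in \<open>auto simp: hom_iff simp del: upt_Suc\<close>)
  obtain P L where P: "P \<in> extensions C j X L" and proj: "\<And>k. 1 \<le> k \<Longrightarrow> k \<le> j \<Longrightarrow> seq_obj C P k \<in> Proj C"
    using presentation_ex[OF ED(7) j] by metis
  note PD = extensionsD[OF P j]
  have idX: "Ident C X \<in> homset C X X" using ED by (simp add: hom_iff)
  obtain f1 where f1: "seq_morphism C P E f1 (Ident C X)" using lift_extension[OF P j proj E idX] by blast
  obtain f2 where f2: "seq_morphism C P F f2 (Ident C X)" using lift_extension[OF P j proj F(1) idX] by blast
  have "seq_morphism C P ?G (Ident C Y \<cdot> f1) (x \<cdot> Ident C X)"
    by (rule seq_morphism_comp[OF f1 x PD(2) ED(2) G(3)])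
  then have 1: "seq_morphism C P ?G f1 x" using seq_morphism_ends[OF f1] xD ED by simp
  have "seq_morphism C P ?G (Ident C Y \<cdot> f2) (x \<cdot> Ident C X)"
    by (rule seq_morphism_comp[OF f2 Fx PD(2) FD(2) G(3)])
  then have 2: "seq_morphism C P ?G f2 x" using seq_morphism_ends[OF f2] xD FD by simp
  have "\<exists>w\<in>homset C (seq_obj C P 1) (seq_obj C ?G 0). arr_diff C f1 f2 = w \<cdot> P ! 0"
    by (rule lift_extension_unique[OF P j proj G(3,1) _ 1 2]) (use c G(2)[of 0] in \<open>auto simp del: upt_Suc\<close>)
  then obtain w where "w\<in>homset C (seq_obj C P 1) Y" "arr_diff C f1 f2 = w \<cdot> P ! 0"
    using G(4) by (auto simp del: upt_Suc)
  from ext_equiv_of_common[OF P j E F(1) f1 f2 this] show ?thesis using F by blast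
qed

lemma acyclic_proj:
  assumes J: "injective_coresolution C Y J d"
    and proj: "\<And>k. 1 \<le> k \<Longrightarrow> k \<le> j \<Longrightarrow> seq_obj C P k \<in> Proj C"
  shows "acyclic_seq C J d j P"
  unfolding acyclic_seq_def using ext_vanish_proj[OF J proj] by auto

end

section \<open>Baer sums\<close>

text \<open>If \<open>k\<close> is the left arrow of a projective presentation of \<open>X\<close>
  with left end \<open>K\<close>, the classes of maps \<open>K \<rightarrow> Y\<close> under this
  relation are the elements of \<open>Ext^j(X, Y)\<close>.\<close>

definition homotopic :: "('o, 'm) precat \<Rightarrow> 'm \<Rightarrow> 'm \<Rightarrow> 'm \<Rightarrow> bool" where
  "homotopic C k f g \<longleftrightarrow> (\<exists>w\<in>homset C (Cod C k) (Cod C f). arr_diff C f g = w \<cdot>\<^bsub>C\<^esub> k)"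

context abelian_category
begin

lemma homotopic_sym:
  assumes "homotopic C k f g" "k \<in> Arr C" "f \<in> homset C (Dom C k) Y" "g \<in> homset C (Dom C k) Y"
  shows "homotopic C k g f"
proof -
  note D = homD[OF assms(3)] homD[OF assms(4)]
  obtain w where w: "w \<in> Arr C" "Dom C w = Cod C k" "Cod C w = Y" "arr_diff C f g = w \<cdot> k"
    using assms(1) D by (auto simp: homotopic_def hom_iff)
  have "Plus C (arr_diff C f g) (arr_diff C g f) = arr_diff C f f"
    by (rule minus_triangle[symmetric]) (use D in auto)
  then have "Plus C (w \<cdot> k) (arr_diff C g f) = Zero C (Dom C k) Y" using D w(4) by simp
  then have "arr_diff C g f = arr_neg C (w \<cdot> k)"
    by (intro neg_unique) (use D w(1-3) assms(2) in auto)
  then have "arr_diff C g f = arr_neg C w \<cdot> k" using w(1-3) assms(2) by simp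
  then show ?thesis unfolding homotopic_def using w(1-3) D by (intro bexI[of _ "arr_neg C w"]) (auto simp: hom_iff)
qed

lemma homotopic_trans:
  assumes "homotopic C k f g" "homotopic C k g h" "k \<in> Arr C"
    "f \<in> homset C (Dom C k) Y" "g \<in> homset C (Dom C k) Y" "h \<in> homset C (Dom C k) Y"
  shows "homotopic C k f h"
proof -
  note D = homD[OF assms(4)] homD[OF assms(5)] homD[OF assms(6)]
  obtain w where w: "w \<in> Arr C" "Dom C w = Cod C k" "Cod C w = Y" "arr_diff C f g = w \<cdot> k"
    using assms(1) D by (auto simp: homotopic_def hom_iff)
  obtain v where v: "v \<in> Arr C" "Dom C v = Cod C k" "Cod C v = Y" "arr_diff C g h = v \<cdot> k"
    using assms(2) D by (auto simp: homotopic_def hom_iff)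
  have "arr_diff C f h = Plus C (arr_diff C f g) (arr_diff C g h)"
    by (rule minus_triangle) (use D in auto)
  also have "\<dots> = Plus C w v \<cdot> k" unfolding w(4) v(4)
    by (rule Comp_Plus(1)[symmetric]) (use w v assms(3) in auto)
  finally show ?thesis unfolding homotopic_def using w(1-3) v(1-3) D
    by (intro bexI[of _ "Plus C w v"]) (auto simp: hom_iff)
qed

lemma homotopic_Plus:
  assumes "homotopic C k f g" "homotopic C k f' g'" "k \<in> Arr C"
    "f \<in> homset C (Dom C k) Y" "g \<in> homset C (Dom C k) Y" "f' \<in> homset C (Dom C k) Y" "g' \<in> homset C (Dom C k) Y"
  shows "homotopic C k (Plus C f f') (Plus C g g')"
proof -
  note D = homD[OF assms(4)] homD[OF assms(5)] homD[OF assms(6)] homD[OF assms(7)]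
  obtain w where w: "w \<in> Arr C" "Dom C w = Cod C k" "Cod C w = Y" "arr_diff C f g = w \<cdot> k"
    using assms(1) D by (auto simp: homotopic_def hom_iff)
  obtain v where v: "v \<in> Arr C" "Dom C v = Cod C k" "Cod C v = Y" "arr_diff C f' g' = v \<cdot> k"
    using assms(2) D by (auto simp: homotopic_def hom_iff)
  have f: "f = Plus C g (w \<cdot> k)" by (rule iffD1[OF minus_eq_iff w(4)]) (use D w(1-3) assms(3) in auto)
  have f': "f' = Plus C g' (v \<cdot> k)" by (rule iffD1[OF minus_eq_iff v(4)]) (use D v(1-3) assms(3) in auto)
  have "Plus C f f' = Plus C (Plus C g g') (Plus C w v \<cdot> k)"
    unfolding f f' using D w(1-3) v(1-3) assms(3) by (simp add: Plus_ac)
  then have "arr_diff C (Plus C f f') (Plus C g g') = Plus C w v \<cdot> k"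
    by (intro iffD2[OF minus_eq_iff]) (use D w(1-3) v(1-3) assms(3) in auto)
  then show ?thesis unfolding homotopic_def using w(1-3) v(1-3) D
    by (intro bexI[of _ "Plus C w v"]) (auto simp: hom_iff)
qed

lemma biproductD:
  assumes "is_biproduct C X Y S i1 i2 p1 p2"
  shows "X \<in> Obj C" "Y \<in> Obj C" "S \<in> Obj C" "i1 \<in> Arr C" "i2 \<in> Arr C" "p1 \<in> Arr C" "p2 \<in> Arr C"
    "Dom C i1 = X" "Cod C i1 = S" "Dom C i2 = Y" "Cod C i2 = S"
    "Dom C p1 = S" "Cod C p1 = X" "Dom C p2 = S" "Cod C p2 = Y"
    "\<And>x. x \<in> Arr C \<Longrightarrow> Cod C x = X \<Longrightarrow> p1 \<cdot> (i1 \<cdot> x) = x"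
    "\<And>x. x \<in> Arr C \<Longrightarrow> Cod C x = Y \<Longrightarrow> p2 \<cdot> (i2 \<cdot> x) = x"
    "\<And>x. x \<in> Arr C \<Longrightarrow> Cod C x = X \<Longrightarrow> p2 \<cdot> (i1 \<cdot> x) = Zero C (Dom C x) Y"
    "\<And>x. x \<in> Arr C \<Longrightarrow> Cod C x = Y \<Longrightarrow> p1 \<cdot> (i2 \<cdot> x) = Zero C (Dom C x) X"
    "\<And>x. x \<in> Arr C \<Longrightarrow> Cod C x = S \<Longrightarrow> Plus C (i1 \<cdot> (p1 \<cdot> x)) (i2 \<cdot> (p2 \<cdot> x)) = x"
proof -
  show S: "X \<in> Obj C" "Y \<in> Obj C" "S \<in> Obj C" "i1 \<in> Arr C" "i2 \<in> Arr C" "p1 \<in> Arr C" "p2 \<in> Arr C"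
    "Dom C i1 = X" "Cod C i1 = S" "Dom C i2 = Y" "Cod C i2 = S"
    "Dom C p1 = S" "Cod C p1 = X" "Dom C p2 = S" "Cod C p2 = Y"
    using assms by (auto simp: is_biproduct_def hom_iff)
  have eqs: "p1 \<cdot> i1 = Ident C X" "p2 \<cdot> i2 = Ident C Y" "p2 \<cdot> i1 = Zero C X Y"
    "p1 \<cdot> i2 = Zero C Y X" "Plus C (i1 \<cdot> p1) (i2 \<cdot> p2) = Ident C S"
    using assms by (auto simp: is_biproduct_def)
  fix x assume x: "x \<in> Arr C"
  show "Cod C x = X \<Longrightarrow> p1 \<cdot> (i1 \<cdot> x) = x" using comp_cong_assoc1[OF eqs(1), of x] S x by simp
  show "Cod C x = Y \<Longrightarrow> p2 \<cdot> (i2 \<cdot> x) = x" using comp_cong_assoc1[OF eqs(2), of x] S x by simp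
  show "Cod C x = X \<Longrightarrow> p2 \<cdot> (i1 \<cdot> x) = Zero C (Dom C x) Y" using comp_cong_assoc1[OF eqs(3), of x] S x by simp
  show "Cod C x = Y \<Longrightarrow> p1 \<cdot> (i2 \<cdot> x) = Zero C (Dom C x) X" using comp_cong_assoc1[OF eqs(4), of x] S x by simp
  assume xS: "Cod C x = S"
  have "Plus C (i1 \<cdot> (p1 \<cdot> x)) (i2 \<cdot> (p2 \<cdot> x)) = Plus C (i1 \<cdot> p1) (i2 \<cdot> p2) \<cdot> x"
    using S x xS by (subst Comp_Plus(1)) auto
  also have "\<dots> = x" unfolding eqs using S x xS by simp
  finally show "Plus C (i1 \<cdot> (p1 \<cdot> x)) (i2 \<cdot> (p2 \<cdot> x)) = x" .
qed

lemma codiagonal_comp: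
  assumes "is_biproduct C Y Y S i1 i2 p1 p2" "f \<in> homset C K Y" "g \<in> homset C K Y"
  shows "Plus C p1 p2 \<cdot> Plus C (i1 \<cdot> f) (i2 \<cdot> g) = Plus C f g"
proof -
  note B = biproductD[OF assms(1)] and D = homD[OF assms(2)] homD[OF assms(3)]
  have "Plus C p1 p2 \<cdot> Plus C (i1 \<cdot> f) (i2 \<cdot> g) =
    Plus C (p1 \<cdot> Plus C (i1 \<cdot> f) (i2 \<cdot> g)) (p2 \<cdot> Plus C (i1 \<cdot> f) (i2 \<cdot> g))"
    by (rule Comp_Plus(1)) (use D B(1-15) in auto)
  then show ?thesis using D B by simp
qed

text \<open>Calculation rules for an arrow \<open>f \<oplus> g\<close> between biproducts, in terms
  of pairs and of components, so that the formula for \<open>s\<close> need not be unfolded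
  again.\<close>

lemma direct_sum_comp:
  assumes b: "is_biproduct C A B S i1 i2 p1 p2" and b': "is_biproduct C A' B' S' i1' i2' p1' p2'"
    and f: "f \<in> homset C A A'" and g: "g \<in> homset C B B'"
    and s: "s = Plus C (i1' \<cdot> f \<cdot> p1) (i2' \<cdot> g \<cdot> p2)"
  shows "s \<in> homset C S S'"
    "\<And>x y. x \<in> Arr C \<Longrightarrow> y \<in> Arr C \<Longrightarrow> Cod C x = A \<Longrightarrow> Cod C y = B \<Longrightarrow> Dom C y = Dom C x \<Longrightarrow>
       s \<cdot> Plus C (i1 \<cdot> x) (i2 \<cdot> y) = Plus C (i1' \<cdot> f \<cdot> x) (i2' \<cdot> g \<cdot> y)"
    "\<And>x. x \<in> Arr C \<Longrightarrow> Cod C x = S \<Longrightarrow> p1' \<cdot> (s \<cdot> x) = f \<cdot> (p1 \<cdot> x)"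
    "\<And>x. x \<in> Arr C \<Longrightarrow> Cod C x = S \<Longrightarrow> p2' \<cdot> (s \<cdot> x) = g \<cdot> (p2 \<cdot> x)"
proof -
  note D = biproductD[OF b] and D' = biproductD[OF b'] and F = homD[OF f] homD[OF g]
  show "s \<in> homset C S S'" unfolding s using D(1-15) D'(1-15) F by (auto simp: hom_iff)
  have *: "s \<cdot> x = Plus C (i1' \<cdot> (f \<cdot> (p1 \<cdot> x))) (i2' \<cdot> (g \<cdot> (p2 \<cdot> x)))" if "x \<in> Arr C" "Cod C x = S" for x
    unfolding s using that D(1-15) D'(1-15) F by (subst Comp_Plus(1)) auto
  show "s \<cdot> Plus C (i1 \<cdot> x) (i2 \<cdot> y) = Plus C (i1' \<cdot> f \<cdot> x) (i2' \<cdot> g \<cdot> y)"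
    if "x \<in> Arr C" "y \<in> Arr C" "Cod C x = A" "Cod C y = B" "Dom C y = Dom C x" for x y
  proof -
    have "p1 \<cdot> Plus C (i1 \<cdot> x) (i2 \<cdot> y) = x" "p2 \<cdot> Plus C (i1 \<cdot> x) (i2 \<cdot> y) = y"
      using that D F by auto
    then show ?thesis by (subst *) (use that D(1-15) in auto)
  qed
  show "p1' \<cdot> (s \<cdot> x) = f \<cdot> (p1 \<cdot> x)" "p2' \<cdot> (s \<cdot> x) = g \<cdot> (p2 \<cdot> x)" if "x \<in> Arr C" "Cod C x = S" for x
    using that D(1-15) D' F by (auto simp: *)
qed

lemma seq_direct_sumD:
  assumes "seq_direct_sum C fs gs ss i1 i2 p1 p2"
  shows "length gs = length fs" "length ss = length fs"
    "\<And>k. k \<le> length fs \<Longrightarrow> is_biproduct C (seq_obj C fs k) (seq_obj C gs k) (seq_obj C ss k) (i1 k) (i2 k) (p1 k) (p2 k)"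
    "\<And>k. k < length fs \<Longrightarrow> ss ! k =
        Plus C (i1 (Suc k) \<cdot> fs ! k \<cdot> p1 k) (i2 (Suc k) \<cdot> gs ! k \<cdot> p2 k)"
  using assms unfolding seq_direct_sum_def by auto

lemma seq_direct_sum_hom:
  assumes ds: "seq_direct_sum C fs gs ss i1 i2 p1 p2" and fs: "exact_seq C fs" and gs: "exact_seq C gs"
    and k: "k < length fs"
  shows "ss ! k \<in> homset C (seq_obj C ss k) (seq_obj C ss (Suc k))"
    "fs ! k \<in> homset C (seq_obj C fs k) (seq_obj C fs (Suc k))"
    "gs ! k \<in> homset C (seq_obj C gs k) (seq_obj C gs (Suc k))"
proof -
  note D = seq_direct_sumD[OF ds]
  show "fs ! k \<in> homset C (seq_obj C fs k) (seq_obj C fs (Suc k))"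
    "gs ! k \<in> homset C (seq_obj C gs k) (seq_obj C gs (Suc k))"
    using exact_seqD[OF fs k] exact_seqD[OF gs, of k] k D(1) by (auto simp: hom_iff)
  then show "ss ! k \<in> homset C (seq_obj C ss k) (seq_obj C ss (Suc k))"
    using direct_sum_comp(1)[OF D(3)[of k] D(3)[of "Suc k"] _ _ D(4)] k by auto
qed

lemma direct_sum_morphism:
  assumes ds: "seq_direct_sum C fs gs ss i1 i2 p1 p2" and fs: "exact_seq C fs" and gs: "exact_seq C gs"
    and P: "exact_seq C P" and m: "seq_morphism C P fs f b" "seq_morphism C P gs g b'"
  shows "seq_morphism C P ss (Plus C (i1 0 \<cdot> f) (i2 0 \<cdot> g)) (Plus C (i1 (length P) \<cdot> b) (i2 (length P) \<cdot> b'))"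
proof -
  note D = seq_direct_sumD[OF ds]
  from m(1) obtain h where h: "h 0 = f" "h (length P) = b" "seq_map C P fs h"
    by (rule seq_morphismE)
  note h = h(1,2) seq_mapD[OF h(3)]
  from m(2) obtain h' where h': "h' 0 = g" "h' (length P) = b'" "seq_map C P gs h'"
    by (rule seq_morphismE)
  note h' = h'(1,2) seq_mapD[OF h'(3)]
  show ?thesis
  proof (rule seq_morphismI[of "\<lambda>k. Plus C (i1 k \<cdot> h k) (i2 k \<cdot> h' k)"])
    fix k assume k: "k \<le> length P"
    have "is_biproduct C (seq_obj C fs k) (seq_obj C gs k) (seq_obj C ss k) (i1 k) (i2 k) (p1 k) (p2 k)"
      using D(3)[of k] k h(3) by simp
    note B = biproductD(1-15)[OF this]
    show "Plus C (i1 k \<cdot> h k) (i2 k \<cdot> h' k) \<in> Arr C" "Dom C (Plus C (i1 k \<cdot> h k) (i2 k \<cdot> h' k)) = seq_obj C P k"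
      "Cod C (Plus C (i1 k \<cdot> h k) (i2 k \<cdot> h' k)) = seq_obj C ss k"
      using B h(4-6)[OF k] h'(4-6)[OF k] by auto
  next
    fix k assume k: "k < length P"
    have b: "is_biproduct C (seq_obj C fs k) (seq_obj C gs k) (seq_obj C ss k) (i1 k) (i2 k) (p1 k) (p2 k)"
      "is_biproduct C (seq_obj C fs (Suc k)) (seq_obj C gs (Suc k)) (seq_obj C ss (Suc k)) (i1 (Suc k)) (i2 (Suc k)) (p1 (Suc k)) (p2 (Suc k))"
      using D(3)[of k] D(3)[of "Suc k"] k h(3) by simp_all
    note B = biproductD(1-15)[OF b(1)] biproductD(1-15)[OF b(2)]
    have hk: "h k \<in> Arr C" "Dom C (h k) = seq_obj C P k" "Cod C (h k) = seq_obj C fs k"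
      "h' k \<in> Arr C" "Dom C (h' k) = seq_obj C P k" "Cod C (h' k) = seq_obj C gs k"
      "h (Suc k) \<in> Arr C" "Dom C (h (Suc k)) = seq_obj C P (Suc k)" "Cod C (h (Suc k)) = seq_obj C fs (Suc k)"
      "h' (Suc k) \<in> Arr C" "Dom C (h' (Suc k)) = seq_obj C P (Suc k)" "Cod C (h' (Suc k)) = seq_obj C gs (Suc k)"
      using h(4-6)[of k] h'(4-6)[of k] h(4-6)[of "Suc k"] h'(4-6)[of "Suc k"] k by auto
    have k': "k < length fs" using k h by simp
    note s = seq_direct_sum_hom[OF ds fs gs k']
    have "ss ! k \<cdot> Plus C (i1 k \<cdot> h k) (i2 k \<cdot> h' k) =
      Plus C (i1 (Suc k) \<cdot> (fs ! k \<cdot> h k)) (i2 (Suc k) \<cdot> (gs ! k \<cdot> h' k))"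
      by (rule direct_sum_comp(2)[OF b s(2,3) D(4)[OF k']]) (use hk in auto)
    also have "\<dots> = Plus C (i1 (Suc k) \<cdot> h (Suc k)) (i2 (Suc k) \<cdot> h' (Suc k)) \<cdot> P ! k"
      unfolding h(7)[OF k] h'(7)[OF k] using hk B exact_seqD[OF P k] by simp
    finally show "ss ! k \<cdot> Plus C (i1 k \<cdot> h k) (i2 k \<cdot> h' k) =
      Plus C (i1 (Suc k) \<cdot> h (Suc k)) (i2 (Suc k) \<cdot> h' (Suc k)) \<cdot> P ! k" .
  qed (use h(1-3) h'(1-3) D in auto)
qed

end

section \<open>Direct sums of extensions and Baer sums\<close>

context enough_proj
begin

lemma is_monoI_proj:
  assumes "f \<in> Arr C" "\<And>g. g \<in> Arr C \<Longrightarrow> Dom C g \<in> Proj C \<Longrightarrow> Cod C g = Dom C f \<Longrightarrow> f \<cdot> g = Zero C (Dom C g) (Cod C f)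
    \<Longrightarrow> g = Zero C (Dom C g) (Dom C f)"
  shows "is_mono C f"
proof (rule is_monoI)
  fix g assume g: "g \<in> Arr C" "Cod C g = Dom C f" "f \<cdot> g = Zero C (Dom C g) (Cod C f)"
  obtain P p where p: "P \<in> Proj C" "is_epi C p" "Dom C p = P" "Cod C p = Dom C g" "p \<in> Arr C"
    using cover[of "Dom C g"] g(1) by auto
  have "f \<cdot> (g \<cdot> p) = Zero C P (Cod C f)" using comp_cong_assoc1[OF g(3), of p] g p assms(1) by simp
  then have "g \<cdot> p = Zero C P (Dom C f)" using assms(2)[of "g \<cdot> p"] g p by simp
  then have "g = Zero C (Cod C p) (Dom C f)" by (rule epi_Zero[OF p(2)]) (use g p in auto)
  then show "g = Zero C (Dom C g) (Dom C f)" unfolding p(4) .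
qed fact

text \<open>Mono, epi and exactness are checked on maps from projectives. Such a map into a direct
  sum is a pair of maps, and each component is treated in its own extension.\<close>

lemma direct_sum_extension:
  assumes ds: "seq_direct_sum C fs gs ss i1 i2 p1 p2" and fs: "fs \<in> extensions C j X Y" and gs: "gs \<in> extensions C j X' Y'"
    and j: "0 < j"
  shows "ss \<in> extensions C j (seq_obj C ss (Suc j)) (seq_obj C ss 0)"
proof -
  note D = seq_direct_sumD[OF ds] and fD = extensionsD[OF fs j] and gD = extensionsD[OF gs j]
  have b: "is_biproduct C (seq_obj C fs k) (seq_obj C gs k) (seq_obj C ss k) (i1 k) (i2 k) (p1 k) (p2 k)" if "k \<le> Suc j" for k
    using D(3) that fD(1) by simp
  have s: "ss ! k \<in> homset C (seq_obj C ss k) (seq_obj C ss (Suc k))"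
    "fs ! k \<in> homset C (seq_obj C fs k) (seq_obj C fs (Suc k))"
    "gs ! k \<in> homset C (seq_obj C gs k) (seq_obj C gs (Suc k))"
    "ss ! k = Plus C (i1 (Suc k) \<cdot> fs ! k \<cdot> p1 k) (i2 (Suc k) \<cdot> gs ! k \<cdot> p2 k)" if "k \<le> j" for k
    using seq_direct_sum_hom[OF ds fD(2) gD(2), of k] D(4)[of k] that fD(1) by auto
  have ls: "length ss = Suc j" using D fD by simp
  have proj_eq: "x = Zero C (Dom C x) (seq_obj C ss k)"
    if k: "k \<le> Suc j" and x: "x \<in> Arr C" "Cod C x = seq_obj C ss k" and "p1 k \<cdot> x = Zero C (Dom C x) (seq_obj C fs k)"
      "p2 k \<cdot> x = Zero C (Dom C x) (seq_obj C gs k)" for x k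
  proof -
    note B = biproductD[OF b[OF k]]
    have "x = Plus C (i1 k \<cdot> (p1 k \<cdot> x)) (i2 k \<cdot> (p2 k \<cdot> x))"
      by (rule B(20)[symmetric]) (use x in auto)
    also have "\<dots> = Zero C (Dom C x) (seq_obj C ss k)" unfolding that using x B(1-15) by simp
    finally show ?thesis .
  qed
  have mono: "is_mono C (ss ! 0)"
  proof (rule is_monoI_proj)
    note s0 = s[of 0] and b0 = b[of 0] and b1 = b[of "Suc 0"]
    note sD = homD[OF s0(1)] homD[OF s0(2)] homD[OF s0(3)] and B = biproductD[OF b0] and B1 = biproductD[OF b1]
    show "ss ! 0 \<in> Arr C" using sD by simp
    fix x assume x: "x \<in> Arr C" "Dom C x \<in> Proj C" "Cod C x = Dom C (ss ! 0)" "ss ! 0 \<cdot> x = Zero C (Dom C x) (Cod C (ss ! 0))"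
    have x': "Cod C x = seq_obj C ss 0" using x sD by simp
    have "fs ! 0 \<cdot> (p1 0 \<cdot> x) = p1 (Suc 0) \<cdot> (ss ! 0 \<cdot> x)"
      by (rule direct_sum_comp(3)[OF b0 b1 s0(2-4), symmetric]) (use x x' in auto)
    also have "\<dots> = Zero C (Dom C x) (Cod C (fs ! 0))" unfolding x(4) using B1(1-15) sD x by simp
    finally have 1: "p1 0 \<cdot> x = Zero C (Dom C x) (Dom C (fs ! 0))"
      by (rule mono_Zero[OF fD(5)]) (use x x' B(1-15) sD in auto)
    have "gs ! 0 \<cdot> (p2 0 \<cdot> x) = p2 (Suc 0) \<cdot> (ss ! 0 \<cdot> x)"
      by (rule direct_sum_comp(4)[OF b0 b1 s0(2-4), symmetric]) (use x x' in auto)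
    also have "\<dots> = Zero C (Dom C x) (Cod C (gs ! 0))" unfolding x(4) using B1(1-15) sD x by simp
    finally have 2: "p2 0 \<cdot> x = Zero C (Dom C x) (Dom C (gs ! 0))"
      by (rule mono_Zero[OF gD(5)]) (use x x' B(1-15) sD in auto)
    have "x = Zero C (Dom C x) (seq_obj C ss 0)"
      by (rule proj_eq) (use x x' 1 2 sD in auto)
    then show "x = Zero C (Dom C x) (Dom C (ss ! 0))" using sD by simp
  qed
  have lift: "\<exists>y\<in>Arr C. Dom C y = Dom C x \<and> Cod C y = Dom C (ss ! k) \<and> ss ! k \<cdot> y = x"
    if k: "k \<le> j" and x: "x \<in> Arr C" "Cod C x = seq_obj C ss (Suc k)"
     and a: "a \<in> homset C (Dom C x) (seq_obj C fs k)" "fs ! k \<cdot> a = p1 (Suc k) \<cdot> x"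
     and a': "a' \<in> homset C (Dom C x) (seq_obj C gs k)" "gs ! k \<cdot> a' = p2 (Suc k) \<cdot> x" for x k a a'
  proof -
    have k': "k \<le> Suc j" "Suc k \<le> Suc j" using k by auto
    note B = biproductD[OF b[OF k'(1)]] and B' = biproductD[OF b[OF k'(2)]] and A = homD[OF a(1)] homD[OF a'(1)]
    note sD = homD[OF s(1)[OF k]]
    have "ss ! k \<cdot> Plus C (i1 k \<cdot> a) (i2 k \<cdot> a') = Plus C (i1 (Suc k) \<cdot> fs ! k \<cdot> a) (i2 (Suc k) \<cdot> gs ! k \<cdot> a')"
      by (rule direct_sum_comp(2)[OF b[OF k'(1)] b[OF k'(2)] s(2-4)[OF k]]) (use A in auto)
    also have "\<dots> = x" unfolding a a' by (rule B'(20)) (use x in auto)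
    finally show ?thesis using B(1-15) A sD x by (intro bexI[of _ "Plus C (i1 k \<cdot> a) (i2 k \<cdot> a')"]) auto
  qed
  have epi: "is_epi C (ss ! j)"
  proof (rule is_epiI_proj)
    note sD = homD[OF s(1)[of j]] homD[OF s(2)[of j]] homD[OF s(3)[of j]] and B = biproductD[OF b[of "Suc j"]]
    show "ss ! j \<in> Arr C" using sD by simp
    fix x assume x: "x \<in> Arr C" "Dom C x \<in> Proj C" "Cod C x = Cod C (ss ! j)"
    have x': "Cod C x = seq_obj C ss (Suc j)" using x sD by simp
    obtain a where a: "a \<in> Arr C" "Dom C a = Dom C x" "Cod C a = Dom C (fs ! j)" "fs ! j \<cdot> a = p1 (Suc j) \<cdot> x"
      using ProjD[OF x(2) fD(6), of "p1 (Suc j) \<cdot> x"] x x' B(1-15) sD by auto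
    obtain a' where a': "a' \<in> Arr C" "Dom C a' = Dom C x" "Cod C a' = Dom C (gs ! j)" "gs ! j \<cdot> a' = p2 (Suc j) \<cdot> x"
      using ProjD[OF x(2) gD(6), of "p2 (Suc j) \<cdot> x"] x x' B(1-15) sD by auto
    show "\<exists>y\<in>Arr C. Dom C y = Dom C x \<and> Cod C y = Dom C (ss ! j) \<and> ss ! j \<cdot> y = x"
      by (rule lift[of j x a a']) (use x x' a a' sD in \<open>auto simp: hom_iff\<close>)
  qed
  have ex: "exact_seq C ss"
    unfolding exact_seq_def
  proof (intro conjI allI impI)
    show "ss \<noteq> []" using ls by auto
    show "set ss \<subseteq> Arr C"
    proof
      fix a assume "a \<in> set ss"
      then obtain k where "k \<le> j" "a = ss ! k" using ls by (auto simp: in_set_conv_nth less_Suc_eq_le)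
      then show "a \<in> Arr C" using homD[OF s(1)] by simp
    qed
    fix k assume "Suc k < length ss"
    then have k: "k \<le> j" "Suc k \<le> j" "k \<le> Suc j" "Suc k \<le> Suc j" "Suc (Suc k) \<le> Suc j" using ls by auto
    note sD = homD[OF s(1)[OF k(1)]] homD[OF s(2)[OF k(1)]] homD[OF s(3)[OF k(1)]]
      homD[OF s(1)[OF k(2)]] homD[OF s(2)[OF k(2)]] homD[OF s(3)[OF k(2)]]
    note B = biproductD[OF b[OF k(3)]] and B1 = biproductD[OF b[OF k(4)]] and B2 = biproductD[OF b[OF k(5)]]
    note fx = exact_seq_comp[OF fD(2), of k] and gx = exact_seq_comp[OF gD(2), of k]
    show "exact_at C (ss ! k) (ss ! Suc k)"
    proof (rule exact_atI_proj)
      have "p1 (Suc (Suc k)) \<cdot> (ss ! Suc k \<cdot> ss ! k) = fs ! Suc k \<cdot> (p1 (Suc k) \<cdot> (ss ! k \<cdot> Ident C (seq_obj C ss k)))"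
        using direct_sum_comp(3)[OF b[OF k(4)] b[OF k(5)] s(2-4)[OF k(2)], of "ss ! k"] sD by simp
      also have "p1 (Suc k) \<cdot> (ss ! k \<cdot> Ident C (seq_obj C ss k)) = fs ! k \<cdot> (p1 k \<cdot> Ident C (seq_obj C ss k))"
        by (rule direct_sum_comp(3)[OF b[OF k(3)] b[OF k(4)] s(2-4)[OF k(1)]]) (use B in auto)
      also have "fs ! Suc k \<cdot> (fs ! k \<cdot> (p1 k \<cdot> Ident C (seq_obj C ss k))) = Zero C (seq_obj C ss k) (seq_obj C fs (Suc (Suc k)))"
        using comp_cong_assoc1[OF fx(2), of "p1 k"] k sD B(1-15) B2(1-15) fD(1) by simp
      finally have 1: "p1 (Suc (Suc k)) \<cdot> (ss ! Suc k \<cdot> ss ! k) = Zero C (seq_obj C ss k) (seq_obj C fs (Suc (Suc k)))" .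
      have "p2 (Suc (Suc k)) \<cdot> (ss ! Suc k \<cdot> ss ! k) = gs ! Suc k \<cdot> (p2 (Suc k) \<cdot> (ss ! k \<cdot> Ident C (seq_obj C ss k)))"
        using direct_sum_comp(4)[OF b[OF k(4)] b[OF k(5)] s(2-4)[OF k(2)], of "ss ! k"] sD by simp
      also have "p2 (Suc k) \<cdot> (ss ! k \<cdot> Ident C (seq_obj C ss k)) = gs ! k \<cdot> (p2 k \<cdot> Ident C (seq_obj C ss k))"
        by (rule direct_sum_comp(4)[OF b[OF k(3)] b[OF k(4)] s(2-4)[OF k(1)]]) (use B in auto)
      also have "gs ! Suc k \<cdot> (gs ! k \<cdot> (p2 k \<cdot> Ident C (seq_obj C ss k))) = Zero C (seq_obj C ss k) (seq_obj C gs (Suc (Suc k)))"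
        using comp_cong_assoc1[OF gx(2), of "p2 k"] k sD B(1-15) B2(1-15) gD(1) by simp
      finally have 2: "p2 (Suc (Suc k)) \<cdot> (ss ! Suc k \<cdot> ss ! k) = Zero C (seq_obj C ss k) (seq_obj C gs (Suc (Suc k)))" .
      have "ss ! Suc k \<cdot> ss ! k = Zero C (Dom C (ss ! Suc k \<cdot> ss ! k)) (seq_obj C ss (Suc (Suc k)))"
        by (rule proj_eq) (use 1 2 sD k in auto)
      then show "ss ! Suc k \<cdot> ss ! k = Zero C (Dom C (ss ! k)) (Cod C (ss ! Suc k))"
        using sD by (metis comp_simps(2))
      fix x assume x: "x \<in> Arr C" "Dom C x \<in> Proj C" "Cod C x = Cod C (ss ! k)"
        "ss ! Suc k \<cdot> x = Zero C (Dom C x) (Cod C (ss ! Suc k))"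
      have x': "Cod C x = seq_obj C ss (Suc k)" using x sD by simp
      have "fs ! Suc k \<cdot> (p1 (Suc k) \<cdot> x) = p1 (Suc (Suc k)) \<cdot> (ss ! Suc k \<cdot> x)"
        by (rule direct_sum_comp(3)[OF b[OF k(4)] b[OF k(5)] s(2-4)[OF k(2)], symmetric]) (use x x' in auto)
      also have "\<dots> = Zero C (Dom C x) (Cod C (fs ! Suc k))" unfolding x(4) using B2(1-15) sD x by simp
      finally have "\<exists>a\<in>homset C (Dom C x) (Dom C (fs ! k)). fs ! k \<cdot> a = p1 (Suc k) \<cdot> x"
        by (intro exact_lift_hom[OF fx(1) x(2)]) (use k fD x x' B1(1-15) sD in \<open>auto simp: hom_iff\<close>)
      then obtain a where a: "a \<in> homset C (Dom C x) (seq_obj C fs k)" "fs ! k \<cdot> a = p1 (Suc k) \<cdot> x" using sD by auto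
      have "gs ! Suc k \<cdot> (p2 (Suc k) \<cdot> x) = p2 (Suc (Suc k)) \<cdot> (ss ! Suc k \<cdot> x)"
        by (rule direct_sum_comp(4)[OF b[OF k(4)] b[OF k(5)] s(2-4)[OF k(2)], symmetric]) (use x x' in auto)
      also have "\<dots> = Zero C (Dom C x) (Cod C (gs ! Suc k))" unfolding x(4) using B2(1-15) sD x by simp
      finally have "\<exists>a\<in>homset C (Dom C x) (Dom C (gs ! k)). gs ! k \<cdot> a = p2 (Suc k) \<cdot> x"
        by (intro exact_lift_hom[OF gx(1) x(2)]) (use k gD x x' B1(1-15) sD in \<open>auto simp: hom_iff\<close>)
      then obtain a' where a': "a' \<in> homset C (Dom C x) (seq_obj C gs k)" "gs ! k \<cdot> a' = p2 (Suc k) \<cdot> x" using sD by auto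
      show "\<exists>y\<in>Arr C. Dom C y = Dom C x \<and> Cod C y = Dom C (ss ! k) \<and> ss ! k \<cdot> y = x"
        by (rule lift[OF k(1) x(1) x' a a'])
    qed (use sD in auto)
  qed
  show ?thesis unfolding extensions_iff[OF j] using ls ex mono epi by auto
qed

end

context enough_proj
begin

lemma direct_sum_ex:
  assumes fs: "fs \<in> extensions C j X Y" and gs: "gs \<in> extensions C j X' Y'" and j: "0 < j"
  obtains ss i1 i2 p1 p2 where "seq_direct_sum C fs gs ss i1 i2 p1 p2"
proof -
  note fD = extensionsD[OF fs j] and gD = extensionsD[OF gs j]
  have "\<forall>k. \<exists>S i1 i2 p1 p2. k \<le> Suc j \<longrightarrow> is_biproduct C (seq_obj C fs k) (seq_obj C gs k) S i1 i2 p1 p2"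
    using ex_biproduct exact_seq_Obj[OF fD(2)] exact_seq_Obj[OF gD(2)] fD(1) gD(1) by metis
  then obtain S i1 i2 p1 p2 where b: "\<And>k. k \<le> Suc j \<Longrightarrow> is_biproduct C (seq_obj C fs k) (seq_obj C gs k) (S k) (i1 k) (i2 k) (p1 k) (p2 k)"
    by metis
  define s where "s k = Plus C (i1 (Suc k) \<cdot> fs ! k \<cdot> p1 k) (i2 (Suc k) \<cdot> gs ! k \<cdot> p2 k)" for k
  define ss where "ss = map s [0..<Suc j]"
  have s: "s k \<in> homset C (S k) (S (Suc k))" if "k \<le> j" for k
    by (rule direct_sum_comp(1)[OF b[of k] b[of "Suc k"] _ _ s_def])
      (use that exact_seqD[OF fD(2), of k] exact_seqD[OF gD(2), of k] fD(1) gD(1) in \<open>auto simp: hom_iff\<close>)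
  have ls: "length ss = Suc j" by (simp add: ss_def)
  have nss: "ss ! k = s k" if "k \<le> j" for k using that by (simp add: ss_def nth_append del: upt_Suc)
  have "seq_obj C ss k = S k" if "k \<le> Suc j" for k
  proof (cases "k = Suc j")
    case True
    have "last ss = s j" using nss[of j] ls by (subst last_conv_nth) auto
    then show ?thesis using True ls homD[OF s[of j]] by (simp add: seq_obj_def)
  next
    case False
    then have "k \<le> j" using that by simp
    then show ?thesis using ls homD[OF s[of k]] nss[of k] by (simp add: seq_obj_def)
  qed
  then have "seq_direct_sum C fs gs ss i1 i2 p1 p2"
    unfolding seq_direct_sum_def using fD(1) gD(1) ls b nss by (auto simp: s_def)
  then show thesis by (rule that)
qed

text \<open>Follows the pair of \<open>f\<close> and \<open>g\<close> from \<open>P\<close> into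
  \<open>fs \<oplus> gs\<close> and on through the codiagonal. Both lie over the identity of
  \<open>X\<close>, so their sum lies over the diagonal.\<close>

lemma baer_sum_chain:
  assumes P: "P \<in> extensions C j X K" and j: "0 < j"
    and fs: "fs \<in> extensions C j X Y" and gs: "gs \<in> extensions C j X Y"
    and f: "seq_morphism C P fs f (Ident C X)" and g: "seq_morphism C P gs g (Ident C X)"
    and ds: "seq_direct_sum C fs gs ss i1 i2 p1 p2" and ts: "ts \<in> extensions C j XX Y"
    and st: "seq_morphism C ss ts (Plus C (p1 0) (p2 0)) (Ident C (seq_obj C ss (Suc j)))"
  shows "seq_morphism C P ts (Plus C f g) (Plus C (i1 (Suc j)) (i2 (Suc j)))"
proof -
  note PD = extensionsD[OF P j] and fD = extensionsD[OF fs j] and gD = extensionsD[OF gs j] and tD = extensionsD[OF ts j]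
  note sD = extensionsD[OF direct_sum_extension[OF ds fs gs j] j]
  have b0: "is_biproduct C Y Y (seq_obj C ss 0) (i1 0) (i2 0) (p1 0) (p2 0)"
    using seq_direct_sumD(3)[OF ds, of 0] fD gD by simp
  have b1: "is_biproduct C X X (seq_obj C ss (Suc j)) (i1 (Suc j)) (i2 (Suc j)) (p1 (Suc j)) (p2 (Suc j))"
    using seq_direct_sumD(3)[OF ds, of "Suc j"] fD gD by simp
  note B1 = biproductD(1-15)[OF b1]
  have fg: "f \<in> homset C K Y" "g \<in> homset C K Y"
    using seq_morphism_ends(1-3)[OF f] seq_morphism_ends(1-3)[OF g] PD fD gD by (auto simp: hom_iff)
  have "seq_morphism C P ts (Plus C (p1 0) (p2 0) \<cdot> Plus C (i1 0 \<cdot> f) (i2 0 \<cdot> g))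
     (Ident C (seq_obj C ss (Suc j)) \<cdot> Plus C (i1 (length P) \<cdot> Ident C X) (i2 (length P) \<cdot> Ident C X))"
    by (rule seq_morphism_comp[OF direct_sum_morphism[OF ds fD(2) gD(2) PD(2) f g] st PD(2) sD(2) tD(2)])
  then show ?thesis using codiagonal_comp[OF b0 fg] B1 PD by simp
qed

text \<open>Both \<open>u\<close>, through \<open>hs\<close>, and \<open>f + g\<close>, through the
  direct sum, are left components of morphisms from \<open>P\<close> to \<open>ts\<close> over the
  diagonal, and such components are unique up to homotopy. So Baer sums correspond to sums of maps
  on \<open>K\<close>.\<close>

lemma baer_sum_lift:
  assumes P: "P \<in> extensions C j X K" and j: "0 < j" and proj: "\<And>k. 1 \<le> k \<Longrightarrow> k \<le> j \<Longrightarrow> seq_obj C P k \<in> Proj C"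
    and fs: "fs \<in> extensions C j X Y" and gs: "gs \<in> extensions C j X Y" and hs: "hs \<in> extensions C j X Y"
    and f: "seq_morphism C P fs f (Ident C X)" and g: "seq_morphism C P gs g (Ident C X)"
    and u: "seq_morphism C P hs u (Ident C X)"
    and baer: "baer_sum C j X Y fs gs hs"
  shows "homotopic C (P ! 0) u (Plus C f g)"
proof -
  note PD = extensionsD[OF P j] and fD = extensionsD[OF fs j] and gD = extensionsD[OF gs j] and hD = extensionsD[OF hs j]
  obtain ss ts i1 i2 p1 p2 XX where ds: "seq_direct_sum C fs gs ss i1 i2 p1 p2" and XX: "XX = seq_obj C ss (Suc j)"
    and ts: "ts \<in> extensions C j XX Y"
    and st: "seq_morphism C ss ts (Plus C (p1 0) (p2 0)) (Ident C XX)"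
    and ht: "seq_morphism C hs ts (Ident C Y) (Plus C (i1 (Suc j)) (i2 (Suc j)))"
    using baer unfolding baer_sum_def by blast
  note tD = extensionsD[OF ts j]
  note F = seq_morphism_ends(1-3)[OF f] seq_morphism_ends(1-3)[OF g] seq_morphism_ends(1-3)[OF u]
  note 1 = baer_sum_chain[OF P j fs gs f g ds ts st[unfolded XX]]
  have "seq_morphism C P ts (Ident C Y \<cdot> u) (Plus C (i1 (Suc j)) (i2 (Suc j)) \<cdot> Ident C X)"
    by (rule seq_morphism_comp[OF u ht PD(2) hD(2) tD(2)])
  then have 2: "seq_morphism C P ts u (Plus C (i1 (Suc j)) (i2 (Suc j)))"
    using F seq_morphism_ends[OF 1] hD PD by simp
  have "\<exists>w\<in>homset C (seq_obj C P 1) (seq_obj C ts 0). arr_diff C u (Plus C f g) = w \<cdot> P ! 0"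
    by (rule lift_extension_unique[OF P j proj tD(2,1,5) 2 1])
  then show ?thesis unfolding homotopic_def
    using exact_seqD(3)[OF PD(2), of 0] PD(1) F hD tD by (auto simp: hom_iff)
qed

end

context enough_proj_inj
begin

text \<open>Instead of building a pullback along the diagonal, \<open>hs\<close> is taken as the
  pushout of \<open>P\<close> along \<open>f + g\<close>. Its universal property supplies the
  morphism from \<open>hs\<close> to \<open>ts\<close> over the diagonal.\<close>

lemma baer_sum_ex:
  assumes fs: "fs \<in> extensions C j X Y" and gs: "gs \<in> extensions C j X Y" and j: "0 < j"
  shows "\<exists>hs. hs \<in> extensions C j X Y \<and> baer_sum C j X Y fs gs hs"
proof -
  note fD = extensionsD[OF fs j] and gD = extensionsD[OF gs j]
  obtain P K where P: "P \<in> extensions C j X K" and proj: "\<And>k. 1 \<le> k \<Longrightarrow> k \<le> j \<Longrightarrow> seq_obj C P k \<in> Proj C"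
    using presentation_ex[OF fD(7) j] by metis
  note PD = extensionsD[OF P j]
  have idX: "Ident C X \<in> homset C X X" using fD by (simp add: hom_iff)
  obtain f where f: "seq_morphism C P fs f (Ident C X)" using lift_extension[OF P j proj fs idX] by blast
  obtain g where g: "seq_morphism C P gs g (Ident C X)" using lift_extension[OF P j proj gs idX] by blast
  obtain ss i1 i2 p1 p2 where ds: "seq_direct_sum C fs gs ss i1 i2 p1 p2"
    using direct_sum_ex[OF fs gs j] .
  define XX where "XX = seq_obj C ss (Suc j)"
  have ss: "ss \<in> extensions C j XX (seq_obj C ss 0)"
    using direct_sum_extension[OF ds fs gs j] by (simp add: XX_def)
  note sD = extensionsD[OF ss j]
  have b0: "is_biproduct C Y Y (seq_obj C ss 0) (i1 0) (i2 0) (p1 0) (p2 0)"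
    using seq_direct_sumD(3)[OF ds, of 0] fD gD by simp
  note B0 = biproductD(1-15)[OF b0]
  note F = seq_morphism_ends(1-3)[OF f] seq_morphism_ends(1-3)[OF g]
  have nab: "Plus C (p1 0) (p2 0) \<in> homset C (seq_obj C ss 0) Y" using B0 by (auto simp: hom_iff)
  obtain ts where ts: "ts \<in> extensions C j XX Y" "seq_morphism C ss ts (Plus C (p1 0) (p2 0)) (Ident C XX)"
    using pushout_extension[OF ss j nab] by metis
  note tD = extensionsD[OF ts(1) j]
  have fg: "Plus C f g \<in> homset C K Y" using F PD fD gD by (simp add: hom_iff)
  obtain hs where hs: "hs \<in> extensions C j X Y"
    and univ: "\<And>G a b. exact_seq C G \<Longrightarrow> a \<in> homset C Y (seq_obj C G 0) \<Longrightarrow>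
       seq_morphism C P G (a \<cdot> Plus C f g) b \<Longrightarrow> seq_morphism C hs G a b"
    using pushout_extension[OF P j fg] by metis
  note 1 = baer_sum_chain[OF P j fs gs f g ds ts[unfolded XX_def]]
  have "Ident C Y \<cdot> Plus C f g = Plus C f g" using fg by (auto simp: hom_iff)
  then have ht: "seq_morphism C hs ts (Ident C Y) (Plus C (i1 (Suc j)) (i2 (Suc j)))"
    using 1 tD fD by (intro univ) (auto simp: hom_iff)
  have "baer_sum C j X Y fs gs hs"
    unfolding baer_sum_def using ds ts hs ht XX_def by blast
  then show ?thesis using hs by blast
qed

lemma baer_sum_ext:
  assumes "baer_sum C j X Y fs gs hs"
  shows "hs \<in> extensions C j X Y"
  using assms by (auto simp: baer_sum_def)

text \<open>All six extensions are compared on one projective presentation. There equivalence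
  amounts to homotopy of left components, and sums of homotopic maps are homotopic.\<close>

lemma baer_sum_unique:
  assumes j: "0 < j" and fs: "fs \<in> extensions C j X Y" "(fs, fs') \<in> ext_equiv C j X Y"
    and gs: "gs \<in> extensions C j X Y" "(gs, gs') \<in> ext_equiv C j X Y"
    and baer: "baer_sum C j X Y fs gs hs" "baer_sum C j X Y fs' gs' hs'"
  shows "(hs, hs') \<in> ext_equiv C j X Y"
proof -
  have fs': "fs' \<in> extensions C j X Y" and gs': "gs' \<in> extensions C j X Y"
    using ext_equiv_extensions[OF fs(2)] fs(1) ext_equiv_extensions[OF gs(2)] gs(1) by auto
  note hs = baer_sum_ext[OF baer(1)] and hs' = baer_sum_ext[OF baer(2)]
  note fD = extensionsD[OF fs(1) j]
  obtain P K where P: "P \<in> extensions C j X K" and proj: "\<And>k. 1 \<le> k \<Longrightarrow> k \<le> j \<Longrightarrow> seq_obj C P k \<in> Proj C"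
    using presentation_ex[OF fD(7) j] by metis
  note PD = extensionsD[OF P j]
  have idX: "Ident C X \<in> homset C X X" using fD by (simp add: hom_iff)
  have lift: "\<exists>f. seq_morphism C P E f (Ident C X)" if "E \<in> extensions C j X Y" for E
    using lift_extension[OF P j proj that idX] by blast
  obtain f f' g g' u u' where m: "seq_morphism C P fs f (Ident C X)" "seq_morphism C P fs' f' (Ident C X)"
    "seq_morphism C P gs g (Ident C X)" "seq_morphism C P gs' g' (Ident C X)"
    "seq_morphism C P hs u (Ident C X)" "seq_morphism C P hs' u' (Ident C X)"
    using lift fs fs' gs gs' hs hs' by metis
  have P0: "P ! 0 \<in> Arr C" "Dom C (P ! 0) = K" "Cod C (P ! 0) = seq_obj C P 1"
    using exact_seqD[OF PD(2), of 0] PD by auto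
  have hom: "a \<in> homset C (Dom C (P ! 0)) Y" if "seq_morphism C P E a (Ident C X)" "E \<in> extensions C j X Y" for a E
    using seq_morphism_ends(1-3)[OF that(1)] extensionsD[OF that(2) j] PD P0 by (simp add: hom_iff)
  note H = hom[OF m(1) fs(1)] hom[OF m(2) fs'] hom[OF m(3) gs(1)] hom[OF m(4) gs'] hom[OF m(5) hs] hom[OF m(6) hs']
  obtain J d where J: "injective_coresolution C Y J d" using coresolution_ex[OF fD(8)] .
  have ac: "acyclic_seq C J d j P" by (rule acyclic_proj[OF J proj])
  have 1: "homotopic C (P ! 0) f f'"
    using class_unique[OF J P j ac fs m(1,2)] homD[OF H(1)] P0 by (simp add: homotopic_def)
  have 2: "homotopic C (P ! 0) g g'"
    using class_unique[OF J P j ac gs m(3,4)] homD[OF H(3)] P0 by (simp add: homotopic_def)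
  have 3: "homotopic C (P ! 0) u (Plus C f g)" by (rule baer_sum_lift[OF P j proj fs(1) gs(1) hs m(1,3,5) baer(1)])
  have 4: "homotopic C (P ! 0) u' (Plus C f' g')" by (rule baer_sum_lift[OF P j proj fs' gs' hs' m(2,4,6) baer(2)])
  have S: "Plus C f g \<in> homset C (Dom C (P ! 0)) Y" "Plus C f' g' \<in> homset C (Dom C (P ! 0)) Y"
    using H by (auto simp: hom_iff)
  have "homotopic C (P ! 0) (Plus C f g) (Plus C f' g')"
    by (rule homotopic_Plus[OF 1 2 P0(1) H(1,2,3,4)])
  then have "homotopic C (P ! 0) u (Plus C f' g')" by (rule homotopic_trans[OF 3 _ P0(1) H(5) S])
  then have "homotopic C (P ! 0) u u'"
    by (rule homotopic_trans[OF _ homotopic_sym[OF 4 P0(1) H(6) S(2)] P0(1) H(5) S(2) H(6)])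
  then obtain w where "w \<in> homset C (seq_obj C P 1) Y" "arr_diff C u u' = w \<cdot> P ! 0"
    using P0 homD[OF H(5)] by (auto simp: homotopic_def)
  from ext_equiv_of_common[OF P j hs hs' m(5,6) this] show ?thesis .
qed

text \<open>\<open>ext_add\<close> ranges over all representatives and all choices of a Baer sum;
  \<open>baer_sum_unique\<close> shows that these choices stay within one class.\<close>

lemma ext_add_class:
  assumes j: "0 < j" and fs: "fs \<in> extensions C j X Y" and gs: "gs \<in> extensions C j X Y"
    and baer: "baer_sum C j X Y fs gs hs"
  shows "ext_add C j X Y (ext_equiv C j X Y `` {fs}) (ext_equiv C j X Y `` {gs}) = ext_equiv C j X Y `` {hs}"
proof -
  have "ext_equiv C j X Y `` {h. \<exists>f\<in>ext_equiv C j X Y `` {fs}. \<exists>g\<in>ext_equiv C j X Y `` {gs}. baer_sum C j X Y f g h}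
    = ext_equiv C j X Y `` {hs}" (is "?L = ?R")
  proof
    show "?L \<subseteq> ?R"
    proof
      fix x assume "x \<in> ?L"
      then obtain h f g where h: "(h, x) \<in> ext_equiv C j X Y" "(fs, f) \<in> ext_equiv C j X Y" "(gs, g) \<in> ext_equiv C j X Y"
        "baer_sum C j X Y f g h" by blast
      have "(hs, h) \<in> ext_equiv C j X Y" by (rule baer_sum_unique[OF j fs h(2) gs h(3) baer h(4)])
      from ext_equiv_trans[OF this h(1)] show "x \<in> ?R" by simp
    qed
    have "hs \<in> {h. \<exists>f\<in>ext_equiv C j X Y `` {fs}. \<exists>g\<in>ext_equiv C j X Y `` {gs}. baer_sum C j X Y f g h}"
      using baer by (intro CollectI bexI[of _ fs] bexI[of _ gs]) auto
    then show "?R \<subseteq> ?L" by blast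
  qed
  then show ?thesis using j by (simp add: ext_add_def)
qed

end

section \<open>Exact functors and Ext\<close>

locale additive_functor_between = D: abelian_category D + E: abelian_category E
  for D :: "('o1, 'm1) precat" and E :: "('o2, 'm2) precat" and F :: "('o1, 'm1, 'o2, 'm2) prefunctor" +
  assumes additive: "additive_functor D E F"
begin

lemma F_Obj [simp]: "X \<in> Obj D \<Longrightarrow> OMap F X \<in> Obj E"
  using additive by (auto simp: additive_functor_def)

lemma F_simps [simp]:
  assumes "f \<in> Arr D"
  shows "AMap F f \<in> Arr E" "Dom E (AMap F f) = OMap F (Dom D f)" "Cod E (AMap F f) = OMap F (Cod D f)"
proof -
  have "\<forall>X\<in>Obj D. \<forall>Y\<in>Obj D. \<forall>f\<in>homset D X Y. AMap F f \<in> homset E (OMap F X) (OMap F Y)"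
    using additive unfolding additive_functor_def by (elim conjE)
  from this[rule_format, of "Dom D f" "Cod D f" f]
  have "AMap F f \<in> homset E (OMap F (Dom D f)) (OMap F (Cod D f))"
    using assms by (simp add: D.hom_iff)
  then show "AMap F f \<in> Arr E" "Dom E (AMap F f) = OMap F (Dom D f)" "Cod E (AMap F f) = OMap F (Cod D f)"
    by (auto simp: E.hom_iff)
qed

lemma F_Ident [simp]: "X \<in> Obj D \<Longrightarrow> AMap F (Ident D X) = Ident E (OMap F X)"
  using additive unfolding additive_functor_def by blast

lemma F_comp [simp]:
  assumes "f \<in> Arr D" "g \<in> Arr D" "Cod D f = Dom D g"
  shows "AMap F (g \<cdot>\<^bsub>D\<^esub> f) = AMap F g \<cdot>\<^bsub>E\<^esub> AMap F f"
proof -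
  have "\<forall>X\<in>Obj D. \<forall>Y\<in>Obj D. \<forall>Z\<in>Obj D. \<forall>f\<in>homset D X Y. \<forall>g\<in>homset D Y Z.
        AMap F (g \<cdot>\<^bsub>D\<^esub> f) = AMap F g \<cdot>\<^bsub>E\<^esub> AMap F f"
    using additive unfolding additive_functor_def by (elim conjE)
  from this[rule_format, of "Dom D f" "Cod D f" "Cod D g" f g] show ?thesis
    using assms by (simp add: D.hom_iff)
qed

lemma F_Plus [simp]:
  assumes "f \<in> Arr D" "g \<in> Arr D" "Dom D f = Dom D g" "Cod D f = Cod D g"
  shows "AMap F (Plus D f g) = Plus E (AMap F f) (AMap F g)"
proof -
  have "\<forall>X\<in>Obj D. \<forall>Y\<in>Obj D. \<forall>f\<in>homset D X Y. \<forall>g\<in>homset D X Y.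
        AMap F (Plus D f g) = Plus E (AMap F f) (AMap F g)"
    using additive unfolding additive_functor_def by (elim conjE)
  from this[rule_format, of "Dom D f" "Cod D f" f g] show ?thesis
    using assms by (simp add: D.hom_iff)
qed

lemma F_Zero [simp]:
  assumes "X \<in> Obj D" "Y \<in> Obj D"
  shows "AMap F (Zero D X Y) = Zero E (OMap F X) (OMap F Y)"
\<comment> \<open>Preservation of zero is not part of \<open>additive_functor\<close>; it follows by
  cancelling in \<open>F 0 + F 0 = F 0\<close>.\<close>
proof (rule E.Plus_left_cancel[of "AMap F (Zero D X Y)"])
  have "Plus E (AMap F (Zero D X Y)) (AMap F (Zero D X Y)) = AMap F (Plus D (Zero D X Y) (Zero D X Y))"
    using assms by (subst F_Plus) auto
  also have "\<dots> = AMap F (Zero D X Y)" using assms by simp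
  finally show "Plus E (AMap F (Zero D X Y)) (AMap F (Zero D X Y)) =
    Plus E (AMap F (Zero D X Y)) (Zero E (OMap F X) (OMap F Y))" using assms by simp
qed (use assms in auto)

lemma F_neg:
  assumes "f \<in> Arr D"
  shows "AMap F (arr_neg D f) = arr_neg E (AMap F f)"
proof (rule E.neg_unique)
  have "Plus E (AMap F f) (AMap F (arr_neg D f)) = AMap F (Plus D f (arr_neg D f))"
    using assms by (subst F_Plus) auto
  then show "Plus E (AMap F f) (AMap F (arr_neg D f)) = Zero E (Dom E (AMap F f)) (Cod E (AMap F f))"
    using assms by (simp add: D.Plus_neg)
qed (use assms in auto)

lemma F_minus:
  assumes "f \<in> Arr D" "g \<in> Arr D" "Dom D f = Dom D g" "Cod D f = Cod D g"
  shows "AMap F (arr_diff D f g) = arr_diff E (AMap F f) (AMap F g)"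
  using assms by (simp add: arr_diff_def F_neg)

end

section \<open>The map on extensions induced by an exact functor\<close>

locale exact_functor = additive_functor_between +
  assumes kernel: "is_kernel D k f \<Longrightarrow> is_kernel E (AMap F k) (AMap F f)"
    and cokernel: "is_cokernel D k f \<Longrightarrow> is_cokernel E (AMap F k) (AMap F f)"
begin

lemma F_mono: "is_mono D f \<Longrightarrow> is_mono E (AMap F f)"
  using D.mono_is_kernel[of f] kernel E.kernelD(5) by blast

lemma F_epi: "is_epi D f \<Longrightarrow> is_epi E (AMap F f)"
  using D.epi_is_cokernel[of f] cokernel E.cokernelD(5) by blast

lemma F_exact_at: "exact_at D f g \<Longrightarrow> exact_at E (AMap F f) (AMap F g)"
  unfolding exact_at_def is_image_def using kernel cokernel by blast

lemma F_seq_obj: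
  assumes "exact_seq D fs" "k \<le> length fs"
  shows "seq_obj E (map (AMap F) fs) k = OMap F (seq_obj D fs k)"
proof -
  have "fs \<noteq> []" "set fs \<subseteq> Arr D" using assms(1) by (auto simp: exact_seq_def)
  moreover have "fs ! k \<in> set fs" if "k < length fs" using that by simp
  moreover have "last fs \<in> set fs" using calculation(1) by simp
  ultimately show ?thesis by (auto simp: seq_obj_def last_map subset_iff)
qed

lemma F_exact_seq:
  assumes "exact_seq D fs"
  shows "exact_seq E (map (AMap F) fs)"
  using assms F_exact_at by (auto simp: exact_seq_def)

lemma F_extension:
  assumes "fs \<in> extensions D j X Y" "0 < j"
  shows "map (AMap F) fs \<in> extensions E j (OMap F X) (OMap F Y)"
proof -
  note fD = D.extensionsD[OF assms]
  have 1: "seq_obj E (map (AMap F) fs) 0 = OMap F Y" "seq_obj E (map (AMap F) fs) (Suc j) = OMap F X"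
    using F_seq_obj[OF fD(2)] fD by auto
  have 2: "map (AMap F) fs ! 0 = AMap F (fs ! 0)" "map (AMap F) fs ! j = AMap F (fs ! j)"
    using fD(1) by auto
  show ?thesis
    unfolding E.extensions_iff[OF assms(2)] 1 2
    using F_exact_seq[OF fD(2)] F_mono[OF fD(5)] F_epi[OF fD(6)] fD(1) by simp
qed

lemma F_seq_morphism:
  assumes "seq_morphism D fs gs a b" "exact_seq D fs" "exact_seq D gs"
  shows "seq_morphism E (map (AMap F) fs) (map (AMap F) gs) (AMap F a) (AMap F b)"
proof -
  from assms(1) obtain h where h: "h 0 = a" "h (length fs) = b" "seq_map D fs gs h"
    by (rule D.seq_morphismE)
  note h = h(1,2) D.seq_mapD[OF h(3)]
  show ?thesis
  proof (rule E.seq_morphismI[of "\<lambda>k. AMap F (h k)"])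
    fix k assume k: "k < length (map (AMap F) fs)"
    then have k': "k < length fs" "k < length gs" using h(3) by auto
    note D = D.exact_seqD[OF assms(2) k'(1)] D.exact_seqD[OF assms(3) k'(2)] h(4-6)[of k] h(4-6)[of "Suc k"]
    have "AMap F (gs ! k) \<cdot>\<^bsub>E\<^esub> AMap F (h k) = AMap F (gs ! k \<cdot>\<^bsub>D\<^esub> h k)"
      by (rule F_comp[symmetric]) (use D k' in auto)
    also have "\<dots> = AMap F (h (Suc k)) \<cdot>\<^bsub>E\<^esub> AMap F (fs ! k)"
      unfolding h(7)[OF k'(1)] by (rule F_comp) (use D k' in auto)
    finally show "map (AMap F) gs ! k \<cdot>\<^bsub>E\<^esub> AMap F (h k) = AMap F (h (Suc k)) \<cdot>\<^bsub>E\<^esub> map (AMap F) fs ! k"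
      using k' by simp
  qed (use h(1-6) F_seq_obj[OF assms(2)] F_seq_obj[OF assms(3)] in auto)
qed

lemma F_ext_equiv:
  assumes "(fs, gs) \<in> ext_equiv D j X Y" "fs \<in> extensions D j X Y" "0 < j"
  shows "(map (AMap F) fs, map (AMap F) gs) \<in> ext_equiv E j (OMap F X) (OMap F Y)"
proof -
  have step: "(map (AMap F) fs, map (AMap F) gs) \<in> ext_step E j (OMap F X) (OMap F Y)"
    if "(fs, gs) \<in> ext_step D j X Y" for fs gs
  proof -
    have s: "fs \<in> extensions D j X Y" "gs \<in> extensions D j X Y" "seq_morphism D fs gs (Ident D Y) (Ident D X)"
      using that by (auto simp: D.ext_step_iff[OF assms(3)])
    note sD = D.extensionsD[OF s(1) assms(3)] D.extensionsD[OF s(2) assms(3)]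
    show ?thesis unfolding E.ext_step_iff[OF assms(3)]
      using F_extension[OF s(1) assms(3)] F_extension[OF s(2) assms(3)] F_seq_morphism[OF s(3)] sD by simp
  qed
  show ?thesis
    using assms(1,2)
  proof (induction rule: ext_equiv_induct)
    case (step_fwd gs hs)
    then show ?case using step[of gs hs] by (meson ext_equiv_step ext_equiv_trans)
  next
    case (step_bwd gs hs)
    then show ?case using step[of hs gs] by (meson ext_equiv_step ext_equiv_trans ext_equiv_sym)
  qed simp
qed

lemma F_biproduct:
  assumes "is_biproduct D X Y S i1 i2 p1 p2"
  shows "is_biproduct E (OMap F X) (OMap F Y) (OMap F S) (AMap F i1) (AMap F i2) (AMap F p1) (AMap F p2)"
proof -
  note B = D.biproductD(1-15)[OF assms]
  have eqs: "p1 \<cdot>\<^bsub>D\<^esub> i1 = Ident D X" "p2 \<cdot>\<^bsub>D\<^esub> i2 = Ident D Y" "p2 \<cdot>\<^bsub>D\<^esub> i1 = Zero D X Y"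
    "p1 \<cdot>\<^bsub>D\<^esub> i2 = Zero D Y X" "Plus D (i1 \<cdot>\<^bsub>D\<^esub> p1) (i2 \<cdot>\<^bsub>D\<^esub> p2) = Ident D S"
    using assms by (auto simp: is_biproduct_def)
  have "AMap F (p1 \<cdot>\<^bsub>D\<^esub> i1) = Ident E (OMap F X)" "AMap F (p2 \<cdot>\<^bsub>D\<^esub> i2) = Ident E (OMap F Y)"
    "AMap F (p2 \<cdot>\<^bsub>D\<^esub> i1) = Zero E (OMap F X) (OMap F Y)" "AMap F (p1 \<cdot>\<^bsub>D\<^esub> i2) = Zero E (OMap F Y) (OMap F X)"
    "AMap F (Plus D (i1 \<cdot>\<^bsub>D\<^esub> p1) (i2 \<cdot>\<^bsub>D\<^esub> p2)) = Ident E (OMap F S)"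
    unfolding eqs using B by auto
  then show ?thesis unfolding is_biproduct_def using B by (simp add: E.hom_iff)
qed

lemma F_baer_sum:
  assumes j: "0 < j" and fs: "fs \<in> extensions D j X Y" and gs: "gs \<in> extensions D j X Y"
    and D: "enough_proj D"
    and baer: "baer_sum D j X Y fs gs hs"
  shows "baer_sum E j (OMap F X) (OMap F Y) (map (AMap F) fs) (map (AMap F) gs) (map (AMap F) hs)"
proof -
  obtain ss ts i1 i2 p1 p2 XX where ds: "seq_direct_sum D fs gs ss i1 i2 p1 p2" and XX: "XX = seq_obj D ss (Suc j)"
    and ts: "ts \<in> extensions D j XX Y" and hs: "hs \<in> extensions D j X Y"
    and st: "seq_morphism D ss ts (Plus D (p1 0) (p2 0)) (Ident D XX)"
    and ht: "seq_morphism D hs ts (Ident D Y) (Plus D (i1 (Suc j)) (i2 (Suc j)))"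
    using baer unfolding baer_sum_def by blast
  note fD = D.extensionsD[OF fs j] and gD = D.extensionsD[OF gs j] and hD = D.extensionsD[OF hs j]
    and tD = D.extensionsD[OF ts j]
  \<comment> \<open>Exactness of the direct sum \<open>ss\<close> enters here, because
    \<open>F_seq_obj\<close> and \<open>F_seq_morphism\<close> speak about exact sequences.\<close>
  note sD = D.extensionsD[OF enough_proj.direct_sum_extension[OF D ds fs gs j] j]
  note dD = D.seq_direct_sumD[OF ds]
  have b: "is_biproduct D (seq_obj D fs k) (seq_obj D gs k) (seq_obj D ss k) (i1 k) (i2 k) (p1 k) (p2 k)" if "k \<le> Suc j" for k
    using dD(3) that fD(1) by simp
  note B0 = D.biproductD(1-15)[OF b[of 0]] and B1 = D.biproductD(1-15)[OF b[of "Suc j"]]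
  have lens: "length fs = Suc j" "length gs = Suc j" "length ss = Suc j" using fD gD sD by auto
  have "seq_direct_sum E (map (AMap F) fs) (map (AMap F) gs) (map (AMap F) ss)
    (\<lambda>k. AMap F (i1 k)) (\<lambda>k. AMap F (i2 k)) (\<lambda>k. AMap F (p1 k)) (\<lambda>k. AMap F (p2 k))"
    unfolding seq_direct_sum_def
  proof (intro conjI allI impI)
    fix k assume "k \<le> length (map (AMap F) fs)"
    then have "k \<le> Suc j" using lens by simp
    then show "is_biproduct E (seq_obj E (map (AMap F) fs) k) (seq_obj E (map (AMap F) gs) k)
          (seq_obj E (map (AMap F) ss) k) (AMap F (i1 k)) (AMap F (i2 k)) (AMap F (p1 k)) (AMap F (p2 k))"
      using F_biproduct[OF b[of k]] F_seq_obj[OF fD(2)] F_seq_obj[OF gD(2)] F_seq_obj[OF sD(2)] lens by simp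
  next
    fix k assume "k < length (map (AMap F) fs)"
    then have k: "k \<le> j" "k \<le> Suc j" "Suc k \<le> Suc j" using lens by auto
    note B = D.biproductD(1-15)[OF b[OF k(2)]] D.biproductD(1-15)[OF b[OF k(3)]]
    note S = D.exact_seqD[OF fD(2), of k] D.exact_seqD[OF gD(2), of k]
    have s: "ss ! k = Plus D (i1 (Suc k) \<cdot>\<^bsub>D\<^esub> fs ! k \<cdot>\<^bsub>D\<^esub> p1 k) (i2 (Suc k) \<cdot>\<^bsub>D\<^esub> gs ! k \<cdot>\<^bsub>D\<^esub> p2 k)"
      using dD(4)[of k] k lens by simp
    have "AMap F (ss ! k) = Plus E (AMap F (i1 (Suc k)) \<cdot>\<^bsub>E\<^esub> AMap F (fs ! k) \<cdot>\<^bsub>E\<^esub> AMap F (p1 k))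
      (AMap F (i2 (Suc k)) \<cdot>\<^bsub>E\<^esub> AMap F (gs ! k) \<cdot>\<^bsub>E\<^esub> AMap F (p2 k))"
      unfolding s using B S k lens by simp
    then show "map (AMap F) ss ! k =
         Plus E (AMap F (i1 (Suc k)) \<cdot>\<^bsub>E\<^esub> map (AMap F) fs ! k \<cdot>\<^bsub>E\<^esub> AMap F (p1 k))
          (AMap F (i2 (Suc k)) \<cdot>\<^bsub>E\<^esub> map (AMap F) gs ! k \<cdot>\<^bsub>E\<^esub> AMap F (p2 k))"
      using k lens by simp
  qed (use lens in auto)
  moreover have "OMap F XX = seq_obj E (map (AMap F) ss) (Suc j)"
    using F_seq_obj[OF sD(2)] lens XX by simp
  moreover have "seq_morphism E (map (AMap F) ss) (map (AMap F) ts) (Plus E (AMap F (p1 0)) (AMap F (p2 0))) (Ident E (OMap F XX))"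
    using F_seq_morphism[OF st sD(2) tD(2)] B0 tD fD gD by simp
  moreover have "seq_morphism E (map (AMap F) hs) (map (AMap F) ts) (Ident E (OMap F Y))
      (Plus E (AMap F (i1 (Suc j))) (AMap F (i2 (Suc j))))"
    using F_seq_morphism[OF ht hD(2) tD(2)] B1 hD fD gD by simp
  ultimately show ?thesis unfolding baer_sum_def
    using F_extension[OF ts j] F_extension[OF hs j] by blast
qed

lemma ext_map_class:
  assumes "fs \<in> extensions D j X Y" "0 < j"
  shows "ext_map E F j X Y (ext_equiv D j X Y `` {fs}) = ext_equiv E j (OMap F X) (OMap F Y) `` {map (AMap F) fs}"
    (is "?L = ?R")
proof
  show "?L \<subseteq> ?R"
  proof
    fix x assume "x \<in> ?L"
    then obtain g where g: "(fs, g) \<in> ext_equiv D j X Y" "(map (AMap F) g, x) \<in> ext_equiv E j (OMap F X) (OMap F Y)"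
      by (auto simp: ext_map_def)
    from ext_equiv_trans[OF F_ext_equiv[OF g(1) assms] g(2)] show "x \<in> ?R" by simp
  qed
  have "fs \<in> ext_equiv D j X Y `` {fs}" by simp
  then show "?R \<subseteq> ?L" unfolding ext_map_def by blast
qed

text \<open>Reduces the isomorphism of groups to injectivity and surjectivity on extensions up to
  equivalence. Additivity comes for free: a Baer sum in \<open>D\<close> is mapped to a Baer sum in
  \<open>E\<close>, and any Baer sum represents the sum of the classes.\<close>

lemma ext_map_iso:
  assumes D: "enough_proj_inj D" and E: "enough_proj_inj E" and j: "0 < j"
    and inj: "\<And>fs gs. fs \<in> extensions D j X Y \<Longrightarrow> gs \<in> extensions D j X Y \<Longrightarrow>
      (map (AMap F) fs, map (AMap F) gs) \<in> ext_equiv E j (OMap F X) (OMap F Y) \<Longrightarrow> (fs, gs) \<in> ext_equiv D j X Y"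
    and surj: "\<And>hs. hs \<in> extensions E j (OMap F X) (OMap F Y) \<Longrightarrow>
      \<exists>fs\<in>extensions D j X Y. (hs, map (AMap F) fs) \<in> ext_equiv E j (OMap F X) (OMap F Y)"
  shows "ext_map E F j X Y \<in> iso (Ext D j X Y) (Ext E j (OMap F X) (OMap F Y))"
proof -
  let ?q = "ext_equiv D j X Y" and ?r = "ext_equiv E j (OMap F X) (OMap F Y)"
  have cl: "\<exists>fs\<in>extensions D j X Y. a = ?q `` {fs}" if "a \<in> extensions D j X Y // ?q" for a
    using that by (auto simp: quotient_def)
  have clE: "?r `` {map (AMap F) fs} \<in> extensions E j (OMap F X) (OMap F Y) // ?r" if "fs \<in> extensions D j X Y" for fs
    using F_extension[OF that j] by (auto simp: quotient_def)
  have "ext_map E F j X Y \<in> hom (Ext D j X Y) (Ext E j (OMap F X) (OMap F Y))"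
    unfolding hom_def
  proof (intro CollectI conjI ballI)
    show "ext_map E F j X Y \<in> carrier (Ext D j X Y) \<rightarrow> carrier (Ext E j (OMap F X) (OMap F Y))"
    proof
      fix a assume "a \<in> carrier (Ext D j X Y)"
      then have "a \<in> extensions D j X Y // ?q" by (simp add: Ext_def)
      then obtain fs where fs: "fs\<in>extensions D j X Y" "a = ?q `` {fs}" using cl by blast
      have "ext_map E F j X Y a \<in> extensions E j (OMap F X) (OMap F Y) // ?r"
        unfolding fs(2) ext_map_class[OF fs(1) j] by (rule clE[OF fs(1)])
      then show "ext_map E F j X Y a \<in> carrier (Ext E j (OMap F X) (OMap F Y))" by (simp add: Ext_def)
    qed
    fix a b assume "a \<in> carrier (Ext D j X Y)" "b \<in> carrier (Ext D j X Y)"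
    then have "a \<in> extensions D j X Y // ?q" "b \<in> extensions D j X Y // ?q" by (simp_all add: Ext_def)
    then obtain fs gs where fs: "fs \<in> extensions D j X Y" "a = ?q `` {fs}" and gs: "gs \<in> extensions D j X Y" "b = ?q `` {gs}"
      using cl by meson
    obtain hs where hs: "hs \<in> extensions D j X Y" "baer_sum D j X Y fs gs hs"
      using enough_proj_inj.baer_sum_ex[OF D fs(1) gs(1) j] by blast
    have "ext_map E F j X Y (ext_add D j X Y a b) = ?r `` {map (AMap F) hs}"
      unfolding fs(2) gs(2) enough_proj_inj.ext_add_class[OF D j fs(1) gs(1) hs(2)]
      by (rule ext_map_class[OF hs(1) j])
    also have "\<dots> = ext_add E j (OMap F X) (OMap F Y) (ext_map E F j X Y a) (ext_map E F j X Y b)"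
      unfolding fs(2) gs(2) ext_map_class[OF fs(1) j] ext_map_class[OF gs(1) j]
      by (rule enough_proj_inj.ext_add_class[OF E j F_extension[OF fs(1) j] F_extension[OF gs(1) j]
         F_baer_sum[OF j fs(1) gs(1) enough_proj_inj.axioms(1)[OF D] hs(2)], symmetric])
    finally show "ext_map E F j X Y (a \<otimes>\<^bsub>Ext D j X Y\<^esub> b) =
       ext_map E F j X Y a \<otimes>\<^bsub>Ext E j (OMap F X) (OMap F Y)\<^esub> ext_map E F j X Y b"
      by (simp add: Ext_def)
  qed
  moreover have "bij_betw (ext_map E F j X Y) (extensions D j X Y // ?q) (extensions E j (OMap F X) (OMap F Y) // ?r)"
    unfolding bij_betw_def
  proof
    show "inj_on (ext_map E F j X Y) (extensions D j X Y // ?q)"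
    proof (rule inj_onI)
      fix a b assume "a \<in> extensions D j X Y // ?q" "b \<in> extensions D j X Y // ?q"
        and eq: "ext_map E F j X Y a = ext_map E F j X Y b"
      then obtain fs gs where fs: "fs \<in> extensions D j X Y" "a = ?q `` {fs}" and gs: "gs \<in> extensions D j X Y" "b = ?q `` {gs}"
        using cl by meson
      have "?r `` {map (AMap F) fs} = ?r `` {map (AMap F) gs}"
        using eq unfolding fs(2) gs(2) ext_map_class[OF fs(1) j] ext_map_class[OF gs(1) j] .
      moreover have "map (AMap F) gs \<in> ?r `` {map (AMap F) gs}" by simp
      ultimately have "map (AMap F) gs \<in> ?r `` {map (AMap F) fs}" by simp
      then have "(map (AMap F) fs, map (AMap F) gs) \<in> ?r" by simp
      then have "(fs, gs) \<in> ?q" by (rule inj[OF fs(1) gs(1)])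
      then show "a = b" unfolding fs(2) gs(2) by (rule ext_equiv_class_eq)
    qed
    show "ext_map E F j X Y ` (extensions D j X Y // ?q) = extensions E j (OMap F X) (OMap F Y) // ?r"
    proof
      show "ext_map E F j X Y ` (extensions D j X Y // ?q) \<subseteq> extensions E j (OMap F X) (OMap F Y) // ?r"
      proof
        fix c assume "c \<in> ext_map E F j X Y ` (extensions D j X Y // ?q)"
        then obtain a where a: "a \<in> extensions D j X Y // ?q" "c = ext_map E F j X Y a" by blast
        obtain fs where fs: "fs\<in>extensions D j X Y" "a = ?q `` {fs}" using cl[OF a(1)] by blast
        show "c \<in> extensions E j (OMap F X) (OMap F Y) // ?r"
          unfolding a(2) fs(2) ext_map_class[OF fs(1) j] by (rule clE[OF fs(1)])
      qed
      show "extensions E j (OMap F X) (OMap F Y) // ?r \<subseteq> ext_map E F j X Y ` (extensions D j X Y // ?q)"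
      proof
        fix c assume "c \<in> extensions E j (OMap F X) (OMap F Y) // ?r"
        then obtain hs where hs: "hs \<in> extensions E j (OMap F X) (OMap F Y)" "c = ?r `` {hs}" by (auto simp: quotient_def)
        obtain fs where fs: "fs\<in>extensions D j X Y" "(hs, map (AMap F) fs) \<in> ?r" using surj[OF hs(1)] by blast
        have "c = ext_map E F j X Y (?q `` {fs})"
          unfolding hs(2) ext_map_class[OF fs(1) j] using fs(2) by (rule ext_equiv_class_eq)
        then show "c \<in> ext_map E F j X Y ` (extensions D j X Y // ?q)" using fs(1) by (auto simp: quotient_def)
      qed
    qed
  qed
  ultimately show ?thesis unfolding iso_def by (simp add: Ext_def)
qed

text \<open>The comparison works with any resolution whose terms are acyclic for \<open>Y\<close> (respectively for
  \<open>F Y\<close>): \<open>F R\<close> need not consist of projectives.\<close>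

lemma ext_map_bij_of_acyclic:
  assumes D: "enough_proj_inj D" and E: "enough_proj_inj E" and j: "0 < j"
    and R: "R \<in> extensions D j X K" and Y: "Y \<in> Obj D"
    and J: "injective_coresolution D Y J d" "acyclic_seq D J d j R"
    and J': "injective_coresolution E (OMap F Y) J' d'" "acyclic_seq E J' d' j (map (AMap F) R)"
    and K: "bij_betw (AMap F) (homset D K Y) (homset E (OMap F K) (OMap F Y))"
    and R1: "bij_betw (AMap F) (homset D (seq_obj D R 1) Y) (homset E (OMap F (seq_obj D R 1)) (OMap F Y))"
  shows "\<And>fs gs. fs \<in> extensions D j X Y \<Longrightarrow> gs \<in> extensions D j X Y \<Longrightarrow>
      (map (AMap F) fs, map (AMap F) gs) \<in> ext_equiv E j (OMap F X) (OMap F Y) \<Longrightarrow> (fs, gs) \<in> ext_equiv D j X Y"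
    and "\<And>hs. hs \<in> extensions E j (OMap F X) (OMap F Y) \<Longrightarrow>
      \<exists>fs\<in>extensions D j X Y. (hs, map (AMap F) fs) \<in> ext_equiv E j (OMap F X) (OMap F Y)"
proof -
  interpret D: enough_proj_inj D by (rule D)
  interpret E: enough_proj_inj E by (rule E)
  note RD = D.extensionsD[OF R j] and FR = F_extension[OF R j]
  have R0: "R ! 0 \<in> Arr D" "Dom D (R ! 0) = K" "Cod D (R ! 0) = seq_obj D R 1"
    using D.exact_seqD[OF RD(2), of 0] RD by auto
  have FR0: "map (AMap F) R ! 0 = AMap F (R ! 0)" and FR1: "seq_obj E (map (AMap F) R) 1 = OMap F (seq_obj D R 1)"
    using RD F_seq_obj[OF RD(2), of 1] by auto
  have FM: "seq_morphism E (map (AMap F) R) (map (AMap F) G) (AMap F f) (Ident E (OMap F X))"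
    if "seq_morphism D R G f (Ident D X)" "G \<in> extensions D j X Y" for G f
    using F_seq_morphism[OF that(1) RD(2) D.extensionsD(2)[OF that(2) j]] RD by simp
  {
    fix fs gs assume fs: "fs \<in> extensions D j X Y" and gs: "gs \<in> extensions D j X Y"
      and eq: "(map (AMap F) fs, map (AMap F) gs) \<in> ext_equiv E j (OMap F X) (OMap F Y)"
    obtain fs' f where f: "fs' \<in> extensions D j X Y" "seq_morphism D R fs' f (Ident D X)" "(fs, fs') \<in> ext_equiv D j X Y"
      using D.class_exists[OF J(1) R j J(2) fs] by blast
    obtain gs' g where g: "gs' \<in> extensions D j X Y" "seq_morphism D R gs' g (Ident D X)" "(gs, gs') \<in> ext_equiv D j X Y"
      using D.class_exists[OF J(1) R j J(2) gs] by blast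
    have fh: "f \<in> homset D K Y" "g \<in> homset D K Y"
      using D.seq_morphism_ends(1-3)[OF f(2)] D.seq_morphism_ends(1-3)[OF g(2)] RD D.extensionsD[OF f(1) j] D.extensionsD[OF g(1) j]
      by (auto simp: D.hom_iff)
    have eq': "(map (AMap F) fs', map (AMap F) gs') \<in> ext_equiv E j (OMap F X) (OMap F Y)"
      using F_ext_equiv[OF f(3) fs j] F_ext_equiv[OF g(3) gs j] eq ext_equiv_sym ext_equiv_trans by meson
    \<comment> \<open>Equivalence in \<open>E\<close> gives a homotopy on the image of the term next
      to \<open>K\<close>. Bijectivity on maps out of that term brings back \<open>w\<close>, and
      injectivity on maps out of \<open>K\<close> brings back the equation.\<close>
    obtain w where w: "w\<in>homset E (OMap F (seq_obj D R 1)) (OMap F Y)" "arr_diff E (AMap F f) (AMap F g) = w \<cdot>\<^bsub>E\<^esub> AMap F (R ! 0)"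
      using E.class_unique[OF J'(1) FR j J'(2) F_extension[OF f(1) j] eq' FM[OF f(2,1)] FM[OF g(2,1)]] FR0 FR1 by auto
    obtain v where v: "v \<in> homset D (seq_obj D R 1) Y" "AMap F v = w"
      using R1 w(1) unfolding bij_betw_def by (metis imageE)
    note fD = D.homD[OF fh(1)] D.homD[OF fh(2)] D.homD[OF v(1)]
    have "AMap F (arr_diff D f g) = AMap F (v \<cdot>\<^bsub>D\<^esub> R ! 0)"
      using w(2) v(2) fD R0 by (simp add: F_minus)
    moreover have "arr_diff D f g \<in> homset D K Y" "v \<cdot>\<^bsub>D\<^esub> R ! 0 \<in> homset D K Y"
      using fD R0 by (auto simp: D.hom_iff)
    ultimately have "arr_diff D f g = v \<cdot>\<^bsub>D\<^esub> R ! 0" using K unfolding bij_betw_def by (meson inj_onD)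
    from D.ext_equiv_of_common[OF R j f(1) g(1) f(2) g(2) v(1) this]
    show "(fs, gs) \<in> ext_equiv D j X Y" using f(3) g(3) ext_equiv_sym ext_equiv_trans by meson
  next
    fix hs assume hs: "hs \<in> extensions E j (OMap F X) (OMap F Y)"
    obtain hs' h where h: "hs' \<in> extensions E j (OMap F X) (OMap F Y)"
      "seq_morphism E (map (AMap F) R) hs' h (Ident E (OMap F X))" "(hs, hs') \<in> ext_equiv E j (OMap F X) (OMap F Y)"
      using E.class_exists[OF J'(1) FR j J'(2) hs] by blast
    have "h \<in> homset E (OMap F K) (OMap F Y)"
      using E.seq_morphism_ends(1-3)[OF h(2)] E.extensionsD[OF FR j] E.extensionsD[OF h(1) j] by (simp add: E.hom_iff)
    then obtain f where f: "f \<in> homset D K Y" "AMap F f = h" using K unfolding bij_betw_def by (metis imageE)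
    obtain fs where fs: "fs \<in> extensions D j X Y" "seq_morphism D R fs f (Ident D X)"
      using D.pushout_extension[OF R j f(1)] by metis
    have hD: "h \<in> Arr E" "Dom E h = OMap F K" "Cod E h = OMap F Y" using f D.homD[OF f(1)] by auto
    \<comment> \<open>The left component \<open>h\<close> equals \<open>F f\<close> on the nose, so
      the zero homotopy compares \<open>hs'\<close> with the image of the pushout along
      \<open>f\<close>.\<close>
    have z: "Zero E (seq_obj E (map (AMap F) R) 1) (OMap F Y) \<in> homset E (seq_obj E (map (AMap F) R) 1) (OMap F Y)"
      using FR1 Y R0 D.Dom_Cod_Obj(2)[OF R0(1)] by (simp add: E.hom_iff)
    have "arr_diff E h (AMap F f) = Zero E (seq_obj E (map (AMap F) R) 1) (OMap F Y) \<cdot>\<^bsub>E\<^esub> map (AMap F) R ! 0"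
      unfolding f(2) using hD FR0 FR1 R0 Y by simp
    from ext_equiv_trans[OF h(3) E.ext_equiv_of_common[OF FR j h(1) F_extension[OF fs(1) j] h(2) FM[OF fs(2,1)] z this]]
    show "\<exists>fs\<in>extensions D j X Y. (hs, map (AMap F) fs) \<in> ext_equiv E j (OMap F X) (OMap F Y)"
      using fs(1) by blast
  }
qed

end

section \<open>Resolutions and dimensions\<close>

context abelian_category
begin

lemma zero_objectI:
  assumes "V \<in> Obj C" "Ident C V = Zero C V V"
  shows "zero_object C V"
  unfolding zero_object_def
proof (intro conjI ballI)
  fix Y assume Y: "Y \<in> Obj C"
  have "f = Zero C V Y" if "f \<in> homset C V Y" for f
  proof -
    have "f = f \<cdot> Ident C V" using homD[OF that] by simp
    also have "\<dots> = Zero C V Y" unfolding assms(2) using homD[OF that] assms(1) by simp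
    finally show ?thesis .
  qed
  then show "\<exists>!f. f \<in> homset C V Y" using assms(1) Y by (intro ex1I[of _ "Zero C V Y"]) (auto simp: hom_iff)
  have "f = Zero C Y V" if "f \<in> homset C Y V" for f
  proof -
    have "f = Ident C V \<cdot> f" using homD[OF that] by simp
    also have "\<dots> = Zero C Y V" unfolding assms(2) using homD[OF that] assms(1) by simp
    finally show ?thesis .
  qed
  then show "\<exists>!f. f \<in> homset C Y V" using assms(1) Y by (intro ex1I[of _ "Zero C Y V"]) (auto simp: hom_iff)
qed fact

lemma zero_objectD:
  assumes "zero_object C V"
  shows "V \<in> Obj C" "\<And>f Y. f \<in> homset C V Y \<Longrightarrow> f = Zero C V Y" "\<And>f Y. f \<in> homset C Y V \<Longrightarrow> f = Zero C Y V"
proof -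
  show V: "V \<in> Obj C" using assms by (simp add: zero_object_def)
  fix f Y
  {
    assume f: "f \<in> homset C V Y"
    then have Y: "Y \<in> Obj C" by (auto simp: hom_iff)
    then have "\<exists>!f. f \<in> homset C V Y" using assms by (simp add: zero_object_def)
    moreover have "Zero C V Y \<in> homset C V Y" using V Y by (simp add: hom_iff)
    ultimately show "f = Zero C V Y" using f by blast
  next
    assume f: "f \<in> homset C Y V"
    then have Y: "Y \<in> Obj C" by (auto simp: hom_iff)
    then have "\<exists>!f. f \<in> homset C Y V" using assms by (simp add: zero_object_def)
    moreover have "Zero C Y V \<in> homset C Y V" using V Y by (simp add: hom_iff)
    ultimately show "f = Zero C Y V" using f by blast
  }
qed

lemma zero_object_of_epi_Zero:
  assumes "is_epi C (Zero C Y V)" "Y \<in> Obj C" "V \<in> Obj C"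
  shows "zero_object C V"
  by (rule zero_objectI) (use assms epiD[OF assms(1), of "Ident C V" "Zero C V V"] in auto)

lemma zero_object_of_epi:
  assumes "is_epi C f" "zero_object C (Dom C f)"
  shows "zero_object C (Cod C f)"
proof -
  have "f = Zero C (Dom C f) (Cod C f)"
    using zero_objectD(2)[OF assms(2), of f] epiA[OF assms(1)] by (simp add: hom_iff)
  then have "is_epi C (Zero C (Dom C f) (Cod C f))" using assms(1) by (rule subst)
  then show ?thesis by (rule zero_object_of_epi_Zero) (use epiA[OF assms(1)] in auto)
qed

text \<open>Zero objects have injective dimension \<open>-\<infinity>\<close> by a case of the
  definition that yields no coresolution. This constant one covers that case.\<close>

lemma zero_coresolution:
  assumes "zero_object C Z"
  shows "injective_coresolution C Z (\<lambda>_. Z) (\<lambda>_. Zero C Z Z)"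
proof -
  note Z = zero_objectD[OF assms]
  have zz: "Zero C Z Z \<in> Arr C" "Dom C (Zero C Z Z) = Z" "Cod C (Zero C Z Z) = Z" using Z(1) by auto
  have mono: "is_mono C (Zero C Z Z)"
    by (rule is_monoI[OF zz(1)], unfold zz, rule Z(3)) (auto simp: hom_iff)
  have epi: "is_epi C (Zero C Z Z)"
    by (rule is_epiI[OF zz(1)], unfold zz, rule Z(2)) (auto simp: hom_iff)
  have ker: "is_kernel C (Zero C Z Z) (Zero C Z Z)"
  proof (rule kernelI[OF zz(1) mono])
    fix g assume g: "g \<in> Arr C" "Cod C g = Dom C (Zero C Z Z)"
    have gZ: "g = Zero C (Dom C g) Z" by (rule Z(3)) (use g zz in \<open>simp add: hom_iff\<close>)
    show "\<exists>h\<in>Arr C. Dom C h = Dom C g \<and> Cod C h = Dom C (Zero C Z Z) \<and> Zero C Z Z \<cdot> h = g"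
    proof (rule bexI[of _ g], intro conjI)
      have "Zero C Z Z \<cdot> g = Zero C (Dom C g) Z" using g zz Z(1) by simp
      then show "Zero C Z Z \<cdot> g = g" using gZ by (rule trans[OF _ sym])
    qed (use g in auto)
  qed (use zz Z(1) in auto)
  have ex: "exact_at C (Zero C Z Z) (Zero C Z Z)"
    using exact_atI[OF ker epi] zz Z(1) by simp
  have "Z \<in> Inj C" unfolding Inj_def
  proof (intro CollectI conjI allI impI)
    fix g f assume "is_mono C g \<and> f \<in> homset C (Dom C g) Z"
    then have g: "is_mono C g" "f \<in> homset C (Dom C g) Z" by auto
    have "f = Zero C (Dom C g) Z" by (rule Z(3)[OF g(2)])
    then show "\<exists>h\<in>homset C (Cod C g) Z. h \<cdot> g = f"
      using monoA[OF g(1)] Z(1) by (intro bexI[of _ "Zero C (Cod C g) Z"]) (auto simp: hom_iff)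
  qed (use Z(1) in simp)
  then show ?thesis unfolding injective_coresolution_def using ex mono zz Z(1) by (simp add: hom_iff)
qed

lemma kernel_mono_comp_iff:
  assumes "is_kernel C k (m \<cdot> p)" "is_mono C m" "p \<in> Arr C" "Dom C m = Cod C p"
  shows "is_kernel C k p"
proof (rule kernelI)
  note kD = kernelD[OF assms(1)] and mA = monoA[OF assms(2)]
  show "is_mono C k" "p \<in> Arr C" "Cod C k = Dom C p" using kD mA assms by auto
  have "m \<cdot> (p \<cdot> k) = Zero C (Dom C k) (Cod C m)" using kD mA assms(3,4) by simp
  then have "p \<cdot> k = Zero C (Dom C k) (Dom C m)"
    by (rule mono_Zero[OF assms(2)]) (use kD mA assms(3,4) in auto)
  then show "p \<cdot> k = Zero C (Dom C k) (Cod C p)" using assms(4) by simp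
  fix g assume g: "g \<in> Arr C" "Cod C g = Dom C p" "p \<cdot> g = Zero C (Dom C g) (Cod C p)"
  have "(m \<cdot> p) \<cdot> g = Zero C (Dom C g) (Cod C (m \<cdot> p))" using g mA assms(3,4) by simp
  then show "\<exists>h\<in>Arr C. Dom C h = Dom C g \<and> Cod C h = Dom C k \<and> k \<cdot> h = g"
    by (rule kernel_lift[OF assms(1) g(1), rotated]) (use g mA assms(3,4) in auto)
qed

lemma resolutionD:
  assumes "projective_resolution C X P d"
  shows "P k \<in> Proj C" "d k \<in> Arr C" "Dom C (d k) = P k" "Cod C (d 0) = X" "Cod C (d (Suc k)) = P k"
    "is_epi C (d 0)" "exact_at C (d (Suc k)) (d k)" "X \<in> Obj C"
proof -
  show "P k \<in> Proj C" "Cod C (d 0) = X" "Cod C (d (Suc k)) = P k"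
    "is_epi C (d 0)" "exact_at C (d (Suc k)) (d k)" "X \<in> Obj C"
    using assms by (auto simp: projective_resolution_def hom_iff)
  show "d k \<in> Arr C" "Dom C (d k) = P k"
    using assms by (cases k, auto simp: projective_resolution_def hom_iff)+
qed

text \<open>Dimension shifting: the kernel \<open>K\<close> of \<open>d t\<close> is the syzygy of
  index \<open>t + 1\<close>, and \<open>Ext^s(K, Y)\<close> is controlled by
  \<open>Ext^(s + t + 1)(X, Y)\<close> for \<open>s > 0\<close>.\<close>

lemma syzygy_ext_vanish:
  assumes J: "injective_coresolution C Y J D" and P: "projective_resolution C X P d"
    and X: "\<And>s. N \<le> s \<Longrightarrow> ext_vanish C J D X s"
    and k: "is_kernel C k (d t)" and s: "0 < s" "N \<le> s + Suc t"
  shows "ext_vanish C J D (Dom C k) s"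
  using k s
proof (induction t arbitrary: k s)
  case 0
  note PD = resolutionD[OF P]
  show ?case
    by (rule ext_vanish_kernel[OF J 0(1) PD(6)]) (use 0 X PD ext_vanish_proj[OF J PD(1)] in auto)
next
  case (Suc t)
  note PD = resolutionD[OF P]
  obtain m e where m: "is_kernel C m (d t)" and e: "is_epi C e" "Dom C e = Dom C (d (Suc t))" "Cod C e = Dom C m" "m \<cdot> e = d (Suc t)"
    using exact_atE[OF PD(7)[of t]] by metis
  have k: "is_kernel C k e"
    by (rule kernel_mono_comp_iff[of k m]) (use Suc(2) e kernelD(5)[OF m] epiA[OF e(1)] in auto)
  have "ext_vanish C J D (Dom C m) (Suc s)" by (rule Suc.IH[OF m]) (use Suc in auto)
  then show ?case
    using ext_vanish_kernel[OF J k e(1)] ext_vanish_proj[OF J PD(1)] Suc(3) e PD by simp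
qed

text \<open>Dimension shifting in the other direction, from the left end of a finite resolution
  towards \<open>X\<close>.\<close>

lemma resolution_ext_vanish:
  assumes J: "injective_coresolution C Y J D" and P: "projective_resolution C X P d"
    and z: "\<And>k. n < k \<Longrightarrow> zero_object C (P k)" and s: "n < s"
  shows "ext_vanish C J D X s"
proof -
  note PD = resolutionD[OF P]
  \<comment> \<open>The kernel of \<open>d (n - i)\<close> has no Ext from degree \<open>i\<close>
    on. For \<open>i = 0\<close> it is a quotient of the zero object \<open>P (n + 1)\<close>, so
    degree 0 is included; each shift costs one degree.\<close>
  have "\<exists>k. is_kernel C k (d (n - i)) \<and> (\<forall>s\<ge>i. ext_vanish C J D (Dom C k) s)" if "i \<le> n" for i
    using that
  proof (induction i)
    case 0
    obtain m e where m: "is_kernel C m (d n)" and e: "is_epi C e" "Dom C e = Dom C (d (Suc n))" "Cod C e = Dom C m" "m \<cdot> e = d (Suc n)"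
      using exact_atE[OF PD(7)[of n]] by metis
    have "zero_object C (Cod C e)"
      by (rule zero_object_of_epi[OF e(1)]) (use z[of "Suc n"] e PD in auto)
    then have "\<forall>s. ext_vanish C J D (Dom C m) s" using ext_vanish_zero[OF J] e by simp
    then show ?case using m by auto
  next
    case (Suc i)
    define t where "t = n - Suc i"
    have t: "n - i = Suc t" using Suc.prems by (simp add: t_def)
    obtain k where k: "is_kernel C k (d (Suc t))" "\<And>s. i \<le> s \<Longrightarrow> ext_vanish C J D (Dom C k) s"
      using Suc t by auto
    obtain m e where m: "is_kernel C m (d t)" and e: "is_epi C e" "Dom C e = Dom C (d (Suc t))" "Cod C e = Dom C m" "m \<cdot> e = d (Suc t)"
      using exact_atE[OF PD(7)[of t]] by metis
    have k': "is_kernel C k e"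
      by (rule kernel_mono_comp_iff[of k m]) (use k e kernelD(5)[OF m] epiA[OF e(1)] in auto)
    have "ext_vanish C J D (Dom C m) s" if si: "Suc i \<le> s" for s
    proof -
      obtain r where r: "s = Suc r" "i \<le> r" using si by (cases s) auto
      show ?thesis
        using ext_vanish_cokernel[OF J k' e(1) k(2)[OF r(2)]] ext_vanish_proj[OF J PD(1)] e PD r by simp
    qed
    then show ?case using m by (auto simp: t_def)
  qed
  from this[of n] obtain k where k: "is_kernel C k (d 0)" "\<And>s. n \<le> s \<Longrightarrow> ext_vanish C J D (Dom C k) s" by auto
  obtain r where r: "s = Suc r" "n \<le> r" using s by (cases s) auto
  show ?thesis
    using ext_vanish_cokernel[OF J k(1) PD(6) k(2)[OF r(2)]] ext_vanish_proj[OF J PD(1)] PD r by simp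
qed

lemma proj_dim_ext_vanish:
  assumes J: "injective_coresolution C Y J D" and pd: "proj_dim C X \<le> ereal (real n)" and s: "n < s"
  shows "ext_vanish C J D X s"
proof (cases "zero_object C X")
  case True
  then show ?thesis by (rule ext_vanish_zero[OF J])
next
  case False
  let ?S = "{n. \<exists>P d. projective_resolution C X P d \<and> (\<forall>k>n. zero_object C (P k))}"
  \<comment> \<open>With the bound written as a strict one, \<open>INF_less_iff\<close> picks a
    resolution, whose length is then at most \<open>n\<close>.\<close>
  have "(INF n \<in> ?S. ereal (real n)) < ereal (real (Suc n))"
    using pd False by (auto simp: proj_dim_def elim!: le_less_trans)
  then obtain n' where n': "n' \<in> ?S" "ereal (real n') < ereal (real (Suc n))" unfolding INF_less_iff by blast
  then have "n' < Suc n" by simp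
  with n'(1) obtain P d where "projective_resolution C X P d" "\<And>k. n < k \<Longrightarrow> zero_object C (P k)" by auto
  from resolution_ext_vanish[OF J this s] show ?thesis .
qed

text \<open>A coresolution of length below \<open>m\<close> has \<open>J s\<close> zero for
  \<open>s \<ge> m\<close>, so there are no nonzero cocycles from any \<open>W\<close>. One
  coresolution thus serves all \<open>W\<close> and all these \<open>s\<close>.\<close>

lemma inj_dim_ext_vanish:
  assumes "inj_dim C Y < ereal (real m)"
  shows "\<exists>J d. injective_coresolution C Y J d \<and> (\<forall>W\<in>Obj C. \<forall>s\<ge>m. ext_vanish C J d W s)"
proof (cases "zero_object C Y")
  case True
  note J = zero_coresolution[OF True]
  show ?thesis using J ext_vanish_zero_target[OF J] True by blast
next
  case False
  let ?S = "{n. \<exists>I d. injective_coresolution C Y I d \<and> (\<forall>k>n. zero_object C (I k))}"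
  have "(INF n \<in> ?S. ereal (real n)) < ereal (real m)"
    using assms False by (auto simp: inj_dim_def)
  then obtain n' where n'': "n' \<in> ?S" "ereal (real n') < ereal (real m)" unfolding INF_less_iff by blast
  then have n': "n' < m" by simp
  from n''(1) obtain J d where J: "injective_coresolution C Y J d" "\<And>k. n' < k \<Longrightarrow> zero_object C (J k)" by auto
  then have "\<forall>W\<in>Obj C. \<forall>s\<ge>m. ext_vanish C J d W s"
    using ext_vanish_zero_target[OF J(1)] J(2) n' by auto
  then show ?thesis using J(1) by blast
qed

text \<open>The list is reversed because extensions are read from the left end towards
  \<open>X\<close>, with the augmentation \<open>d 0\<close> last.\<close>

lemma resolution_extension:
  assumes P: "projective_resolution C X P d" and k: "is_kernel C k (d m)"
  defines "R \<equiv> k # rev (map d [0..<Suc m])"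
  shows "R \<in> extensions C (Suc m) X (Dom C k)"
    "\<And>i. 1 \<le> i \<Longrightarrow> i \<le> Suc m \<Longrightarrow> seq_obj C R i \<in> Proj C"
proof -
  note PD = resolutionD[OF P] and kD = kernelD[OF k]
  have l: "length R = Suc (Suc m)" by (simp add: R_def)
  have n0: "R ! 0 = k" by (simp add: R_def)
  have nS: "R ! Suc i = d (m - i)" if "i \<le> m" for i
    using that by (simp add: R_def rev_nth nth_append del: upt_Suc)
  have ex: "exact_seq C R"
    unfolding exact_seq_def
  proof (intro conjI allI impI)
    show "R \<noteq> []" by (simp add: R_def)
    show "set R \<subseteq> Arr C" using kD PD(2) by (auto simp: R_def)
    fix i assume i: "Suc i < length R"
    show "exact_at C (R ! i) (R ! Suc i)"
    proof (cases i)
      case 0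
      then show ?thesis using exact_kernel_self[OF k] n0 nS[of 0] by simp
    next
      case (Suc r)
      then have "R ! i = d (Suc (m - i))" "R ! Suc i = d (m - i)"
        using nS[of r] nS[of i] i l by (auto simp: Suc_diff_Suc)
      then show ?thesis using PD(7) by simp
    qed
  qed
  show proj: "seq_obj C R i \<in> Proj C" if i: "1 \<le> i" "i \<le> Suc m" for i
  proof -
    obtain r where r: "i = Suc r" "r \<le> m" using i by (cases i) auto
    have "seq_obj C R i = P (m - r)" using exact_seqD(2)[OF ex, of i] nS[of r] r l PD(3) by simp
    then show ?thesis using PD(1) by simp
  qed
  show "R \<in> extensions C (Suc m) X (Dom C k)"
    using l ex exact_seqD(2)[OF ex, of 0] exact_seqD(3)[OF ex, of "Suc m"] n0 nS[of m] kD PD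
    by (simp add: extensions_iff)
qed

end

section \<open>Adjoint functors: kernels, projectives and Hom bijections\<close>

lemma additive_functor_op: "additive_functor C D F \<Longrightarrow> additive_functor (op_cat C) (op_cat D) F"
  unfolding additive_functor_def by (auto; blast)

locale adjunction = L: additive_functor_between C D F + R: additive_functor_between D C G
  for C :: "('o1, 'm1) precat" and D :: "('o2, 'm2) precat" and F and G +
  fixes \<phi>
  assumes \<phi>_bij: "X \<in> Obj C \<Longrightarrow> Y \<in> Obj D \<Longrightarrow>
        bij_betw (\<phi> X Y) (homset D (OMap F X) Y) (homset C X (OMap G Y))"
    and \<phi>_natural: "\<lbrakk>X \<in> Obj C; X' \<in> Obj C; Y \<in> Obj D; Y' \<in> Obj D; f \<in> homset C X' X; g \<in> homset D Y Y';
        u \<in> homset D (OMap F X) Y\<rbrakk>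
      \<Longrightarrow> \<phi> X' Y' (g \<cdot>\<^bsub>D\<^esub> u \<cdot>\<^bsub>D\<^esub> AMap F f) = AMap G g \<cdot>\<^bsub>C\<^esub> \<phi> X Y u \<cdot>\<^bsub>C\<^esub> f"
begin

lemma \<phi>_hom: "u \<in> homset D (OMap F X) Y \<Longrightarrow> X \<in> Obj C \<Longrightarrow> \<phi> X Y u \<in> homset C X (OMap G Y)"
  using \<phi>_bij[of X Y] L.E.hom_Obj[of u] by (auto simp: bij_betw_def)

lemma \<phi>_inj:
  assumes "\<phi> X Y u = \<phi> X Y v" "u \<in> homset D (OMap F X) Y" "v \<in> homset D (OMap F X) Y" "X \<in> Obj C"
  shows "u = v"
  using \<phi>_bij[of X Y] L.E.hom_Obj[OF assms(2)] assms by (auto simp: bij_betw_def dest: inj_onD)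

lemma \<phi>_surj:
  assumes "f \<in> homset C X (OMap G Y)" "Y \<in> Obj D"
  obtains u where "u \<in> homset D (OMap F X) Y" "\<phi> X Y u = f"
proof -
  have "X \<in> Obj C" using L.D.hom_Obj[OF assms(1)] by simp
  from \<phi>_bij[OF this assms(2)] have "f \<in> \<phi> X Y ` homset D (OMap F X) Y"
    using assms(1) by (simp add: bij_betw_def)
  then show thesis using that by blast
qed

lemma \<phi>_left:
  assumes "u \<in> homset D (OMap F X) Y" "g \<in> homset D Y Y'" "X \<in> Obj C"
  shows "\<phi> X Y' (g \<cdot>\<^bsub>D\<^esub> u) = AMap G g \<cdot>\<^bsub>C\<^esub> \<phi> X Y u"
  using \<phi>_natural[of X X Y Y' "Ident C X" g u] assms L.E.hom_Obj[OF assms(1)] L.E.hom_Obj[OF assms(2)]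
    L.E.homD[OF assms(1)] L.E.homD[OF assms(2)] L.D.homD[OF \<phi>_hom[OF assms(1,3)]]
  by (simp add: L.D.hom_iff)

lemma \<phi>_right:
  assumes "u \<in> homset D (OMap F X) Y" "f \<in> homset C X' X"
  shows "\<phi> X' Y (u \<cdot>\<^bsub>D\<^esub> AMap F f) = \<phi> X Y u \<cdot>\<^bsub>C\<^esub> f"
  using \<phi>_natural[of X X' Y Y f "Ident D Y" u] assms L.E.hom_Obj[OF assms(1)] L.D.hom_Obj[OF assms(2)]
    L.E.homD[OF assms(1)] L.D.homD[OF assms(2)] L.D.homD[OF \<phi>_hom[OF assms(1)]]
  by (simp add: L.E.hom_iff)

lemma \<phi>_Zero:
  assumes "X \<in> Obj C" "Y \<in> Obj D"
  shows "\<phi> X Y (Zero D (OMap F X) Y) = Zero C X (OMap G Y)"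
proof -
  have "\<phi> X Y (Zero D (OMap F X) Y) = \<phi> X Y (Zero D (OMap F X) Y \<cdot>\<^bsub>D\<^esub> Ident D (OMap F X))"
    using assms by simp
  also have "\<dots> = AMap G (Zero D (OMap F X) Y) \<cdot>\<^bsub>C\<^esub> \<phi> X (OMap F X) (Ident D (OMap F X))"
    by (rule \<phi>_left) (use assms in \<open>auto simp: L.E.hom_iff\<close>)
  also have "\<dots> = Zero C X (OMap G Y)"
    using L.D.homD[OF \<phi>_hom[of "Ident D (OMap F X)" X "OMap F X"]] assms by (simp add: L.E.hom_iff)
  finally show ?thesis .
qed

lemma \<phi>_eq_Zero:
  assumes "\<phi> X Y u = Zero C X (OMap G Y)" "u \<in> homset D (OMap F X) Y" "X \<in> Obj C"
  shows "u = Zero D (OMap F X) Y"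
  by (rule \<phi>_inj) (use assms \<phi>_Zero L.E.hom_Obj[OF assms(2)] in \<open>auto simp: L.E.hom_iff\<close>)

text \<open>\<open>\<phi>\<close> turns maps into \<open>G\<close> of an object into maps out of
  \<open>F\<close> of the source and respects composition and zero, so the universal property of
  \<open>k\<close> carries over.\<close>

lemma right_adjoint_kernel:
  assumes k: "is_kernel D k f"
  shows "is_kernel C (AMap G k) (AMap G f)"
proof (rule L.D.kernelI)
  note kD = L.E.kernelD[OF k]
  show "is_mono C (AMap G k)"
  proof (rule L.D.is_monoI)
    show "AMap G k \<in> Arr C" using kD by simp
    fix y assume y: "y \<in> Arr C" "Cod C y = Dom C (AMap G k)" "AMap G k \<cdot>\<^bsub>C\<^esub> y = Zero C (Dom C y) (Cod C (AMap G k))"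
    have yO: "Dom C y \<in> Obj C" using y by simp
    obtain v where v: "v \<in> homset D (OMap F (Dom C y)) (Dom D k)" "\<phi> (Dom C y) (Dom D k) v = y"
      by (rule \<phi>_surj[of y "Dom C y" "Dom D k"]) (use y kD in \<open>auto simp: L.D.hom_iff\<close>)
    have kh: "k \<in> homset D (Dom D k) (Cod D k)" using kD by (simp add: L.E.hom_iff)
    have "\<phi> (Dom C y) (Cod D k) (k \<cdot>\<^bsub>D\<^esub> v) = Zero C (Dom C y) (OMap G (Cod D k))"
      using \<phi>_left[OF v(1) kh yO] v(2) y kD by simp
    then have "k \<cdot>\<^bsub>D\<^esub> v = Zero D (OMap F (Dom C y)) (Cod D k)"
      by (rule \<phi>_eq_Zero) (use L.E.homD[OF v(1)] kD yO in \<open>auto simp: L.E.hom_iff\<close>)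
    then have "v = Zero D (OMap F (Dom C y)) (Dom D k)"
      by (rule L.E.mono_Zero[OF kD(5)]) (use L.E.homD[OF v(1)] kD in auto)
    then have "y = Zero C (Dom C y) (OMap G (Dom D k))" using v(2) \<phi>_Zero[OF yO, of "Dom D k"] kD by simp
    then show "y = Zero C (Dom C y) (Dom C (AMap G k))" using kD by simp
  qed
  show "AMap G f \<in> Arr C" "Cod C (AMap G k) = Dom C (AMap G f)" using kD by auto
  have "AMap G f \<cdot>\<^bsub>C\<^esub> AMap G k = AMap G (f \<cdot>\<^bsub>D\<^esub> k)" by (rule R.F_comp[symmetric]) (use kD in auto)
  then show "AMap G f \<cdot>\<^bsub>C\<^esub> AMap G k = Zero C (Dom C (AMap G k)) (Cod C (AMap G f))"
    using kD by simp
  fix x assume x: "x \<in> Arr C" "Cod C x = Dom C (AMap G f)" "AMap G f \<cdot>\<^bsub>C\<^esub> x = Zero C (Dom C x) (Cod C (AMap G f))"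
  have xO: "Dom C x \<in> Obj C" using x by simp
  obtain u where u: "u \<in> homset D (OMap F (Dom C x)) (Dom D f)" "\<phi> (Dom C x) (Dom D f) u = x"
    by (rule \<phi>_surj[of x "Dom C x" "Dom D f"]) (use x kD in \<open>auto simp: L.D.hom_iff\<close>)
  have fh: "f \<in> homset D (Dom D f) (Cod D f)" using kD by (simp add: L.E.hom_iff)
  have "\<phi> (Dom C x) (Cod D f) (f \<cdot>\<^bsub>D\<^esub> u) = Zero C (Dom C x) (OMap G (Cod D f))"
    using \<phi>_left[OF u(1) fh xO] u(2) x kD by simp
  then have "f \<cdot>\<^bsub>D\<^esub> u = Zero D (OMap F (Dom C x)) (Cod D f)"
    by (rule \<phi>_eq_Zero) (use L.E.homD[OF u(1)] kD xO in \<open>auto simp: L.E.hom_iff\<close>)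
  then obtain v where v: "v \<in> homset D (OMap F (Dom C x)) (Dom D k)" "k \<cdot>\<^bsub>D\<^esub> v = u"
    using L.E.kernel_lift_hom[OF k u(1)] by auto
  have kh: "k \<in> homset D (Dom D k) (Dom D f)" using kD by (simp add: L.E.hom_iff)
  have "AMap G k \<cdot>\<^bsub>C\<^esub> \<phi> (Dom C x) (Dom D k) v = x"
    using \<phi>_left[OF v(1) kh xO] v(2) u(2) by simp
  then show "\<exists>h\<in>Arr C. Dom C h = Dom C x \<and> Cod C h = Dom C (AMap G k) \<and> AMap G k \<cdot>\<^bsub>C\<^esub> h = x"
    using L.D.homD[OF \<phi>_hom[OF v(1) xO]] kD by (intro bexI[of _ "\<phi> (Dom C x) (Dom D k) v"]) auto
qed

lemma left_adjoint_Proj: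
  assumes epi: "\<And>g. is_epi D g \<Longrightarrow> is_epi C (AMap G g)" and Q: "Q \<in> Proj C"
  shows "OMap F Q \<in> Proj D"
  unfolding Proj_def
proof (intro CollectI conjI allI impI)
  have QO: "Q \<in> Obj C" by (rule L.D.Proj_Obj[OF Q])
  then show "OMap F Q \<in> Obj D" by simp
  fix g f assume "is_epi D g \<and> f \<in> homset D (OMap F Q) (Cod D g)"
  then have g: "is_epi D g" "f \<in> homset D (OMap F Q) (Cod D g)" by auto
  note gA = L.E.epiA[OF g(1)]
  have gh: "g \<in> homset D (Dom D g) (Cod D g)" using gA by (simp add: L.E.hom_iff)
  obtain h where h: "h \<in> Arr C" "Dom C h = Q" "Cod C h = Dom C (AMap G g)" "AMap G g \<cdot>\<^bsub>C\<^esub> h = \<phi> Q (Cod D g) f"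
    using L.D.ProjD[OF Q epi[OF g(1)], of "\<phi> Q (Cod D g) f"] L.D.homD[OF \<phi>_hom[OF g(2) QO]] gA by auto
  obtain h' where h': "h' \<in> homset D (OMap F Q) (Dom D g)" "\<phi> Q (Dom D g) h' = h"
    by (rule \<phi>_surj[of h Q "Dom D g"]) (use h gA in \<open>auto simp: L.D.hom_iff\<close>)
  have "\<phi> Q (Cod D g) (g \<cdot>\<^bsub>D\<^esub> h') = \<phi> Q (Cod D g) f"
    using \<phi>_left[OF h'(1) gh QO] h'(2) h(4) by simp
  then have "g \<cdot>\<^bsub>D\<^esub> h' = f"
    by (rule \<phi>_inj) (use g L.E.homD[OF h'(1)] gA QO in \<open>auto simp: L.E.hom_iff\<close>)
  then show "\<exists>h\<in>homset D (OMap F Q) (Dom D g). g \<cdot>\<^bsub>D\<^esub> h = f" using h' by auto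
qed

end

section \<open>Adjunctions and recollements\<close>

lemma adjunction_ex:
  assumes "adjoint_pair C D F G" "abelian_category C" "abelian_category D" "additive_functor C D F" "additive_functor D C G"
  shows "\<exists>\<phi>. adjunction C D F G \<phi>"
proof -
  obtain \<phi> where b: "\<forall>X\<in>Obj C. \<forall>Y\<in>Obj D.
        bij_betw (\<phi> X Y) (homset D (OMap F X) Y) (homset C X (OMap G Y))"
    and n: "\<forall>X\<in>Obj C. \<forall>X'\<in>Obj C. \<forall>Y\<in>Obj D. \<forall>Y'\<in>Obj D.
        \<forall>f\<in>homset C X' X. \<forall>g\<in>homset D Y Y'. \<forall>u\<in>homset D (OMap F X) Y.
          \<phi> X' Y' (g \<cdot>\<^bsub>D\<^esub> u \<cdot>\<^bsub>D\<^esub> AMap F f) = AMap G g \<cdot>\<^bsub>C\<^esub> \<phi> X Y u \<cdot>\<^bsub>C\<^esub> f"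
    using assms(1) unfolding adjoint_pair_def by (elim exE conjE)
  interpret C: abelian_category C by fact
  interpret D: abelian_category D by fact
  have "adjunction C D F G \<phi>"
    by (intro adjunction.intro additive_functor_between.intro additive_functor_between_axioms.intro adjunction_axioms.intro assms(2-))
      (use b n in blast)+
  then show ?thesis by (intro exI)
qed

context adjunction
begin

text \<open>In the opposite categories \<open>G\<close> becomes the left adjoint, with the inverse
  of \<open>\<phi>\<close> as its bijection. Facts about cokernels and injectives follow by
  duality.\<close>

lemma adjunction_op: "adjunction (op_cat D) (op_cat C) G F (\<lambda>Y X. the_inv_into (homset D (OMap F X) Y) (\<phi> X Y))"
proof (intro adjunction.intro additive_functor_between.intro additive_functor_between_axioms.intro adjunction_axioms.intro)
  show "abelian_category (op_cat D)" "abelian_category (op_cat C)" "abelian_category (op_cat C)" "abelian_category (op_cat D)"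
    using L.D.abelian_op L.E.abelian_op by auto
  show "additive_functor (op_cat D) (op_cat C) G" "additive_functor (op_cat C) (op_cat D) F"
    using additive_functor_op L.additive R.additive by auto
  fix X Y assume "X \<in> Obj (op_cat D)" "Y \<in> Obj (op_cat C)"
  then show "bij_betw (the_inv_into (homset D (OMap F Y) X) (\<phi> Y X)) (homset (op_cat C) (OMap G X) Y) (homset (op_cat D) X (OMap F Y))"
    using bij_betw_the_inv_into[OF \<phi>_bij[of Y X]] by simp
next
  fix X X' Y Y' f g u
  assume "X \<in> Obj (op_cat D)" "X' \<in> Obj (op_cat D)" "Y \<in> Obj (op_cat C)" "Y' \<in> Obj (op_cat C)"
    "f \<in> homset (op_cat D) X' X" "g \<in> homset (op_cat C) Y Y'" "u \<in> homset (op_cat C) (OMap G X) Y"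
  then have a: "X \<in> Obj D" "X' \<in> Obj D" "Y \<in> Obj C" "Y' \<in> Obj C" "f \<in> homset D X X'" "g \<in> homset C Y' Y" "u \<in> homset C Y (OMap G X)"
    by auto
  obtain v where v: "v \<in> homset D (OMap F Y) X" "\<phi> Y X v = u" by (rule \<phi>_surj[OF a(7,1)])
  have inv: "the_inv_into (homset D (OMap F Y) X) (\<phi> Y X) (\<phi> Y X v) = v" if "v \<in> homset D (OMap F Y) X" "X \<in> Obj D" "Y \<in> Obj C" for v X Y
    using the_inv_into_f_f[of "\<phi> Y X" "homset D (OMap F Y) X" v] \<phi>_bij[OF that(3,2)] that(1) by (auto simp: bij_betw_def)
  note V = L.E.homD[OF v(1)] L.E.homD[OF a(5)] L.D.homD[OF a(6)] L.D.homD[OF a(7)]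
  have "f \<cdot>\<^bsub>D\<^esub> v \<cdot>\<^bsub>D\<^esub> AMap F g \<in> homset D (OMap F Y') X'"
    using V by (auto simp: L.E.hom_iff)
  from inv[OF this a(2,4)]
  have "the_inv_into (homset D (OMap F Y') X') (\<phi> Y' X') (AMap G f \<cdot>\<^bsub>C\<^esub> u \<cdot>\<^bsub>C\<^esub> g) = f \<cdot>\<^bsub>D\<^esub> v \<cdot>\<^bsub>D\<^esub> AMap F g"
    using \<phi>_natural[OF a(3,4,1,2,6,5) v(1)] v(2) by simp
  then show "the_inv_into (homset D (OMap F Y') X') (\<phi> Y' X') (g \<cdot>\<^bsub>op_cat C\<^esub> u \<cdot>\<^bsub>op_cat C\<^esub> AMap G f) =
       AMap F g \<cdot>\<^bsub>op_cat D\<^esub> the_inv_into (homset D (OMap F Y) X) (\<phi> Y X) u \<cdot>\<^bsub>op_cat D\<^esub> f"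
    using inv[OF v(1) a(1,3)] v(2) V by simp
qed

lemma left_adjoint_cokernel:
  assumes "is_cokernel C k f"
  shows "is_cokernel D (AMap F k) (AMap F f)"
  using adjunction.right_adjoint_kernel[OF adjunction_op, of k f] assms by simp

lemma right_adjoint_Inj:
  assumes "\<And>g. is_mono C g \<Longrightarrow> is_mono D (AMap F g)" "J \<in> Inj D"
  shows "OMap G J \<in> Inj C"
  using adjunction.left_adjoint_Proj[OF adjunction_op, of J] assms by simp

text \<open>\<open>\<eta>\<close> is the unit. Its inverse \<open>s\<close> is the preimage under
  \<open>F\<close> of the counit at \<open>F Q\<close>, that is, of the map that
  \<open>\<phi>\<close> sends to the identity of \<open>G F Q\<close>. The second equation follows
  by faithfulness of \<open>F\<close> from
  \<open>\<eta> \<cdot> s \<cdot> \<eta> = \<eta>\<close>.\<close>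

lemma unit_iso:
  assumes ff: "fully_faithful C D F" and Q: "Q \<in> Obj C"
  obtains \<eta> s where "\<eta> \<in> homset C Q (OMap G (OMap F Q))" "s \<in> homset C (OMap G (OMap F Q)) Q"
    "\<eta> \<cdot>\<^bsub>C\<^esub> s = Ident C (OMap G (OMap F Q))" "s \<cdot>\<^bsub>C\<^esub> \<eta> = Ident C Q"
    "\<And>u Y. u \<in> homset D (OMap F Q) Y \<Longrightarrow> \<phi> Q Y u = AMap G u \<cdot>\<^bsub>C\<^esub> \<eta>"
proof -
  let ?FQ = "OMap F Q" and ?GFQ = "OMap G (OMap F Q)"
  define \<eta> where "\<eta> = \<phi> Q ?FQ (Ident D ?FQ)"
  have id: "Ident D ?FQ \<in> homset D ?FQ ?FQ" using Q by (simp add: L.E.hom_iff)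
  have \<eta>: "\<eta> \<in> homset C Q ?GFQ" unfolding \<eta>_def by (rule \<phi>_hom[OF id Q])
  note \<eta>D = L.D.homD[OF \<eta>]
  have bij: "bij_betw (AMap F) (homset C X Y) (homset D (OMap F X) (OMap F Y))" if "X \<in> Obj C" "Y \<in> Obj C" for X Y
    using ff that by (auto simp: fully_faithful_def)
  have post: "\<phi> X ?FQ (AMap F f) = \<eta> \<cdot>\<^bsub>C\<^esub> f" if "f \<in> homset C X Q" for f X
    using \<phi>_right[OF id that] L.D.homD[OF that] by (simp add: \<eta>_def)
  have GO: "?GFQ \<in> Obj C" using Q by simp
  obtain u where u: "u \<in> homset D (OMap F ?GFQ) ?FQ" "\<phi> ?GFQ ?FQ u = Ident C ?GFQ"
    by (rule \<phi>_surj[of "Ident C ?GFQ" ?GFQ ?FQ]) (use Q in \<open>auto simp: L.D.hom_iff\<close>)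
  obtain s where s: "s \<in> homset C ?GFQ Q" "AMap F s = u"
    using bij[OF GO Q] u(1) unfolding bij_betw_def by (metis imageE)
  note sD = L.D.homD[OF s(1)]
  have es: "\<eta> \<cdot>\<^bsub>C\<^esub> s = Ident C ?GFQ" using post[OF s(1)] s(2) u(2) by simp
  have se: "s \<cdot>\<^bsub>C\<^esub> \<eta> \<in> homset C Q Q" using sD \<eta>D by (auto simp: L.D.hom_iff)
  have idQ: "Ident C Q \<in> homset C Q Q" using Q by (simp add: L.D.hom_iff)
  have "\<eta> \<cdot>\<^bsub>C\<^esub> (s \<cdot>\<^bsub>C\<^esub> \<eta>) = \<eta> \<cdot>\<^bsub>C\<^esub> Ident C Q"
    using L.D.comp_cong_assoc1[OF es, of \<eta>] sD \<eta>D by simp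
  then have "\<phi> Q ?FQ (AMap F (s \<cdot>\<^bsub>C\<^esub> \<eta>)) = \<phi> Q ?FQ (AMap F (Ident C Q))"
    using post[OF se] post[OF idQ] by simp
  then have "AMap F (s \<cdot>\<^bsub>C\<^esub> \<eta>) = AMap F (Ident C Q)"
    by (rule \<phi>_inj) (use L.D.homD[OF se] L.D.homD[OF idQ] Q in \<open>auto simp: L.E.hom_iff\<close>)
  then have "s \<cdot>\<^bsub>C\<^esub> \<eta> = Ident C Q"
    using bij[OF Q Q] se idQ unfolding bij_betw_def by (meson inj_onD)
  moreover have "\<phi> Q Y u = AMap G u \<cdot>\<^bsub>C\<^esub> \<eta>" if "u \<in> homset D ?FQ Y" for u Y
    using \<phi>_left[OF id that Q] L.E.homD[OF that] by (simp add: \<eta>_def)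
  ultimately show thesis using that \<eta> s(1) es by blast
qed

text \<open>The bijection \<open>\<phi>\<close> sends \<open>u\<close> to
  \<open>G u \<cdot> \<eta>\<close>, and the unit \<open>\<eta>\<close> at \<open>Q\<close> is
  invertible.\<close>

lemma right_adjoint_bij:
  assumes ff: "fully_faithful C D F" and Q: "Q \<in> Obj C" and Y: "Y \<in> Obj D"
  shows "bij_betw (AMap G) (homset D (OMap F Q) Y) (homset C (OMap G (OMap F Q)) (OMap G Y))"
proof -
  obtain \<eta> s where u: "\<eta> \<in> homset C Q (OMap G (OMap F Q))" "s \<in> homset C (OMap G (OMap F Q)) Q"
    "\<eta> \<cdot>\<^bsub>C\<^esub> s = Ident C (OMap G (OMap F Q))"
    "\<And>u Y. u \<in> homset D (OMap F Q) Y \<Longrightarrow> \<phi> Q Y u = AMap G u \<cdot>\<^bsub>C\<^esub> \<eta>"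
    using unit_iso[OF ff Q] by metis
  note D = L.D.homD[OF u(1)] L.D.homD[OF u(2)]
  show ?thesis unfolding bij_betw_def
  proof
    show "inj_on (AMap G) (homset D (OMap F Q) Y)"
    proof (rule inj_onI)
      fix a b assume "a \<in> homset D (OMap F Q) Y" "b \<in> homset D (OMap F Q) Y" "AMap G a = AMap G b"
      then show "a = b" using \<phi>_inj[of Q Y a b] u(4)[of a Y] u(4)[of b Y] Q by simp
    qed
    show "AMap G ` homset D (OMap F Q) Y = homset C (OMap G (OMap F Q)) (OMap G Y)"
    proof
      show "AMap G ` homset D (OMap F Q) Y \<subseteq> homset C (OMap G (OMap F Q)) (OMap G Y)"
        by (auto simp: L.D.hom_iff L.E.hom_iff)
      show "homset C (OMap G (OMap F Q)) (OMap G Y) \<subseteq> AMap G ` homset D (OMap F Q) Y"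
      proof
        fix h assume h: "h \<in> homset C (OMap G (OMap F Q)) (OMap G Y)"
        note hD = L.D.homD[OF h]
        obtain v where v: "v \<in> homset D (OMap F Q) Y" "\<phi> Q Y v = h \<cdot>\<^bsub>C\<^esub> \<eta>"
          by (rule \<phi>_surj[of "h \<cdot>\<^bsub>C\<^esub> \<eta>" Q Y]) (use hD D Y in \<open>auto simp: L.D.hom_iff\<close>)
        note vD = L.E.homD[OF v(1)]
        have "AMap G v \<cdot>\<^bsub>C\<^esub> \<eta> = h \<cdot>\<^bsub>C\<^esub> \<eta>" using v u(4) by simp
        then have "AMap G v \<cdot>\<^bsub>C\<^esub> (\<eta> \<cdot>\<^bsub>C\<^esub> s) = h \<cdot>\<^bsub>C\<^esub> (\<eta> \<cdot>\<^bsub>C\<^esub> s)"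
          by (rule L.D.comp_cong_assoc) (use vD hD D in auto)
        then have "AMap G v = h" unfolding u(3) using vD hD by simp
        then show "h \<in> AMap G ` homset D (OMap F Q) Y" using v(1) by blast
      qed
    qed
  qed
qed

text \<open>The unit identifies \<open>G F Q\<close> with \<open>Q\<close>, so lifting problems are
  moved to \<open>Q\<close> by \<open>\<eta>\<close> and back by \<open>s\<close>.\<close>

lemma GF_Proj:
  assumes ff: "fully_faithful C D F" and Q: "Q \<in> Proj C"
  shows "OMap G (OMap F Q) \<in> Proj C"
  unfolding Proj_def
proof (intro CollectI conjI allI impI)
  have QO: "Q \<in> Obj C" by (rule L.D.Proj_Obj[OF Q])
  then show "OMap G (OMap F Q) \<in> Obj C" by simp
  obtain \<eta> s where u: "\<eta> \<in> homset C Q (OMap G (OMap F Q))" "s \<in> homset C (OMap G (OMap F Q)) Q"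
    "\<eta> \<cdot>\<^bsub>C\<^esub> s = Ident C (OMap G (OMap F Q))"
    using unit_iso[OF ff QO] by metis
  note D = L.D.homD[OF u(1)] L.D.homD[OF u(2)]
  fix g f assume "is_epi C g \<and> f \<in> homset C (OMap G (OMap F Q)) (Cod C g)"
  then have g: "is_epi C g" "f \<in> homset C (OMap G (OMap F Q)) (Cod C g)" by auto
  note gA = L.D.epiA[OF g(1)] and fD = L.D.homD[OF g(2)]
  obtain h where h: "h \<in> Arr C" "Dom C h = Q" "Cod C h = Dom C g" "g \<cdot>\<^bsub>C\<^esub> h = f \<cdot>\<^bsub>C\<^esub> \<eta>"
    using L.D.ProjD[OF Q g(1), of "f \<cdot>\<^bsub>C\<^esub> \<eta>"] D fD by auto
  have "g \<cdot>\<^bsub>C\<^esub> (h \<cdot>\<^bsub>C\<^esub> s) = f \<cdot>\<^bsub>C\<^esub> (\<eta> \<cdot>\<^bsub>C\<^esub> s)"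
    by (rule L.D.comp_cong_assoc[OF h(4)]) (use h D fD gA in auto)
  also have "\<dots> = f" unfolding u(3) using fD by simp
  finally show "\<exists>h\<in>homset C (OMap G (OMap F Q)) (Dom C g). g \<cdot>\<^bsub>C\<^esub> h = f"
    using h D by (intro bexI[of _ "h \<cdot>\<^bsub>C\<^esub> s"]) (auto simp: L.D.hom_iff)
qed

end

lemma exact_functor_of_adjoints:
  assumes "adjoint_pair E D L F" "adjoint_pair D E F R"
    "abelian_category D" "abelian_category E" "additive_functor D E F" "additive_functor E D L" "additive_functor E D R"
  shows "exact_functor D E F"
proof -
  obtain \<phi> where l: "adjunction E D L F \<phi>" using adjunction_ex assms by blast
  obtain \<psi> where r: "adjunction D E F R \<psi>" using adjunction_ex assms by blast
  show ?thesis
    by (intro exact_functor.intro additive_functor_between.intro additive_functor_between_axioms.intro exact_functor_axioms.intro assms(3-5))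
      (fact adjunction.right_adjoint_kernel[OF l], fact adjunction.left_adjoint_cokernel[OF r])
qed

section \<open>Objects of a recollement without Ext into the image of \<open>i\<close>\<close>

locale recollement_situation = A: abelian_category A + B: enough_proj_inj B + C: enough_proj_inj C
  for A :: "('oa, 'ma) precat" and B :: "('ob, 'mb) precat" and C :: "('oc, 'mc) precat" +
  fixes i e q p l r
  assumes recollement: "recollement A B C i e q p l r"
begin

lemma recollementD:
  "additive_functor A B i" "additive_functor B C e"
  "additive_functor B A q" "additive_functor B A p"
  "additive_functor C B l" "additive_functor C B r"
  "adjoint_pair C B l e" "adjoint_pair B C e r"
  "adjoint_pair B A q i" "adjoint_pair A B i p"
  "fully_faithful A B i" "fully_faithful C B l"
  "{X \<in> Obj B. \<exists>Y\<in>Obj A. isomorphic_objects B X (OMap i Y)} = {X \<in> Obj B. zero_object C (OMap e X)}"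
  using recollement unfolding recollement_def by auto

lemma exact_e: "exact_functor B C e"
  by (rule exact_functor_of_adjoints[of _ _ l _ r])
    (use recollementD B.abelian_category_axioms C.abelian_category_axioms in auto)

lemma exact_i: "exact_functor A B i"
  by (rule exact_functor_of_adjoints[of _ _ q _ p])
    (use recollementD A.abelian_category_axioms B.abelian_category_axioms in auto)

sublocale e: exact_functor B C e by (rule exact_e)
sublocale i: exact_functor A B i by (rule exact_i)

lemma adj_le: obtains \<phi> where "adjunction C B l e \<phi>"
  using adjunction_ex[OF recollementD(7)] recollementD B.abelian_category_axioms C.abelian_category_axioms by blast

lemma l_Obj: "Q \<in> Obj C \<Longrightarrow> OMap l Q \<in> Obj B"
  using recollementD(5) by (auto simp: additive_functor_def)

lemma ei_zero:
  assumes "X \<in> Obj A"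
  shows "zero_object C (OMap e (OMap i X))"
proof -
  have iX: "OMap i X \<in> Obj B" using assms by simp
  then have "isomorphic_objects B (OMap i X) (OMap i X)"
    unfolding isomorphic_objects_def by (auto simp: B.hom_iff intro!: bexI[of _ "Ident B (OMap i X)"])
  then have "OMap i X \<in> {X \<in> Obj B. zero_object C (OMap e X)}"
    using recollementD(13) iX assms by blast
  then show ?thesis by simp
qed

text \<open>Enough injectives are assumed for \<open>B\<close> and \<open>C\<close> only;
  \<open>A\<close> inherits them. The right adjoint \<open>p\<close> of the exact functor
  \<open>i\<close> preserves injectives, and the adjunct of an embedding of \<open>i X\<close> is
  mono since \<open>i\<close> is faithful.\<close>

lemma embed_A:
  assumes X: "X \<in> Obj A"
  obtains u where "is_mono A u" "Dom A u = X" "Cod A u \<in> Inj A"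
proof -
  obtain \<phi> where "adjunction A B i p \<phi>"
    using adjunction_ex[OF recollementD(10)] recollementD A.abelian_category_axioms B.abelian_category_axioms by blast
  then interpret adj: adjunction A B i p \<phi> .
  obtain j where j: "is_mono B j" "Dom B j = OMap i X" "Cod B j \<in> Inj B"
    by (rule B.embed[of "OMap i X"]) (use X in auto)
  note jA = B.monoA[OF j(1)]
  have jh: "j \<in> homset B (OMap i X) (Cod B j)" using jA j by (simp add: B.hom_iff)
  define u where "u = \<phi> X (Cod B j) j"
  have u: "u \<in> homset A X (OMap p (Cod B j))" unfolding u_def by (rule adj.\<phi>_hom[OF jh X])
  note uD = A.homD[OF u]
  have "is_mono A u"
  proof (rule A.is_monoI)
    show "u \<in> Arr A" using uD by simp
    fix x assume x: "x \<in> Arr A" "Cod A x = Dom A u" "u \<cdot>\<^bsub>A\<^esub> x = Zero A (Dom A x) (Cod A u)"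
    have xh: "x \<in> homset A (Dom A x) X" using x uD by (simp add: A.hom_iff)
    have "\<phi> (Dom A x) (Cod B j) (j \<cdot>\<^bsub>B\<^esub> AMap i x) = Zero A (Dom A x) (OMap p (Cod B j))"
      using adj.\<phi>_right[OF jh xh] x uD by (simp add: u_def)
    then have "j \<cdot>\<^bsub>B\<^esub> AMap i x = Zero B (OMap i (Dom A x)) (Cod B j)"
      by (rule adj.\<phi>_eq_Zero) (use x uD jA j in \<open>auto simp: B.hom_iff\<close>)
    then have "AMap i x = Zero B (OMap i (Dom A x)) (Dom B j)"
      by (rule B.mono_Zero[OF j(1)]) (use x uD jA j in auto)
    then have "AMap i x = AMap i (Zero A (Dom A x) X)" using x X j by simp
    moreover have "bij_betw (AMap i) (homset A (Dom A x) X) (homset B (OMap i (Dom A x)) (OMap i X))"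
      using recollementD(11) x X by (simp add: fully_faithful_def)
    moreover have "Zero A (Dom A x) X \<in> homset A (Dom A x) X" using x X by (simp add: A.hom_iff)
    ultimately have "x = Zero A (Dom A x) X" using xh unfolding bij_betw_def by (meson inj_onD)
    then show "x = Zero A (Dom A x) (Dom A u)" using uD by simp
  qed
  moreover have "OMap p (Cod B j) \<in> Inj A" by (rule adj.right_adjoint_Inj[OF i.F_mono j(3)])
  ultimately show thesis using that uD by auto
qed

text \<open>The condition \<open>Ext^s(W, i I) = 0\<close> for all \<open>s \<ge> 0\<close> and all
  injective \<open>I\<close> of \<open>A\<close>. One coresolution per \<open>I\<close> serves all
  degrees, so that vanishing passes between degrees without comparing coresolutions.\<close>

definition good :: "'ob \<Rightarrow> bool" where
  "good W \<longleftrightarrow> W \<in> Obj B \<and> (\<forall>I\<in>Inj A. \<exists>J d. injective_coresolution B (OMap i I) J d \<and> (\<forall>s. ext_vanish B J d W s))"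

text \<open>\<open>X\<close> embeds into an injective \<open>I\<close>, and \<open>i\<close>
  preserves the embedding. A map from \<open>W\<close> to \<open>i I\<close> is zero by degree 0 of
  \<open>good\<close>, because its composite with the coaugmentation is a cocycle.\<close>

lemma good_hom:
  assumes W: "good W" and X: "X \<in> Obj A" and t: "t \<in> homset B W (OMap i X)"
  shows "t = Zero B W (OMap i X)"
proof -
  obtain u where u: "is_mono A u" "Dom A u = X" "Cod A u \<in> Inj A" by (rule embed_A[OF X])
  obtain J d where J: "injective_coresolution B (OMap i (Cod A u)) J d" "\<And>s. ext_vanish B J d W s"
    using W u(3) unfolding good_def by blast
  note c = B.coresD[OF J(1)] and uA = A.monoA[OF u(1)] and tD = B.homD[OF t]
  have dd: "d (Suc 0) \<cdot>\<^bsub>B\<^esub> d 0 = Zero B (OMap i (Cod A u)) (J (Suc 0))"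
    using B.exact_at_simps(4)[OF c(9)[of 0]] c by simp
  have W': "W \<in> Obj B" using W by (simp add: good_def)
  have "d (Suc 0) \<cdot>\<^bsub>B\<^esub> (d 0 \<cdot>\<^bsub>B\<^esub> (AMap i u \<cdot>\<^bsub>B\<^esub> t)) = Zero B W (J (Suc 0))"
    using B.comp_cong_assoc1[OF dd, of "AMap i u \<cdot>\<^bsub>B\<^esub> t"] c(2,4,5,6,7) uA tD u(2) by simp
  then have "d 0 \<cdot>\<^bsub>B\<^esub> (AMap i u \<cdot>\<^bsub>B\<^esub> t) = Zero B W (J 0)"
    by (intro B.ext_vanishD(1)[OF J(2)]) (use c(2,4,5,6,7) uA tD u(2) in auto)
  then have "AMap i u \<cdot>\<^bsub>B\<^esub> t = Zero B W (Dom B (d 0))"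
    by (rule B.mono_Zero[OF c(8)]) (use c(2,4,5,6,7) uA tD u(2) in auto)
  then have "t = Zero B W (Dom B (AMap i u))"
    by (intro B.mono_Zero[OF i.F_mono[OF u(1)]]) (use c(6) uA tD u(2) in auto)
  then show ?thesis using uA u(2) by simp
qed

text \<open>By adjunction such maps are maps from \<open>Q\<close> to \<open>e i X\<close>, which is
  a zero object.\<close>

lemma l_hom_zero:
  assumes Q: "Q \<in> Obj C" and X: "X \<in> Obj A" and t: "t \<in> homset B (OMap l Q) (OMap i X)"
  shows "t = Zero B (OMap l Q) (OMap i X)"
proof -
  obtain \<phi> where "adjunction C B l e \<phi>" by (rule adj_le)
  then interpret adj: adjunction C B l e \<phi> .
  have "\<phi> Q (OMap i X) t = Zero C Q (OMap e (OMap i X))"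
    by (rule C.zero_objectD(3)[OF ei_zero[OF X]]) (rule adj.\<phi>_hom[OF t Q])
  then show ?thesis by (rule adj.\<phi>_eq_Zero[OF _ t Q])
qed

lemma l_Proj: "Q \<in> Proj C \<Longrightarrow> OMap l Q \<in> Proj B"
proof -
  assume Q: "Q \<in> Proj C"
  obtain \<phi> where "adjunction C B l e \<phi>" by (rule adj_le)
  then interpret adj: adjunction C B l e \<phi> .
  show ?thesis by (rule adj.left_adjoint_Proj[OF e.F_epi Q])
qed

text \<open>Positive degrees vanish as \<open>l Q\<close> is projective. In degree 0 a cocycle comes
  from a map to \<open>i I\<close>, and \<open>l_hom_zero\<close> applies.\<close>

lemma good_l:
  assumes Q: "Q \<in> Proj C" and J: "injective_coresolution B (OMap i I) J d" and I: "I \<in> Obj A"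
  shows "ext_vanish B J d (OMap l Q) s"
proof (cases "s = 0")
  case False
  then show ?thesis using B.ext_vanish_proj[OF J l_Proj[OF Q]] by simp
next
  case True
  note c = B.coresD[OF J] and QO = C.Proj_Obj[OF Q]
  have "t = Zero B (OMap l Q) (J 0)" if t: "t \<in> homset B (OMap l Q) (J 0)" and z: "d (Suc 0) \<cdot>\<^bsub>B\<^esub> t = Zero B (OMap l Q) (J (Suc 0))" for t
  proof -
    have ker: "is_kernel B (d 0) (d (Suc 0))" by (rule B.mono_exact_kernel[OF c(8,9)])
    obtain v where v: "v \<in> homset B (OMap l Q) (OMap i I)" "d 0 \<cdot>\<^bsub>B\<^esub> v = t"
      using B.kernel_lift_hom[OF ker, of t "OMap l Q"] t z c by auto
    have "v = Zero B (OMap l Q) (OMap i I)" by (rule l_hom_zero[OF QO I v(1)])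
    then show ?thesis using v(2) c(4,5,6) l_Obj[OF QO] by simp
  qed
  then show ?thesis using True by (simp add: ext_vanish_def)
qed

text \<open>The cokernel of the map \<open>l Q \<rightarrow> W\<close> is killed by \<open>e\<close>, so it is in the image of \<open>i\<close>,
  to which \<open>W\<close> has no nonzero maps.\<close>

lemma good_cover:
  assumes W: "good W"
  obtains Q u where "Q \<in> Proj C" "is_epi B u" "Dom B u = OMap l Q" "Cod B u = W"
    "\<And>k. is_kernel B k u \<Longrightarrow> good (Dom B k)"
proof -
  obtain \<phi> where "adjunction C B l e \<phi>" by (rule adj_le)
  then interpret adj: adjunction C B l e \<phi> .
  have WO: "W \<in> Obj B" using W by (simp add: good_def)
  obtain Q \<pi> where Q: "Q \<in> Proj C" "is_epi C \<pi>" "Dom C \<pi> = Q" "Cod C \<pi> = OMap e W" "\<pi> \<in> Arr C"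
    by (rule C.cover[of "OMap e W"]) (use WO in auto)
  have QO: "Q \<in> Obj C" using Q by auto
  obtain u where u: "u \<in> homset B (OMap l Q) W" "\<phi> Q W u = \<pi>"
    by (rule adj.\<phi>_surj[of \<pi> Q W]) (use Q WO in \<open>auto simp: C.hom_iff\<close>)
  note uD = B.homD[OF u(1)]
  obtain c where c: "is_cokernel B c u" using B.ex_cokernel uD by blast
  note cD = B.cokernelD[OF c]
  have ch: "c \<in> homset B W (Cod B c)" using cD uD by (simp add: B.hom_iff)
  \<comment> \<open>\<open>e c\<close> composed with the epi \<open>\<pi>\<close> is zero, so
    \<open>e c\<close> is zero. It is also epi, as \<open>e\<close> is exact, which forces
    \<open>e (Cod c) = 0\<close>.\<close>
  have "AMap e c \<cdot>\<^bsub>C\<^esub> \<pi> = \<phi> Q (Cod B c) (c \<cdot>\<^bsub>B\<^esub> u)"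
    using adj.\<phi>_left[OF u(1) ch QO] u(2) by simp
  also have "\<dots> = Zero C Q (OMap e (Cod B c))"
    using cD uD adj.\<phi>_Zero[OF QO, of "Cod B c"] by simp
  finally have "AMap e c = Zero C (Cod C \<pi>) (OMap e (Cod B c))"
    by (rule C.epi_Zero[OF Q(2)]) (use Q cD uD in auto)
  then have "is_epi C (Zero C (OMap e W) (OMap e (Cod B c)))"
    using e.F_epi[OF cD(5)] Q by simp
  then have "zero_object C (OMap e (Cod B c))"
    by (rule C.zero_object_of_epi_Zero) (use cD WO in auto)
  then have "Cod B c \<in> {X \<in> Obj B. \<exists>Y\<in>Obj A. isomorphic_objects B X (OMap i Y)}"
    unfolding recollementD(13) using cD by simp
  then obtain Y f g where Y: "Y \<in> Obj A" "f \<in> homset B (Cod B c) (OMap i Y)" "g \<in> homset B (OMap i Y) (Cod B c)"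
    "g \<cdot>\<^bsub>B\<^esub> f = Ident B (Cod B c)" unfolding isomorphic_objects_def by blast
  note fD = B.homD[OF Y(2)] B.homD[OF Y(3)]
  have "f \<cdot>\<^bsub>B\<^esub> c = Zero B W (OMap i Y)"
    by (rule good_hom[OF W Y(1)]) (use fD cD uD in \<open>auto simp: B.hom_iff\<close>)
  then have "g \<cdot>\<^bsub>B\<^esub> (f \<cdot>\<^bsub>B\<^esub> c) = Zero B W (Cod B c)" using fD WO by simp
  moreover have "g \<cdot>\<^bsub>B\<^esub> (f \<cdot>\<^bsub>B\<^esub> c) = c"
    using B.comp_cong_assoc1[OF Y(4), of c] fD cD by simp
  ultimately have c0: "c = Zero B W (Cod B c)" by (rule trans[OF sym, rotated])
  have epi: "is_epi B u"
  proof (rule B.is_epiI)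
    show "u \<in> Arr B" using uD by simp
    fix a assume a: "a \<in> Arr B" "Dom B a = Cod B u" "a \<cdot>\<^bsub>B\<^esub> u = Zero B (Dom B u) (Cod B a)"
    obtain h where h: "h \<in> Arr B" "Dom B h = Cod B c" "Cod B h = Cod B a" "h \<cdot>\<^bsub>B\<^esub> c = a"
      by (rule B.cokernel_desc[OF c a])
    have "h \<cdot>\<^bsub>B\<^esub> c = h \<cdot>\<^bsub>B\<^esub> Zero B W (Cod B c)" by (rule arg_cong[OF c0])
    then have "a = h \<cdot>\<^bsub>B\<^esub> Zero B W (Cod B c)" unfolding h(4) .
    then show "a = Zero B (Cod B u) (Cod B a)" using h(1-3) uD WO by simp
  qed
  have "good (Dom B k)" if k: "is_kernel B k u" for k
    unfolding good_def
  proof (intro conjI ballI)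
    show "Dom B k \<in> Obj B" using B.kernelD[OF k] by simp
    fix I assume I: "I \<in> Inj A"
    obtain J d where J: "injective_coresolution B (OMap i I) J d" "\<And>s. ext_vanish B J d W s"
      using W I unfolding good_def by blast
    \<comment> \<open>Degree \<open>s\<close> of the kernel sits between degree \<open>s\<close> of
      \<open>l Q\<close> and degree \<open>s + 1\<close> of \<open>W\<close>, both zero. So the
      kernel is good with no loss of degrees, and covers can be iterated.\<close>
    have "ext_vanish B J d (Dom B k) s" for s
      by (rule B.ext_vanish_kernel[OF J(1) k epi]) (use uD J(2) good_l[OF Q(1) J(1) A.Inj_Obj[OF I]] in auto)
    then show "\<exists>J d. injective_coresolution B (OMap i I) J d \<and> (\<forall>s. ext_vanish B J d (Dom B k) s)"
      using J(1) by blast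
  qed
  then show thesis using that[OF Q(1) epi] uD by blast
qed

lemma l_bij:
  assumes "Q \<in> Obj C" "Y \<in> Obj B"
  shows "bij_betw (AMap e) (homset B (OMap l Q) Y) (homset C (OMap e (OMap l Q)) (OMap e Y))"
proof -
  obtain \<phi> where "adjunction C B l e \<phi>" by (rule adj_le)
  then interpret adj: adjunction C B l e \<phi> .
  show ?thesis by (rule adj.right_adjoint_bij[OF recollementD(12) assms])
qed

lemma el_Proj:
  assumes "Q \<in> Proj C"
  shows "OMap e (OMap l Q) \<in> Proj C"
proof -
  obtain \<phi> where "adjunction C B l e \<phi>" by (rule adj_le)
  then interpret adj: adjunction C B l e \<phi> .
  show ?thesis by (rule adj.GF_Proj[OF recollementD(12) assms])
qed

text \<open>Covering \<open>W\<close> and then the kernel gives a presentation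
  \<open>l Q' \<rightarrow> l Q \<rightarrow> W \<rightarrow> 0\<close>, which \<open>e\<close>
  keeps exact. As \<open>e\<close> is bijective on maps out of \<open>l Q\<close> and
  \<open>l Q'\<close>, it is bijective on maps out of the cokernel \<open>W\<close>.\<close>

lemma good_bij:
  assumes W: "good W" and Y: "Y \<in> Obj B"
  shows "bij_betw (AMap e) (homset B W Y) (homset C (OMap e W) (OMap e Y))"
proof -
  obtain Q u where Q: "Q \<in> Proj C" "is_epi B u" "Dom B u = OMap l Q" "Cod B u = W"
    "\<And>k. is_kernel B k u \<Longrightarrow> good (Dom B k)" using good_cover[OF W] by metis
  note uA = B.epiA[OF Q(2)]
  obtain k where k: "is_kernel B k u" using B.ex_kernel uA by blast
  note kD = B.kernelD[OF k]
  obtain Q' v where Q': "Q' \<in> Proj C" "is_epi B v" "Dom B v = OMap l Q'" "Cod B v = Dom B k"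
    using good_cover[OF Q(5)[OF k]] by metis
  note vA = B.epiA[OF Q'(2)]
  note lb = l_bij[OF C.Proj_Obj[OF Q(1)] Y] and lb' = l_bij[OF C.Proj_Obj[OF Q'(1)] Y]
  show ?thesis unfolding bij_betw_def
  proof
    show "inj_on (AMap e) (homset B W Y)"
    proof (rule inj_onI)
      fix a b assume a: "a \<in> homset B W Y" and b: "b \<in> homset B W Y" and eq: "AMap e a = AMap e b"
      note D = B.homD[OF a] B.homD[OF b]
      have "AMap e (a \<cdot>\<^bsub>B\<^esub> u) = AMap e (b \<cdot>\<^bsub>B\<^esub> u)" using D uA Q eq by simp
      moreover have "a \<cdot>\<^bsub>B\<^esub> u \<in> homset B (OMap l Q) Y" "b \<cdot>\<^bsub>B\<^esub> u \<in> homset B (OMap l Q) Y"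
        using D uA Q by (auto simp: B.hom_iff)
      ultimately have "a \<cdot>\<^bsub>B\<^esub> u = b \<cdot>\<^bsub>B\<^esub> u" using lb unfolding bij_betw_def by (meson inj_onD)
      then show "a = b" by (rule B.epiD[OF Q(2)]) (use D Q in auto)
    qed
    show "AMap e ` homset B W Y = homset C (OMap e W) (OMap e Y)"
    proof
      show "AMap e ` homset B W Y \<subseteq> homset C (OMap e W) (OMap e Y)" by (auto simp: B.hom_iff C.hom_iff)
      show "homset C (OMap e W) (OMap e Y) \<subseteq> AMap e ` homset B W Y"
      proof
        fix h assume h: "h \<in> homset C (OMap e W) (OMap e Y)"
        note hD = C.homD[OF h]
        have "h \<cdot>\<^bsub>C\<^esub> AMap e u \<in> homset C (OMap e (OMap l Q)) (OMap e Y)" using hD uA Q by (auto simp: C.hom_iff)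
        \<comment> \<open>The lift \<open>t\<close> on \<open>l Q\<close> descends to
          \<open>W\<close> once it vanishes on the kernel of \<open>u\<close>. This is tested on the
          cover \<open>l Q'\<close>, where it can be checked after applying
          \<open>e\<close>.\<close>
        then obtain t where t: "t \<in> homset B (OMap l Q) Y" "AMap e t = h \<cdot>\<^bsub>C\<^esub> AMap e u"
          using lb unfolding bij_betw_def by (metis imageE)
        note tD = B.homD[OF t(1)]
        have uk: "u \<cdot>\<^bsub>B\<^esub> (k \<cdot>\<^bsub>B\<^esub> v) = Zero B (OMap l Q') W"
          using B.comp_cong_assoc1[OF kD(4), of v] kD(1-3) vA uA Q Q' W by (simp add: good_def)
        have "AMap e (t \<cdot>\<^bsub>B\<^esub> (k \<cdot>\<^bsub>B\<^esub> v)) = AMap e t \<cdot>\<^bsub>C\<^esub> AMap e (k \<cdot>\<^bsub>B\<^esub> v)"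
          by (rule e.F_comp) (use tD kD(1-3) vA Q Q' in auto)
        also have "\<dots> = h \<cdot>\<^bsub>C\<^esub> (AMap e u \<cdot>\<^bsub>C\<^esub> AMap e (k \<cdot>\<^bsub>B\<^esub> v))"
          unfolding t(2) by (rule C.comp_assoc) (use hD kD(1-3) vA uA Q Q' in auto)
        also have "AMap e u \<cdot>\<^bsub>C\<^esub> AMap e (k \<cdot>\<^bsub>B\<^esub> v) = AMap e (u \<cdot>\<^bsub>B\<^esub> (k \<cdot>\<^bsub>B\<^esub> v))"
          by (rule e.F_comp[symmetric]) (use kD(1-3) vA uA Q Q' in auto)
        also have "h \<cdot>\<^bsub>C\<^esub> AMap e (u \<cdot>\<^bsub>B\<^esub> (k \<cdot>\<^bsub>B\<^esub> v)) = AMap e (Zero B (OMap l Q') Y)"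
          unfolding uk using hD Y l_Obj[OF C.Proj_Obj[OF Q'(1)]] W by (simp add: good_def)
        finally have "AMap e (t \<cdot>\<^bsub>B\<^esub> (k \<cdot>\<^bsub>B\<^esub> v)) = AMap e (Zero B (OMap l Q') Y)" .
        moreover have "t \<cdot>\<^bsub>B\<^esub> (k \<cdot>\<^bsub>B\<^esub> v) \<in> homset B (OMap l Q') Y" "Zero B (OMap l Q') Y \<in> homset B (OMap l Q') Y"
          using tD kD(1-3) vA Q Q' l_Obj[OF C.Proj_Obj[OF Q'(1)]] Y by (auto simp: B.hom_iff)
        ultimately have z: "t \<cdot>\<^bsub>B\<^esub> (k \<cdot>\<^bsub>B\<^esub> v) = Zero B (OMap l Q') Y" using lb' unfolding bij_betw_def by (meson inj_onD)
        have "(t \<cdot>\<^bsub>B\<^esub> k) \<cdot>\<^bsub>B\<^esub> v = Zero B (Dom B v) Y" using z tD kD(1-3) vA Q Q' by simp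
        then have "t \<cdot>\<^bsub>B\<^esub> k = Zero B (Cod B v) Y"
          by (rule B.epi_Zero[OF Q'(2)]) (use tD kD(1-3) vA Q Q' in auto)
        then have tk: "t \<cdot>\<^bsub>B\<^esub> k = Zero B (Dom B k) (Cod B t)" using Q' tD by simp
        obtain w where w: "w \<in> Arr B" "Dom B w = Cod B u" "Cod B w = Cod B t" "w \<cdot>\<^bsub>B\<^esub> u = t"
          by (rule B.cokernel_desc[OF B.epi_coker_of_kernel[OF Q(2) k], of t]) (use tk tD kD Q in auto)
        have "AMap e w \<cdot>\<^bsub>C\<^esub> AMap e u = AMap e (w \<cdot>\<^bsub>B\<^esub> u)" by (rule e.F_comp[symmetric]) (use w uA in auto)
        then have "AMap e w \<cdot>\<^bsub>C\<^esub> AMap e u = h \<cdot>\<^bsub>C\<^esub> AMap e u" using w(4) t(2) by simp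
        then have "AMap e w = h" by (rule C.epiD[OF e.F_epi[OF Q(2)]]) (use w hD uA Q tD in auto)
        then show "h \<in> AMap e ` homset B W Y" using w Q tD by (auto simp: B.hom_iff)
      qed
    qed
  qed
qed

end

section \<open>The special resolution and the comparison of extensions\<close>

context recollement_situation
begin

text \<open>Degree 0 is \<open>(\<epsilon>)\<close>, since a cocycle there comes from a map to
  \<open>i I\<close>. For \<open>s > 0\<close>, \<open>Ext^s(K, i I)\<close> shifts to
  \<open>Ext^(s + m)(X, i I)\<close>, which \<open>(\<alpha>')\<close> kills.\<close>

lemma good_of_syzygy:
  assumes inj: "\<And>I. I \<in> Inj A \<Longrightarrow> inj_dim B (OMap i I) < ereal (real m)"
    and K: "syzygy B m X K" "K \<in> left_perp B (OMap i ` Inj A)"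
  shows "good K"
  unfolding good_def
proof (intro conjI ballI)
  show KO: "K \<in> Obj B" using K(2) by (simp add: left_perp_def)
  fix I assume I: "I \<in> Inj A"
  obtain J d where J: "injective_coresolution B (OMap i I) J d"
    and van: "\<And>W s. W \<in> Obj B \<Longrightarrow> m \<le> s \<Longrightarrow> ext_vanish B J d W s"
    using B.inj_dim_ext_vanish[OF inj[OF I]] by blast
  note c = B.coresD[OF J]
  have "ext_vanish B J d K s" for s
  proof (cases "s = 0")
    case True
    have "t = Zero B K (J 0)" if t: "t \<in> homset B K (J 0)" and z: "d (Suc 0) \<cdot>\<^bsub>B\<^esub> t = Zero B K (J (Suc 0))" for t
    proof -
      have ker: "is_kernel B (d 0) (d (Suc 0))" by (rule B.mono_exact_kernel[OF c(8,9)])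
      obtain v where v: "v \<in> homset B K (OMap i I)" "d 0 \<cdot>\<^bsub>B\<^esub> v = t"
        using B.kernel_lift_hom[OF ker, of t K] t z c by auto
      have "v = Zero B K (OMap i I)" using K(2) I v(1) by (auto simp: left_perp_def)
      then show ?thesis using v(2) c(4,5,6) KO by simp
    qed
    then show ?thesis using True by (simp add: ext_vanish_def)
  next
    case False
    show ?thesis
    proof (cases m)
      case 0
      then show ?thesis using van KO by simp
    next
      case (Suc m')
      then obtain P D k where P: "projective_resolution B X P D" "is_kernel B k (D m')" "Dom B k = K"
        using K(1) by auto
      have "ext_vanish B J d (Dom B k) s"
        by (rule B.syzygy_ext_vanish[OF J P(1) _ P(2), of m])
          (use van B.resolutionD(8)[OF P(1)] False Suc in auto)
      then show ?thesis using P(3) by simp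
    qed
  qed
  then show "\<exists>J d. injective_coresolution B (OMap i I) J d \<and> (\<forall>s. ext_vanish B J d K s)" using J by blast
qed

text \<open>The \<open>m\<close> terms nearest to \<open>X\<close> come from the resolution in
  \<open>(\<epsilon>)\<close>. Each further term on the left covers a good object, so it is some
  \<open>l Q\<close> and leaves a good kernel. The induction starts at \<open>max 1 m\<close>
  because extensions of degree 0 are encoded differently; for \<open>m = 0\<close> the first cover
  is one of \<open>X\<close> itself.\<close>

lemma good_presentation:
  assumes inj: "\<And>I. I \<in> Inj A \<Longrightarrow> inj_dim B (OMap i I) < ereal (real m)"
    and K: "syzygy B m X K" "K \<in> left_perp B (OMap i ` Inj A)"
    and t: "max 1 m \<le> t"
  shows "\<exists>R K. R \<in> extensions B t X K \<and> good K \<and> (\<forall>k. 1 \<le> k \<longrightarrow> k \<le> t \<longrightarrow> seq_obj B R k \<in> Proj B) \<and>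
    (\<forall>k. 1 \<le> k \<longrightarrow> k \<le> t - m \<longrightarrow> (\<exists>Q\<in>Proj C. seq_obj B R k = OMap l Q))"
  using t
proof (induction t rule: nat_induct_at_least)
  case base
  have good: "good K" by (rule good_of_syzygy[OF inj K])
  show ?case
  proof (cases m)
    case 0
    then have KX: "K = X" using K(1) by simp
    obtain Q u where Q: "Q \<in> Proj C" "is_epi B u" "Dom B u = OMap l Q" "Cod B u = X"
      "\<And>k. is_kernel B k u \<Longrightarrow> good (Dom B k)" using good_cover[OF good] KX by metis
    obtain k where k: "is_kernel B k u" using B.ex_kernel B.epiA[OF Q(2)] by blast
    note b = B.extension_base[OF Q(2) k]
    have "seq_obj B [k, u] a = OMap l Q" if "1 \<le> a" "a \<le> 1" for a
      using b(2) Q(3) le_antisym[OF that] by simp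
    then have "[k, u] \<in> extensions B (max 1 m) X (Dom B k) \<and> good (Dom B k) \<and>
      (\<forall>a. 1 \<le> a \<longrightarrow> a \<le> max 1 m \<longrightarrow> seq_obj B [k, u] a \<in> Proj B) \<and>
      (\<forall>a. 1 \<le> a \<longrightarrow> a \<le> max 1 m - m \<longrightarrow> (\<exists>Q\<in>Proj C. seq_obj B [k, u] a = OMap l Q))"
      using b(1) Q(1,4) Q(5)[OF k] l_Proj[OF Q(1)] 0 by auto
    then show ?thesis by blast
  next
    case (Suc m')
    then obtain P D k where P: "projective_resolution B X P D" "is_kernel B k (D m')" "Dom B k = K"
      using K(1) by auto
    note R = B.resolution_extension[OF P(1,2)]
    have "k # rev (map D [0..<Suc m']) \<in> extensions B (max 1 m) X K \<and> good K \<and>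
      (\<forall>a. 1 \<le> a \<longrightarrow> a \<le> max 1 m \<longrightarrow> seq_obj B (k # rev (map D [0..<Suc m'])) a \<in> Proj B) \<and>
      (\<forall>a. 1 \<le> a \<longrightarrow> a \<le> max 1 m - m \<longrightarrow> (\<exists>Q\<in>Proj C. seq_obj B (k # rev (map D [0..<Suc m'])) a = OMap l Q))"
      using R P(3) good Suc by (auto simp del: upt_Suc)
    then show ?thesis by blast
  qed
next
  case (Suc t)
  then obtain R K where R: "R \<in> extensions B t X K" "good K"
    "\<And>k. 1 \<le> k \<Longrightarrow> k \<le> t \<Longrightarrow> seq_obj B R k \<in> Proj B"
    "\<And>k. 1 \<le> k \<Longrightarrow> k \<le> t - m \<Longrightarrow> \<exists>Q\<in>Proj C. seq_obj B R k = OMap l Q" by blast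
  have t: "0 < t" "m \<le> t" using Suc by auto
  obtain Q u where Q: "Q \<in> Proj C" "is_epi B u" "Dom B u = OMap l Q" "Cod B u = K"
      "\<And>k. is_kernel B k u \<Longrightarrow> good (Dom B k)" using good_cover[OF R(2)] by metis
  obtain k where k: "is_kernel B k u" using B.ex_kernel B.epiA[OF Q(2)] by blast
  let ?R = "k # (R ! 0 \<cdot>\<^bsub>B\<^esub> u) # tl R"
  note s = B.extension_splice[OF R(1) t(1) Q(2,4) k]
  have 1: "seq_obj B ?R a \<in> Proj B" if a: "1 \<le> a" "a \<le> Suc t" for a
  proof (cases "a = 1")
    case True
    then show ?thesis using s(2) Q(3) l_Proj[OF Q(1)] by simp
  next
    case False
    then obtain b where "a = Suc b" "1 \<le> b" "b \<le> t" using a by (cases a) auto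
    then show ?thesis using s(3) R(3) by simp
  qed
  have 2: "\<exists>Q\<in>Proj C. seq_obj B ?R a = OMap l Q" if a: "1 \<le> a" "a \<le> Suc t - m" for a
  proof (cases "a = 1")
    case True
    then show ?thesis using s(2) Q(1,3) by auto
  next
    case False
    then obtain b where b: "a = Suc b" "1 \<le> b" "b \<le> t - m" "b \<le> t" using a t by (cases a) auto
    then show ?thesis using s(3) R(4)[of b] by simp
  qed
  from s(1) Q(5)[OF k] 1 2 show ?case by blast
qed

lemma ext_map_bij:
  assumes inj: "\<forall>I\<in>Inj A. inj_dim B (OMap i I) < ereal (real m)"
    and syz: "\<forall>X\<in>Obj B. \<exists>K. syzygy B m X K \<and> K \<in> left_perp B (OMap i ` Inj A)"
    and pd: "\<forall>P\<in>Proj B. proj_dim C (OMap e P) \<le> ereal (real n)"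
    and X: "X \<in> Obj B" and Y: "Y \<in> Obj B" and j: "m + n < j"
  shows "\<And>fs gs. fs \<in> extensions B j X Y \<Longrightarrow> gs \<in> extensions B j X Y \<Longrightarrow>
      (map (AMap e) fs, map (AMap e) gs) \<in> ext_equiv C j (OMap e X) (OMap e Y) \<Longrightarrow> (fs, gs) \<in> ext_equiv B j X Y"
    and "\<And>hs. hs \<in> extensions C j (OMap e X) (OMap e Y) \<Longrightarrow>
      \<exists>fs\<in>extensions B j X Y. (hs, map (AMap e) fs) \<in> ext_equiv C j (OMap e X) (OMap e Y)"
proof -
  have j0: "0 < j" "max 1 m \<le> j" using j by auto
  obtain K0 where K0: "syzygy B m X K0" "K0 \<in> left_perp B (OMap i ` Inj A)" using syz X by blast
  obtain R K where R: "R \<in> extensions B j X K" "good K"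
    "\<And>k. 1 \<le> k \<Longrightarrow> k \<le> j \<Longrightarrow> seq_obj B R k \<in> Proj B"
    "\<And>k. 1 \<le> k \<Longrightarrow> k \<le> j - m \<Longrightarrow> \<exists>Q\<in>Proj C. seq_obj B R k = OMap l Q"
    using good_presentation[OF _ K0 j0(2)] inj by blast
  note RD = B.extensionsD[OF R(1) j0(1)]
  have "1 \<le> j - m" using j by linarith
  then obtain Q where Q: "Q \<in> Proj C" "seq_obj B R 1 = OMap l Q" using R(4)[of 1] by blast
  have eY: "OMap e Y \<in> Obj C" using Y by simp
  obtain J d where J: "injective_coresolution B Y J d" by (rule B.coresolution_ex[OF Y])
  obtain J' d' where J': "injective_coresolution C (OMap e Y) J' d'" by (rule C.coresolution_ex[OF eY])
  have ac: "acyclic_seq B J d j R" by (rule B.acyclic_proj[OF J R(3)])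
  \<comment> \<open>Treats both conditions of \<open>acyclic_seq\<close> at once: at position
    \<open>k\<close> they concern \<open>s = k\<close> and \<open>s = k - 1\<close>.\<close>
  have van: "ext_vanish C J' d' (OMap e (seq_obj B R k)) s"
    if k: "1 \<le> k" "k \<le> j" and s: "0 < s" "k \<le> Suc s" for k s
  proof (cases "k \<le> j - m")
    case True
    then obtain Q where "Q \<in> Proj C" "seq_obj B R k = OMap l Q" using R(4) k by blast
    then show ?thesis using C.ext_vanish_proj[OF J' el_Proj s(1)] by simp
  next
    case False
    \<comment> \<open>Here \<open>s \<ge> k - 1 \<ge> j - m > n\<close>.\<close>
    then have "n < s" using s j by linarith
    then show ?thesis by (rule C.proj_dim_ext_vanish[OF J' bspec[OF pd R(3)[OF k]]])
  qed
  have ac': "acyclic_seq C J' d' j (map (AMap e) R)"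
    unfolding acyclic_seq_def using van e.F_seq_obj[OF RD(2)] RD(1) by auto
  have R1: "bij_betw (AMap e) (homset B (seq_obj B R 1) Y) (homset C (OMap e (seq_obj B R 1)) (OMap e Y))"
    unfolding Q(2) by (rule l_bij[OF C.Proj_Obj[OF Q(1)] Y])
  note main = e.ext_map_bij_of_acyclic[OF B.enough_proj_inj_axioms C.enough_proj_inj_axioms j0(1) R(1) Y J ac J' ac'
     good_bij[OF R(2) Y] R1]
  show "\<And>fs gs. fs \<in> extensions B j X Y \<Longrightarrow> gs \<in> extensions B j X Y \<Longrightarrow>
      (map (AMap e) fs, map (AMap e) gs) \<in> ext_equiv C j (OMap e X) (OMap e Y) \<Longrightarrow> (fs, gs) \<in> ext_equiv B j X Y"
    by (rule main(1))
  show "\<And>hs. hs \<in> extensions C j (OMap e X) (OMap e Y) \<Longrightarrow>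
      \<exists>fs\<in>extensions B j X Y. (hs, map (AMap e) fs) \<in> ext_equiv C j (OMap e X) (OMap e Y)"
    by (rule main(2))
qed

end

section \<open>Duality\<close>

context abelian_category
begin

lemma seq_obj_op:
  assumes fs: "exact_seq C fs" and k: "k \<le> length fs"
  shows "seq_obj (op_cat C) (rev fs) k = seq_obj C fs (length fs - k)"
proof (cases "k < length fs")
  case True
  then have "seq_obj (op_cat C) (rev fs) k = Cod C (fs ! (length fs - Suc k))"
    by (simp add: seq_obj_def rev_nth)
  also have "\<dots> = seq_obj C fs (Suc (length fs - Suc k))"
    by (rule exact_seqD(3)[OF fs]) (use True in auto)
  finally show ?thesis using True by (simp add: Suc_diff_Suc)
next
  case False
  then have "k = length fs" "fs \<noteq> []" using k fs by (auto simp: exact_seq_def)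
  then show ?thesis by (simp add: seq_obj_def last_rev hd_conv_nth)
qed

lemma exact_seq_op:
  assumes "exact_seq C fs"
  shows "exact_seq (op_cat C) (rev fs)"
  unfolding exact_seq_def
proof (intro conjI allI impI)
  show "rev fs \<noteq> []" "set (rev fs) \<subseteq> Arr (op_cat C)" using assms by (auto simp: exact_seq_def)
  fix k assume k: "Suc k < length (rev fs)"
  define r where "r = length fs - Suc (Suc k)"
  have r: "rev fs ! k = fs ! Suc r" "rev fs ! Suc k = fs ! r" "Suc r < length fs"
    using k by (auto simp: r_def rev_nth Suc_diff_Suc)
  show "exact_at (op_cat C) (rev fs ! k) (rev fs ! Suc k)"
    unfolding r exact_at_op by (rule exact_seq_comp(1)[OF assms r(3)])
qed

lemma extensions_op:
  assumes fs: "fs \<in> extensions C j X Y" and j: "0 < j"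
  shows "rev fs \<in> extensions (op_cat C) j Y X"
proof -
  note fD = extensionsD[OF fs j]
  interpret op: abelian_category "op_cat C" by (rule abelian_op)
  have "rev fs ! 0 = fs ! j" "rev fs ! j = fs ! 0" using fD(1) by (auto simp: rev_nth)
  then show ?thesis unfolding op.extensions_iff[OF j]
    using fD seq_obj_op[OF fD(2), of 0] seq_obj_op[OF fD(2), of "Suc j"] exact_seq_op[OF fD(2)] by simp
qed

lemma seq_morphism_op:
  assumes m: "seq_morphism C fs gs a b" and fs: "exact_seq C fs" and gs: "exact_seq C gs"
  shows "seq_morphism (op_cat C) (rev gs) (rev fs) b a"
proof -
  interpret op: abelian_category "op_cat C" by (rule abelian_op)
  from m obtain h where h: "h 0 = a" "h (length fs) = b" "seq_map C fs gs h"
    by (rule seq_morphismE)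
  note h = h(1,2) seq_mapD[OF h(3)]
  show ?thesis
  proof (rule op.seq_morphismI[of "\<lambda>k. h (length fs - k)"])
    fix k assume "k < length (rev gs)"
    then have k: "k < length fs" using h(3) by simp
    define r where "r = length fs - Suc k"
    have r: "length fs - k = Suc r" "r < length fs" "rev fs ! k = fs ! r" "rev gs ! k = gs ! r"
      using k h(3) by (auto simp: r_def rev_nth)
    show "rev fs ! k \<cdot>\<^bsub>op_cat C\<^esub> h (length fs - k) = h (length fs - Suc k) \<cdot>\<^bsub>op_cat C\<^esub> rev gs ! k"
      using h(7)[OF r(2)] r by (simp flip: r_def)
  qed (use h(1-6) seq_obj_op[OF fs] seq_obj_op[OF gs] in auto)
qed

lemma ext_equiv_op:
  assumes eq: "(fs, gs) \<in> ext_equiv C j X Y" and fs: "fs \<in> extensions C j X Y" and j: "0 < j"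
  shows "(rev fs, rev gs) \<in> ext_equiv (op_cat C) j Y X"
proof -
  interpret op: abelian_category "op_cat C" by (rule abelian_op)
  have step: "(rev gs, rev fs) \<in> ext_step (op_cat C) j Y X"
    if "(fs, gs) \<in> ext_step C j X Y" for fs gs
  proof -
    have s: "fs \<in> extensions C j X Y" "gs \<in> extensions C j X Y" "seq_morphism C fs gs (Ident C Y) (Ident C X)"
      using that by (auto simp: ext_step_iff[OF j])
    show ?thesis unfolding op.ext_step_iff[OF j]
      using extensions_op[OF s(1) j] extensions_op[OF s(2) j]
        seq_morphism_op[OF s(3) extensionsD(2)[OF s(1) j] extensionsD(2)[OF s(2) j]] by simp
  qed
  show ?thesis
    using eq fs
  proof (induction rule: ext_equiv_induct)
    case (step_fwd gs hs)
    then show ?case using step[of gs hs] by (meson ext_equiv_step ext_equiv_sym ext_equiv_trans)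
  next
    case (step_bwd gs hs)
    then show ?case using step[of hs gs] by (meson ext_equiv_step ext_equiv_trans)
  qed simp
qed

lemma injective_coresolution_op: "injective_coresolution (op_cat C) X P d \<longleftrightarrow> projective_resolution C X P d"
  by (simp add: injective_coresolution_def projective_resolution_def exact_at_op)

lemma projective_resolution_op: "projective_resolution (op_cat C) X P d \<longleftrightarrow> injective_coresolution C X P d"
  by (simp add: injective_coresolution_def projective_resolution_def exact_at_op)

lemma inj_dim_op: "inj_dim (op_cat C) X = proj_dim C X"
  by (simp add: inj_dim_def proj_dim_def injective_coresolution_op)

lemma proj_dim_op: "proj_dim (op_cat C) X = inj_dim C X"
  by (simp add: inj_dim_def proj_dim_def projective_resolution_op)

lemma left_perp_op: "left_perp (op_cat C) S = right_perp C S"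
  by (auto simp: left_perp_def right_perp_def)

text \<open>The cosyzygy is the image of \<open>d (n' + 1)\<close>, while a syzygy in the opposite
  category is a cokernel of \<open>d n'\<close> here. Exactness identifies the two: the epi part
  \<open>p\<close> of \<open>d (n' + 1)\<close> has the image \<open>m\<close> of
  \<open>d n'\<close> as its kernel.\<close>

lemma syzygy_op:
  assumes "cosyzygy C n X K"
  shows "syzygy (op_cat C) n X K"
proof (cases n)
  case 0
  then show ?thesis using assms by simp
next
  case (Suc n')
  then obtain J d k where J: "injective_coresolution C X J d" and k: "is_image C k (d (Suc n'))" "Dom C k = K"
    using assms by auto
  note c = coresD[OF J]
  obtain c' where c': "is_cokernel C c' (d (Suc n'))" "is_kernel C k c'" using k(1) by (auto simp: is_image_def)
  obtain p where p: "is_epi C p" "Dom C p = Dom C (d (Suc n'))" "Cod C p = Dom C k" "k \<cdot> p = d (Suc n')"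
    by (rule image_factor[OF c'])
  obtain m e where m: "is_kernel C m (d (Suc n'))" and e: "is_epi C e" "Cod C e = Dom C m" "m \<cdot> e = d n'"
    using exact_atE[OF c(9)[of n']] by metis
  have "is_kernel C m p"
    by (rule kernel_mono_comp_iff[of m k]) (use m p epiA[OF p(1)] kernelD(5)[OF c'(2)] in auto)
  then have "is_cokernel C p m" by (rule epi_coker_of_kernel[OF p(1)])
  \<comment> \<open>Replacing \<open>m\<close> by \<open>m \<cdot> e = d n'\<close> does not change
    the cokernel, as \<open>e\<close> is epi.\<close>
  then have "is_kernel (op_cat C) p (e \<cdot>\<^bsub>op_cat C\<^esub> m)"
    by (intro abelian_category.kernel_mono_comp[OF abelian_op]) (use e in auto)
  then have "is_kernel (op_cat C) p (d n')" using e(3) by simp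
  moreover have "Dom (op_cat C) p = K" using p(3) k(2) by simp
  moreover have "projective_resolution (op_cat C) X J d" using J projective_resolution_op by simp
  ultimately show ?thesis using Suc by auto
qed

end

section \<open>The opposite recollement\<close>

lemma enough_proj_injI:
  assumes "abelian_category C" "enough_projectives C" "enough_injectives C"
  shows "enough_proj_inj C"
  using assms by (simp add: enough_proj_inj_def enough_proj_def enough_proj_axioms_def enough_proj_inj_axioms_def)

lemma (in enough_proj_inj) enough_proj_inj_op: "enough_proj_inj (op_cat C)"
  by (rule enough_proj_injI) (use abelian_op enough_projectives enough_injectives in auto)

lemma (in adjunction) adjoint_pair: "adjoint_pair C D F G"
  unfolding adjoint_pair_def
  by (intro exI[of _ \<phi>] conjI ballI \<phi>_bij \<phi>_natural)

lemma adjoint_pair_op: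
  assumes "adjoint_pair C D F G" "abelian_category C" "abelian_category D" "additive_functor C D F" "additive_functor D C G"
  shows "adjoint_pair (op_cat D) (op_cat C) G F"
proof -
  obtain \<phi> where "adjunction C D F G \<phi>" using adjunction_ex[OF assms] by blast
  then show ?thesis by (rule adjunction.adjoint_pair[OF adjunction.adjunction_op])
qed

lemma fully_faithful_op: "fully_faithful (op_cat C) (op_cat D) F \<longleftrightarrow> fully_faithful C D F"
  by (auto simp: fully_faithful_def)

lemma isomorphic_objects_op: "isomorphic_objects (op_cat C) X Y \<longleftrightarrow> isomorphic_objects C X Y"
  by (auto simp: isomorphic_objects_def)

text \<open>Left and right adjoints trade places, so \<open>q\<close> swaps with \<open>p\<close>
  and \<open>l\<close> with \<open>r\<close>, while \<open>i\<close> and \<open>e\<close>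
  stay.\<close>

lemma (in recollement_situation) recollement_op: "recollement (op_cat A) (op_cat B) (op_cat C) i e p q r l"
  unfolding recollement_def
proof (intro conjI)
  note ab = A.abelian_category_axioms B.abelian_category_axioms C.abelian_category_axioms
  note D = recollementD
  show "abelian_category (op_cat A)" "abelian_category (op_cat B)" "abelian_category (op_cat C)"
    by (fact A.abelian_op B.abelian_op C.abelian_op)+
  show "additive_functor (op_cat A) (op_cat B) i" "additive_functor (op_cat B) (op_cat C) e" "additive_functor (op_cat B) (op_cat A) p"
    "additive_functor (op_cat B) (op_cat A) q" "additive_functor (op_cat C) (op_cat B) r" "additive_functor (op_cat C) (op_cat B) l"
    using D(1-6) additive_functor_op by blast+
  show "adjoint_pair (op_cat C) (op_cat B) r e" "adjoint_pair (op_cat B) (op_cat C) e l" "adjoint_pair (op_cat B) (op_cat A) p i" "adjoint_pair (op_cat A) (op_cat B) i q"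
    using adjoint_pair_op D(1-10) ab by blast+
  show "fully_faithful (op_cat A) (op_cat B) i" "fully_faithful (op_cat C) (op_cat B) l"
    using D(11,12) by (auto simp: fully_faithful_op)
  show "fully_faithful (op_cat C) (op_cat B) r"
    using recollement by (simp add: fully_faithful_op recollement_def)
  show "{X \<in> Obj (op_cat B). \<exists>Y\<in>Obj (op_cat A). isomorphic_objects (op_cat B) X (OMap i Y)} = {X \<in> Obj (op_cat B). zero_object (op_cat C) (OMap e X)}"
    using D(13) by (simp add: isomorphic_objects_op)
qed

text \<open>\<open>ext_map_bij\<close> for the opposite recollement. There \<open>m\<close> and
  \<open>n\<close> are exchanged, and so are \<open>X\<close> and \<open>Y\<close>, since extensions
  are read backwards. Reversing lists carries equivalences over and back.\<close>

lemma (in recollement_situation) ext_map_bij_dual: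
  assumes proj: "\<forall>P\<in>Proj A. proj_dim B (OMap i P) < ereal (real n)"
    and syz: "\<forall>X\<in>Obj B. \<exists>K. cosyzygy B n X K \<and> K \<in> right_perp B (OMap i ` Proj A)"
    and id: "\<forall>I\<in>Inj B. inj_dim C (OMap e I) \<le> ereal (real m)"
    and X: "X \<in> Obj B" and Y: "Y \<in> Obj B" and j: "m + n < j"
  shows "\<And>fs gs. fs \<in> extensions B j X Y \<Longrightarrow> gs \<in> extensions B j X Y \<Longrightarrow>
      (map (AMap e) fs, map (AMap e) gs) \<in> ext_equiv C j (OMap e X) (OMap e Y) \<Longrightarrow> (fs, gs) \<in> ext_equiv B j X Y"
    and "\<And>hs. hs \<in> extensions C j (OMap e X) (OMap e Y) \<Longrightarrow>
      \<exists>fs\<in>extensions B j X Y. (hs, map (AMap e) fs) \<in> ext_equiv C j (OMap e X) (OMap e Y)"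
proof -
  interpret opA: abelian_category "op_cat A" by (rule A.abelian_op)
  interpret opB: enough_proj_inj "op_cat B" by (rule B.enough_proj_inj_op)
  interpret opC: enough_proj_inj "op_cat C" by (rule C.enough_proj_inj_op)
  have op: "recollement_situation (op_cat A) (op_cat B) (op_cat C) i e p q r l"
    by (intro recollement_situation.intro recollement_situation_axioms.intro recollement_op
      opA.abelian_category_axioms opB.enough_proj_inj_axioms opC.enough_proj_inj_axioms)
  have j': "n + m < j" and j0: "0 < j" using j by auto
  have h1: "\<forall>I\<in>Inj (op_cat A). inj_dim (op_cat B) (OMap i I) < ereal (real n)"
    using proj by (simp add: B.inj_dim_op)
  have h2: "\<forall>X\<in>Obj (op_cat B). \<exists>K. syzygy (op_cat B) n X K \<and> K \<in> left_perp (op_cat B) (OMap i ` Inj (op_cat A))"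
    using syz B.syzygy_op by (fastforce simp: B.left_perp_op)
  have h3: "\<forall>P\<in>Proj (op_cat B). proj_dim (op_cat C) (OMap e P) \<le> ereal (real m)"
    using id by (simp add: C.proj_dim_op)
  have XY: "X \<in> Obj (op_cat B)" "Y \<in> Obj (op_cat B)" using X Y by auto
  note main = recollement_situation.ext_map_bij[OF op h1 h2 h3 XY(2,1) j']
  {
    fix fs gs assume fs: "fs \<in> extensions B j X Y" and gs: "gs \<in> extensions B j X Y"
      and eq: "(map (AMap e) fs, map (AMap e) gs) \<in> ext_equiv C j (OMap e X) (OMap e Y)"
    have "(rev (map (AMap e) fs), rev (map (AMap e) gs)) \<in> ext_equiv (op_cat C) j (OMap e Y) (OMap e X)"
      by (rule C.ext_equiv_op[OF eq e.F_extension[OF fs j0] j0])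
    then have "(map (AMap e) (rev fs), map (AMap e) (rev gs)) \<in> ext_equiv (op_cat C) j (OMap e Y) (OMap e X)"
      by (simp add: rev_map)
    then have "(rev fs, rev gs) \<in> ext_equiv (op_cat B) j Y X"
      using main(1) B.extensions_op[OF fs j0] B.extensions_op[OF gs j0] by blast
    then have "(rev (rev fs), rev (rev gs)) \<in> ext_equiv (op_cat (op_cat B)) j X Y"
      by (rule opB.ext_equiv_op[OF _ B.extensions_op[OF fs j0] j0])
    then show "(fs, gs) \<in> ext_equiv B j X Y" by simp
  next
    fix hs assume hs: "hs \<in> extensions C j (OMap e X) (OMap e Y)"
    obtain fs where fs: "fs \<in> extensions (op_cat B) j Y X"
      "(rev hs, map (AMap e) fs) \<in> ext_equiv (op_cat C) j (OMap e Y) (OMap e X)"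
      using main(2)[OF C.extensions_op[OF hs j0]] by blast
    have "(rev (rev hs), rev (map (AMap e) fs)) \<in> ext_equiv (op_cat (op_cat C)) j (OMap e X) (OMap e Y)"
      by (rule opC.ext_equiv_op[OF fs(2) C.extensions_op[OF hs j0] j0])
    then have "(hs, map (AMap e) (rev fs)) \<in> ext_equiv C j (OMap e X) (OMap e Y)" by (simp add: rev_map)
    moreover have "rev fs \<in> extensions B j X Y" using opB.extensions_op[OF fs(1) j0] by simp
    ultimately show "\<exists>fs\<in>extensions B j X Y. (hs, map (AMap e) fs) \<in> ext_equiv C j (OMap e X) (OMap e Y)" by blast
  }
qed

theorem corollary3p6:
  fixes A :: "('oa, 'ma) precat" and B :: "('ob, 'mb) precat" and C :: "('oc, 'mc) precat"
    and m n :: nat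
  assumes "recollement A B C i e q p l r"
    and "enough_projectives B" and "enough_injectives B"
    and "enough_projectives C" and "enough_injectives C"
    and "((SUP I\<in>Inj A. inj_dim B (OMap i I)) < ereal (real m) \<and>
          (\<forall>X\<in>Obj B. \<exists>K. syzygy B m X K \<and> K \<in> left_perp B (OMap i ` Inj A)) \<and>
          (SUP P\<in>Proj B. proj_dim C (OMap e P)) \<le> ereal (real n))
       \<or> ((SUP P\<in>Proj A. proj_dim B (OMap i P)) < ereal (real n) \<and>
          (\<forall>X\<in>Obj B. \<exists>K. cosyzygy B n X K \<and> K \<in> right_perp B (OMap i ` Proj A)) \<and>
          (SUP I\<in>Inj B. inj_dim C (OMap e I)) \<le> ereal (real m))"
  shows "homological_isomorphism B C e (m + n) \<and>
    (\<forall>X\<in>Obj B. \<forall>Y\<in>Obj B. \<forall>j>m + n.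
       ext_map C e j X Y \<in> iso (Ext B j X Y) (Ext C j (OMap e X) (OMap e Y)))"
proof -
  have B: "enough_proj_inj B" and C: "enough_proj_inj C" and A: "abelian_category A"
    using assms(1-5) by (auto simp: recollement_def intro: enough_proj_injI)
  interpret recollement_situation A B C i e q p l r
    by (intro recollement_situation.intro recollement_situation_axioms.intro A B C assms(1))
  have iso: "ext_map C e j X Y \<in> iso (Ext B j X Y) (Ext C j (OMap e X) (OMap e Y))"
    if X: "X \<in> Obj B" and Y: "Y \<in> Obj B" and j: "m + n < j" for X Y j
  proof -
    have "0 < j" using j by simp
    note iso = e.ext_map_iso[OF B C this]
    from assms(6) show ?thesis
    proof (elim disjE conjE)
      assume "(SUP I\<in>Inj A. inj_dim B (OMap i I)) < ereal (real m)"
        and syz: "\<forall>X\<in>Obj B. \<exists>K. syzygy B m X K \<and> K \<in> left_perp B (OMap i ` Inj A)"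
        and "(SUP P\<in>Proj B. proj_dim C (OMap e P)) \<le> ereal (real n)"
      then have "\<forall>I\<in>Inj A. inj_dim B (OMap i I) < ereal (real m)"
        and "\<forall>P\<in>Proj B. proj_dim C (OMap e P) \<le> ereal (real n)"
        by (meson SUP_upper le_less_trans, meson SUP_le_iff)
      note bij = ext_map_bij[OF this(1) syz this(2) X Y j]
      show ?thesis by (rule iso) (fact bij)+
    next
      assume "(SUP P\<in>Proj A. proj_dim B (OMap i P)) < ereal (real n)"
        and syz: "\<forall>X\<in>Obj B. \<exists>K. cosyzygy B n X K \<and> K \<in> right_perp B (OMap i ` Proj A)"
        and "(SUP I\<in>Inj B. inj_dim C (OMap e I)) \<le> ereal (real m)"
      then have "\<forall>P\<in>Proj A. proj_dim B (OMap i P) < ereal (real n)"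
        and "\<forall>I\<in>Inj B. inj_dim C (OMap e I) \<le> ereal (real m)"
        by (meson SUP_upper le_less_trans, meson SUP_le_iff)
      note bij = ext_map_bij_dual[OF this(1) syz this(2) X Y j]
      show ?thesis by (rule iso) (fact bij)+
    qed
  qed
  \<comment> \<open>The induced map itself witnesses the abstract isomorphism that
    \<open>homological_isomorphism\<close> asks for.\<close>
  then show ?thesis
    unfolding homological_isomorphism_def is_iso_def by blast
qed

end
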